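(* Let $\mathbf A\sim\mathrm{RDPG}(\mathbf X_0)$ with sparsity factor $\rho_n$, where $\mathbf X_0=[\mathbf x_{01},\ldots,\mathbf x_{0n}]^{\mathrm T}\in\mathcal X^n$. Assume $\sup_{\mathbf x\in\mathcal X}|F_n(\mathbf x)-F(\mathbf x)|\to0$ as $n\to\infty$, that there is a constant $\delta>0$ independent of $n$ with $(\mathbf x_{0i})_{i=1}^n\subset\mathcal X(\delta)$, and let $\widehat{\mathbf X}=[\widehat{\mathbf x}_1,\ldots,\widehat{\mathbf x}_n]^{\mathrm T}$ be the one-step estimator based on an initial estimator $\widetilde{\mathbf X}$ satisfying the approximate linearization property with exponent $\omega\ge0$. Suppose either $\rho_n\equiv1$ for all $n$, or $\rho_n\to0$ but $(\log n)^{2(1\vee\omega)}/(n\rho_n^5)\to0$, and let $\rho=\lim_{n\to\infty}\rho_n$. Let $$\mathbf G(\mathbf x)=\int_{\mathcal X}\frac{\mathbf x_1\mathbf x_1^{\mathrm T}}{\mathbf x^{\mathrm T}\mathbf x_1(1-\rho\,\mathbf x^{\mathrm T}\mathbf x_1)}F(d\mathbf x_1).$$ Then there exists a sequence of orthogonal matrices $\mathbf W=\mathbf W_n\in\mathbb O(d)$ such that, as $n\to\infty$, $$\big\|\widehat{\mathbf X}\mathbf W-\rho_n^{1/2}\mathbf X_0\big\|_{\mathrm F}^2\to\int_{\mathcal X}\mathrm{tr}\{\mathbf G(\mathbf x)^{-1}\}F(d\mathbf x)\quad\text{in }\mathbb P_0\text{-probability},$$ and for each fixed index $i$, $$\sqrt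 n\,(\mathbf W^{\mathrm T}\widehat{\mathbf x}_i-\rho_n^{1/2}\mathbf x_{0i})\to\mathrm N(\mathbf 0,\mathbf G(\mathbf x_{0i})^{-1})\quad\text{in distribution}.$$
   Context: Setting: $d\ge1$ is fixed and $\mathcal X=\{\mathbf x=[x_1,\ldots,x_d]^{\mathrm T}\in\mathbb R^d: x_1,\ldots,x_d>0,\ \|\mathbf x\|<1\}$. $(\mathbf x_{0i})_{i\ge1}$ is a deterministic sequence in $\mathcal X$ and $\mathbf X_0=[\mathbf x_{01},\ldots,\mathbf x_{0n}]^{\mathrm T}\in\mathbb R^{n\times d}$; $\rho_n\in(0,1]$. $\mathbf A\sim\mathrm{RDPG}(\mathbf X_0)$ with sparsity factor $\rho_n$ means that $\mathbf A=[A_{ij}]$ is a random symmetric $n\times n$ $\{0,1\}$-matrix with zero diagonal and $A_{ij}\sim\mathrm{Bernoulli}(\rho_n\mathbf x_{0i}^{\mathrm T}\mathbf x_{0j})$ independently for $i<j$. $\mathbb P_0$ is the corresponding probability; $O_{\mathbb P_0},o_{\mathbb P_0}$ are stochastic orders as $n\to\infty$. $F$ is a probability distribution on $\mathcal X$ (identified with its cumulative distribution function), $F_n(\mathbf x)=\frac1n\sum_{i=1}^n\mathbf 1\{\mathbf x_{0i}\le\mathbf x\}$ with $\le$ coordinatewise. The matrix $\boldsymbol\Delta=\int_{\mathcal X}\mathbf x\mathbf x^{\mathrm T}F(d\mathbf x)$ is assumed non-singular. For $\delta\in(0,1/2)$, $\mathcal X(\delta)$ is a compact convex subset of $\mathcal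 X$ with $\mathbf x^{\mathrm T}\mathbf u\in[\delta,1-\delta]$ for all $\mathbf x,\mathbf u\in\mathcal X(\delta)$. $\mathbb O(d)$ is the set of $d\times d$ orthogonal matrices; orthogonal alignment matrices depend on $n$ and may depend on $\mathbf A$. $a\vee b=\max(a,b)$; $a\lesssim b$ means $a\le Cb$ for a constant $C>0$. Approximate linearization property (exponent $\omega\ge0$): an estimator $\widetilde{\mathbf X}=[\widetilde{\mathbf x}_1,\ldots,\widetilde{\mathbf x}_n]^{\mathrm T}\in\mathbb R^{n\times d}$ (a function of $\mathbf A$) has this property if for all $n$ there exist $\mathbf W=\mathbf W_n\in\mathbb O(d)$ and an $n\times d$ matrix $\widetilde{\mathbf R}=[\widetilde{\mathbf R}_1,\ldots,\widetilde{\mathbf R}_n]^{\mathrm T}$ with $\|\widetilde{\mathbf R}\|_{\mathrm F}^2=O_{\mathbb P_0}((n\rho_n)^{-1}(\log n)^\omega)$ such that $$\mathbf W^{\mathrm T}\widetilde{\mathbf x}_i-\rho_n^{1/2}\mathbf x_{0i}=\rho_n^{-1/2}\sum_{j=1}^n(A_{ij}-\rho_n\mathbf x_{0i}^{\mathrm T}\mathbf x_{0j})\boldsymbol\zeta_{ij}+\widetilde{\mathbf R}_i,\quad i=1,\ldots,n,$$ where $\{\boldsymbol\zeta_{ij}:i,j\in[n]\}$ are deterministic vectors in $\mathbb R^d$ with $\sup_{i,j\in[n]}\|\boldsymbol\zeta_{ij}\|\lesssim1/n$. One-step estimator initialized at $\widetilde{\mathbf X}$: for $i=1,\ldots,n$,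 $$\widehat{\mathbf x}_i=\widetilde{\mathbf x}_i+\left\{\frac1n\sum_{j=1}^n\frac{\widetilde{\mathbf x}_j\widetilde{\mathbf x}_j^{\mathrm T}}{\widetilde{\mathbf x}_i^{\mathrm T}\widetilde{\mathbf x}_j(1-\widetilde{\mathbf x}_i^{\mathrm T}\widetilde{\mathbf x}_j)}\right\}^{-1}\left\{\frac1n\sum_{j=1}^n\frac{(A_{ij}-\widetilde{\mathbf x}_i^{\mathrm T}\widetilde{\mathbf x}_j)\widetilde{\mathbf x}_j}{\widetilde{\mathbf x}_i^{\mathrm T}\widetilde{\mathbf x}_j(1-\widetilde{\mathbf x}_i^{\mathrm T}\widetilde{\mathbf x}_j)}\right\}$$ (on the event that these expressions are well defined; arbitrary otherwise). *)

theory Defs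
  imports "HOL-Probability.Probability"
begin

text \<open>
  An \<open>n \<times> d\<close> matrix is represented by its rows \<open>X 1, \<dots>, X n\<close>, given as a function
  \<open>X :: nat \<Rightarrow> real^'d\<close> of which only the values on \<open>{1..n}\<close> matter.
  An adjacency matrix on the vertex set \<open>{1..n}\<close> is a function \<open>nat \<Rightarrow> nat \<Rightarrow> real\<close>.
\<close>

type_synonym adj = "nat \<Rightarrow> nat \<Rightarrow> real"

definition frob_norm :: "nat \<Rightarrow> (nat \<Rightarrow> real^'d) \<Rightarrow> real" where
  "frob_norm n X = sqrt (\<Sum>i=1..n. \<Sum>k\<in>UNIV. (X i $ k)\<^sup>2)"

definition outer :: "real^'d \<Rightarrow> real^'d \<Rightarrow> real^'d^'d" where
  "outer u v = (\<chi> k l. u $ k * v $ l)"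

definition latent_space :: "(real^'d) set" where
  "latent_space = {x. (\<forall>k. x $ k > 0) \<and> norm x < 1}"

definition restricted_latent_space :: "real \<Rightarrow> (real^'d) set \<Rightarrow> bool" where
  "restricted_latent_space \<delta> K \<longleftrightarrow>
     compact K \<and> convex K \<and> K \<subseteq> latent_space \<and> (\<forall>x\<in>K. \<forall>u\<in>K. x \<bullet> u \<in> {\<delta>..1-\<delta>})"

text \<open>
  The law of the symmetric hollow matrix with independent entries
  \<open>A i j \<sim> Bernoulli (\<rho> (x i \<bullet> x j))\<close> for \<open>1 \<le> i < j \<le> n\<close>. The default value \<open>False\<close> of
  \<^const>\<open>Pi_pmf\<close> makes the diagonal and all entries outside \<open>{1..n} \<times> {1..n}\<close> zero.
\<close>

definition RDPG :: "nat \<Rightarrow> real \<Rightarrow> (nat \<Rightarrow> real^'d) \<Rightarrow> adj pmf" where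
  "RDPG n \<rho> x =
     map_pmf (\<lambda>e i j. of_bool (e (min i j, max i j)))
       (Pi_pmf {(i, j). 1 \<le> i \<and> i < j \<and> j \<le> n} False
          (\<lambda>(i, j). bernoulli_pmf (\<rho> * (x i \<bullet> x j))))"

text \<open>The order on \<open>real^'d\<close> is coordinatewise, so \<open>{..u}\<close> is a lower orthant.\<close>

definition ecdf :: "nat \<Rightarrow> (nat \<Rightarrow> real^'d) \<Rightarrow> real^'d \<Rightarrow> real" where
  "ecdf n x u = (1 / real n) * (\<Sum>i=1..n. indicator {..u} (x i))"

definition mv_cdf :: "(real^'d) measure \<Rightarrow> real^'d \<Rightarrow> real" where
  "mv_cdf F u = measure F {..u}"

definition bounded_in_prob ::
    "(nat \<Rightarrow> 'a measure) \<Rightarrow> (nat \<Rightarrow> 'a \<Rightarrow> real) \<Rightarrow> (nat \<Rightarrow> real) \<Rightarrow> bool" where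
  "bounded_in_prob P Y r \<longleftrightarrow>
     (\<forall>\<epsilon>>0. \<exists>C. \<forall>\<^sub>F n in sequentially.
        measure (P n) {a \<in> space (P n). \<bar>Y n a\<bar> > C * r n} < \<epsilon>)"

definition tendsto_in_prob ::
    "(nat \<Rightarrow> 'a measure) \<Rightarrow> (nat \<Rightarrow> 'a \<Rightarrow> real) \<Rightarrow> real \<Rightarrow> bool" where
  "tendsto_in_prob P Y c \<longleftrightarrow>
     (\<forall>\<epsilon>>0. (\<lambda>n. measure (P n) {a \<in> space (P n). \<bar>Y n a - c\<bar> > \<epsilon>}) \<longlonglongrightarrow> 0)"

definition tendsto_in_distr ::
    "(nat \<Rightarrow> 'a measure) \<Rightarrow> (nat \<Rightarrow> 'a \<Rightarrow> real^'d) \<Rightarrow> (real^'d) measure \<Rightarrow> bool" where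
  "tendsto_in_distr P Z N \<longleftrightarrow>
     (\<forall>f :: real^'d \<Rightarrow> real. continuous_on UNIV f \<and> bounded (range f) \<longrightarrow>
        (\<lambda>n. LINT z|distr (P n) borel (Z n). f z) \<longlonglongrightarrow> (LINT z|N. f z))"

text \<open>The Gaussian law with mean \<open>\<mu>\<close> and positive definite covariance matrix \<open>S\<close>.\<close>

definition mv_normal :: "real^'d \<Rightarrow> real^'d^'d \<Rightarrow> (real^'d) measure" where
  "mv_normal \<mu> S =
     density lborel (\<lambda>z. ennreal
       (exp (- ((z - \<mu>) \<bullet> (matrix_inv S *v (z - \<mu>))) / 2) / sqrt ((2 * pi) ^ CARD('d) * det S)))"

text \<open>
  An estimator \<open>Xt\<close> assigns to each \<open>n\<close> and each adjacency matrix the rows of an \<open>n \<times> d\<close> matrix.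
  The alignment \<open>W\<close> and the remainder \<open>R\<close> may depend on the adjacency matrix, \<open>\<zeta>\<close> may not.
\<close>

definition approx_linearization ::
    "real \<Rightarrow> (nat \<Rightarrow> real) \<Rightarrow> (nat \<Rightarrow> real^'d) \<Rightarrow> (nat \<Rightarrow> adj \<Rightarrow> nat \<Rightarrow> real^'d) \<Rightarrow> bool" where
  "approx_linearization \<omega> \<rho> x0 Xt \<longleftrightarrow>
     (\<exists>(W :: nat \<Rightarrow> adj \<Rightarrow> real^'d^'d) (R :: nat \<Rightarrow> adj \<Rightarrow> nat \<Rightarrow> real^'d)
        (\<zeta> :: nat \<Rightarrow> nat \<Rightarrow> nat \<Rightarrow> real^'d) (C :: real).
        (\<forall>n a. orthogonal_matrix (W n a)) \<and>
        (\<forall>n. \<forall>i\<in>{1..n}. \<forall>j\<in>{1..n}. norm (\<zeta> n i j) \<le> C * (1 / real n)) \<and>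
        bounded_in_prob (\<lambda>n. measure_pmf (RDPG n (\<rho> n) x0))
          (\<lambda>n a. (frob_norm n (R n a))\<^sup>2)
          (\<lambda>n. inverse (real n * \<rho> n) * ln (real n) powr \<omega>) \<and>
        (\<forall>n a. \<forall>i\<in>{1..n}.
           transpose (W n a) *v Xt n a i - sqrt (\<rho> n) *\<^sub>R x0 i =
             (1 / sqrt (\<rho> n)) *\<^sub>R (\<Sum>j=1..n. (a i j - \<rho> n * (x0 i \<bullet> x0 j)) *\<^sub>R \<zeta> n i j) + R n a i))"

definition one_step_information :: "nat \<Rightarrow> (nat \<Rightarrow> real^'d) \<Rightarrow> nat \<Rightarrow> real^'d^'d" where
  "one_step_information n y i =
     (1 / real n) *\<^sub>R (\<Sum>j=1..n. (1 / ((y i \<bullet> y j) * (1 - y i \<bullet> y j))) *\<^sub>R outer (y j) (y j))"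

definition one_step_score :: "nat \<Rightarrow> adj \<Rightarrow> (nat \<Rightarrow> real^'d) \<Rightarrow> nat \<Rightarrow> real^'d" where
  "one_step_score n a y i =
     (1 / real n) *\<^sub>R (\<Sum>j=1..n. ((a i j - y i \<bullet> y j) / ((y i \<bullet> y j) * (1 - y i \<bullet> y j))) *\<^sub>R y j)"

definition one_step_well_defined :: "nat \<Rightarrow> (nat \<Rightarrow> real^'d) \<Rightarrow> nat \<Rightarrow> bool" where
  "one_step_well_defined n y i \<longleftrightarrow>
     (\<forall>j\<in>{1..n}. (y i \<bullet> y j) * (1 - y i \<bullet> y j) \<noteq> 0) \<and> invertible (one_step_information n y i)"

text \<open>\<open>Xh\<close> is unconstrained wherever the defining expression divides by zero or inverts a
  singular matrix.\<close>

definition one_step_estimator ::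
    "(nat \<Rightarrow> adj \<Rightarrow> nat \<Rightarrow> real^'d) \<Rightarrow> (nat \<Rightarrow> adj \<Rightarrow> nat \<Rightarrow> real^'d) \<Rightarrow> bool" where
  "one_step_estimator Xt Xh \<longleftrightarrow>
     (\<forall>n a. \<forall>i\<in>{1..n}. one_step_well_defined n (Xt n a) i \<longrightarrow>
        Xh n a i = Xt n a i +
          matrix_inv (one_step_information n (Xt n a) i) *v one_step_score n a (Xt n a) i)"

definition G_matrix :: "real \<Rightarrow> (real^'d) measure \<Rightarrow> real^'d \<Rightarrow> real^'d^'d" where
  "G_matrix \<rho> F x =
     (LINT u:latent_space|F. (1 / ((x \<bullet> u) * (1 - \<rho> * (x \<bullet> u)))) *\<^sub>R outer u u)"

end

theory Submission imports Defs begin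

text \<open>
  Write the aligned initial estimator as \<open>\<rho>\<^sup>1\<^sup>/\<^sup>2 (x i + \<epsilon> i)\<close>, where \<open>\<epsilon>\<close> is linear in the noise
  \<open>A - E A\<close> up to a small remainder. One scoring step solves a linear system whose matrix is close
  to \<open>G (x i)\<close>; expanding its right-hand side, the contributions of \<open>\<epsilon> i\<close> cancel to first order,
  and what survives is the efficient score \<open>\<Sum>j. (A i j - E A i j) w i j x j\<close> plus quadratic terms
  in the noise, weighted paths \<open>A i j \<rightarrow> A j k\<close> and averages. Their second and fourth moments are
  small under \<open>(log n) ^ (2 max 1 \<omega>) / (n \<rho>\<^sup>5) \<rightarrow> 0\<close>.

  For the score itself, the sum over all vertices of the squared norms concentrates around its mean,
  a Riemann sum for \<open>\<integral> tr (G\<^sup>-\<^sup>1) dF\<close>, because the squared rows are nearly uncorrelated. A single row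
  is a sum of independent terms, so its characteristic function converges to the Gaussian one.
  Uniform convergence of distribution functions gives weak convergence of \<open>F\<^sub>n\<close> on the compact set
  \<open>K\<close>, which turns averages over the rows into integrals.
\<close>

section \<open>Moments of inhomogeneous Bernoulli graphs\<close>

text \<open>The remainder of the initial estimator is controlled only in Frobenius norm, which
  yields no sharp bound for individual rows. The sum \<open>S4\<close> of the fourth powers of the
  row errors takes the place of one: its fourth root bounds every row at once, which keeps all inner
  products where the weights are smooth, and it also sums the squares of the quadratic remainder.
  The linear part of the error contributes 1/(n \<rho>^5) to \<open>S4 n a / \<rho> n\<close>, and
  in a single row, where a further factor n is lost, the Frobenius part contributes (log n)^(2
  \<omega>)/(n \<rho>^5); this is the origin of the fifth power. After division by \<rho>^(1/2) the
  Fisher weights stay bounded as \<rho> tends to 0, so both regimes share the same estimates. The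
  update is equivariant under rotations, hence the expansion is carried out for aligned rows and for
  one realization of the graph; probability enters through moments of polynomials in independent
  centred edges. Since the Fisher weight is an inverse variance, the covariance of the leading term
  collapses from G^-1 G G^-1 to G^-1.\<close>

lemma finite_set_Pi_pmf_bool:
  "finite I \<Longrightarrow> finite (set_pmf (Pi_pmf I (d::bool) p))"
  by (rule finite_subset[OF set_Pi_pmf_subset']) auto

lemma integrable_Pi_pmf_bool [simp, intro]:
  fixes f :: "_ \<Rightarrow> 'b::{banach, second_countable_topology}"
  shows "finite I \<Longrightarrow> integrable (measure_pmf (Pi_pmf I (d::bool) p)) f"
  by (rule integrable_measure_pmf_finite[OF finite_set_Pi_pmf_bool])

text \<open>Independence enters through this redrawing of one coordinate: that a function does not
  involve \<open>e\<close> becomes invariance under \<open>fun_upd\<close>, a condition checked by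
  unfolding.\<close>

lemma expectation_Pi_pmf_resample:
  fixes f :: "('a \<Rightarrow> bool) \<Rightarrow> real"
  assumes "finite I" "e \<in> I" "0 \<le> q e" "q e \<le> 1"
  shows "measure_pmf.expectation (Pi_pmf I False (\<lambda>e. bernoulli_pmf (q e))) f =
    measure_pmf.expectation (Pi_pmf I False (\<lambda>e. bernoulli_pmf (q e)))
      (\<lambda>\<omega>. q e * f (fun_upd \<omega> e True) + (1 - q e) * f (fun_upd \<omega> e False))"
proof -
  let ?J = "I - {e}" and ?p = "\<lambda>e. bernoulli_pmf (q e)"
  have fJ: "finite ?J" using assms by simp
  have "Pi_pmf (insert e ?J) False ?p =
      bind_pmf (?p e) (\<lambda>y. bind_pmf (Pi_pmf ?J False ?p) (\<lambda>f. return_pmf (fun_upd f e y)))"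
    by (rule Pi_pmf_insert') (use assms in auto)
  also have "insert e ?J = I" using assms by auto
  finally have eq: "Pi_pmf I False ?p =
      bind_pmf (?p e) (\<lambda>y. map_pmf (\<lambda>f. fun_upd f e y) (Pi_pmf ?J False ?p))"
    by (simp only: map_pmf_def)
  have ex: "measure_pmf.expectation (Pi_pmf I False ?p) g =
      measure_pmf.expectation (Pi_pmf ?J False ?p)
       (\<lambda>\<omega>. q e * g (fun_upd \<omega> e True) + (1 - q e) * g (fun_upd \<omega> e False))" for g :: "('a \<Rightarrow> bool) \<Rightarrow> real"
    unfolding eq
    by (subst pmf_expectation_bind[of UNIV])
       (auto simp: UNIV_bool finite_set_Pi_pmf_bool assms fJ integrable_Pi_pmf_bool[OF fJ])
  \<comment> \<open>The disintegration is used on both sides; on the right the update inside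
    \<open>f\<close> overwrites the one of the disintegration, and the two weights add up to
    1.\<close>
  show ?thesis
    by (subst (1 2) ex) (simp add: algebra_simps)
qed

text \<open>The bounds on \<open>q\<close> are imposed at every index, also outside
  \<open>I\<close>, so that pointwise estimates such as \<open>abs_xi_le\<close> cover the diagonal
  pairs, for which nothing is drawn.\<close>

locale bernoulli_product =
  fixes I :: "'a set" and q :: "'a \<Rightarrow> real"
  assumes fin: "finite I" and q01: "\<And>e. 0 \<le> q e \<and> q e \<le> 1"
begin

definition pr :: "('a \<Rightarrow> bool) pmf" where
  "pr = Pi_pmf I False (\<lambda>e. bernoulli_pmf (q e))"

abbreviation ex :: "(('a \<Rightarrow> bool) \<Rightarrow> real) \<Rightarrow> real" where
  "ex \<equiv> measure_pmf.expectation pr"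

definition xi :: "'a \<Rightarrow> ('a \<Rightarrow> bool) \<Rightarrow> real" where
  "xi e \<omega> = of_bool (\<omega> e) - q e"

lemma integrable_pr [simp, intro]:
  fixes f :: "('a \<Rightarrow> bool) \<Rightarrow> 'b::{banach, second_countable_topology}"
  shows "integrable (measure_pmf pr) f"
  unfolding pr_def using fin by simp

lemma ex_add: "ex (\<lambda>\<omega>. f \<omega> + g \<omega>) = ex f + ex g" and
  ex_cmult: "ex (\<lambda>\<omega>. c * f \<omega>) = c * ex f" and
  ex_sum: "ex (\<lambda>\<omega>. \<Sum>a\<in>A. h a \<omega>) = (\<Sum>a\<in>A. ex (h a))"
  by (simp_all add: Bochner_Integration.integral_sum)

lemma ex_mono: "(\<And>\<omega>. f \<omega> \<le> g \<omega>) \<Longrightarrow> ex f \<le> ex g"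
  by (rule integral_mono) auto

lemma ex_le_const: "(\<And>\<omega>. f \<omega> \<le> c) \<Longrightarrow> ex f \<le> c"
  using ex_mono[of f "\<lambda>_. c"] by simp

lemma abs_xi_le: "\<bar>xi e \<omega>\<bar> \<le> 1"
  using q01[of e] by (auto simp: xi_def)

lemma ex_indep:
  assumes "e \<in> I" "\<And>\<omega> b. g (fun_upd \<omega> e b) = g \<omega>"
  shows "ex (\<lambda>\<omega>. \<phi> (\<omega> e) * g \<omega>) = (q e * \<phi> True + (1 - q e) * \<phi> False) * ex g"
  unfolding pr_def
  by (subst expectation_Pi_pmf_resample[OF fin assms(1)])
     (use q01[of e] in \<open>auto simp: assms(2) mult.assoc[symmetric] distrib_right[symmetric]\<close>)

lemma ex_xi_mult:
  assumes "e \<in> I" "\<And>\<omega> b. g (fun_upd \<omega> e b) = g \<omega>"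
  shows "ex (\<lambda>\<omega>. xi e \<omega> * g \<omega>) = 0"
  using ex_indep[OF assms, where \<phi> = "\<lambda>b. of_bool b - q e"] by (simp add: xi_def algebra_simps)

lemma ex_xi_sq_mult:
  assumes "e \<in> I" "\<And>\<omega> b. g (fun_upd \<omega> e b) = g \<omega>"
  shows "ex (\<lambda>\<omega>. (xi e \<omega>)\<^sup>2 * g \<omega>) = q e * (1 - q e) * ex g"
  using ex_indep[OF assms, where \<phi> = "\<lambda>b. (of_bool b - q e)^2"]
  by (simp add: xi_def algebra_simps power2_eq_square)

lemma ex_xi: "e \<in> I \<Longrightarrow> ex (xi e) = 0"
  using ex_xi_mult[of e "\<lambda>_. 1"] by simp

lemma ex_xi_xi: "e \<in> I \<Longrightarrow> f \<noteq> e \<Longrightarrow> ex (\<lambda>\<omega>. xi e \<omega> * xi f \<omega>) = 0"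
  by (rule ex_xi_mult) (auto simp: xi_def)

text \<open>Of two different two-element sets neither contains the other, so \<open>e1\<close> or
  \<open>e2\<close> occurs exactly once in the product, and its centred factor has mean
  zero.\<close>

lemma ex_xi_pairs:
  assumes "e1 \<in> I" "e2 \<in> I" "f1 \<in> I" "f2 \<in> I" "e1 \<noteq> e2" "f1 \<noteq> f2" "{e1, e2} \<noteq> {f1, f2}"
  shows "ex (\<lambda>\<omega>. (xi e1 \<omega> * xi e2 \<omega>) * (xi f1 \<omega> * xi f2 \<omega>)) = 0"
proof -
  consider "e1 \<notin> {f1, f2}" | "e2 \<notin> {f1, f2}" using assms by auto
  then show ?thesis
  proof cases
    case 1
    have "ex (\<lambda>\<omega>. xi e1 \<omega> * (xi e2 \<omega> * (xi f1 \<omega> * xi f2 \<omega>))) = 0"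
      by (rule ex_xi_mult) (use 1 assms in \<open>auto simp: xi_def\<close>)
    then show ?thesis by (simp add: mult_ac)
  next
    case 2
    have "ex (\<lambda>\<omega>. xi e2 \<omega> * (xi e1 \<omega> * (xi f1 \<omega> * xi f2 \<omega>))) = 0"
      by (rule ex_xi_mult) (use 2 assms in \<open>auto simp: xi_def\<close>)
    then show ?thesis by (simp add: mult_ac)
  qed
qed

text \<open>Pythagoras in L2. The random factors \<open>T\<close> are arbitrary so that one
  computation serves single edges, two-edge paths and pairs of edges at a vertex.\<close>

lemma ex_orthogonal_sum_le:
  fixes v :: "'b \<Rightarrow> 'v::real_inner"
  assumes "finite A" "\<And>a b. a \<in> A \<Longrightarrow> b \<in> A \<Longrightarrow> a \<noteq> b \<Longrightarrow> ex (\<lambda>\<omega>. T a \<omega> * T b \<omega>) = 0"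
    and "\<And>a. a \<in> A \<Longrightarrow> ex (\<lambda>\<omega>. (T a \<omega>)\<^sup>2) \<le> s"
  shows "ex (\<lambda>\<omega>. (norm (\<Sum>a\<in>A. T a \<omega> *\<^sub>R v a))\<^sup>2) \<le> s * (\<Sum>a\<in>A. (norm (v a))\<^sup>2)"
proof -
  have "(norm (\<Sum>a\<in>A. T a \<omega> *\<^sub>R v a))\<^sup>2 = (\<Sum>a\<in>A. \<Sum>b\<in>A. (v a \<bullet> v b) * (T a \<omega> * T b \<omega>))" for \<omega>
    unfolding power2_norm_eq_inner inner_sum_left inner_sum_right inner_scaleR_left inner_scaleR_right
    by (intro sum.cong refl) (simp add: sum_distrib_left mult_ac inner_commute)
  then have "ex (\<lambda>\<omega>. (norm (\<Sum>a\<in>A. T a \<omega> *\<^sub>R v a))\<^sup>2)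
     = (\<Sum>a\<in>A. \<Sum>b\<in>A. (v a \<bullet> v b) * ex (\<lambda>\<omega>. T a \<omega> * T b \<omega>))"
    by (simp add: ex_sum)
  also have "\<dots> = (\<Sum>a\<in>A. \<Sum>b\<in>A. if b = a then (v a \<bullet> v a) * ex (\<lambda>\<omega>. T a \<omega> * T a \<omega>) else 0)"
    using assms(2) by (intro sum.cong refl) auto
  also have "\<dots> = (\<Sum>a\<in>A. (norm (v a))\<^sup>2 * ex (\<lambda>\<omega>. (T a \<omega>)\<^sup>2))"
    using assms(1) by (simp add: dot_square_norm power2_eq_square[symmetric])
  also have "\<dots> \<le> (\<Sum>a\<in>A. (norm (v a))\<^sup>2 * s)"
    using assms(3) by (intro sum_mono mult_left_mono) auto
  finally show ?thesis by (simp add: sum_distrib_left mult_ac)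
qed

lemma ex_linear_sq_le:
  fixes w :: "'a \<Rightarrow> 'v::real_inner"
  assumes "J \<subseteq> I" "\<And>e. e \<in> J \<Longrightarrow> q e * (1 - q e) \<le> s"
  shows "ex (\<lambda>\<omega>. (norm (\<Sum>e\<in>J. xi e \<omega> *\<^sub>R w e))\<^sup>2) \<le> s * (\<Sum>e\<in>J. (norm (w e))\<^sup>2)"
proof (rule ex_orthogonal_sum_le)
  show "finite J" using assms fin finite_subset by blast
  show "ex (\<lambda>\<omega>. xi a \<omega> * xi b \<omega>) = 0" if "a \<in> J" "b \<in> J" "a \<noteq> b" for a b
    using that assms by (intro ex_xi_xi) auto
  show "ex (\<lambda>\<omega>. (xi a \<omega>)\<^sup>2) \<le> s" if "a \<in> J" for a
    using ex_xi_sq_mult[of a "\<lambda>_. 1"] that assms by (auto intro: order.trans)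
qed

lemma q_var_le: "q e * (1 - q e) \<le> 1"
  using q01[of e] by (simp add: mult_le_one)

text \<open>Induction over the edges: the terms odd in the new edge vanish in the mean, and with the
  Gaussian constant 3 the bound reproduces itself, because 3 V^2 + 6 V \<bar>w\<bar>^2 + 3
  \<bar>w\<bar>^4 is three times a square.\<close>

lemma ex_linear_fourth_le:
  fixes w :: "'a \<Rightarrow> 'v::real_inner"
  assumes "J \<subseteq> I"
  shows "ex (\<lambda>\<omega>. (norm (\<Sum>e\<in>J. xi e \<omega> *\<^sub>R w e))^4) \<le> 3 * (\<Sum>e\<in>J. (norm (w e))\<^sup>2)\<^sup>2"
proof -
  have "finite J" using assms fin finite_subset by blast
  then show ?thesis using assms
  proof (induction J)
    case empty
    then show ?case by simp
  next
    case (insert e J)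
    define S where "S \<omega> = (\<Sum>e\<in>J. xi e \<omega> *\<^sub>R w e)" for \<omega>
    define V where "V = (\<Sum>e\<in>J. (norm (w e))\<^sup>2)"
    let ?x = "xi e" and ?w = "w e"
    have Sind: "S (fun_upd \<omega> e b) = S \<omega>" for \<omega> b
      unfolding S_def by (intro sum.cong refl) (use insert in \<open>auto simp: xi_def\<close>)
    \<comment> \<open>Only the terms that vanish in the mean are kept exactly. Even powers of the
      edge are bounded by 1 and the squared inner product by Cauchy-Schwarz, which gives 4 + 2 =
      6.\<close>
    have pt: "(norm (S \<omega> + ?x \<omega> *\<^sub>R ?w))^4 \<le> (norm (S \<omega>))^4 + 6 * (norm ?w)\<^sup>2 * (norm (S \<omega>))\<^sup>2 + (norm ?w)^4
       + ?x \<omega> * (4 * (norm (S \<omega>))\<^sup>2 * (S \<omega> \<bullet> ?w)) + 4 * (norm ?w)\<^sup>2 * ((?x \<omega>)^3 * (S \<omega> \<bullet> ?w))" for \<omega>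
    proof -
      have sq: "(norm (S \<omega> + ?x \<omega> *\<^sub>R ?w))\<^sup>2 = (norm (S \<omega>))\<^sup>2 + 2 * ?x \<omega> * (S \<omega> \<bullet> ?w) + (?x \<omega>)\<^sup>2 * (norm ?w)\<^sup>2"
        using dot_norm[of "S \<omega>" "?x \<omega> *\<^sub>R ?w"] by (simp add: power_mult_distrib)
      have x2: "(?x \<omega>)\<^sup>2 \<le> 1" using abs_xi_le by (simp add: abs_square_le_1)
      have x4: "(?x \<omega>)^4 \<le> 1" using power_le_one[OF _ x2, of 2] by simp
      have cs: "(S \<omega> \<bullet> ?w)\<^sup>2 \<le> (norm (S \<omega>))\<^sup>2 * (norm ?w)\<^sup>2"
        using Cauchy_Schwarz_ineq[of "S \<omega>" ?w] by (simp add: power2_norm_eq_inner)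
      have "(norm (S \<omega> + ?x \<omega> *\<^sub>R ?w))^4 = ((norm (S \<omega> + ?x \<omega> *\<^sub>R ?w))\<^sup>2)\<^sup>2" by simp
      also have "\<dots> = (norm (S \<omega>))^4 + 4 * ((?x \<omega>)\<^sup>2 * (S \<omega> \<bullet> ?w)\<^sup>2) + 2 * ((?x \<omega>)\<^sup>2 * ((norm (S \<omega>))\<^sup>2 * (norm ?w)\<^sup>2)) + (?x \<omega>)^4 * (norm ?w)^4
        + ?x \<omega> * (4 * (norm (S \<omega>))\<^sup>2 * (S \<omega> \<bullet> ?w)) + 4 * (norm ?w)\<^sup>2 * ((?x \<omega>)^3 * (S \<omega> \<bullet> ?w))"
        unfolding sq by algebra
      also have "(?x \<omega>)\<^sup>2 * (S \<omega> \<bullet> ?w)\<^sup>2 \<le> 1 * ((norm (S \<omega>))\<^sup>2 * (norm ?w)\<^sup>2)"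
        using x2 cs by (intro mult_mono) auto
      also have "(?x \<omega>)\<^sup>2 * ((norm (S \<omega>))\<^sup>2 * (norm ?w)\<^sup>2) \<le> 1 * ((norm (S \<omega>))\<^sup>2 * (norm ?w)\<^sup>2)"
        using x2 by (intro mult_right_mono) auto
      also have "(?x \<omega>)^4 * (norm ?w)^4 \<le> 1 * (norm ?w)^4"
        using x4 by (intro mult_right_mono) auto
      finally show ?thesis by (simp add: mult_ac)
    qed
    have z1: "ex (\<lambda>\<omega>. ?x \<omega> * (4 * (norm (S \<omega>))\<^sup>2 * (S \<omega> \<bullet> ?w))) = 0"
      by (rule ex_xi_mult) (use insert Sind in auto)
    \<comment> \<open>The cube of a centred Bernoulli variable need not be centred; the cubic term
      vanishes because the sum over the earlier edges has mean zero.\<close>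
    have "ex (\<lambda>\<omega>. S \<omega> \<bullet> ?w) = 0"
      unfolding S_def using insert(4) by (auto simp: inner_sum_left ex_sum ex_xi intro!: sum.neutral)
    then have z2: "ex (\<lambda>\<omega>. (?x \<omega>)^3 * (S \<omega> \<bullet> ?w)) = 0"
      using ex_indep[of e "\<lambda>\<omega>. S \<omega> \<bullet> ?w" "\<lambda>b. (of_bool b - q e)^3"] insert(4) Sind by (simp add: xi_def)
    have S2: "ex (\<lambda>\<omega>. (norm (S \<omega>))\<^sup>2) \<le> V"
      using ex_linear_sq_le[of J 1 w] insert(4) q_var_le by (simp add: S_def V_def)
    have S4: "ex (\<lambda>\<omega>. (norm (S \<omega>))^4) \<le> 3 * V\<^sup>2"
      using insert by (simp add: S_def V_def)
    have "ex (\<lambda>\<omega>. (norm (\<Sum>e\<in>insert e J. xi e \<omega> *\<^sub>R w e))^4) = ex (\<lambda>\<omega>. (norm (S \<omega> + ?x \<omega> *\<^sub>R ?w))^4)"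
      using insert by (simp add: S_def add.commute)
    also have "\<dots> \<le> ex (\<lambda>\<omega>. (norm (S \<omega>))^4 + 6 * (norm ?w)\<^sup>2 * (norm (S \<omega>))\<^sup>2 + (norm ?w)^4
       + ?x \<omega> * (4 * (norm (S \<omega>))\<^sup>2 * (S \<omega> \<bullet> ?w)) + 4 * (norm ?w)\<^sup>2 * ((?x \<omega>)^3 * (S \<omega> \<bullet> ?w)))"
      by (rule ex_mono) (rule pt)
    also have "\<dots> = ex (\<lambda>\<omega>. (norm (S \<omega>))^4) + 6 * (norm ?w)\<^sup>2 * ex (\<lambda>\<omega>. (norm (S \<omega>))\<^sup>2) + (norm ?w)^4"
      using z1 z2 by (simp only: ex_add ex_cmult) simp
    \<comment> \<open>The last coefficient is raised from 1 to 3 to complete the square.\<close>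
    also have "\<dots> \<le> 3 * V\<^sup>2 + 6 * (norm ?w)\<^sup>2 * V + 3 * (norm ?w)^4"
      using S2 S4 by (intro add_mono mult_left_mono) auto
    also have "\<dots> = 3 * (V + (norm ?w)\<^sup>2)\<^sup>2" by algebra
    finally show ?case using insert by (simp add: V_def add.commute)
  qed
qed

lemma ex_linear_sq_le_inj:
  fixes w :: "'b \<Rightarrow> 'v::real_inner"
  assumes "inj_on m A" "m ` A \<subseteq> I" "\<And>a. a \<in> A \<Longrightarrow> q (m a) * (1 - q (m a)) \<le> s"
  shows "ex (\<lambda>\<omega>. (norm (\<Sum>a\<in>A. xi (m a) \<omega> *\<^sub>R w a))\<^sup>2) \<le> s * (\<Sum>a\<in>A. (norm (w a))\<^sup>2)"
  using ex_linear_sq_le[of "m ` A" s "w \<circ> inv_into A m"] assms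
  by (auto simp: sum.reindex)

lemma ex_linear_fourth_le_inj:
  fixes w :: "'b \<Rightarrow> 'v::real_inner"
  assumes "inj_on m A" "m ` A \<subseteq> I"
  shows "ex (\<lambda>\<omega>. (norm (\<Sum>a\<in>A. xi (m a) \<omega> *\<^sub>R w a))^4) \<le> 3 * (\<Sum>a\<in>A. (norm (w a))\<^sup>2)\<^sup>2"
  using ex_linear_fourth_le[of "m ` A" "w \<circ> inv_into A m"] assms
  by (simp add: sum.reindex)

end

lemma norm_add_sq_le: "(norm (a + b))\<^sup>2 \<le> 2 * (norm a)\<^sup>2 + 2 * (norm (b::'v::real_normed_vector))\<^sup>2"
proof -
  have "(norm (a + b))\<^sup>2 \<le> (norm a + norm b)\<^sup>2"
    by (intro power_mono norm_triangle_ineq) auto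
  also have "\<dots> \<le> 2 * (norm a)\<^sup>2 + 2 * (norm b)\<^sup>2"
    using sum_squares_bound[of "norm a" "norm b"] by (simp add: power2_sum)
  finally show ?thesis .
qed

lemma norm_add_fourth_le: "(norm (a + b))^4 \<le> 8 * (norm a)^4 + 8 * (norm (b::'v::real_normed_vector))^4"
proof -
  have "(norm (a + b))^4 = ((norm (a + b))\<^sup>2)\<^sup>2" by simp
  also have "\<dots> \<le> (2 * (norm a)\<^sup>2 + 2 * (norm b)\<^sup>2)\<^sup>2"
    by (intro power_mono norm_add_sq_le) auto
  also have "\<dots> \<le> 2 * (2 * (norm a)\<^sup>2)\<^sup>2 + 2 * (2 * (norm b)\<^sup>2)\<^sup>2"
    using norm_add_sq_le[of "2 * (norm a)\<^sup>2" "2 * (norm b)\<^sup>2"] by simp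
  finally show ?thesis by (simp add: power_mult_distrib mult_ac)
qed

section \<open>Edges of a symmetric random graph\<close>

definition mk_edge :: "nat \<Rightarrow> nat \<Rightarrow> nat \<times> nat" where
  "mk_edge i j = (min i j, max i j)"

lemma mk_edge_eq_iff: "mk_edge i j = mk_edge k l \<longleftrightarrow> (i = k \<and> j = l) \<or> (i = l \<and> j = k)"
  by (auto simp: mk_edge_def min_def max_def)

definition edge_set :: "nat \<Rightarrow> (nat \<times> nat) set" where
  "edge_set n = {(i, j). 1 \<le> i \<and> i < j \<and> j \<le> n}"

lemma finite_edge_set: "finite (edge_set n)"
  by (rule finite_subset[of _ "{1..n} \<times> {1..n}"]) (auto simp: edge_set_def)

locale bernoulli_graph =
  fixes n :: nat and P :: "nat \<Rightarrow> nat \<Rightarrow> real"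
  assumes P_sym: "P i j = P j i" and P01: "0 \<le> P i j \<and> P i j \<le> 1"
begin

sublocale bernoulli_product "edge_set n" "\<lambda>(i, j). P i j"
  by standard (use P01 finite_edge_set in auto)

text \<open>No coordinate is drawn on the diagonal, so \<open>E i i\<close> is almost surely the
  constant - P i i and not a centred variable. Moment bounds over full rows split it off and use
  only that it is at most 1 in absolute value.\<close>

definition E :: "nat \<Rightarrow> nat \<Rightarrow> (nat \<times> nat \<Rightarrow> bool) \<Rightarrow> real" where
  "E i j = xi (mk_edge i j)"

lemma E_eq: "E i j \<omega> = of_bool (\<omega> (min i j, max i j)) - P i j"
  by (auto simp: E_def xi_def mk_edge_def min_def max_def P_sym)

lemma abs_E_le: "\<bar>E i j \<omega>\<bar> \<le> 1"
  by (simp add: E_def abs_xi_le)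

lemma edge_mem: "i \<in> {1..n} \<Longrightarrow> j \<in> {1..n} \<Longrightarrow> i \<noteq> j \<Longrightarrow> mk_edge i j \<in> edge_set n"
  by (auto simp: edge_set_def mk_edge_def min_def max_def)

lemma var_mk_edge: "(case mk_edge i j of (i, j) \<Rightarrow> P i j) = P i j"
  by (auto simp: mk_edge_def min_def max_def P_sym)

lemma row_inj: "inj_on (mk_edge i) ({1..n} - {i})"
  by (auto simp: inj_on_def mk_edge_eq_iff)

lemma row_sub: "i \<in> {1..n} \<Longrightarrow> mk_edge i ` ({1..n} - {i}) \<subseteq> edge_set n"
  by (intro image_subsetI edge_mem) auto

lemma sum_sq_le_card:
  assumes "\<And>a. a \<in> A \<Longrightarrow> norm (w a) \<le> c" "real (card A) \<le> m" "0 \<le> m"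
  shows "(\<Sum>a\<in>A. (norm (w a))\<^sup>2) \<le> m * (c::real)\<^sup>2"
proof -
  have "(\<Sum>a\<in>A. (norm (w a))\<^sup>2) \<le> (\<Sum>a\<in>A. c\<^sup>2)"
    using assms by (intro sum_mono power_mono) auto
  also have "\<dots> \<le> m * c\<^sup>2" using assms by (simp add: mult_right_mono)
  finally show ?thesis .
qed

lemma norm_E_scaleR_le: "norm v \<le> c \<Longrightarrow> norm (E i j \<omega> *\<^sub>R v) \<le> c"
  using abs_E_le[of i j \<omega>] mult_mono[of "\<bar>E i j \<omega>\<bar>" 1 "norm v" c] by (simp add: order.trans[OF norm_ge_zero])

lemma norm_E_E_scaleR_le: "norm v \<le> c \<Longrightarrow> norm ((E i j \<omega> * E k l \<omega>) *\<^sub>R v) \<le> c"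
  using norm_E_scaleR_le[OF norm_E_scaleR_le, of v c i j \<omega> k l] by simp

lemma card_row_le: "real (card ({1..n} - {i})) \<le> real n"
  using card_mono[of "{1..n}" "{1..n} - {i}"] by simp

text \<open>The variance bound \<open>s\<close> is carried along because, with \<open>s\<close>
  equal to the sparsity, it cancels the normalization of the leading term. Moments of remainder
  terms make do with the crude value 1.\<close>

lemma row_offdiag_sq_le:
  fixes w :: "nat \<Rightarrow> 'v::real_inner"
  assumes "i \<in> {1..n}" "\<And>j. j \<in> {1..n} \<Longrightarrow> norm (w j) \<le> c" "\<And>j. j \<in> {1..n} \<Longrightarrow> P i j \<le> s" "0 \<le> s"
  shows "ex (\<lambda>\<omega>. (norm (\<Sum>j\<in>{1..n}-{i}. E i j \<omega> *\<^sub>R w j))\<^sup>2) \<le> s * (real n * c\<^sup>2)"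
proof -
  have "ex (\<lambda>\<omega>. (norm (\<Sum>j\<in>{1..n}-{i}. E i j \<omega> *\<^sub>R w j))\<^sup>2) \<le> s * (\<Sum>j\<in>{1..n}-{i}. (norm (w j))\<^sup>2)"
    unfolding E_def
  proof (rule ex_linear_sq_le_inj[OF row_inj row_sub[OF assms(1)]])
    fix j assume "j \<in> {1..n} - {i}"
    then show "(case mk_edge i j of (i, j) \<Rightarrow> P i j) * (1 - (case mk_edge i j of (i, j) \<Rightarrow> P i j)) \<le> s"
      using assms(3)[of j] P01[of i j] mult_mono[of "P i j" s "1 - P i j" 1] assms(4) by (simp add: var_mk_edge)
  qed
  also have "\<dots> \<le> s * (real n * c\<^sup>2)"
    using assms card_row_le by (intro mult_left_mono sum_sq_le_card) auto
  finally show ?thesis .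
qed

lemma row_sum_split:
  fixes f :: "nat \<Rightarrow> 'v::comm_monoid_add"
  shows "i \<in> {1..n} \<Longrightarrow> (\<Sum>j=1..n. f j) = f i + (\<Sum>j\<in>{1..n}-{i}. f j)"
  by (rule sum.remove) auto

lemma row_sq_le:
  fixes w :: "nat \<Rightarrow> 'v::real_inner"
  assumes "i \<in> {1..n}" "\<And>j. j \<in> {1..n} \<Longrightarrow> norm (w j) \<le> c"
  shows "ex (\<lambda>\<omega>. (norm (\<Sum>j=1..n. E i j \<omega> *\<^sub>R w j))\<^sup>2) \<le> 4 * real n * c\<^sup>2"
proof -
  have n1: "1 \<le> real n" using assms(1) by auto
  have "ex (\<lambda>\<omega>. (norm (\<Sum>j=1..n. E i j \<omega> *\<^sub>R w j))\<^sup>2) \<le>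
    ex (\<lambda>\<omega>. 2 * c\<^sup>2 + 2 * (norm (\<Sum>j\<in>{1..n}-{i}. E i j \<omega> *\<^sub>R w j))\<^sup>2)"
  proof (rule ex_mono)
    fix \<omega>
    have "(norm (E i i \<omega> *\<^sub>R w i))\<^sup>2 \<le> c\<^sup>2"
      using assms by (intro power_mono norm_E_scaleR_le) auto
    then show "(norm (\<Sum>j=1..n. E i j \<omega> *\<^sub>R w j))\<^sup>2 \<le> 2 * c\<^sup>2 + 2 * (norm (\<Sum>j\<in>{1..n}-{i}. E i j \<omega> *\<^sub>R w j))\<^sup>2"
      unfolding row_sum_split[OF assms(1)]
      by (intro order.trans[OF norm_add_sq_le]) auto
  qed
  also have "\<dots> = 2 * c\<^sup>2 + 2 * ex (\<lambda>\<omega>. (norm (\<Sum>j\<in>{1..n}-{i}. E i j \<omega> *\<^sub>R w j))\<^sup>2)"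
    by (simp add: ex_add)
  also have "\<dots> \<le> 2 * c\<^sup>2 + 2 * (1 * (real n * c\<^sup>2))"
    using row_offdiag_sq_le[of i w c 1] assms P01 by (intro add_mono mult_left_mono) auto
  also have "\<dots> \<le> 2 * (real n * c\<^sup>2) + 2 * (1 * (real n * c\<^sup>2))"
    using n1 mult_right_mono[OF n1, of "c\<^sup>2"] by simp
  finally show ?thesis by simp
qed

lemma row_fourth_le:
  fixes w :: "nat \<Rightarrow> 'v::real_inner"
  assumes "i \<in> {1..n}" "\<And>j. j \<in> {1..n} \<Longrightarrow> norm (w j) \<le> c"
  shows "ex (\<lambda>\<omega>. (norm (\<Sum>j=1..n. E i j \<omega> *\<^sub>R w j))^4) \<le> 32 * (real n)\<^sup>2 * c^4"
proof -
  have n1: "1 \<le> (real n)\<^sup>2" using assms(1) by (simp add: one_le_power)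
  have "ex (\<lambda>\<omega>. (norm (\<Sum>j=1..n. E i j \<omega> *\<^sub>R w j))^4) \<le>
    ex (\<lambda>\<omega>. 8 * c^4 + 8 * (norm (\<Sum>j\<in>{1..n}-{i}. E i j \<omega> *\<^sub>R w j))^4)"
  proof (rule ex_mono)
    fix \<omega>
    have "(norm (E i i \<omega> *\<^sub>R w i))^4 \<le> c^4"
      using assms by (intro power_mono norm_E_scaleR_le) auto
    then show "(norm (\<Sum>j=1..n. E i j \<omega> *\<^sub>R w j))^4 \<le> 8 * c^4 + 8 * (norm (\<Sum>j\<in>{1..n}-{i}. E i j \<omega> *\<^sub>R w j))^4"
      unfolding row_sum_split[OF assms(1)]
      by (intro order.trans[OF norm_add_fourth_le]) auto
  qed
  also have "\<dots> = 8 * c^4 + 8 * ex (\<lambda>\<omega>. (norm (\<Sum>j\<in>{1..n}-{i}. E i j \<omega> *\<^sub>R w j))^4)"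
    by (simp add: ex_add)
  also have "ex (\<lambda>\<omega>. (norm (\<Sum>j\<in>{1..n}-{i}. E i j \<omega> *\<^sub>R w j))^4) \<le> 3 * (\<Sum>j\<in>{1..n}-{i}. (norm (w j))\<^sup>2)\<^sup>2"
    unfolding E_def by (rule ex_linear_fourth_le_inj[OF row_inj row_sub[OF assms(1)]])
  also have "\<dots> \<le> 3 * (real n * c\<^sup>2)\<^sup>2"
    using assms card_row_le by (intro mult_left_mono power_mono sum_sq_le_card sum_nonneg) auto
  also have "8 * c^4 + 8 * (3 * (real n * c\<^sup>2)\<^sup>2) \<le> 8 * ((real n)\<^sup>2 * c^4) + 8 * (3 * (real n * c\<^sup>2)\<^sup>2)"
    using mult_right_mono[OF n1, of "c^4"] by simp
  finally show ?thesis by (simp add: power_mult_distrib mult_ac)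
qed

lemma norm_sum_E_le:
  assumes "finite A" "real (card A) \<le> m" "0 \<le> c" "\<And>a. a \<in> A \<Longrightarrow> norm (f a) \<le> c"
  shows "norm (sum f A) \<le> m * c"
proof -
  have "norm (sum f A) \<le> (\<Sum>a\<in>A. c)" by (rule order.trans[OF norm_sum sum_mono]) (use assms in auto)
  also have "\<dots> \<le> m * c" using assms by (simp add: mult_right_mono)
  finally show ?thesis .
qed

text \<open>If i, j, k are distinct, the first edge is the only one of the path that meets i, so
  paths with the same edge set coincide and distinct paths are orthogonal. The at most 3 n
  degenerate pairs are bounded termwise; squared, they have the same order n^2. The constant is 2 *
  9 + 2.\<close>

lemma path_sq_le:
  fixes w :: "nat \<Rightarrow> nat \<Rightarrow> 'v::real_inner"
  assumes "i \<in> {1..n}" "\<And>j k. j \<in> {1..n} \<Longrightarrow> k \<in> {1..n} \<Longrightarrow> norm (w j k) \<le> c"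
  shows "ex (\<lambda>\<omega>. (norm (\<Sum>j=1..n. \<Sum>k=1..n. (E i j \<omega> * E j k \<omega>) *\<^sub>R w j k))\<^sup>2) \<le> 20 * (real n)\<^sup>2 * c\<^sup>2"
proof -
  let ?N = "{1..n}"
  have c0: "0 \<le> c" using order.trans[OF norm_ge_zero assms(2)[OF assms(1,1)]] .
  define A where "A = {(j, k). j \<in> ?N \<and> k \<in> ?N \<and> j \<noteq> i \<and> k \<noteq> i \<and> j \<noteq> k}"
  define B where "B = ?N \<times> ?N - A"
  have AN: "A \<subseteq> ?N \<times> ?N" by (auto simp: A_def)
  then have finA: "finite A" by (rule finite_subset) auto
  have finB: "finite B" by (simp add: B_def)
  have cardA: "real (card A) \<le> (real n)\<^sup>2"
    using card_mono[OF _ AN] by (simp add: power2_eq_square flip: of_nat_mult)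
  have "B \<subseteq> {i} \<times> ?N \<union> ?N \<times> {i} \<union> (\<lambda>j. (j, j)) ` ?N" by (auto simp: A_def B_def)
  then have "card B \<le> card ({i} \<times> ?N \<union> ?N \<times> {i} \<union> (\<lambda>j. (j, j)) ` ?N)"
    by (intro card_mono) auto
  also have "\<dots> \<le> card ({i} \<times> ?N) + card (?N \<times> {i}) + card ((\<lambda>j. (j, j)) ` ?N)"
    by (intro order.trans[OF card_Un_le] add_mono card_Un_le order.refl)
  also have "\<dots> \<le> n + n + n"
    by (intro add_mono order.trans[OF card_image_le]) auto
  finally have cardB: "real (card B) \<le> 3 * real n" by simp
  let ?T = "\<lambda>a \<omega>. E i (fst a) \<omega> * E (fst a) (snd a) \<omega>" and ?w = "\<lambda>a. w (fst a) (snd a)"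
  have split: "(\<Sum>j=1..n. \<Sum>k=1..n. (E i j \<omega> * E j k \<omega>) *\<^sub>R w j k) =
     (\<Sum>a\<in>B. ?T a \<omega> *\<^sub>R ?w a) + (\<Sum>a\<in>A. ?T a \<omega> *\<^sub>R ?w a)" for \<omega>
  proof -
    have "(\<Sum>j=1..n. \<Sum>k=1..n. (E i j \<omega> * E j k \<omega>) *\<^sub>R w j k) = (\<Sum>a\<in>?N \<times> ?N. ?T a \<omega> *\<^sub>R ?w a)"
      by (simp add: sum.cartesian_product case_prod_unfold)
    also have "\<dots> = (\<Sum>a\<in>B. ?T a \<omega> *\<^sub>R ?w a) + (\<Sum>a\<in>A. ?T a \<omega> *\<^sub>R ?w a)"
      unfolding B_def by (rule sum.subset_diff[OF AN]) auto
    finally show ?thesis .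
  qed
  have A: "ex (\<lambda>\<omega>. (norm (\<Sum>a\<in>A. ?T a \<omega> *\<^sub>R ?w a))\<^sup>2) \<le> 1 * (\<Sum>a\<in>A. (norm (?w a))\<^sup>2)"
  proof (rule ex_orthogonal_sum_le[OF finA])
    fix a b assume ab: "a \<in> A" "b \<in> A" "a \<noteq> b"
    obtain j k j' k' where jk: "a = (j, k)" "b = (j', k')" by fastforce
    have "ex (\<lambda>\<omega>. (xi (mk_edge i j) \<omega> * xi (mk_edge j k) \<omega>) * (xi (mk_edge i j') \<omega> * xi (mk_edge j' k') \<omega>)) = 0"
      by (rule ex_xi_pairs; (rule edge_mem)?)
        (use ab jk assms(1) in \<open>auto simp: A_def mk_edge_eq_iff doubleton_eq_iff\<close>)
    then show "ex (\<lambda>\<omega>. ?T a \<omega> * ?T b \<omega>) = 0" by (simp add: jk E_def)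
  next
    fix a :: "nat \<times> nat"
    show "ex (\<lambda>\<omega>. (?T a \<omega>)\<^sup>2) \<le> 1"
      using abs_E_le by (intro ex_le_const) (auto simp: abs_square_le_1 abs_mult intro!: mult_le_one)
  qed
  have "ex (\<lambda>\<omega>. (norm (\<Sum>j=1..n. \<Sum>k=1..n. (E i j \<omega> * E j k \<omega>) *\<^sub>R w j k))\<^sup>2) \<le>
    ex (\<lambda>\<omega>. 2 * (3 * real n * c)\<^sup>2 + 2 * (norm (\<Sum>a\<in>A. ?T a \<omega> *\<^sub>R ?w a))\<^sup>2)"
  proof (rule ex_mono)
    fix \<omega>
    have "norm (?T a \<omega> *\<^sub>R ?w a) \<le> c" if "a \<in> B" for a
      by (rule norm_E_E_scaleR_le) (use that assms(2) in \<open>auto simp: B_def\<close>)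
    then have "(norm (\<Sum>a\<in>B. ?T a \<omega> *\<^sub>R ?w a))\<^sup>2 \<le> (3 * real n * c)\<^sup>2"
      by (intro power_mono norm_sum_E_le[OF finB cardB c0]) auto
    then show "(norm (\<Sum>j=1..n. \<Sum>k=1..n. (E i j \<omega> * E j k \<omega>) *\<^sub>R w j k))\<^sup>2 \<le>
       2 * (3 * real n * c)\<^sup>2 + 2 * (norm (\<Sum>a\<in>A. ?T a \<omega> *\<^sub>R ?w a))\<^sup>2"
      unfolding split by (intro order.trans[OF norm_add_sq_le]) auto
  qed
  also have "\<dots> = 2 * (3 * real n * c)\<^sup>2 + 2 * ex (\<lambda>\<omega>. (norm (\<Sum>a\<in>A. ?T a \<omega> *\<^sub>R ?w a))\<^sup>2)"
    by (simp add: ex_add)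
  also have "\<dots> \<le> 2 * (3 * real n * c)\<^sup>2 + 2 * (1 * ((real n)\<^sup>2 * c\<^sup>2))"
    using assms cardA
    by (intro add_mono mult_left_mono order.trans[OF A] sum_sq_le_card) (auto simp: A_def)
  finally show ?thesis by (simp add: power_mult_distrib mult_ac)
qed

text \<open>\<open>A\<close> contains at most one orientation of every edge, so different summands
  carry different independent coordinates.\<close>

lemma quad_half_sq_le:
  fixes w :: "nat \<Rightarrow> nat \<Rightarrow> 'v::real_inner"
  assumes "\<And>j k. j \<in> {1..n} \<Longrightarrow> k \<in> {1..n} \<Longrightarrow> norm (w j k) \<le> c"
    and "A \<subseteq> {1..n} \<times> {1..n}" "\<And>j k. (j, k) \<in> A \<Longrightarrow> j \<noteq> k \<and> (k, j) \<notin> A"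
  shows "ex (\<lambda>\<omega>. (norm (\<Sum>(j,k)\<in>A. E j k \<omega> *\<^sub>R w j k))\<^sup>2) \<le> (real n)\<^sup>2 * c\<^sup>2"
proof -
  let ?m = "\<lambda>(j, k). mk_edge j k" and ?w = "\<lambda>(j, k). w j k"
  have fin: "finite A" using assms(2) by (rule finite_subset) auto
  have cardA: "real (card A) \<le> (real n)\<^sup>2"
    using card_mono[OF _ assms(2)] by (simp add: power2_eq_square flip: of_nat_mult)
  have "ex (\<lambda>\<omega>. (norm (\<Sum>a\<in>A. xi (?m a) \<omega> *\<^sub>R ?w a))\<^sup>2) \<le> 1 * (\<Sum>a\<in>A. (norm (?w a))\<^sup>2)"
  proof (rule ex_linear_sq_le_inj)
    show "inj_on ?m A" using assms(3) by (auto simp: inj_on_def mk_edge_eq_iff)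
    show "?m ` A \<subseteq> edge_set n"
    proof (rule image_subsetI)
      fix a assume a: "a \<in> A"
      obtain j k where jk: "a = (j, k)" by fastforce
      have "mk_edge j k \<in> edge_set n"
        by (rule edge_mem) (use a assms(2,3) in \<open>auto simp: jk\<close>)
      then show "?m a \<in> edge_set n" by (simp add: jk)
    qed
  qed (rule q_var_le)
  also have "\<dots> \<le> 1 * ((real n)\<^sup>2 * c\<^sup>2)"
    using assms cardA by (intro mult_left_mono sum_sq_le_card) auto
  finally show ?thesis by (simp add: E_def case_prod_unfold)
qed

text \<open>\<open>E j k\<close> and \<open>E k j\<close> are the same variable with different
  coefficients, hence the cut into the diagonal and two triangles. The constant is 2 + 4 +
  4.\<close>

lemma quad_sq_le:
  fixes w :: "nat \<Rightarrow> nat \<Rightarrow> 'v::real_inner"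
  assumes "n \<ge> 1" "\<And>j k. j \<in> {1..n} \<Longrightarrow> k \<in> {1..n} \<Longrightarrow> norm (w j k) \<le> c"
  shows "ex (\<lambda>\<omega>. (norm (\<Sum>j=1..n. \<Sum>k=1..n. E j k \<omega> *\<^sub>R w j k))\<^sup>2) \<le> 10 * (real n)\<^sup>2 * c\<^sup>2"
proof -
  let ?N = "{1..n}" and ?f = "\<lambda>\<omega> (j, k). E j k \<omega> *\<^sub>R w j k"
  have c0: "0 \<le> c" using order.trans[OF norm_ge_zero assms(2)[of 1 1]] assms(1) by simp
  define A B D where "A = {(j, k). j \<in> ?N \<and> k \<in> ?N \<and> j < k}" and "B = {(j, k). j \<in> ?N \<and> k \<in> ?N \<and> k < j}"
    and "D = (\<lambda>j. (j, j)) ` ?N"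
  have fin: "finite A" "finite B" "finite D"
    by (auto simp: A_def B_def D_def intro: finite_subset[of _ "?N \<times> ?N"])
  have "?N \<times> ?N = D \<union> (A \<union> B)" by (auto simp: A_def B_def D_def image_iff)
  then have split: "(\<Sum>j=1..n. \<Sum>k=1..n. E j k \<omega> *\<^sub>R w j k) = sum (?f \<omega>) D + (sum (?f \<omega>) A + sum (?f \<omega>) B)" for \<omega>
  proof -
    have "(\<Sum>j=1..n. \<Sum>k=1..n. E j k \<omega> *\<^sub>R w j k) = sum (?f \<omega>) (?N \<times> ?N)"
      by (rule sum.cartesian_product)
    also have "\<dots> = sum (?f \<omega>) (D \<union> (A \<union> B))" by (simp only: \<open>?N \<times> ?N = D \<union> (A \<union> B)\<close>)
    also have "\<dots> = sum (?f \<omega>) D + sum (?f \<omega>) (A \<union> B)"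
      by (rule sum.union_disjoint) (use fin in \<open>auto simp: A_def B_def D_def\<close>)
    also have "sum (?f \<omega>) (A \<union> B) = sum (?f \<omega>) A + sum (?f \<omega>) B"
      by (rule sum.union_disjoint) (use fin in \<open>auto simp: A_def B_def\<close>)
    finally show ?thesis .
  qed
  have D: "norm (sum (?f \<omega>) D) \<le> real n * c" for \<omega>
    by (rule norm_sum_E_le[OF fin(3) _ c0])
      (auto simp: D_def intro!: card_image_le[THEN order.trans] norm_E_scaleR_le assms)
  have AB: "ex (\<lambda>\<omega>. (norm (sum (?f \<omega>) A))\<^sup>2) \<le> (real n)\<^sup>2 * c\<^sup>2" "ex (\<lambda>\<omega>. (norm (sum (?f \<omega>) B))\<^sup>2) \<le> (real n)\<^sup>2 * c\<^sup>2"
    by (rule quad_half_sq_le[OF assms(2)]; auto simp: A_def B_def)+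
  have "ex (\<lambda>\<omega>. (norm (\<Sum>j=1..n. \<Sum>k=1..n. E j k \<omega> *\<^sub>R w j k))\<^sup>2)
     \<le> ex (\<lambda>\<omega>. 2 * (real n * c)\<^sup>2 + (4 * (norm (sum (?f \<omega>) A))\<^sup>2 + 4 * (norm (sum (?f \<omega>) B))\<^sup>2))"
  proof (rule ex_mono)
    fix \<omega>
    have "(norm (sum (?f \<omega>) D))\<^sup>2 \<le> (real n * c)\<^sup>2" by (intro power_mono D) auto
    moreover have "(norm (sum (?f \<omega>) A + sum (?f \<omega>) B))\<^sup>2 \<le> 2 * (norm (sum (?f \<omega>) A))\<^sup>2 + 2 * (norm (sum (?f \<omega>) B))\<^sup>2"
      by (rule norm_add_sq_le)
    ultimately show "(norm (\<Sum>j=1..n. \<Sum>k=1..n. E j k \<omega> *\<^sub>R w j k))\<^sup>2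
      \<le> 2 * (real n * c)\<^sup>2 + (4 * (norm (sum (?f \<omega>) A))\<^sup>2 + 4 * (norm (sum (?f \<omega>) B))\<^sup>2)"
      unfolding split using norm_add_sq_le[of "sum (?f \<omega>) D" "sum (?f \<omega>) A + sum (?f \<omega>) B"] by linarith
  qed
  also have "\<dots> = 2 * (real n * c)\<^sup>2 + (4 * ex (\<lambda>\<omega>. (norm (sum (?f \<omega>) A))\<^sup>2) + 4 * ex (\<lambda>\<omega>. (norm (sum (?f \<omega>) B))\<^sup>2))"
    by (simp add: ex_add)
  also have "\<dots> \<le> 2 * (real n * c)\<^sup>2 + (4 * ((real n)\<^sup>2 * c\<^sup>2) + 4 * ((real n)\<^sup>2 * c\<^sup>2))"
    by (intro add_mono mult_left_mono AB) auto
  finally show ?thesis by (simp add: power_mult_distrib mult_ac)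
qed

text \<open>A Bernoulli variable satisfies \<open>(b - p)\<^sup>2 - p (1 - p) = (1 - 2 p) (b - p)\<close>, so the squares
  fluctuate linearly in the centred entries.\<close>

lemma E_sq: "(E i j \<omega>)\<^sup>2 = P i j * (1 - P i j) + E i j \<omega> * (1 - 2 * P i j)"
  by (auto simp: E_eq power2_eq_square algebra_simps)

text \<open>With the pairs ordered, every product of two distinct edges occurs once, as the
  orthogonality of distinct summands requires.\<close>

lemma sum_square_eq_pairs:
  fixes u :: "nat \<Rightarrow> 'v::real_inner"
  assumes "finite A"
  shows "(norm (\<Sum>j\<in>A. u j))\<^sup>2 = (\<Sum>j\<in>A. (norm (u j))\<^sup>2) + 2 * (\<Sum>(j,k)\<in>{(j,k). j \<in> A \<and> k \<in> A \<and> j < k}. u j \<bullet> u k)"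
proof -
  let ?L = "{(j,k). j \<in> A \<and> k \<in> A \<and> j < k}" and ?U = "{(j,k). j \<in> A \<and> k \<in> A \<and> k < j}"
  let ?D = "(\<lambda>j. (j, j)) ` A"
  have fin: "finite ?L" "finite ?U" "finite ?D"
    using assms by (auto intro: finite_subset[of _ "A \<times> A"])
  have AA: "A \<times> A = ?D \<union> (?L \<union> ?U)" by (auto simp: image_iff)
  have "(norm (\<Sum>j\<in>A. u j))\<^sup>2 = (\<Sum>(j,k)\<in>A \<times> A. u j \<bullet> u k)"
    unfolding power2_norm_eq_inner inner_sum_left inner_sum_right
    by (subst sum.swap) (simp add: sum.cartesian_product)
  also have "\<dots> = (\<Sum>(j,k)\<in>?D. u j \<bullet> u k) + ((\<Sum>(j,k)\<in>?L. u j \<bullet> u k) + (\<Sum>(j,k)\<in>?U. u j \<bullet> u k))"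
  proof -
    let ?g = "\<lambda>(j,k). u j \<bullet> u k"
    have "sum ?g (A \<times> A) = sum ?g (?D \<union> (?L \<union> ?U))" by (simp only: AA)
    also have "\<dots> = sum ?g ?D + sum ?g (?L \<union> ?U)"
      by (rule sum.union_disjoint) (use fin in auto)
    also have "sum ?g (?L \<union> ?U) = sum ?g ?L + sum ?g ?U"
      by (rule sum.union_disjoint) (use fin in auto)
    finally show ?thesis .
  qed
  also have "(\<Sum>(j,k)\<in>?D. u j \<bullet> u k) = (\<Sum>j\<in>A. (norm (u j))\<^sup>2)"
    by (subst sum.reindex) (auto simp: inj_on_def power2_norm_eq_inner)
  also have "(\<Sum>(j,k)\<in>?U. u j \<bullet> u k) = (\<Sum>(j,k)\<in>?L. u j \<bullet> u k)"
    by (rule sum.reindex_bij_witness[of _ "\<lambda>(j,k). (k,j)" "\<lambda>(j,k). (k,j)"]) (auto simp: inner_commute)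
  finally show ?thesis by simp
qed

text \<open>Expanding the squared rows leaves a part linear in the edges, from the squared entries,
  and products of two edges with a common vertex. Two distinct edges meet in at most one vertex, so
  these products are pairwise orthogonal. There are at most n^3 of them, which improves on the n^4
  of a termwise bound. The constant is 2 * 10 + 8.\<close>

lemma sum_row_squares_concentration:
  fixes b :: "nat \<Rightarrow> nat \<Rightarrow> 'v::real_inner"
  assumes "n \<ge> 1" "\<And>j k. j \<in> {1..n} \<Longrightarrow> k \<in> {1..n} \<Longrightarrow> norm (b j k) \<le> c"
  shows "ex (\<lambda>\<omega>. ((\<Sum>i=1..n. (norm (\<Sum>j\<in>{1..n}-{i}. E i j \<omega> *\<^sub>R b i j))\<^sup>2)
      - (\<Sum>i=1..n. \<Sum>j\<in>{1..n}-{i}. P i j * (1 - P i j) * (norm (b i j))\<^sup>2))\<^sup>2) \<le> 28 * (real n)^3 * c^4"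
proof -
  let ?N = "{1..n}"
  have c0: "0 \<le> c" using order.trans[OF norm_ge_zero assms(2)[of 1 1]] assms(1) by simp
  \<comment> \<open>The coefficient that \<open>E_sq\<close> leaves on an edge; its zero on the
    diagonal lets the bound for full double sums apply to off-diagonal rows.\<close>
  define w where "w i j = (if j = i then 0 else (1 - 2 * P i j) * (norm (b i j))\<^sup>2)" for i j
  have wb: "norm (w i j) \<le> c\<^sup>2" if "i \<in> ?N" "j \<in> ?N" for i j
  proof -
    have "\<bar>1 - 2 * P i j\<bar> * (norm (b i j))\<^sup>2 \<le> 1 * c\<^sup>2"
      using P01[of i j] assms(2)[OF that] by (intro mult_mono power_mono) (auto simp: abs_le_iff)
    then show ?thesis by (simp add: w_def abs_mult)
  qed
  define A where "A = {(i, j, k). i \<in> ?N \<and> j \<in> ?N \<and> k \<in> ?N \<and> j \<noteq> i \<and> k \<noteq> i \<and> j < k}"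
  have AN: "A \<subseteq> ?N \<times> ?N \<times> ?N" by (auto simp: A_def)
  then have finA: "finite A" by (rule finite_subset) auto
  have cardA: "real (card A) \<le> (real n)^3"
    using card_mono[OF _ AN] by (simp add: power3_eq_cube mult.assoc flip: of_nat_mult)
  let ?T = "\<lambda>a \<omega>. E (fst a) (fst (snd a)) \<omega> * E (fst a) (snd (snd a)) \<omega>"
    and ?v = "\<lambda>a. b (fst a) (fst (snd a)) \<bullet> b (fst a) (snd (snd a))"
  let ?X = "\<lambda>\<omega>. \<Sum>j=1..n. \<Sum>k=1..n. E j k \<omega> *\<^sub>R w j k" and ?Y = "\<lambda>\<omega>. \<Sum>a\<in>A. ?T a \<omega> *\<^sub>R ?v a"
  have eq: "(\<Sum>i=1..n. (norm (\<Sum>j\<in>{1..n}-{i}. E i j \<omega> *\<^sub>R b i j))\<^sup>2)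
      - (\<Sum>i=1..n. \<Sum>j\<in>{1..n}-{i}. P i j * (1 - P i j) * (norm (b i j))\<^sup>2) = ?X \<omega> + 2 * ?Y \<omega>" for \<omega>
  proof -
    define q Xr Yr where "q i = (\<Sum>j\<in>?N-{i}. P i j * (1 - P i j) * (norm (b i j))\<^sup>2)"
      and "Xr i = (\<Sum>j=1..n. E i j \<omega> *\<^sub>R w i j)"
      and "Yr i = (\<Sum>(j,k)\<in>{(j,k). j \<in> ?N-{i} \<and> k \<in> ?N-{i} \<and> j < k}. (E i j \<omega> * E i k \<omega>) * (b i j \<bullet> b i k))" for i
    have row: "(norm (\<Sum>j\<in>?N-{i}. E i j \<omega> *\<^sub>R b i j))\<^sup>2 = q i + Xr i + 2 * Yr i" if i: "i \<in> ?N" for i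
    proof -
      have "(\<Sum>j\<in>?N-{i}. (norm (E i j \<omega> *\<^sub>R b i j))\<^sup>2) =
         (\<Sum>j\<in>?N-{i}. P i j * (1 - P i j) * (norm (b i j))\<^sup>2 + E i j \<omega> *\<^sub>R w i j)"
        by (intro sum.cong refl) (auto simp: power_mult_distrib E_sq w_def algebra_simps)
      also have "\<dots> = q i + Xr i"
        unfolding q_def Xr_def row_sum_split[OF i] by (simp add: sum.distrib w_def)
      finally have 1: "(\<Sum>j\<in>?N-{i}. (norm (E i j \<omega> *\<^sub>R b i j))\<^sup>2) = q i + Xr i" .
      have 2: "(\<Sum>(j,k)\<in>{(j,k). j \<in> ?N-{i} \<and> k \<in> ?N-{i} \<and> j < k}. (E i j \<omega> *\<^sub>R b i j) \<bullet> (E i k \<omega> *\<^sub>R b i k)) = Yr i"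
        unfolding Yr_def by (intro sum.cong refl) auto
      show ?thesis
        by (subst sum_square_eq_pairs) (simp, unfold 1 2, rule refl)
    qed
    have "sum Yr ?N = ?Y \<omega>"
    proof -
      have AS: "A = Sigma ?N (\<lambda>i. {(j,k). j \<in> ?N-{i} \<and> k \<in> ?N-{i} \<and> j < k})" by (auto simp: A_def)
      show ?thesis unfolding Yr_def AS
        by (subst sum.Sigma) (auto simp: case_prod_unfold intro: finite_subset[of _ "?N \<times> ?N"])
    qed
    moreover have "(\<Sum>i=1..n. (norm (\<Sum>j\<in>?N-{i}. E i j \<omega> *\<^sub>R b i j))\<^sup>2) = sum q ?N + sum Xr ?N + 2 * sum Yr ?N"
    proof -
      have "(\<Sum>i=1..n. (norm (\<Sum>j\<in>?N-{i}. E i j \<omega> *\<^sub>R b i j))\<^sup>2) = (\<Sum>i=1..n. q i + Xr i + 2 * Yr i)"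
        by (rule sum.cong[OF refl row])
      then show ?thesis by (simp add: sum.distrib sum_distrib_left)
    qed
    ultimately show ?thesis by (simp add: q_def Xr_def)
  qed
  have Y: "ex (\<lambda>\<omega>. (norm (?Y \<omega>))\<^sup>2) \<le> 1 * (\<Sum>a\<in>A. (norm (?v a))\<^sup>2)"
  proof (rule ex_orthogonal_sum_le[OF finA])
    fix a a' assume ab: "a \<in> A" "a' \<in> A" "a \<noteq> a'"
    obtain i j k i' j' k' where jk: "a = (i, j, k)" "a' = (i', j', k')" by (metis prod_cases3)
    have "ex (\<lambda>\<omega>. (xi (mk_edge i j) \<omega> * xi (mk_edge i k) \<omega>) * (xi (mk_edge i' j') \<omega> * xi (mk_edge i' k') \<omega>)) = 0"
      by (rule ex_xi_pairs; (rule edge_mem)?)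
        (use ab jk in \<open>auto simp: A_def mk_edge_eq_iff doubleton_eq_iff\<close>)
    then show "ex (\<lambda>\<omega>. ?T a \<omega> * ?T a' \<omega>) = 0" by (simp add: jk E_def)
  next
    fix a :: "nat \<times> nat \<times> nat"
    show "ex (\<lambda>\<omega>. (?T a \<omega>)\<^sup>2) \<le> 1"
      using abs_E_le by (intro ex_le_const) (auto simp: abs_square_le_1 abs_mult intro!: mult_le_one)
  qed
  have vb: "norm (?v a) \<le> c\<^sup>2" if "a \<in> A" for a
  proof -
    obtain i j k where a: "a = (i, j, k)" by (metis prod_cases3)
    have "\<bar>b i j \<bullet> b i k\<bar> \<le> norm (b i j) * norm (b i k)" by (rule Cauchy_Schwarz_ineq2)
    also have "\<dots> \<le> c * c" using that a assms(2) c0 by (intro mult_mono) (auto simp: A_def)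
    finally show ?thesis by (simp add: a power2_eq_square)
  qed
  have "ex (\<lambda>\<omega>. (norm (?Y \<omega>))\<^sup>2) \<le> (real n)^3 * (c\<^sup>2)\<^sup>2"
    by (rule order.trans[OF Y]) (unfold mult_1, rule sum_sq_le_card[OF vb cardA], auto)
  moreover have "ex (\<lambda>\<omega>. (norm (?X \<omega>))\<^sup>2) \<le> 10 * (real n)\<^sup>2 * (c\<^sup>2)\<^sup>2"
    by (rule quad_sq_le[OF assms(1) wb])
  moreover have "10 * (real n)\<^sup>2 * (c\<^sup>2)\<^sup>2 \<le> 10 * (real n)^3 * (c\<^sup>2)\<^sup>2"
    using assms(1) by (intro mult_right_mono mult_left_mono power_increasing) auto
  ultimately have XY: "2 * ex (\<lambda>\<omega>. (norm (?X \<omega>))\<^sup>2) + 8 * ex (\<lambda>\<omega>. (norm (?Y \<omega>))\<^sup>2) \<le> 28 * (real n)^3 * (c\<^sup>2)\<^sup>2"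
    by linarith
  have "ex (\<lambda>\<omega>. (?X \<omega> + 2 * ?Y \<omega>)\<^sup>2) \<le> ex (\<lambda>\<omega>. 2 * (norm (?X \<omega>))\<^sup>2 + 8 * (norm (?Y \<omega>))\<^sup>2)"
  proof (rule ex_mono)
    fix \<omega>
    show "(?X \<omega> + 2 * ?Y \<omega>)\<^sup>2 \<le> 2 * (norm (?X \<omega>))\<^sup>2 + 8 * (norm (?Y \<omega>))\<^sup>2"
      using norm_add_sq_le[of "?X \<omega>" "2 * ?Y \<omega>"] by (simp add: power_mult_distrib)
  qed
  also have "\<dots> = 2 * ex (\<lambda>\<omega>. (norm (?X \<omega>))\<^sup>2) + 8 * ex (\<lambda>\<omega>. (norm (?Y \<omega>))\<^sup>2)"
    by (simp only: ex_add ex_cmult)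
  also note XY
  finally show ?thesis unfolding eq by simp
qed

end

section \<open>Weak convergence from distribution functions\<close>

text \<open>Distribution functions are compared at points of the latent space only. Lowering
  coordinates of such a point, as long as they stay positive, gives another admissible
  corner.\<close>

lemma latent_space_downward:
  assumes "u \<in> latent_space" "v \<le> u" "\<And>k. 0 < v $ k"
  shows "v \<in> latent_space"
proof -
  have "norm (v $ k) \<le> norm (u $ k)" for k
    using assms(2) assms(3)[of k] unfolding less_eq_vec_def real_norm_def by (smt (verit))
  then have "norm v \<le> norm u" by (rule norm_le_componentwise_cart)
  then show ?thesis using assms by (auto simp: latent_space_def)
qed

lemma latent_space_inf:
  assumes "u \<in> latent_space" "v \<in> latent_space"
  shows "(\<chi> k. min (u $ k) (v $ k)) \<in> latent_space"
  by (rule latent_space_downward[OF assms(1)]) (use assms in \<open>auto simp: less_eq_vec_def latent_space_def\<close>)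

lemma open_latent_space: "open (latent_space :: (real^'d) set)"
proof -
  have "latent_space = (\<Inter>k. {x :: real^'d. 0 < x $ k}) \<inter> ball 0 1"
    by (auto simp: latent_space_def)
  also have "open \<dots>" by (intro open_Int open_INT) (auto simp: open_halfspace_component_gt_cart)
  finally show ?thesis .
qed

text \<open>The functions whose averages the assumed convergence governs directly; the corners are
  those over which the supremum runs. The class is closed under products because two lower orthants
  intersect in one whose corner is the componentwise minimum.\<close>

inductive_set orthant_steps :: "(real^'d \<Rightarrow> real) set" where
  const: "(\<lambda>_. c) \<in> orthant_steps"
| step: "f \<in> orthant_steps \<Longrightarrow> u \<in> latent_space \<Longrightarrow> (\<lambda>x. f x + c * indicator {..u} x) \<in> orthant_steps"

lemma orthant_steps_add:
  assumes "f \<in> orthant_steps" "g \<in> orthant_steps"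
  shows "(\<lambda>x. f x + g x) \<in> orthant_steps"
  using assms(2,1)
proof (induction g arbitrary: f rule: orthant_steps.induct)
  case (const c)
  then show ?case
  proof (induction f rule: orthant_steps.induct)
    case (step f u c')
    then show ?case using orthant_steps.step[of "\<lambda>x. f x + c" u c'] by (simp add: algebra_simps)
  qed (auto intro: orthant_steps.const)
next
  case (step g u c)
  then show ?case using orthant_steps.step[of "\<lambda>x. f x + g x" u c] by (simp add: algebra_simps)
qed

lemma orthant_steps_cmult: "f \<in> orthant_steps \<Longrightarrow> (\<lambda>x. c * f x) \<in> orthant_steps"
proof (induction f rule: orthant_steps.induct)
  case (step f u c')
  then show ?case using orthant_steps.step[of "\<lambda>x. c * f x" u "c * c'"] by (simp add: algebra_simps)
qed (auto intro: orthant_steps.const)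

lemma orthant_steps_indicator: "u \<in> latent_space \<Longrightarrow> indicator {..u} \<in> orthant_steps"
  using orthant_steps.step[OF orthant_steps.const[of 0], of u 1] by simp

lemma orthant_steps_mult_indicator:
  "f \<in> orthant_steps \<Longrightarrow> v \<in> latent_space \<Longrightarrow> (\<lambda>x. f x * indicator {..v} x) \<in> orthant_steps"
proof (induction f rule: orthant_steps.induct)
  case (const c)
  then show ?case using orthant_steps.step[OF orthant_steps.const[of 0], of v c] by simp
next
  case (step f u c)
  have "indicator {..u} x * indicator {..v} x = (indicator {..\<chi> k. min (u $ k) (v $ k)} x :: real)" for x
    by (auto simp: indicator_def less_eq_vec_def)
  then show ?case
    using orthant_steps.step[OF step.IH[OF step.prems] latent_space_inf[OF step.hyps(2) step.prems], of c]
    by (simp add: algebra_simps)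
qed

lemma orthant_steps_mult:
  assumes "f \<in> orthant_steps" "g \<in> orthant_steps"
  shows "(\<lambda>x. f x * g x) \<in> orthant_steps"
  using assms(2,1)
proof (induction g arbitrary: f rule: orthant_steps.induct)
  case (const c)
  then show ?case using orthant_steps_cmult[of f c] by (simp add: mult.commute)
next
  case (step g u c)
  show ?case
    using orthant_steps_add[OF step.IH[OF step.prems]
        orthant_steps_cmult[OF orthant_steps_mult_indicator[OF step.prems step.hyps(2)], of c]]
    by (simp add: algebra_simps)
qed

lemma orthant_steps_sum:
  "finite A \<Longrightarrow> (\<And>a. a \<in> A \<Longrightarrow> f a \<in> orthant_steps) \<Longrightarrow> (\<lambda>x. \<Sum>a\<in>A. f a x) \<in> orthant_steps"
  by (induction rule: finite_induct) (auto intro: orthant_steps.const orthant_steps_add)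

lemma orthant_steps_prod:
  "finite A \<Longrightarrow> (\<And>a. a \<in> A \<Longrightarrow> f a \<in> orthant_steps) \<Longrightarrow> (\<lambda>x. \<Prod>a\<in>A. f a x) \<in> orthant_steps"
  by (induction rule: finite_induct) (auto intro: orthant_steps.const orthant_steps_mult)

lemma orthant_steps_bounded: "f \<in> orthant_steps \<Longrightarrow> \<exists>B. \<forall>x. \<bar>f x\<bar> \<le> B"
proof (induction f rule: orthant_steps.induct)
  case (step f u c)
  then obtain B where "\<And>x. \<bar>f x\<bar> \<le> B" by auto
  then have "\<bar>f x + c * indicator {..u} x\<bar> \<le> B + \<bar>c\<bar>" for x
    by (cases "x \<in> {..u}") (auto intro: order.trans[OF abs_triangle_ineq] add_increasing2)
  then show ?case by blast
qed auto

lemma orthant_steps_measurable: "f \<in> orthant_steps \<Longrightarrow> f \<in> borel_measurable borel"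
  by (induction f rule: orthant_steps.induct) auto

text \<open>A ramp is approximated by a staircase of \<open>m\<close> steps: counting the levels l /
  m above \<open>s\<close> is wrong by at most one level.\<close>

lemma step_count_approx:
  fixes s :: real
  assumes "m \<ge> 1"
  shows "\<bar>(\<Sum>l=1..m. of_bool (s \<le> real l / real m)) / real m - max 0 (min 1 (1 - s))\<bar> \<le> 1 / real m"
proof -
  have m: "real m > 0" using assms by simp
  have cnt: "(\<Sum>l=1..m. of_bool (s \<le> real l / real m)) = real (card {l\<in>{1..m}. s * real m \<le> real l})"
    using m by (simp add: of_bool_def sum.If_cases Int_def pos_le_divide_eq)
  consider "s \<le> 0" | "s > 1" | "0 < s" "s \<le> 1" by linarith
  then show ?thesis
  proof cases
    case 1
    then have "{l\<in>{1..m}. s * real m \<le> real l} = {1..m}"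
      by (auto intro: order.trans[of _ 0] simp: mult_nonpos_nonneg)
    then have "(\<Sum>l=1..m. of_bool (s \<le> real l / real m)) = real m" unfolding cnt by simp
    then show ?thesis using 1 m by simp
  next
    case 2
    have "\<not> s * real m \<le> real l" if "l \<le> m" for l
    proof -
      have "real l \<le> real m" using that by simp
      also have "\<dots> < s * real m" using 2 m by simp
      finally show ?thesis by simp
    qed
    then have e: "{l\<in>{1..m}. s * real m \<le> real l} = {}" by auto
    show ?thesis unfolding cnt e using 2 by simp
  next
    case 3
    \<comment> \<open>The first level counted, so the count is m - c + 1. It is at least 1 since s >
      0 and at most m since s \<le> 1.\<close>
    define c where "c = nat \<lceil>s * real m\<rceil>"
    have sm: "0 < s * real m" using 3 m by simp
    have c: "real c \<ge> s * real m" "real c < s * real m + 1"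
      unfolding c_def using sm by linarith+
    have "s * real m \<le> real m" using 3 m by simp
    then have cm: "c \<le> m" unfolding c_def by linarith
    have c1: "1 \<le> c" using sm c by linarith
    have "{l\<in>{1..m}. s * real m \<le> real l} = {c..m}"
      using c1 c by (auto simp: c_def nat_le_iff ceiling_le_iff)
    then have "real (card {l\<in>{1..m}. s * real m \<le> real l}) = real m - real c + 1"
      using cm by (simp add: of_nat_diff)
    then have "(\<Sum>l=1..m. of_bool (s \<le> real l / real m)) / real m - max 0 (min 1 (1 - s))
       = (real m - real c + 1) / real m - (1 - s)"
      unfolding cnt using 3 by (simp add: max_def min_def)
    also have "\<dots> = (s * real m - real c + 1) / real m" using m by (simp add: field_simps)
    finally have "(\<Sum>l=1..m. of_bool (s \<le> real l / real m)) / real m - max 0 (min 1 (1 - s))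
       = (s * real m - real c + 1) / real m" .
    moreover have "\<bar>(s * real m - real c + 1) / real m\<bar> \<le> 1 / real m"
      unfolding abs_divide using c m by (simp add: divide_right_mono)
    ultimately show ?thesis by simp
  qed
qed

text \<open>The separating function is a ramp in the largest excess of a coordinate of the argument
  over \<open>x\<close>. Sublevel sets of this excess are lower orthants with corner on the diagonal
  ray from \<open>x\<close>, so staircases built from orthants approximate the ramp
  uniformly.\<close>

lemma orthant_steps_separate:
  fixes x y :: "real^'d"
  assumes "x \<in> latent_space" "x $ k < y $ k"
  obtains f where "continuous_on UNIV f" "f x \<noteq> f y"
    "\<And>e. e > 0 \<Longrightarrow> \<exists>g\<in>orthant_steps. \<forall>z. \<bar>f z - g z\<bar> \<le> e"
proof -
  \<comment> \<open>The first bound puts \<open>y\<close> beyond the end of the ramp; the second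
    keeps the corners up to \<open>x + \<epsilon> *\<^sub>R 1\<close> inside the unit ball,
    \<open>1\<close> being the all-ones vector.\<close>
  define \<epsilon> where "\<epsilon> = min ((y $ k - x $ k) / 2) ((1 - norm x) / (2 * norm (1 :: real^'d)))"
  have n1: "norm (1 :: real^'d) > 0" by simp
  have nx: "norm x < 1" using assms by (auto simp: latent_space_def)
  have \<epsilon>0: "\<epsilon> > 0" using assms(2) nx n1 by (auto simp: \<epsilon>_def)
  have "\<epsilon> \<le> (y $ k - x $ k) / 2" unfolding \<epsilon>_def by (rule min.cobounded1)
  then have \<epsilon>1: "\<epsilon> < y $ k - x $ k" using assms(2) by simp
  have "\<epsilon> \<le> (1 - norm x) / (2 * norm (1 :: real^'d))" unfolding \<epsilon>_def by (rule min.cobounded2)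
  then have "\<epsilon> * norm (1 :: real^'d) \<le> (1 - norm x) / 2"
    using n1 by (simp add: field_simps)
  then have \<epsilon>2: "norm (x + \<epsilon> *\<^sub>R 1) < 1"
    using norm_triangle_ineq[of x "\<epsilon> *\<^sub>R 1"] nx \<epsilon>0 by simp
  have lat: "x + c *\<^sub>R 1 \<in> latent_space" if "0 \<le> c" "c \<le> \<epsilon>" for c
  proof -
    have up: "x + \<epsilon> *\<^sub>R 1 \<in> latent_space"
      using assms(1) \<epsilon>0 \<epsilon>2 by (auto simp: latent_space_def add_pos_pos)
    show ?thesis
      by (rule latent_space_downward[OF up])
        (use that assms(1) in \<open>auto simp: latent_space_def less_eq_vec_def add_pos_nonneg\<close>)
  qed
  define s where "s z = Max (range (\<lambda>k. z $ k - x $ k))" for z :: "real^'d"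
  have s_le: "s z \<le> c \<longleftrightarrow> (\<forall>k. z $ k - x $ k \<le> c)" for z c
    unfolding s_def by (subst Max_le_iff) auto
  have s_ge: "z $ k - x $ k \<le> s z" for z k
    using s_le[of z "s z"] by simp
  have s_lip: "s z \<le> s z' + norm (z - z')" for z z'
    unfolding s_le
  proof
    fix k
    have "z $ k - z' $ k \<le> norm (z - z')"
      using component_le_norm_cart[of "z - z'" k] by simp
    then show "z $ k - x $ k \<le> s z' + norm (z - z')" using s_ge[of z' k] by linarith
  qed
  have s_lip': "\<bar>s z - s z'\<bar> \<le> norm (z - z')" for z z'
    using s_lip[of z z'] s_lip[of z' z] by (simp add: norm_minus_commute abs_le_iff)
  have s_cont: "continuous_on UNIV s"
    unfolding continuous_on_iff dist_norm real_norm_def using s_lip' order.strict_trans1 by blast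
  define f where "f z = max 0 (min 1 (1 - s z / \<epsilon>))" for z
  show ?thesis
  proof
    show "continuous_on UNIV f"
      unfolding f_def by (intro continuous_intros s_cont) (use \<epsilon>0 in auto)
    have "s x \<le> 0" by (simp add: s_le)
    moreover have "s y > \<epsilon>" using s_ge[of y k] \<epsilon>1 by linarith
    ultimately have "f x = 1" "f y = 0" using \<epsilon>0 by (auto simp: f_def field_simps)
    then show "f x \<noteq> f y" by simp
    fix e :: real assume "e > 0"
    then obtain m :: nat where m: "m \<ge> 1" "1 / real m < e"
      by (metis One_nat_def Suc_leI nat_approx_posE zero_less_Suc inverse_eq_divide)
    define u where "u l = x + (real l * \<epsilon> / real m) *\<^sub>R 1" for l :: nat
    define g where "g z = 1 / real m * (\<Sum>l=1..m. indicator {..u l} z)" for z :: "real^'d"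
    have "g \<in> orthant_steps" unfolding g_def u_def
      using m \<epsilon>0 by (intro orthant_steps_cmult orthant_steps_sum orthant_steps_indicator lat)
        (auto simp: field_simps)
    moreover have "\<bar>f z - g z\<bar> \<le> e" for z
    proof -
      have "indicator {..u l} z = (of_bool (s z / \<epsilon> \<le> real l / real m) :: real)" for l
      proof -
        have "z \<le> u l \<longleftrightarrow> s z \<le> real l * \<epsilon> / real m"
          unfolding s_le by (auto simp: u_def less_eq_vec_def algebra_simps)
        also have "\<dots> \<longleftrightarrow> s z / \<epsilon> \<le> real l / real m" using \<epsilon>0 by (simp add: field_simps)
        finally show ?thesis by (auto simp: indicator_def)
      qed
      then show ?thesis using step_count_approx[OF m(1), of "s z / \<epsilon>"] m(2)
        by (simp add: f_def g_def abs_minus_commute)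
    qed
    ultimately show "\<exists>g\<in>orthant_steps. \<forall>z. \<bar>f z - g z\<bar> \<le> e" by blast
  qed
qed

text \<open>Orthant steps are discontinuous, so Stone-Weierstrass is applied to the continuous
  functions on \<open>K\<close> that they approximate uniformly. These form an algebra, and the
  ramps separate points.\<close>

lemma orthant_steps_dense:
  fixes K :: "(real^'d) set"
  assumes "compact K" "K \<subseteq> latent_space" "continuous_on K f" "e > 0"
  shows "\<exists>g\<in>orthant_steps. \<forall>x\<in>K. \<bar>f x - g x\<bar> \<le> e"
proof -
  define R where "R f \<longleftrightarrow> continuous_on K f \<and> (\<forall>e>0. \<exists>g\<in>orthant_steps. \<forall>x\<in>K. \<bar>f x - g x\<bar> \<le> e)"
    for f :: "real^'d \<Rightarrow> real"
  have "\<exists>g. R g \<and> (\<forall>x\<in>K. \<bar>f x - g x\<bar> < e / 2)"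
  proof (rule Stone_Weierstrass_HOL[where P = R])
    show "R (\<lambda>x. c)" for c :: real
      unfolding R_def by (auto intro!: bexI[of _ "\<lambda>_. c"] orthant_steps.const)
    show "continuous_on K f" if "R f" for f using that by (simp add: R_def)
    show "R (\<lambda>x. f x + g x)" if h: "R f \<and> R g" for f g
      unfolding R_def
    proof (intro conjI allI impI)
      show "continuous_on K (\<lambda>x. f x + g x)" using h by (auto simp: R_def intro: continuous_intros)
      fix e :: real assume "e > 0"
      then obtain f' g' where f': "f' \<in> orthant_steps" "\<forall>x\<in>K. \<bar>f x - f' x\<bar> \<le> e / 2"
        and g': "g' \<in> orthant_steps" "\<forall>x\<in>K. \<bar>g x - g' x\<bar> \<le> e / 2"
        using h unfolding R_def by (meson half_gt_zero)
      show "\<exists>h\<in>orthant_steps. \<forall>x\<in>K. \<bar>f x + g x - h x\<bar> \<le> e"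
      proof (rule bexI[OF _ orthant_steps_add[OF f'(1) g'(1)]], rule ballI)
        fix x assume "x \<in> K"
        then have "\<bar>f x - f' x\<bar> \<le> e / 2" "\<bar>g x - g' x\<bar> \<le> e / 2" using f' g' by auto
        then show "\<bar>f x + g x - (f' x + g' x)\<bar> \<le> e" by linarith
      qed
    qed
    show "R (\<lambda>x. f x * g x)" if h: "R f \<and> R g" for f g
      unfolding R_def
    proof (intro conjI allI impI)
      show "continuous_on K (\<lambda>x. f x * g x)" using h by (auto simp: R_def intro: continuous_intros)
      fix e :: real assume e: "e > 0"
      have "bounded (f ` K)" "bounded (g ` K)"
        using h assms(1) by (auto simp: R_def intro: compact_imp_bounded compact_continuous_image)
      then obtain B1 B2 where "\<And>x. x \<in> K \<Longrightarrow> \<bar>f x\<bar> \<le> B1" "\<And>x. x \<in> K \<Longrightarrow> \<bar>g x\<bar> \<le> B2"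
        by (auto simp: bounded_iff)
      then have B: "\<bar>f x\<bar> \<le> \<bar>B1\<bar> + \<bar>B2\<bar> + 1" "\<bar>g x\<bar> \<le> \<bar>B1\<bar> + \<bar>B2\<bar> + 1" if "x \<in> K" for x
        using that by (smt (verit))+
      define B where "B = \<bar>B1\<bar> + \<bar>B2\<bar> + 1"
      have Bp: "B > 0" by (simp add: B_def)
      \<comment> \<open>Replacing both factors costs at most d (2 B + d); with d \<le> 1 this is at
        most d (2 B + 1), hence at most e.\<close>
      define d where "d = min 1 (e / (2 * B + 1))"
      have "d \<le> e / (2 * B + 1)" unfolding d_def by (rule min.cobounded2)
      then have d: "d > 0" "d \<le> 1" "d * (2 * B + 1) \<le> e"
        using e Bp by (simp_all add: pos_le_divide_eq) (simp_all add: d_def)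
      obtain f' g' where f': "f' \<in> orthant_steps" "\<forall>x\<in>K. \<bar>f x - f' x\<bar> \<le> d"
        and g': "g' \<in> orthant_steps" "\<forall>x\<in>K. \<bar>g x - g' x\<bar> \<le> d"
        using h d(1) unfolding R_def by meson
      have "\<bar>f x * g x - f' x * g' x\<bar> \<le> e" if x: "x \<in> K" for x
      proof -
        have 1: "\<bar>f' x\<bar> \<le> B + d" using B(1)[OF x] f'(2) x unfolding B_def by (smt (verit))
        have "\<bar>f x * g x - f' x * g' x\<bar> = \<bar>(f x - f' x) * g x + f' x * (g x - g' x)\<bar>"
          by (simp add: algebra_simps)
        also have "\<dots> \<le> \<bar>f x - f' x\<bar> * \<bar>g x\<bar> + \<bar>f' x\<bar> * \<bar>g x - g' x\<bar>"
          by (metis abs_mult abs_triangle_ineq)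
        also have "\<dots> \<le> d * B + (B + d) * d"
          by (intro add_mono mult_mono) (use f' g' x 1 B[OF x] d Bp in \<open>auto simp: B_def\<close>)
        also have "\<dots> = d * (2 * B + d)" by (simp add: algebra_simps)
        also have "\<dots> \<le> d * (2 * B + 1)" using d by (intro mult_left_mono) auto
        finally show ?thesis using d by simp
      qed
      then show "\<exists>h\<in>orthant_steps. \<forall>x\<in>K. \<bar>f x * g x - h x\<bar> \<le> e"
        by (intro bexI[OF _ orthant_steps_mult[OF f'(1) g'(1)]]) auto
    qed
    show "\<exists>f. R f \<and> f x \<noteq> f y" if xy: "x \<in> K \<and> y \<in> K \<and> x \<noteq> y" for x y
    proof -
      \<comment> \<open>The ramp requires a coordinate in which the first point is the smaller one;
        otherwise the two points exchange roles.\<close>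
      have *: "\<exists>f. R f \<and> f x \<noteq> f y" if "x \<in> K" "y \<in> K" "x $ k < y $ k" for x y k
      proof -
        have "x \<in> latent_space" using that assms(2) by blast
        then show ?thesis
        proof (rule orthant_steps_separate[OF _ that(3)])
          fix f :: "real^'d \<Rightarrow> real"
          assume f: "continuous_on UNIV f" "f x \<noteq> f y"
            "\<And>e. e > 0 \<Longrightarrow> \<exists>g\<in>orthant_steps. \<forall>z. \<bar>f z - g z\<bar> \<le> e"
          have "R f" unfolding R_def
            using continuous_on_subset[OF f(1) subset_UNIV] f(3) by blast
          then show "\<exists>f. R f \<and> f x \<noteq> f y" using f(2) by blast
        qed
      qed
      obtain k where "x $ k \<noteq> y $ k" using xy by (auto simp: vec_eq_iff)
      then consider "x $ k < y $ k" | "y $ k < x $ k" by linarith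
      then show ?thesis
      proof cases
        case 1
        then show ?thesis using *[of x y k] xy by blast
      next
        case 2
        then obtain f where "R f" "f y \<noteq> f x" using *[of y x k] xy by blast
        then show ?thesis by (auto intro!: exI[of _ f])
      qed
    qed
  qed (use assms in auto)
  then obtain h where h: "R h" "\<forall>x\<in>K. \<bar>f x - h x\<bar> < e / 2" by blast
  then obtain g where g: "g \<in> orthant_steps" "\<forall>x\<in>K. \<bar>h x - g x\<bar> \<le> e / 2"
    using assms(4) unfolding R_def by (meson half_gt_zero)
  show ?thesis
  proof (rule bexI[OF _ g(1)], rule ballI)
    fix x assume "x \<in> K"
    then have "\<bar>f x - h x\<bar> < e / 2" "\<bar>h x - g x\<bar> \<le> e / 2" using h g by auto
    then show "\<bar>f x - g x\<bar> \<le> e" by linarith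
  qed
qed

section \<open>Averages over the latent positions and the support of the limit law\<close>

locale ecdf_limit =
  fixes x0 :: "nat \<Rightarrow> real^'d" and F :: "(real^'d) measure" and K :: "(real^'d) set"
  assumes prF: "prob_space F" and setsF: "sets F = sets borel" and F1: "measure F latent_space = 1"
    and conv: "(\<lambda>n. SUP x\<in>latent_space. \<bar>ecdf n x0 x - mv_cdf F x\<bar>) \<longlonglongrightarrow> 0"
    and cK: "compact K" and KL: "K \<subseteq> latent_space" and xK: "\<And>i. i \<ge> 1 \<Longrightarrow> x0 i \<in> K"
begin

sublocale prob_space F by (rule prF)

lemma measF: "f \<in> borel_measurable borel \<Longrightarrow> f \<in> borel_measurable F"
  by (simp add: measurable_cong_sets[OF setsF refl])

lemma spaceF: "space F = UNIV"
  using sets_eq_imp_space_eq[OF setsF] by simp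

definition avg :: "nat \<Rightarrow> (real^'d \<Rightarrow> real) \<Rightarrow> real" where
  "avg n f = (1 / real n) * (\<Sum>i=1..n. f (x0 i))"

lemma ecdf_tendsto:
  assumes "u \<in> latent_space"
  shows "(\<lambda>n. ecdf n x0 u) \<longlonglongrightarrow> measure F {..u}"
proof -
  have e01: "0 \<le> ecdf n x0 v \<and> ecdf n x0 v \<le> 1" for n v
  proof -
    have "(\<Sum>i=1..n. indicator {..v} (x0 i)) \<le> (\<Sum>i=1..n. (1::real))"
      by (intro sum_mono) (auto simp: indicator_def)
    then show ?thesis by (auto simp: ecdf_def divide_simps intro!: sum_nonneg)
  qed
  \<comment> \<open>A supremum of reals dominates its members only if the set is bounded above; here
    both functions take values in [0, 1].\<close>
  have "\<bar>ecdf n x0 u - mv_cdf F u\<bar> \<le> (SUP x\<in>latent_space. \<bar>ecdf n x0 x - mv_cdf F x\<bar>)" for n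
  proof (rule cSUP_upper[OF assms bdd_aboveI2])
    fix v show "\<bar>ecdf n x0 v - mv_cdf F v\<bar> \<le> 1"
      using e01[of n v] prob_le_1[of "{..v}"] measure_nonneg[of F "{..v}"]
      unfolding mv_cdf_def abs_le_iff by linarith
  qed
  then have "(\<lambda>n. ecdf n x0 u - mv_cdf F u) \<longlonglongrightarrow> 0"
    by (intro Lim_null_comparison[OF _ conv]) auto
  then show ?thesis by (simp add: mv_cdf_def LIM_zero_iff)
qed

lemma integrable_bounded_F:
  fixes f :: "real^'d \<Rightarrow> real"
  assumes "f \<in> borel_measurable borel" "\<And>x. \<bar>f x\<bar> \<le> B"
  shows "integrable F f"
  by (rule integrable_const_bound[of _ B]) (use assms measF in auto)

lemma avg_orthant_steps_tendsto: "f \<in> orthant_steps \<Longrightarrow> (\<lambda>n. avg n f) \<longlonglongrightarrow> (LINT x|F. f x)"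
proof (induction f rule: orthant_steps.induct)
  case (const c)
  have "avg n (\<lambda>_. c) = c" if "n \<ge> 1" for n using that by (simp add: avg_def)
  then have "(\<lambda>n. avg n (\<lambda>_. c)) \<longlonglongrightarrow> c"
    by (intro tendsto_eventually) (auto simp: eventually_sequentially)
  then show ?case by (simp add: prob_space)
next
  case (step f u c)
  have 1: "avg n (\<lambda>x. f x + c * indicator {..u} x) = avg n f + c * ecdf n x0 u" for n
    unfolding avg_def ecdf_def sum.distrib sum_distrib_left[symmetric] by (simp add: algebra_simps)
  obtain B where B: "\<And>x. \<bar>f x\<bar> \<le> B" using orthant_steps_bounded[OF step.hyps(1)] by auto
  have "(LINT x|F. f x + c * indicator {..u} x) = (LINT x|F. f x) + c * measure F {..u}"
  proof -
    have "integrable F (indicator {..u} :: _ \<Rightarrow> real)"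
      by (rule integrable_bounded_F[of _ 1]) (auto simp: indicator_def)
    then show ?thesis
      using integrable_bounded_F[OF orthant_steps_measurable[OF step.hyps(1)] B]
      by (simp add: spaceF)
  qed
  then show ?case unfolding 1 using step.IH ecdf_tendsto[OF step.hyps(2)]
    by (auto intro!: tendsto_intros)
qed

text \<open>The indicator of the half-open box is a combination of orthant steps with corners in the
  closed box. No position lies there, so its averages vanish, and with them the integral under
  \<open>F\<close>.\<close>

lemma null_box:
  assumes "cbox a b \<subseteq> latent_space - K"
  shows "box a b \<in> null_sets F"
proof (cases "box a b = {}")
  case False
  then have ab: "a $ k < b $ k" for k by (auto simp: interval_ne_empty_cart)
  \<comment> \<open>The upper corner with its k-th coordinate lowered to that of \<open>a\<close>:
    the orthant below it consists, within the one below \<open>b\<close>, of the points failing the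
    k-th strict inequality.\<close>
  define v where "v k = (\<chi> l. if l = k then a $ l else b $ l)" for k
  have in_cbox: "b \<in> cbox a b" "v k \<in> cbox a b" for k
    using ab by (auto simp: mem_box_cart v_def less_imp_le)
  then have lat: "b \<in> latent_space" "v k \<in> latent_space" for k using assms by auto
  define f :: "real^'d \<Rightarrow> real" where "f x = indicator {..b} x * (\<Prod>k\<in>UNIV. 1 + (-1) * indicator {..v k} x)" for x
  have fV: "f \<in> orthant_steps" unfolding f_def
    by (intro orthant_steps_mult orthant_steps_indicator lat orthant_steps_prod orthant_steps.step orthant_steps.const) auto
  have f_eq: "f x = of_bool (\<forall>k. a $ k < x $ k \<and> x $ k \<le> b $ k)" for x
  proof -
    consider "\<not> x \<le> b" | k where "x \<le> b" "x $ k \<le> a $ k" | "x \<le> b" "\<forall>k. a $ k < x $ k"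
      by (meson not_le)
    then show ?thesis
    proof cases
      case 1 then show ?thesis by (auto simp: f_def less_eq_vec_def)
    next
      case (2 k)
      then have "x \<le> v k" by (auto simp: v_def less_eq_vec_def)
      then have "(\<Prod>k\<in>UNIV. 1 + (-1) * indicator {..v k} x :: real) = 0"
        by (intro prod_zero) (auto intro!: exI[of _ k])
      then have "f x = 0" unfolding f_def by simp
      then show ?thesis using 2 by (auto simp: not_less intro!: exI[of _ k])
    next
      case 3
      then have "\<not> x \<le> v k" for k
        using 3 by (auto simp: v_def less_eq_vec_def not_le intro!: exI[of _ k])
      then show ?thesis using 3 by (auto simp: f_def less_eq_vec_def)
    qed
  qed
  have "f (x0 i) = 0" if "i \<ge> 1" for i
  proof -
    have "x0 i \<notin> cbox a b" using xK[OF that] assms by auto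
    then have "\<not> (\<forall>k. a $ k < x0 i $ k \<and> x0 i $ k \<le> b $ k)"
      unfolding mem_box_cart by (meson less_imp_le)
    then show ?thesis unfolding f_eq by simp
  qed
  then have "avg n f = 0" for n by (simp add: avg_def)
  then have "(LINT x|F. f x) = 0"
    using LIMSEQ_unique[OF avg_orthant_steps_tendsto[OF fV]] by simp
  moreover have "measure F (box a b) \<le> (LINT x|F. f x)"
  proof -
    have "measure F (box a b) = (LINT x|F. indicator (box a b) x)" by (simp add: spaceF)
    also have "\<dots> \<le> (LINT x|F. f x)"
    proof (rule integral_mono)
      show "integrable F (indicator (box a b) :: _ \<Rightarrow> real)" by (rule integrable_bounded_F[of _ 1]) (auto simp: indicator_def)
      show "integrable F f"
        by (rule integrable_bounded_F[OF orthant_steps_measurable[OF fV], of 1]) (auto simp: f_eq)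
      show "indicator (box a b) x \<le> f x" for x
        by (auto simp: f_eq indicator_def mem_box_cart less_imp_le)
    qed
    finally show ?thesis .
  qed
  ultimately have "measure F (box a b) = 0" using measure_nonneg[of F "box a b"] by linarith
  then show ?thesis by (simp add: null_sets_def emeasure_eq_measure setsF)
qed simp

text \<open>The limit law is given on the latent space, whereas the Fisher weights are bounded on
  \<open>K\<close>. The complement of \<open>K\<close> in the latent space is open, hence a
  countable union of null boxes, and integrals may be taken over \<open>K\<close>.\<close>

lemma prob_K: "measure F K = 1"
proof -
  let ?M = "latent_space - K"
  have oM: "open ?M" using open_latent_space cK by (auto intro: open_Diff compact_imp_closed)
  define \<F> where "\<F> = {box a b | a b. cbox a b \<subseteq> ?M}"
  obtain \<F>' where \<F>': "\<F>' \<subseteq> \<F>" "countable \<F>'" "\<Union>\<F>' = \<Union>\<F>"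
    using Lindelof[of \<F>] by (auto simp: \<F>_def)
  have "?M \<subseteq> \<Union>\<F>"
  proof
    fix x assume "x \<in> ?M"
    then obtain e where e: "e > 0" "ball x e \<subseteq> ?M" using oM by (auto simp: open_contains_ball)
    \<comment> \<open>Half the radius, so that the closed box also avoids \<open>K\<close>.\<close>
    obtain a b where ab: "x \<in> box a b" "box a b \<subseteq> ball x (e/2)"
      using rational_boxes[of "e/2" x] e by auto
    have "cbox a b = closure (box a b)" using ab(1) by (metis closure_box empty_iff)
    also have "\<dots> \<subseteq> closure (ball x (e/2))" by (rule closure_mono) (rule ab)
    also have "\<dots> \<subseteq> ball x e" using e by auto
    finally have "cbox a b \<subseteq> ?M" using e by blast
    then have "box a b \<in> \<F>" unfolding \<F>_def by blast
    then show "x \<in> \<Union>\<F>" using ab by blast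
  qed
  moreover have "\<Union>\<F>' \<in> null_sets F"
    using null_sets_UN'[OF \<F>'(2), of "\<lambda>x. x" F] \<F>'(1) null_box by (auto simp: \<F>_def)
  moreover have "?M \<in> sets F" using oM unfolding setsF by simp
  ultimately have "?M \<in> null_sets F"
    unfolding \<F>'(3) by (rule null_sets_subset[rotated 2])
  then have "measure F ?M = 0" by (simp add: measure_def null_setsD1)
  moreover have "measure F ?M = measure F latent_space - measure F K"
    by (rule finite_measure_Diff)
      (use KL borel_open[OF open_latent_space] borel_closed[OF compact_imp_closed[OF cK]] in \<open>auto simp: setsF\<close>)
  ultimately show ?thesis using F1 by simp
qed

lemma AE_K: "AE x in F. x \<in> K"
  using prob_K cK by (intro prob_eq_1[THEN iffD1]) (auto simp: setsF compact_imp_closed)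

text \<open>Every position lies in \<open>K\<close>, and so does almost all mass of
  \<open>F\<close>; approximating \<open>f\<close> on \<open>K\<close> by orthant steps therefore
  controls the averages and the integral alike. The indicator makes the integrand measurable, as
  \<open>f\<close> is arbitrary off \<open>K\<close>.\<close>

theorem avg_tendsto:
  assumes "continuous_on K f"
  shows "(\<lambda>n. avg n f) \<longlonglongrightarrow> (LINT x|F. indicator K x * f x)"
proof (rule LIMSEQ_I)
  fix e :: real assume e: "e > 0"
  then obtain g where g: "g \<in> orthant_steps" "\<forall>x\<in>K. \<bar>f x - g x\<bar> \<le> e / 4"
    using orthant_steps_dense[OF cK KL assms, of "e / 4"] by auto
  obtain B where B: "\<And>x. \<bar>g x\<bar> \<le> B" using orthant_steps_bounded[OF g(1)] by auto
  have mf: "(\<lambda>x. indicator K x * f x) \<in> borel_measurable borel"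
    using borel_measurable_continuous_on_indicator[OF _ assms] cK by (simp add: compact_imp_closed)
  have fi: "integrable F (\<lambda>x. indicator K x * f x)"
  proof (rule integrable_bounded_F[OF mf, of "B + e"])
    have B0: "B \<ge> 0" using B[of 0] by linarith
    fix x show "\<bar>indicator K x * f x\<bar> \<le> B + e"
    proof (cases "x \<in> K")
      case True
      then have "\<bar>f x - g x\<bar> \<le> e / 4" using g(2) by simp
      then have "\<bar>f x\<bar> \<le> B + e" using B[of x] e by linarith
      then show ?thesis using True by simp
    qed (use B0 e in simp)
  qed
  have gi: "integrable F g" by (rule integrable_bounded_F[OF orthant_steps_measurable[OF g(1)] B])
  have I: "\<bar>(LINT x|F. indicator K x * f x) - (LINT x|F. g x)\<bar> \<le> e / 4"
  proof -
    have "\<bar>LINT x|F. indicator K x * f x - g x\<bar> \<le> (LINT x|F. e / 4)"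
    proof (rule order.trans[OF integral_abs_bound integral_mono_AE])
      show "AE x in F. \<bar>indicator K x * f x - g x\<bar> \<le> e / 4"
        by (rule AE_mp[OF AE_K AE_I2]) (use g(2) in auto)
    qed (use fi gi in auto)
    then show ?thesis using fi gi prob_space by (simp add: spaceF)
  qed
  have A: "\<bar>avg n f - avg n g\<bar> \<le> e / 4" for n
  proof -
    have "\<bar>\<Sum>i=1..n. f (x0 i) - g (x0 i)\<bar> \<le> (\<Sum>i=1..n. e / 4)"
      by (rule order.trans[OF sum_abs sum_mono]) (use g(2) xK in auto)
    then have "\<bar>(\<Sum>i=1..n. f (x0 i)) - (\<Sum>i=1..n. g (x0 i))\<bar> \<le> real n * (e / 4)"
      by (simp add: sum_subtractf)
    then show ?thesis unfolding avg_def right_diff_distrib[symmetric] abs_mult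
      using e by (cases "n = 0") (auto simp: field_simps)
  qed
  obtain N where N: "\<And>n. n \<ge> N \<Longrightarrow> \<bar>avg n g - (LINT x|F. g x)\<bar> < e / 4"
    using LIMSEQ_D[OF avg_orthant_steps_tendsto[OF g(1)], of "e / 4"] e by auto
  have "norm (avg n f - (LINT x|F. indicator K x * f x)) < e" if "n \<ge> N" for n
    using N[OF that] A[of n] I e unfolding real_norm_def by linarith
  then show "\<exists>N. \<forall>n\<ge>N. norm (avg n f - (LINT x|F. indicator K x * f x)) < e" by blast
qed

end

section \<open>Convergence in distribution from characteristic functions\<close>

text \<open>Free phases include the sines without complex values, and the product-to-sum formula
  makes the class an algebra. Characteristic functions are used in this real form
  throughout.\<close>

inductive_set trig_polys :: "(real^'d \<Rightarrow> real) set" where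
  zero: "(\<lambda>_. 0) \<in> trig_polys"
| step: "f \<in> trig_polys \<Longrightarrow> (\<lambda>x. f x + c * cos (t \<bullet> x + s)) \<in> trig_polys"

lemma trig_polys_cos: "(\<lambda>x. cos (t \<bullet> x + s)) \<in> trig_polys"
  using trig_polys.step[OF trig_polys.zero, of 1 t s] by simp

lemma trig_polys_const: "(\<lambda>x. c) \<in> trig_polys"
  using trig_polys.step[OF trig_polys.zero, of c 0 0] by simp

lemma trig_polys_add:
  assumes "f \<in> trig_polys" "g \<in> trig_polys"
  shows "(\<lambda>x. f x + g x) \<in> trig_polys"
  using assms(2,1)
proof (induction g arbitrary: f rule: trig_polys.induct)
  case (step g c t s)
  then show ?case using trig_polys.step[of "\<lambda>x. f x + g x" c t s] by (simp add: algebra_simps)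
qed simp

lemma trig_polys_mult_cos:
  "f \<in> trig_polys \<Longrightarrow> (\<lambda>x. f x * (c' * cos (t' \<bullet> x + s'))) \<in> trig_polys"
proof (induction f rule: trig_polys.induct)
  case (step f c t s)
  have "c * cos (t \<bullet> x + s) * (c' * cos (t' \<bullet> x + s')) =
     (c * c' / 2) * cos ((t - t') \<bullet> x + (s - s')) + (c * c' / 2) * cos ((t + t') \<bullet> x + (s + s'))" for x
    using cos_times_cos[of "t \<bullet> x + s" "t' \<bullet> x + s'"]
    by (simp add: inner_simps algebra_simps add_divide_distrib)
  then show ?case
    using trig_polys.step[OF trig_polys.step[OF step.IH, of "c * c' / 2" "t - t'" "s - s'"], of "c * c' / 2" "t + t'" "s + s'"]
    by (simp add: distrib_right add.assoc)
qed (simp add: trig_polys.zero)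

lemma trig_polys_mult:
  assumes "f \<in> trig_polys" "g \<in> trig_polys"
  shows "(\<lambda>x. f x * g x) \<in> trig_polys"
  using assms(2,1)
proof (induction g arbitrary: f rule: trig_polys.induct)
  case (step g c t s)
  then show ?case
    using trig_polys_add[OF step.IH[OF step.prems] trig_polys_mult_cos[OF step.prems, of c t s]]
    by (simp add: algebra_simps)
qed (simp add: trig_polys.zero)

lemma trig_polys_continuous: "f \<in> trig_polys \<Longrightarrow> continuous_on UNIV f"
  by (induction f rule: trig_polys.induct) (auto intro!: continuous_intros)

lemma trig_polys_bounded: "f \<in> trig_polys \<Longrightarrow> \<exists>B. \<forall>x. \<bar>f x\<bar> \<le> B"
proof (induction f rule: trig_polys.induct)
  case (step f c t s)
  then obtain B where B: "\<And>x. \<bar>f x\<bar> \<le> B" by auto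
  have "\<bar>f x + c * cos (t \<bullet> x + s)\<bar> \<le> B + \<bar>c\<bar>" for x
  proof -
    have "\<bar>c * cos (t \<bullet> x + s)\<bar> \<le> \<bar>c\<bar> * 1" unfolding abs_mult by (intro mult_left_mono) auto
    then show ?thesis using B[of x] abs_triangle_ineq[of "f x" "c * cos (t \<bullet> x + s)"] by linarith
  qed
  then show ?case by blast
qed auto

text \<open>Composing with \<open>x \<mapsto> sin (x / L)\<close>, a continuous function on a cube becomes a globally
  bounded function, and polynomials become trigonometric polynomials; this gives an approximation
  that is uniform on a box without losing the global bound.\<close>

lemma trig_polys_approx:
  fixes f :: "real^'d \<Rightarrow> real"
  assumes f: "continuous_on UNIV f" "\<And>x. \<bar>f x\<bar> \<le> B" and e: "e > 0" and L: "L > 0"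
  obtains g where "g \<in> trig_polys" "\<And>x. norm x \<le> L \<Longrightarrow> \<bar>f x - g x\<bar> \<le> e" "\<And>x. \<bar>g x\<bar> \<le> B + e"
proof -
  define C :: "(real^'d) set" where "C = cbox (\<chi> k. -1) (\<chi> k. 1)"
  define \<sigma> where "\<sigma> x = (\<chi> k. sin (x $ k / L))" for x :: "real^'d"
  define F where "F s = f (\<chi> k. L * arcsin (s $ k))" for s
  have \<sigma>C: "\<sigma> x \<in> C" for x by (auto simp: C_def \<sigma>_def mem_box_cart)
  have contF: "continuous_on C F"
    unfolding F_def
    by (intro continuous_on_compose2[OF f(1)] continuous_intros)
       (auto simp: C_def mem_box_cart)
  define R where "R h \<longleftrightarrow> continuous_on C h \<and> (\<lambda>x. h (\<sigma> x)) \<in> trig_polys" for h :: "real^'d \<Rightarrow> real"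
  have "\<exists>g. R g \<and> (\<forall>x\<in>C. \<bar>F x - g x\<bar> < e)"
  proof (rule Stone_Weierstrass_HOL[where P = R])
    show "compact C" by (simp add: C_def)
    show "\<exists>f. R f \<and> f x \<noteq> f y" if xy: "x \<in> C \<and> y \<in> C \<and> x \<noteq> y" for x y
    proof -
      obtain k where "x $ k \<noteq> y $ k" using xy by (auto simp: vec_eq_iff)
      moreover have "R (\<lambda>s. s $ k)"
      proof -
        have "\<sigma> z $ k = cos (axis k (1 / L) \<bullet> z + (- (pi / 2)))" for z
          using cos_diff[of "z $ k / L" "pi / 2"] by (simp add: \<sigma>_def inner_axis')
        then show ?thesis unfolding R_def using trig_polys_cos[of "axis k (1 / L)" "- (pi / 2)"]
          by (auto intro!: continuous_intros)
      qed
      ultimately show ?thesis by (intro exI[of _ "\<lambda>s. s $ k"]) auto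
    qed
  qed (use contF e in \<open>auto simp: R_def intro: trig_polys_const trig_polys_add trig_polys_mult continuous_on_add continuous_on_mult\<close>)
  then obtain g where g: "R g" "\<And>x. x \<in> C \<Longrightarrow> \<bar>F x - g x\<bar> < e" by blast
  show ?thesis
  proof
    show "(\<lambda>x. g (\<sigma> x)) \<in> trig_polys" using g by (simp add: R_def)
    show "\<bar>g (\<sigma> x)\<bar> \<le> B + e" for x
      using g(2)[OF \<sigma>C, of x] f(2)[of "\<chi> k. L * arcsin (\<sigma> x $ k)"] by (simp add: F_def)
    fix x :: "real^'d" assume x: "norm x \<le> L"
    \<comment> \<open>arcsin inverts sin on [-pi/2, pi/2], which contains [-1, 1]; the radius
      \<open>L\<close> brings the coordinates into that range.\<close>
    have "L * arcsin (sin (x $ k / L)) = x $ k" for k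
    proof -
      have "\<bar>x $ k\<bar> \<le> L" using component_le_norm_cart[of x k] x by simp
      then have "\<bar>x $ k / L\<bar> \<le> 1" using L by simp
      then have "arcsin (sin (x $ k / L)) = x $ k / L"
        using pi_ge_two unfolding abs_le_iff by (intro arcsin_sin) linarith+
      then show ?thesis using L by simp
    qed
    then have "F (\<sigma> x) = f x" by (simp add: F_def \<sigma>_def)
    then show "\<bar>f x - g (\<sigma> x)\<bar> \<le> e" using g(2)[OF \<sigma>C, of x] by simp
  qed
qed

text \<open>Outside the ball only the global bounds are available, so the tail mass enters with the
  factor 2 B + e.\<close>

lemma integral_approx_on_ball:
  fixes f g :: "real^'d \<Rightarrow> real"
  assumes \<mu>: "prob_space \<mu>" "sets \<mu> = sets borel" and e: "e \<ge> 0"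
    and f: "continuous_on UNIV f" "\<And>x. \<bar>f x\<bar> \<le> B"
    and g: "continuous_on UNIV g" "\<And>x. \<bar>g x\<bar> \<le> B + e"
    and fg: "\<And>x. norm x \<le> L \<Longrightarrow> \<bar>f x - g x\<bar> \<le> e"
  shows "\<bar>(LINT z|\<mu>. f z) - (LINT z|\<mu>. g z)\<bar> \<le> e + (2 * B + e) * measure \<mu> {z. norm z > L}"
proof -
  interpret prob_space \<mu> by fact
  have m: "h \<in> borel_measurable \<mu>" if "continuous_on UNIV h" for h :: "real^'d \<Rightarrow> real"
    using borel_measurable_continuous_onI[OF that] by (simp add: measurable_cong_sets[OF \<mu>(2) refl])
  have sp: "space \<mu> = UNIV" using sets_eq_imp_space_eq[OF \<mu>(2)] by simp
  have int: "integrable \<mu> f" "integrable \<mu> g"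
    by (rule integrable_const_bound[of _ B] integrable_const_bound[of _ "B + e"]; use f g m in auto)+
  let ?A = "{z :: real^'d. norm z > L}"
  have A: "?A \<in> sets \<mu>" unfolding \<mu>(2) by measurable
  have pt: "\<bar>f z - g z\<bar> \<le> e + (2 * B + e) * indicator ?A z" for z
  proof (cases "z \<in> ?A")
    case True
    then have "\<bar>f z - g z\<bar> \<le> B + (B + e)"
      using f(2)[of z] g(2)[of z] by linarith
    then show ?thesis using True e by simp
  next
    case False
    then show ?thesis using fg[of z] by simp
  qed
  have intA: "integrable \<mu> (indicator ?A :: _ \<Rightarrow> real)"
    using A by (intro integrable_real_indicator) (auto simp: less_top[symmetric])
  have "\<bar>LINT z|\<mu>. f z - g z\<bar> \<le> (LINT z|\<mu>. e + (2 * B + e) * indicator ?A z)"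
    by (rule order.trans[OF integral_abs_bound integral_mono]) (use int intA pt in auto)
  also have "\<dots> = e + (2 * B + e) * measure \<mu> ?A"
    using A intA prob_space by (simp add: sp)
  finally show ?thesis using int by simp
qed

lemma prob_norm_gt_tendsto_0:
  assumes "prob_space (N :: (real^'d) measure)" "sets N = sets borel"
  shows "(\<lambda>k::nat. measure N {z. norm z > real k}) \<longlonglongrightarrow> 0"
proof -
  interpret prob_space N by fact
  have "(\<lambda>k::nat. measure N {z. norm z > real k}) \<longlonglongrightarrow> measure N (\<Inter>k::nat. {z. norm z > real k})"
  proof (rule finite_Lim_measure_decseq)
    have "{z :: real^'d. norm z > real k} \<in> sets borel" for k by measurable
    then show "range (\<lambda>k. {z :: real^'d. norm z > real k}) \<subseteq> sets N"
      unfolding assms(2) by (rule image_subsetI)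
    show "decseq (\<lambda>k. {z :: real^'d. norm z > real k})" by (auto simp: decseq_def)
  qed
  also have "(\<Inter>k::nat. {z :: real^'d. norm z > real k}) = {}"
  proof -
    have "\<exists>k::nat. \<not> norm z > real k" for z :: "real^'d"
      using reals_Archimedean2[of "norm z"] by (meson not_less less_imp_le)
    then show ?thesis by blast
  qed
  finally show ?thesis by simp
qed

text \<open>A continuity theorem for vectors with tightness as a premise. A test function is
  replaced by a trigonometric polynomial that is close to it on a large ball and bounded everywhere;
  integrals of such polynomials converge, and the mass outside the ball is small for all late laws
  and for the limit.\<close>

lemma tendsto_in_distr_cosI:
  fixes M :: "nat \<Rightarrow> 'a pmf" and X :: "nat \<Rightarrow> 'a \<Rightarrow> real^'d"
  assumes N: "prob_space N" "sets N = sets borel"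
    and conv: "\<And>t s. (\<lambda>n. measure_pmf.expectation (M n) (\<lambda>a. cos (t \<bullet> X n a + s))) \<longlonglongrightarrow> (LINT z|N. cos (t \<bullet> z + s))"
    and tight: "\<And>e. e > 0 \<Longrightarrow> \<exists>L. \<forall>\<^sub>F n in sequentially. measure (M n) {a. norm (X n a) > L} < e"
  shows "tendsto_in_distr (\<lambda>n. measure_pmf (M n)) X N"
  unfolding tendsto_in_distr_def
proof (intro allI impI, elim conjE)
  fix f :: "real^'d \<Rightarrow> real" assume f: "continuous_on UNIV f" and bf: "bounded (range f)"
  define \<mu> where "\<mu> n = distr (measure_pmf (M n)) borel (X n)" for n
  have \<mu>: "prob_space (\<mu> n)" "sets (\<mu> n) = sets borel" for n
    unfolding \<mu>_def by (auto intro!: measure_pmf.prob_space_distr)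
  have int_\<mu>: "(LINT z|\<mu> n. h z) = measure_pmf.expectation (M n) (\<lambda>a. h (X n a))"
    if "continuous_on UNIV h" for h :: "real^'d \<Rightarrow> real" and n
    unfolding \<mu>_def by (rule integral_distr) (auto intro: borel_measurable_continuous_onI that)
  have meas_\<mu>: "measure (\<mu> n) {z. norm z > L} = measure (M n) {a. norm (X n a) > L}" for n L
    unfolding \<mu>_def by (subst measure_distr) (auto simp: vimage_def)
  interpret N: prob_space N by fact
  have spN: "space N = UNIV" using sets_eq_imp_space_eq[OF N(2)] by simp
  have trig: "(\<lambda>n. LINT z|\<mu> n. g z) \<longlonglongrightarrow> (LINT z|N. g z)" if "g \<in> trig_polys" for g
    using that
  proof (induction g rule: trig_polys.induct)
    case (step g c t s)
    have ints: "integrable \<nu> g" "integrable \<nu> (\<lambda>z. c * cos (t \<bullet> z + s))"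
      if "prob_space \<nu>" "sets \<nu> = sets borel" for \<nu>
    proof -
      interpret prob_space \<nu> by fact
      have m: "h \<in> borel_measurable \<nu>" if "continuous_on UNIV h" for h :: "real^'d \<Rightarrow> real"
        using borel_measurable_continuous_onI[OF that] \<open>sets \<nu> = sets borel\<close> by (simp cong: measurable_cong_sets)
      obtain B where "\<forall>x. \<bar>g x\<bar> \<le> B" using trig_polys_bounded[OF step.hyps] by blast
      then show "integrable \<nu> g"
        by (intro integrable_const_bound[of _ B] m trig_polys_continuous step.hyps) auto
      have "integrable \<nu> (\<lambda>z. cos (t \<bullet> z + s))"
        by (rule integrable_const_bound[of _ 1]) (auto intro!: m continuous_intros)
      then show "integrable \<nu> (\<lambda>z. c * cos (t \<bullet> z + s))" by simp
    qed
    have "(\<lambda>n. LINT z|\<mu> n. cos (t \<bullet> z + s)) \<longlonglongrightarrow> (LINT z|N. cos (t \<bullet> z + s))"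
      by (subst int_\<mu>) (auto intro!: continuous_intros conv)
    then show ?case
      by (simp only: Bochner_Integration.integral_add[OF ints[OF \<mu>]] Bochner_Integration.integral_add[OF ints[OF N]]
            integral_mult_right_zero) (intro tendsto_intros step.IH)
  qed simp
  obtain B where B: "\<And>x. \<bar>f x\<bar> \<le> B" using bf by (auto simp: bounded_iff)
  have B0: "B \<ge> 0" using B[of 0] by linarith
  have "(\<lambda>n. LINT z|\<mu> n. f z) \<longlonglongrightarrow> (LINT z|N. f z)"
  proof (rule tendstoI)
    fix \<epsilon> :: real assume \<epsilon>: "\<epsilon> > 0"
    \<comment> \<open>Chosen so that e + (2 B + 1) e, the price of replacing \<open>f\<close> when
      the tail mass is at most e, does not exceed a quarter of \<epsilon>.\<close>
    define e where "e = min 1 (\<epsilon> / (4 * (2 * B + 2)))"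
    have e: "e > 0" "e \<le> 1" using \<epsilon> B0 by (auto simp: e_def)
    have "e \<le> \<epsilon> / (4 * (2 * B + 2))" unfolding e_def by (rule min.cobounded2)
    then have e4: "e * (2 * B + 2) \<le> \<epsilon> / 4" using B0 by (simp add: pos_le_divide_eq field_simps)
    obtain L1 where L1: "\<forall>\<^sub>F n in sequentially. measure (M n) {a. norm (X n a) > L1} < e"
      using tight[OF e(1)] by blast
    have "\<forall>\<^sub>F k in sequentially. measure N {z. norm z > real k} < e"
      using order_tendstoD(2)[OF prob_norm_gt_tendsto_0[OF N] e(1)] .
    then obtain k where k: "measure N {z. norm z > real k} < e" by (auto dest: eventually_happens)
    \<comment> \<open>One radius for all large \<open>n\<close> and for the limit law; the value 1
      ensures that it is positive.\<close>
    define L where "L = max (max L1 (real k)) 1"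
    have LN: "measure N {z. norm z > L} \<le> e"
    proof -
      have "measure N {z. norm z > L} \<le> measure N {z. norm z > real k}"
        by (rule N.finite_measure_mono) (auto simp: L_def N(2))
      then show ?thesis using k by simp
    qed
    obtain g where g: "g \<in> trig_polys" "\<And>x. norm x \<le> L \<Longrightarrow> \<bar>f x - g x\<bar> \<le> e" "\<And>x. \<bar>g x\<bar> \<le> B + e"
    proof -
      have "L > 0" by (simp add: L_def)
      from trig_polys_approx[OF f B e(1) this] that show ?thesis by blast
    qed
    have approx: "\<bar>(LINT z|\<nu>. f z) - (LINT z|\<nu>. g z)\<bar> \<le> \<epsilon> / 4"
      if "prob_space \<nu>" "sets \<nu> = sets borel" "measure \<nu> {z. norm z > L} \<le> e" for \<nu>
    proof -
      have "\<bar>(LINT z|\<nu>. f z) - (LINT z|\<nu>. g z)\<bar> \<le> e + (2 * B + e) * measure \<nu> {z. norm z > L}"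
        by (rule integral_approx_on_ball[OF that(1,2) _ f B trig_polys_continuous[OF g(1)] g(3,2)]) (use e in auto)
      also have "\<dots> \<le> e + (2 * B + 1) * e"
        using that(3) e B0 by (intro add_mono mult_mono) auto
      finally show ?thesis using e4 by (simp add: algebra_simps)
    qed
    have "\<forall>\<^sub>F n in sequentially. dist (LINT z|\<mu> n. g z) (LINT z|N. g z) < \<epsilon> / 4"
      using tendstoD[OF trig[OF g(1)], of "\<epsilon> / 4"] \<epsilon> by simp
    with L1 show "\<forall>\<^sub>F n in sequentially. dist (LINT z|\<mu> n. f z) (LINT z|N. f z) < \<epsilon>"
    proof eventually_elim
      case (elim n)
      have "measure (\<mu> n) {z. norm z > L} \<le> measure (M n) {a. norm (X n a) > L1}"
        unfolding meas_\<mu> by (rule measure_pmf.finite_measure_mono) (auto simp: L_def)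
      then have "\<bar>(LINT z|\<mu> n. f z) - (LINT z|\<mu> n. g z)\<bar> \<le> \<epsilon> / 4"
        using elim by (intro approx \<mu>) auto
      moreover have "\<bar>(LINT z|N. f z) - (LINT z|N. g z)\<bar> \<le> \<epsilon> / 4" by (intro approx N LN)
      ultimately show ?case using elim \<epsilon> unfolding dist_real_def by linarith
    qed
  qed
  then show "(\<lambda>n. LINT z|distr (measure_pmf (M n)) borel (X n). f z) \<longlonglongrightarrow> (LINT z|N. f z)"
    by (simp add: \<mu>_def)
qed

section \<open>Multivariate normal distributions\<close>

lemma Basis_cart_real: "(Basis :: (real^'d) set) = range (\<lambda>k. axis k 1)"
  by (auto simp: Basis_vec_def)

lemma inj_axis_1: "inj (\<lambda>k. axis k (1::real) :: real^'d)"
  by (auto simp: inj_on_def axis_eq_axis)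

lemma borel_measurable_vecI:
  fixes f :: "'a \<Rightarrow> 'b::euclidean_space^'d"
  assumes "\<And>k. (\<lambda>x. f x $ k) \<in> borel_measurable M"
  shows "f \<in> borel_measurable M"
  by (subst borel_measurable_euclidean_space) (use assms in \<open>auto simp: Basis_vec_def inner_axis\<close>)

text \<open>Lebesgue measure as the image of a product measure indexed by the coordinates: this
  opens \<open>real^'d\<close> to Fubini in a single coordinate and to product formulas.\<close>

lemma lborel_cart: "(lborel :: (real^'d) measure) = distr (\<Pi>\<^sub>M k\<in>UNIV. lborel) borel (\<lambda>f. \<chi> k. f k)"
proof (rule lborel_eqI)
  fix l u :: "real^'d" assume lu: "\<And>b. b \<in> Basis \<Longrightarrow> l \<bullet> b \<le> u \<bullet> b"
  interpret product_sigma_finite "\<lambda>_ :: 'd. lborel :: real measure" by standard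
  have lu': "l $ k \<le> u $ k" for k
    using lu[of "axis k 1"] by (simp add: Basis_cart_real inner_axis)
  have m[measurable]: "(\<lambda>f. \<chi> k. f k) \<in> (\<Pi>\<^sub>M k\<in>(UNIV::'d set). (lborel :: real measure)) \<rightarrow>\<^sub>M borel"
    by (rule borel_measurable_vecI) simp
  have "(\<lambda>f. \<chi> k. f k) -` box l u \<inter> space (\<Pi>\<^sub>M k\<in>UNIV. lborel) = Pi\<^sub>E UNIV (\<lambda>k. {l $ k <..< u $ k})"
    by (auto simp: space_PiM mem_box_cart PiE_iff)
  then have "emeasure (distr (\<Pi>\<^sub>M k\<in>UNIV. lborel) borel (\<lambda>f. \<chi> k. f k)) (box l u) =
     emeasure (\<Pi>\<^sub>M k\<in>(UNIV::'d set). lborel) (Pi\<^sub>E UNIV (\<lambda>k. {l $ k <..< u $ k}))"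
    by (simp add: emeasure_distr)
  also have "\<dots> = (\<Prod>k\<in>UNIV. ennreal (u $ k - l $ k))"
    using lu' by (subst emeasure_PiM) auto
  also have "\<dots> = ennreal (\<Prod>k\<in>UNIV. (u - l) \<bullet> axis k 1)"
    using lu' by (subst prod_ennreal) (auto simp: inner_axis)
  also have "(\<Prod>k\<in>UNIV. (u - l) \<bullet> axis k 1) = (\<Prod>b\<in>Basis. (u - l) \<bullet> b)"
    unfolding Basis_cart_real by (subst prod.reindex) (auto simp: inj_axis_1)
  finally show "emeasure (distr (\<Pi>\<^sub>M k\<in>UNIV. lborel) borel (\<lambda>f. \<chi> k. f k)) (box l u) =
     ennreal (\<Prod>b\<in>Basis. (u - l) \<bullet> b)" .
qed simp

lemma measurable_cart_lambda [measurable]: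
  "(\<lambda>f. \<chi> k. f k) \<in> (\<Pi>\<^sub>M k\<in>(UNIV::'d::finite set). (lborel :: real measure)) \<rightarrow>\<^sub>M borel"
  by (rule borel_measurable_vecI) simp

lemma linear_borel_measurable:
  fixes f :: "real^'d \<Rightarrow> real^'d"
  shows "linear f \<Longrightarrow> f \<in> borel_measurable borel"
  by (intro borel_measurable_continuous_onI linear_continuous_on) (simp add: linear_conv_bounded_linear)

section \<open>Linear change of variables for Lebesgue integrals\<close>

lemma nn_integral_linear_diagonal:
  fixes c :: "'d::finite \<Rightarrow> real" and h :: "real^'d \<Rightarrow> ennreal"
  assumes c: "\<And>k. c k \<noteq> 0" and h: "h \<in> borel_measurable borel"
  shows "ennreal (\<Prod>k\<in>UNIV. \<bar>c k\<bar>) * (\<integral>\<^sup>+x. h (\<chi> k. c k * x $ k) \<partial>lborel) = (\<integral>\<^sup>+x. h x \<partial>lborel)"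
proof -
  define c' where "c' b = (\<Sum>k\<in>UNIV. c k * b $ k)" for b :: "real^'d"
  have c'_axis: "c' (axis k 1) = c k" for k
    by (simp add: c'_def axis_def if_distrib cong: if_cong)
  let ?T = "\<lambda>x :: real^'d. 0 + (\<Sum>j\<in>Basis. (c' j * (x \<bullet> j)) *\<^sub>R j)"
  have "?T x = (\<chi> k. c k * x $ k)" for x
  proof -
    have "?T x = (\<Sum>k\<in>UNIV. (c k * x $ k) *\<^sub>R axis k 1)"
      unfolding Basis_cart_real by (subst sum.reindex) (auto simp: inj_axis_1 c'_axis inner_axis)
    also have "\<dots> = (\<chi> k. c k * x $ k)"
      by (auto simp: vec_eq_iff axis_def if_distrib cong: if_cong)
    finally show ?thesis .
  qed
  then have T: "?T = (\<lambda>x. \<chi> k. c k * x $ k)" by auto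
  have p: "(\<Prod>j\<in>Basis. \<bar>c' j\<bar>) = (\<Prod>k\<in>UNIV. \<bar>c k\<bar>)"
    unfolding Basis_cart_real by (subst prod.reindex) (auto simp: inj_axis_1 c'_axis)
  have mT[measurable]: "(\<lambda>x :: real^'d. \<chi> k. c k * x $ k) \<in> borel_measurable borel"
    by (rule borel_measurable_vecI) simp
  have lb: "lborel = density (distr lborel borel (\<lambda>x. \<chi> k. c k * x $ k)) (\<lambda>_. ennreal (\<Prod>k\<in>UNIV. \<bar>c k\<bar>))"
  proof -
    have "c' j \<noteq> 0" if "j \<in> Basis" for j using that c by (auto simp: Basis_cart_real c'_axis)
    from lborel_affine_euclidean[where c = c' and t = 0, OF this] show ?thesis unfolding T p .
  qed
  show ?thesis
    by (subst (2) lb) (use h in \<open>simp add: nn_integral_density nn_integral_distr nn_integral_cmult\<close>)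
qed

lemma nn_integral_linear_swap:
  fixes h :: "real^'d \<Rightarrow> ennreal"
  assumes \<pi>: "\<pi> permutes UNIV" and h: "h \<in> borel_measurable borel"
  shows "(\<integral>\<^sup>+x. h (\<chi> k. x $ \<pi> k) \<partial>lborel) = (\<integral>\<^sup>+x. h x \<partial>lborel)"
proof -
  let ?T = "\<lambda>x :: real^'d. \<chi> k. x $ \<pi> k"
  have mT[measurable]: "?T \<in> borel_measurable borel" by (rule borel_measurable_vecI) simp
  have inv: "\<pi> (inv \<pi> k) = k" "inv \<pi> (\<pi> k) = k" for k
    using \<pi> by (simp_all add: permutes_inverses)
  have eq: "lborel = distr lborel borel ?T"
  proof (rule lborel_eqI)
    fix l u :: "real^'d" assume lu: "\<And>b. b \<in> Basis \<Longrightarrow> l \<bullet> b \<le> u \<bullet> b"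
    have lu': "l $ k \<le> u $ k" for k
      using lu[of "axis k 1"] by (simp add: Basis_cart_real inner_axis)
    have "?T -` box l u = box (\<chi> k. l $ inv \<pi> k) (\<chi> k. u $ inv \<pi> k)"
      by (auto simp: mem_box_cart) (metis inv)+
    then have "emeasure (distr lborel borel ?T) (box l u) = emeasure lborel (box (\<chi> k. l $ inv \<pi> k) (\<chi> k. u $ inv \<pi> k))"
      by (simp add: emeasure_distr)
    also have "\<dots> = (\<Prod>b\<in>Basis. ((\<chi> k. u $ inv \<pi> k) - (\<chi> k. l $ inv \<pi> k)) \<bullet> b)"
      using lu' by (intro emeasure_lborel_box) (auto simp: Basis_cart_real inner_axis)
    also have "(\<Prod>b\<in>Basis. ((\<chi> k. u $ inv \<pi> k) - (\<chi> k. l $ inv \<pi> k)) \<bullet> b) = (\<Prod>k\<in>UNIV. u $ inv \<pi> k - l $ inv \<pi> k)"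
      unfolding Basis_cart_real by (subst prod.reindex) (auto simp: inj_axis_1 inner_axis)
    also have "\<dots> = (\<Prod>k\<in>UNIV. u $ k - l $ k)"
      using prod.permute[OF permutes_inv[OF \<pi>], of "\<lambda>k. u $ k - l $ k"] by (simp add: o_def)
    also have "\<dots> = (\<Prod>b\<in>Basis. (u - l) \<bullet> b)"
      unfolding Basis_cart_real by (subst prod.reindex) (auto simp: inj_axis_1 inner_axis)
    finally show "emeasure (distr lborel borel ?T) (box l u) = ennreal (\<Prod>b\<in>Basis. (u - l) \<bullet> b)" .
  qed simp
  have "(\<integral>\<^sup>+x. h x \<partial>lborel) = (\<integral>\<^sup>+x. h x \<partial>distr lborel borel ?T)"
    by (rule arg_cong[where f = "\<lambda>M. integral\<^sup>N M h", OF eq])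
  then show ?thesis using h by (simp add: nn_integral_distr)
qed

lemma nn_integral_linear_shear:
  fixes h :: "real^'d \<Rightarrow> ennreal"
  assumes mn: "m \<noteq> n" and h[measurable]: "h \<in> borel_measurable borel"
  shows "(\<integral>\<^sup>+x. h (\<chi> i. if i = m then x $ m + x $ n else x $ i) \<partial>lborel) = (\<integral>\<^sup>+x. h x \<partial>lborel)"
proof -
  interpret product_sigma_finite "\<lambda>_ :: 'd. lborel :: real measure" by standard
  let ?J = "UNIV - {m}"
  have J: "UNIV = insert m ?J" by auto
  have fJ: "finite ?J" "m \<notin> ?J" by auto
  have ms: "(\<lambda>x :: real^'d. \<chi> i. if i = m then x $ m + x $ n else x $ i) \<in> borel_measurable borel"
    by (rule borel_measurable_vecI) auto
  have mh: "(\<lambda>f. h (\<chi> i. f i)) \<in> borel_measurable (\<Pi>\<^sub>M k\<in>insert m ?J. lborel)"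
    using measurable_compose[OF measurable_cart_lambda h] by (simp add: J[symmetric])
  have mg: "(\<lambda>f. h (\<chi> i. if i = m then f m + f n else f i)) \<in> borel_measurable (\<Pi>\<^sub>M k\<in>insert m ?J. lborel)"
    using measurable_compose[OF measurable_compose[OF measurable_cart_lambda ms] h]
    by (simp add: J[symmetric] cong: if_cong)
  have "(\<integral>\<^sup>+x. h (\<chi> i. if i = m then x $ m + x $ n else x $ i) \<partial>lborel)
     = (\<integral>\<^sup>+f. h (\<chi> i. if i = m then f m + f n else f i) \<partial>(\<Pi>\<^sub>M k\<in>UNIV. lborel))"
    by (subst lborel_cart, subst nn_integral_distr[OF measurable_cart_lambda])
       (use measurable_compose[OF ms h] in \<open>simp_all cong: if_cong\<close>)
  also have "\<dots> = (\<integral>\<^sup>+f. (\<integral>\<^sup>+y. h (\<chi> i. if i = m then y + f n else f i) \<partial>lborel) \<partial>(\<Pi>\<^sub>M k\<in>?J. lborel))"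
    by (subst J, subst product_nn_integral_insert[OF fJ mg])
       (use mn in \<open>auto intro!: nn_integral_cong arg_cong[where f = h] simp: vec_eq_iff\<close>)
  also have "\<dots> = (\<integral>\<^sup>+f. (\<integral>\<^sup>+y. h (\<chi> i. if i = m then y else f i) \<partial>lborel) \<partial>(\<Pi>\<^sub>M k\<in>?J. lborel))"
  proof (rule nn_integral_cong)
    fix f :: "'d \<Rightarrow> real"
    have mm: "(\<lambda>y. h (\<chi> i. if i = m then y else f i)) \<in> borel_measurable borel"
      by (rule measurable_compose[OF _ h]) (rule borel_measurable_vecI, auto)
    show "(\<integral>\<^sup>+y. h (\<chi> i. if i = m then y + f n else f i) \<partial>lborel) = (\<integral>\<^sup>+y. h (\<chi> i. if i = m then y else f i) \<partial>lborel)"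
      using nn_integral_real_affine[OF mm, of 1 "f n"] by (simp add: add.commute cong: if_cong)
  qed
  also have "\<dots> = (\<integral>\<^sup>+f. h (\<chi> i. f i) \<partial>(\<Pi>\<^sub>M k\<in>UNIV. lborel))"
    by (subst (2) J, subst product_nn_integral_insert[OF fJ mh])
       (auto intro!: nn_integral_cong arg_cong[where f = h] simp: vec_eq_iff)
  also have "\<dots> = (\<integral>\<^sup>+x. h x \<partial>lborel)"
    by (subst lborel_cart, subst nn_integral_distr[OF measurable_cart_lambda]) simp_all
  finally show ?thesis .
qed

text \<open>Linear maps are compositions of maps with a zero row, diagonal maps, coordinate
  transpositions and shears. A zero row makes the determinant vanish, which the premise
  excludes.\<close>

lemma nn_integral_linear_image:
  fixes f :: "real^'d \<Rightarrow> real^'d" and h :: "real^'d \<Rightarrow> ennreal"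
  assumes f: "linear f" and h: "h \<in> borel_measurable borel" and d: "det (matrix f) \<noteq> 0"
  shows "ennreal \<bar>det (matrix f)\<bar> * (\<integral>\<^sup>+x. h (f x) \<partial>lborel) = (\<integral>\<^sup>+x. h x \<partial>lborel)"
proof -
  \<comment> \<open>\<open>h\<close> is quantified inside the property because the composition step
    uses it for \<open>h\<close> composed with the outer map.\<close>
  let ?P = "\<lambda>f :: real^'d \<Rightarrow> real^'d. \<forall>h. h \<in> borel_measurable borel \<longrightarrow> det (matrix f) \<noteq> 0 \<longrightarrow>
    ennreal \<bar>det (matrix f)\<bar> * (\<integral>\<^sup>+x. h (f x) \<partial>lborel) = (\<integral>\<^sup>+x. h x \<partial>lborel)"
  have "?P f"
  proof (rule induct_linear_elementary[OF f])
    fix f g :: "real^'d \<Rightarrow> real^'d"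
    assume l: "linear f" "linear g" and Pf: "?P f" and Pg: "?P g"
    have m: "det (matrix (f \<circ> g)) = det (matrix f) * det (matrix g)"
      by (simp add: matrix_compose[OF l(2,1)] det_mul)
    show "?P (f \<circ> g)"
    proof (intro allI impI)
      fix h :: "real^'d \<Rightarrow> ennreal"
      assume h: "h \<in> borel_measurable borel" and "det (matrix (f \<circ> g)) \<noteq> 0"
      then have d: "det (matrix f) \<noteq> 0" "det (matrix g) \<noteq> 0" by (auto simp: m)
      have hf: "(\<lambda>x. h (f x)) \<in> borel_measurable borel"
        by (rule measurable_compose[OF linear_borel_measurable[OF l(1)] h])
      have "ennreal \<bar>det (matrix (f \<circ> g))\<bar> * (\<integral>\<^sup>+x. h ((f \<circ> g) x) \<partial>lborel) =
        ennreal \<bar>det (matrix f)\<bar> * (ennreal \<bar>det (matrix g)\<bar> * (\<integral>\<^sup>+x. h (f (g x)) \<partial>lborel))"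
        by (simp add: m abs_mult ennreal_mult' mult.assoc)
      also have "ennreal \<bar>det (matrix g)\<bar> * (\<integral>\<^sup>+x. h (f (g x)) \<partial>lborel) = (\<integral>\<^sup>+x. h (f x) \<partial>lborel)"
        using Pg hf d by blast
      also have "ennreal \<bar>det (matrix f)\<bar> * (\<integral>\<^sup>+x. h (f x) \<partial>lborel) = (\<integral>\<^sup>+x. h x \<partial>lborel)"
        using Pf h d by blast
      finally show "ennreal \<bar>det (matrix (f \<circ> g))\<bar> * (\<integral>\<^sup>+x. h ((f \<circ> g) x) \<partial>lborel) = (\<integral>\<^sup>+x. h x \<partial>lborel)" .
    qed
  next
    fix f :: "real^'d \<Rightarrow> real^'d" and i
    assume "linear f" "\<And>x. f x $ i = 0"
    then have "row i (matrix f) = 0" by (simp add: row_def matrix_def vec_eq_iff)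
    then show "?P f" using det_zero_row(1) by blast
  next
    fix c :: "'d \<Rightarrow> real"
    have M: "matrix (\<lambda>x. \<chi> i. c i * x $ i) = (\<chi> i j. if i = j then c i else 0)"
      by (auto simp: matrix_def vec_eq_iff axis_def)
    have "det (matrix (\<lambda>x. \<chi> i. c i * x $ i)) = (\<Prod>k\<in>UNIV. c k)"
      unfolding M by (subst det_diagonal) auto
    then show "?P (\<lambda>x. \<chi> i. c i * x $ i)"
      using nn_integral_linear_diagonal[of c] by (simp add: abs_prod)
  next
    fix m n :: 'd assume mn: "m \<noteq> n"
    let ?\<pi> = "Transposition.transpose m n"
    have p: "?\<pi> permutes UNIV" by (rule permutes_swap_id) auto
    have "matrix (\<lambda>x :: real^'d. \<chi> i. x $ ?\<pi> i) = (\<chi> i. (mat 1 :: real^'d^'d) $ ?\<pi> i)"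
      by (auto simp: matrix_def vec_eq_iff axis_def mat_def)
    then have "det (matrix (\<lambda>x :: real^'d. \<chi> i. x $ ?\<pi> i)) = of_int (sign ?\<pi>)"
      using det_permute_rows[OF p, of "mat 1 :: real^'d^'d"] by simp
    then have "\<bar>det (matrix (\<lambda>x :: real^'d. \<chi> i. x $ ?\<pi> i))\<bar> = 1" by (simp add: sign_def)
    then show "?P (\<lambda>x. \<chi> i. x $ ?\<pi> i)"
      using nn_integral_linear_swap[OF p] by simp
  next
    fix m n :: 'd assume mn: "m \<noteq> n"
    have "matrix (\<lambda>x :: real^'d. \<chi> i. if i = m then x $ m + x $ n else x $ i)
       = (\<chi> k. if k = m then row m (mat 1) + 1 *s row n (mat 1) else row k (mat 1 :: real^'d^'d))"
      using mn by (auto simp: matrix_def vec_eq_iff axis_def mat_def row_def)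
    then have "det (matrix (\<lambda>x :: real^'d. \<chi> i. if i = m then x $ m + x $ n else x $ i)) = 1"
      using det_row_operation[OF mn, of "mat 1 :: real^'d^'d" 1] by simp
    then show "?P (\<lambda>x. \<chi> i. if i = m then x $ m + x $ n else x $ i)"
      using nn_integral_linear_shear[OF mn] by simp
  qed
  then show ?thesis using h d by blast
qed

lemma lborel_linear_image:
  fixes f :: "real^'d \<Rightarrow> real^'d"
  assumes "linear f" "det (matrix f) \<noteq> 0"
  shows "lborel = density (distr lborel borel f) (\<lambda>_. ennreal \<bar>det (matrix f)\<bar>)"
proof (rule measure_eqI)
  have mf[measurable]: "f \<in> borel_measurable borel" by (rule linear_borel_measurable) fact
  fix A :: "(real^'d) set" assume "A \<in> sets lborel"
  then have A[measurable]: "A \<in> sets borel" by simp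
  have "emeasure lborel A = (\<integral>\<^sup>+x. indicator A x \<partial>lborel)" by simp
  also have "\<dots> = ennreal \<bar>det (matrix f)\<bar> * (\<integral>\<^sup>+x. indicator A (f x) \<partial>lborel)"
    by (rule nn_integral_linear_image[symmetric, OF assms(1) _ assms(2)]) simp
  also have "\<dots> = emeasure (density (distr lborel borel f) (\<lambda>_. ennreal \<bar>det (matrix f)\<bar>)) A"
    by (subst emeasure_density, simp, simp, subst nn_integral_distr, simp, simp, subst nn_integral_cmult) simp_all
  finally show "emeasure lborel A = emeasure (density (distr lborel borel f) (\<lambda>_. ennreal \<bar>det (matrix f)\<bar>)) A" .
qed simp

section \<open>Gaussian laws given by their precision matrix\<close>

lemma matrix_inv_eqI:
  fixes A B :: "real^'d^'d"
  assumes "A ** B = mat 1"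
  shows "matrix_inv A = B"
proof -
  have BA: "B ** A = mat 1" using assms matrix_left_right_inverse by blast
  have "A ** matrix_inv A = mat 1 \<and> matrix_inv A ** A = mat 1"
    unfolding matrix_inv_def by (rule someI[of _ B]) (use assms BA in auto)
  then have "matrix_inv A = (B ** A) ** matrix_inv A" using BA by simp
  also have "\<dots> = B ** (A ** matrix_inv A)" by (simp only: matrix_mul_assoc)
  also have "\<dots> = B" using \<open>_ \<and> _\<close> by simp
  finally show ?thesis .
qed

lemma matrix_inv_mult:
  fixes A :: "real^'d^'d"
  assumes "invertible A"
  shows "A ** matrix_inv A = mat 1" "matrix_inv A ** A = mat 1"
proof -
  obtain B where B: "A ** B = mat 1" "B ** A = mat 1" using assms by (auto simp: invertible_def)
  then show "A ** matrix_inv A = mat 1" "matrix_inv A ** A = mat 1" by (simp_all add: matrix_inv_eqI)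
qed

definition pos_def_matrix :: "real^'d^'d \<Rightarrow> bool" where
  "pos_def_matrix G \<longleftrightarrow> transpose G = G \<and> (\<forall>v. v \<noteq> 0 \<longrightarrow> 0 < v \<bullet> (G *v v))"

lemma inner_matrix_transpose:
  fixes A :: "real^'d^'d"
  shows "x \<bullet> (A *v y) = (transpose A *v x) \<bullet> y"
  by (simp add: dot_lmul_matrix transpose_matrix_vector)

lemma pos_def_commute:
  fixes G :: "real^'d^'d"
  assumes "pos_def_matrix G"
  shows "x \<bullet> (G *v y) = y \<bullet> (G *v x)"
proof -
  have "x \<bullet> (G *v y) = (transpose G *v x) \<bullet> y" by (rule inner_matrix_transpose)
  also have "\<dots> = (G *v x) \<bullet> y" using assms by (simp add: pos_def_matrix_def)
  also have "\<dots> = y \<bullet> (G *v x)" by (rule inner_commute)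
  finally show ?thesis .
qed

lemma pos_def_invertible:
  fixes G :: "real^'d^'d"
  assumes "pos_def_matrix G"
  shows "invertible G"
proof -
  have "x = 0" if "G *v x = 0" for x
    using assms that unfolding pos_def_matrix_def by (metis inner_zero_right less_irrefl)
  then show ?thesis
    by (simp add: invertible_left_inverse matrix_left_invertible_ker)
qed

text \<open>Gram-Schmidt for the inner product of \<open>G\<close>. As long as the index set is not
  exhausted, the images under \<open>G\<close> of the vectors found so far do not span, so some
  direction is orthogonal to all of them and can be normalized.\<close>

lemma pos_def_orthonormal_family:
  fixes G :: "real^'d^'d"
  assumes "pos_def_matrix G" "finite I"
  shows "\<exists>b :: 'd \<Rightarrow> real^'d. \<forall>k\<in>I. \<forall>l\<in>I. b k \<bullet> (G *v b l) = (if k = l then 1 else 0)"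
  using assms(2)
proof (induction I)
  case (insert k0 I)
  then obtain b where b: "\<And>k l. k \<in> I \<Longrightarrow> l \<in> I \<Longrightarrow> b k \<bullet> (G *v b l) = (if k = l then 1 else 0)"
    by blast
  let ?S = "(\<lambda>l. G *v b l) ` I"
  have "dim ?S \<le> card ?S" by (rule dim_le_card') (use insert in auto)
  also have "\<dots> \<le> card I" by (rule card_image_le) (use insert in auto)
  also have "\<dots> < card (insert k0 I)" using insert by simp
  also have "\<dots> \<le> DIM(real^'d)" by (simp add: card_mono)
  finally have "dim ?S < DIM(real^'d)" .
  then obtain v where v: "v \<noteq> 0" "\<And>y. y \<in> span ?S \<Longrightarrow> orthogonal v y"
    by (rule orthogonal_to_subspace_exists) blast
  have vG: "v \<bullet> (G *v b l) = 0" if "l \<in> I" for l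
    using v(2)[OF span_base, of "G *v b l"] that by (auto simp: orthogonal_def)
  define c where "c = v \<bullet> (G *v v)"
  have c: "c > 0" using assms(1) v(1) by (simp add: pos_def_matrix_def c_def)
  define u where "u = (1 / sqrt c) *\<^sub>R v"
  have uG: "u \<bullet> (G *v b l) = 0" if "l \<in> I" for l using vG[OF that] by (simp add: u_def)
  have Gu: "b l \<bullet> (G *v u) = 0" if "l \<in> I" for l
    using uG[OF that] pos_def_commute[OF assms(1), of u] by simp
  have uu: "u \<bullet> (G *v u) = 1"
    using c by (simp add: u_def matrix_vector_mult_scaleR c_def[symmetric])
  show ?case
    by (rule exI[of _ "\<lambda>k. if k = k0 then u else b k"]) (use insert(2) b uG Gu uu in auto)
qed simp

text \<open>With the orthonormal family as columns, \<open>B\<close> acts as an inverse square root: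
  the substitution z = B w turns the quadratic form of \<open>G\<close> into the standard
  one.\<close>

lemma pos_def_factor:
  fixes G :: "real^'d^'d"
  assumes "pos_def_matrix G"
  obtains B :: "real^'d^'d" where "transpose B ** G ** B = mat 1"
proof -
  obtain b :: "'d \<Rightarrow> real^'d" where b: "\<And>k l. b k \<bullet> (G *v b l) = (if k = l then 1 else 0)"
    using pos_def_orthonormal_family[OF assms, of UNIV] by auto
  define B :: "real^'d^'d" where "B = (\<chi> i k. b k $ i)"
  have "transpose B ** (G ** B) = mat 1"
  proof -
    have "(transpose B ** (G ** B)) $ k $ l = b k \<bullet> (G *v b l)" for k l
      by (simp add: matrix_matrix_mult_def transpose_def B_def inner_vec_def matrix_vector_mult_def)
    then show ?thesis by (simp add: vec_eq_iff b mat_def)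
  qed
  then show ?thesis using that by (simp add: matrix_mul_assoc)
qed

lemma std_normal_char_integral:
  "integrable lborel (\<lambda>x. std_normal_density x *\<^sub>R iexp (a * x))"
  "(LINT x|lborel. std_normal_density x *\<^sub>R iexp (a * x)) = complex_of_real (exp (- (a\<^sup>2) / 2))"
proof -
  interpret real_distribution std_normal_distribution by (rule real_dist_normal_dist)
  have "integrable std_normal_distribution (\<lambda>x. iexp (a * x))"
    by (rule integrable_const_bound[of _ 1]) auto
  then show "integrable lborel (\<lambda>x. std_normal_density x *\<^sub>R iexp (a * x))"
    by (subst (asm) integrable_density) auto
  have "(LINT x|lborel. std_normal_density x *\<^sub>R iexp (a * x)) = char std_normal_distribution a"
    unfolding char_def by (subst integral_density) auto
  then show "(LINT x|lborel. std_normal_density x *\<^sub>R iexp (a * x)) = complex_of_real (exp (- (a\<^sup>2) / 2))"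
    by (simp add: char_std_normal_distribution)
qed

text \<open>The cosine is the real part of e^(i s) times a product of one-dimensional exponentials,
  so the integral factors into characteristic functions of the standard normal law.\<close>

lemma integral_std_normal_cos:
  fixes a :: "real^'d"
  shows "(LINT w|lborel. (\<Prod>k\<in>UNIV. std_normal_density (w $ k)) * cos (a \<bullet> w + s)) = exp (- ((norm a)\<^sup>2) / 2) * cos s"
proof -
  interpret product_sigma_finite "\<lambda>_ :: 'd. lborel :: real measure" by standard
  let ?f = "\<lambda>k x. std_normal_density x *\<^sub>R iexp (a $ k * x)"
  let ?g = "\<lambda>f. \<Prod>k\<in>UNIV. ?f k (f k)"
  have int: "integrable (\<Pi>\<^sub>M k\<in>UNIV. lborel) ?g"
    by (rule product_integrable_prod[OF finite std_normal_char_integral(1)])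
  have na: "(norm a)\<^sup>2 = (\<Sum>k\<in>UNIV. (a $ k)\<^sup>2)"
    unfolding power2_norm_eq_inner inner_vec_def by (simp add: power2_eq_square)
  have val: "(LINT f|(\<Pi>\<^sub>M k\<in>UNIV. lborel). ?g f) = complex_of_real (exp (- ((norm a)\<^sup>2) / 2))"
  proof -
    have "(LINT f|(\<Pi>\<^sub>M k\<in>UNIV. lborel). ?g f) = (\<Prod>k\<in>UNIV. complex_of_real (exp (- ((a $ k)\<^sup>2) / 2)))"
      by (subst product_integral_prod) (simp_all only: std_normal_char_integral finite)
    also have "\<dots> = complex_of_real (exp (\<Sum>k\<in>UNIV. - ((a $ k)\<^sup>2) / 2))"
      by (simp add: exp_sum)
    also have "(\<Sum>k\<in>UNIV. - ((a $ k)\<^sup>2) / 2) = - ((norm a)\<^sup>2) / 2"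
      by (simp add: na sum_negf sum_divide_distrib)
    finally show ?thesis .
  qed
  have pt: "(\<Prod>k\<in>UNIV. std_normal_density (f k)) * cos (a \<bullet> (\<chi> k. f k) + s) = Re (cis s * ?g f)" for f
  proof -
    have "?g f = of_real (\<Prod>k\<in>UNIV. std_normal_density (f k)) * cis (\<Sum>k\<in>UNIV. a $ k * f k)"
      by (simp add: scaleR_conv_of_real prod.distrib cis_conv_exp sum_distrib_left exp_sum)
    then have "cis s * ?g f = of_real (\<Prod>k\<in>UNIV. std_normal_density (f k)) * cis (s + (\<Sum>k\<in>UNIV. a $ k * f k))"
      by (simp add: cis_mult[symmetric] mult_ac)
    then show ?thesis by (simp add: inner_vec_def add.commute del: of_real_prod)
  qed
  have "(LINT w|lborel. (\<Prod>k\<in>UNIV. std_normal_density (w $ k)) * cos (a \<bullet> w + s)) =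
      (LINT f|(\<Pi>\<^sub>M k\<in>UNIV. lborel). Re (cis s * ?g f))"
    by (subst lborel_cart, subst integral_distr[OF measurable_cart_lambda]) (simp_all add: pt)
  also have "\<dots> = Re (cis s * (LINT f|(\<Pi>\<^sub>M k\<in>UNIV. lborel). ?g f))"
    using int by (subst integral_Re) auto
  also have "\<dots> = exp (- ((norm a)\<^sup>2) / 2) * cos s"
    unfolding val by simp
  finally show ?thesis .
qed

lemma nn_integral_std_normal:
  "(\<integral>\<^sup>+w. ennreal (\<Prod>k\<in>UNIV. std_normal_density (w $ k)) \<partial>(lborel :: (real^'d) measure)) = 1"
proof -
  interpret product_sigma_finite "\<lambda>_ :: 'd. lborel :: real measure" by standard
  have "(\<integral>\<^sup>+x. ennreal (std_normal_density x) \<partial>lborel) = 1"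
    using prob_space.emeasure_space_1[OF prob_space_normal_density[of 1 0]]
    by (simp add: emeasure_density)
  then have "(\<integral>\<^sup>+f. (\<Prod>k\<in>(UNIV::'d set). ennreal (std_normal_density (f k))) \<partial>(\<Pi>\<^sub>M k\<in>UNIV. lborel)) = 1"
    by (subst product_nn_integral_prod) auto
  then show ?thesis
    by (subst lborel_cart, subst nn_integral_distr[OF measurable_cart_lambda]) (simp_all add: prod_ennreal)
qed

text \<open>Formulated with the precision matrix \<open>G\<close> because the limit covariance is an
  inverse. The substitution by the factor \<open>B\<close> turns the density into a product of
  standard normal densities.\<close>

lemma mv_normal_pos_def:
  fixes G :: "real^'d^'d"
  assumes G: "pos_def_matrix G"
  shows "prob_space (mv_normal 0 (matrix_inv G))"
    and "(LINT z|mv_normal 0 (matrix_inv G). cos (t \<bullet> z + s)) = exp (- (t \<bullet> (matrix_inv G *v t)) / 2) * cos s"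
proof -
  obtain B :: "real^'d^'d" where B: "transpose B ** G ** B = mat 1" by (rule pos_def_factor[OF G])
  have detB: "(det B)\<^sup>2 * det G = 1"
    using arg_cong[OF B, of det] by (simp add: det_mul det_transpose power2_eq_square mult_ac)
  then have dB: "det B \<noteq> 0" by auto
  \<comment> \<open>A one-sided inverse of a square matrix is two-sided; this moves \<open>B\<close>
    to the other end and yields G^-1 = B B^T.\<close>
  have "B ** (transpose B ** G) = mat 1" using B matrix_left_right_inverse by blast
  then have "(B ** transpose B) ** G = mat 1" by (simp add: matrix_mul_assoc)
  then have "G ** (B ** transpose B) = mat 1" using matrix_left_right_inverse by blast
  then have S: "matrix_inv G = B ** transpose B" by (rule matrix_inv_eqI)
  have SG: "matrix_inv (matrix_inv G) = G"
    by (rule matrix_inv_eqI) (use pos_def_invertible[OF G] in \<open>simp add: matrix_inv_mult\<close>)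
  have detS: "det (matrix_inv G) = (det B)\<^sup>2" by (simp add: S det_mul det_transpose power2_eq_square)
  define p :: "real^'d \<Rightarrow> real" where
    "p z = exp (- (z \<bullet> (G *v z)) / 2) / sqrt ((2 * pi) ^ CARD('d) * (det B)\<^sup>2)" for z
  have N: "mv_normal 0 (matrix_inv G) = density lborel (\<lambda>z. ennreal (p z))"
    by (simp add: mv_normal_def SG detS p_def)
  have p0: "p z \<ge> 0" for z by (simp add: p_def)
  have "continuous_on UNIV p" unfolding p_def
    by (intro continuous_intros linear_continuous_on) (use dB in \<open>auto simp: matrix_vector_mul_linear linear_linear\<close>)
  then have pm[measurable]: "p \<in> borel_measurable borel" by (rule borel_measurable_continuous_onI)
  have lin: "linear ((*v) B)" by (rule matrix_vector_mul_linear)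
  have mat: "matrix ((*v) B) = B" by (rule matrix_of_matrix_vector_mul)
  \<comment> \<open>The Jacobian cancels the determinant in the normalizing constant, since det
    (matrix_inv G) is the square of det B.\<close>
  have pB: "\<bar>det B\<bar> * p (B *v w) = (\<Prod>k\<in>UNIV. std_normal_density (w $ k))" for w
  proof -
    have "w \<bullet> ((transpose B ** G ** B) *v w) = w \<bullet> (transpose B *v (G *v (B *v w)))"
      by (simp add: matrix_vector_mul_assoc matrix_mul_assoc)
    also have "\<dots> = (B *v w) \<bullet> (G *v (B *v w))"
      by (simp only: inner_matrix_transpose[of w "transpose B"] transpose_transpose)
    finally have e: "(B *v w) \<bullet> (G *v (B *v w)) = w \<bullet> w" by (simp add: B)
    have "(\<Prod>k\<in>UNIV. std_normal_density (w $ k)) = (\<Prod>k\<in>(UNIV::'d set). 1 / sqrt (2 * pi)) * exp (\<Sum>k\<in>UNIV. - (w $ k)\<^sup>2 / 2)"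
      by (simp add: std_normal_density_def prod.distrib exp_sum prod_dividef power_one_over)
    also have "(\<Sum>k\<in>UNIV. - (w $ k)\<^sup>2 / 2) = - (w \<bullet> w) / 2"
      by (simp add: inner_vec_def sum_negf sum_divide_distrib power2_eq_square)
    also have "(\<Prod>k\<in>(UNIV::'d set). 1 / sqrt (2 * pi)) = 1 / sqrt ((2 * pi) ^ CARD('d))"
      by (simp only: prod_constant power_one_over real_sqrt_power)
    finally show ?thesis using dB by (simp add: p_def e real_sqrt_mult)
  qed
  show "prob_space (mv_normal 0 (matrix_inv G))"
  proof
    have "emeasure (mv_normal 0 (matrix_inv G)) UNIV = (\<integral>\<^sup>+z. ennreal (p z) \<partial>lborel)"
      unfolding N by (simp add: emeasure_density)
    also have "\<dots> = ennreal \<bar>det B\<bar> * (\<integral>\<^sup>+w. ennreal (p (B *v w)) \<partial>lborel)"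
      using nn_integral_linear_image[OF lin, of "\<lambda>z. ennreal (p z)"] dB by (simp add: mat)
    also have "\<dots> = (\<integral>\<^sup>+w. ennreal (\<bar>det B\<bar> * p (B *v w)) \<partial>lborel)"
      using measurable_compose[OF linear_borel_measurable[OF lin] pm]
      by (subst nn_integral_cmult[symmetric]) (simp_all add: ennreal_mult' p0)
    also have "\<dots> = 1" unfolding pB by (rule nn_integral_std_normal)
    finally show "emeasure (mv_normal 0 (matrix_inv G)) (space (mv_normal 0 (matrix_inv G))) = 1"
      by (simp add: N)
  qed
  have "(LINT z|mv_normal 0 (matrix_inv G). cos (t \<bullet> z + s)) = (LINT z|lborel. p z * cos (t \<bullet> z + s))"
    unfolding N by (subst integral_density) (auto simp: p0)
  also have "\<dots> = (LINT z|density (distr lborel borel ((*v) B)) (\<lambda>_. ennreal \<bar>det B\<bar>). p z * cos (t \<bullet> z + s))"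
    using lborel_linear_image[OF lin] dB by (simp add: mat)
  also have "\<dots> = (LINT z|distr lborel borel ((*v) B). \<bar>det B\<bar> * (p z * cos (t \<bullet> z + s)))"
    by (subst integral_density) auto
  also have "\<dots> = (LINT w|lborel. \<bar>det B\<bar> * (p (B *v w) * cos (t \<bullet> (B *v w) + s)))"
    using linear_borel_measurable[OF lin] by (subst integral_distr) auto
  also have "\<dots> = (LINT w|lborel. (\<Prod>k\<in>UNIV. std_normal_density (w $ k)) * cos ((transpose B *v t) \<bullet> w + s))"
    by (simp only: pB[symmetric] inner_matrix_transpose[of t B] mult.assoc)
  also have "\<dots> = exp (- ((norm (transpose B *v t))\<^sup>2) / 2) * cos s" by (rule integral_std_normal_cos)
  also have "(norm (transpose B *v t))\<^sup>2 = t \<bullet> (matrix_inv G *v t)"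
    unfolding power2_norm_eq_inner S matrix_vector_mul_assoc[symmetric]
    by (rule inner_matrix_transpose[symmetric])
  finally show "(LINT z|mv_normal 0 (matrix_inv G). cos (t \<bullet> z + s)) = exp (- (t \<bullet> (matrix_inv G *v t)) / 2) * cos s" .
qed

lemma sets_mv_normal: "sets (mv_normal \<mu> S) = sets borel"
  by (simp add: mv_normal_def)

section \<open>Fisher information\<close>

text \<open>The norm of a vector of rows is the Frobenius norm, so this is Cauchy-Schwarz in every
  row.\<close>

lemma norm_matrix_vector_le:
  fixes A :: "real^'d^'m"
  shows "norm (A *v w) \<le> norm A * norm w"
proof -
  have "(norm (A *v w))\<^sup>2 = (\<Sum>k\<in>UNIV. (A $ k \<bullet> w)\<^sup>2)"
    unfolding power2_norm_eq_inner inner_vec_def[of "A *v w"]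
    by (simp add: matrix_vector_mult_def inner_vec_def power2_eq_square)
  also have "\<dots> \<le> (\<Sum>k\<in>UNIV. (norm (A $ k))\<^sup>2 * (norm w)\<^sup>2)"
    by (intro sum_mono) (metis Cauchy_Schwarz_ineq2 abs_ge_zero power2_abs power_mono power_mult_distrib)
  also have "\<dots> = (norm A * norm w)\<^sup>2"
    by (simp add: power_mult_distrib sum_distrib_right[symmetric] norm_vec_def L2_set_def sum_nonneg)
  finally show ?thesis by (rule power2_le_imp_le) simp
qed

lemma outer_mult_vec: "outer u v *v w = (v \<bullet> w) *\<^sub>R u"
  by (simp add: outer_def matrix_vector_mult_def vec_eq_iff inner_vec_def sum_distrib_left mult_ac)

lemma norm_outer: "norm (outer u v) = norm u * norm v"
proof -
  have "norm (outer u v) = sqrt (\<Sum>k\<in>UNIV. (u $ k)\<^sup>2 * (norm v)\<^sup>2)"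
  proof -
    have "outer u v $ k = (u $ k) *\<^sub>R v" for k by (simp add: outer_def vec_eq_iff)
    then show ?thesis by (simp add: norm_vec_def[of "outer u v"] L2_set_def power_mult_distrib)
  qed
  also have "\<dots> = norm u * norm v"
    by (simp add: sum_distrib_right[symmetric] real_sqrt_mult norm_vec_def[of u] L2_set_def)
  finally show ?thesis .
qed

lemma outer_diff: "outer u u - outer v v = outer (u - v) u + outer v (u - v)"
  by (simp add: outer_def vec_eq_iff algebra_simps)

lemma norm_outer_diff_le:
  assumes "norm u \<le> c" "norm v \<le> c"
  shows "norm (outer u u - outer v v) \<le> 2 * c * norm (u - v)"
proof -
  have "norm (outer u u - outer v v) \<le> norm (u - v) * norm u + norm v * norm (u - v)"
    unfolding outer_diff by (rule order.trans[OF norm_triangle_ineq]) (simp add: norm_outer)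
  also have "\<dots> \<le> norm (u - v) * c + c * norm (u - v)"
    using assms by (intro add_mono mult_left_mono mult_right_mono) auto
  finally show ?thesis by simp
qed

text \<open>The weight of the Fisher information after rescaling the rows by \<open>\<rho>\<^sup>1\<^sup>/\<^sup>2\<close>.\<close>

definition fisher_weight :: "real \<Rightarrow> real \<Rightarrow> real" where
  "fisher_weight r s = 1 / (s * (1 - r * s))"

lemma fisher_denom_ge:
  fixes a s r :: real
  assumes "0 < a" "a \<le> s" "s \<le> 1 - a" "0 \<le> r" "r \<le> 1"
  shows "a\<^sup>2 \<le> s * (1 - r * s)" "s * (1 - r * s) \<le> 1" "a \<le> 1 - r * s" "1 - r * s \<le> 1"
proof -
  have "r * s \<le> 1 * (1 - a)" using assms by (intro mult_mono) auto
  then show r: "a \<le> 1 - r * s" by simp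
  show r2: "1 - r * s \<le> 1" using assms by simp
  have "a * a \<le> s * (1 - r * s)" using assms r by (intro mult_mono) auto
  then show "a\<^sup>2 \<le> s * (1 - r * s)" by (simp add: power2_eq_square)
  have "s * (1 - r * s) \<le> 1 * 1" using assms r r2 by (intro mult_mono) auto
  then show "s * (1 - r * s) \<le> 1" by simp
qed

lemma fisher_weight_bounds:
  fixes a s r :: real
  assumes "0 < a" "a \<le> s" "s \<le> 1 - a" "0 \<le> r" "r \<le> 1"
  shows "1 \<le> fisher_weight r s" "fisher_weight r s \<le> 1 / a\<^sup>2" "0 < fisher_weight r s" "\<bar>fisher_weight r s\<bar> \<le> 1 / a\<^sup>2"
proof -
  note d = fisher_denom_ge[OF assms]
  have p: "0 < s * (1 - r * s)" using d(1) assms(1) by (meson less_le_trans zero_less_power)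
  show 1: "1 \<le> fisher_weight r s" using p d(2) by (simp add: fisher_weight_def)
  show 2: "fisher_weight r s \<le> 1 / a\<^sup>2"
    unfolding fisher_weight_def using d(1) assms(1) by (intro divide_left_mono) (auto simp: p)
  show "0 < fisher_weight r s" using 1 by simp
  show "\<bar>fisher_weight r s\<bar> \<le> 1 / a\<^sup>2" using 1 2 by simp
qed

text \<open>The increment in \<open>r\<close> is included because the sparsity moves with
  \<open>n\<close> while the limit matrix uses its limit. The power a^4 bounds the product of two
  denominators, each at least a^2.\<close>

lemma fisher_weight_diff_le:
  fixes a s s' r r' :: real
  assumes a: "0 < a" and s: "a \<le> s" "s \<le> 1 - a" and s': "a \<le> s'" "s' \<le> 1 - a"
    and r: "0 \<le> r" "r \<le> 1" "0 \<le> r'" "r' \<le> 1"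
  shows "\<bar>fisher_weight r s - fisher_weight r' s'\<bar> \<le> (3 * \<bar>s - s'\<bar> + \<bar>r - r'\<bar>) / a^4"
proof -
  let ?x = "s * (1 - r * s)" and ?y = "s' * (1 - r' * s')"
  have x: "a\<^sup>2 \<le> ?x" and y: "a\<^sup>2 \<le> ?y"
    using fisher_denom_ge(1)[OF a s r(1,2)] fisher_denom_ge(1)[OF a s' r(3,4)] by auto
  have a2: "0 < a\<^sup>2" using a by simp
  have xy: "a^4 \<le> ?x * ?y"
    using mult_mono[OF x y] a2 x by (simp add: power2_eq_square power4_eq_xxxx mult.assoc)
  have "fisher_weight r s - fisher_weight r' s' = (?y - ?x) / (?x * ?y)"
    using x y a2 unfolding fisher_weight_def by (subst diff_frac_eq) auto
  then have "\<bar>fisher_weight r s - fisher_weight r' s'\<bar> = \<bar>?y - ?x\<bar> / (?x * ?y)"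
  proof -
    have "0 < ?x * ?y" by (rule mult_pos_pos[OF less_le_trans[OF a2 x] less_le_trans[OF a2 y]])
    then show ?thesis using \<open>_ = (?y - ?x) / (?x * ?y)\<close> by (simp only: abs_divide abs_of_pos)
  qed
  also have "\<dots> \<le> \<bar>?y - ?x\<bar> / a^4"
    using xy a by (intro divide_left_mono) (auto intro!: mult_pos_pos less_le_trans[OF a2 x] less_le_trans[OF a2 y])
  also have "\<bar>?y - ?x\<bar> \<le> 3 * \<bar>s - s'\<bar> + \<bar>r - r'\<bar>"
  proof -
    have "?y - ?x = (s' - s) * (1 - r * (s + s')) + (r - r') * s'\<^sup>2"
      by (simp add: algebra_simps power2_eq_square)
    then have "\<bar>?y - ?x\<bar> \<le> \<bar>(s' - s) * (1 - r * (s + s'))\<bar> + \<bar>(r - r') * s'\<^sup>2\<bar>"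
      by (simp only: abs_triangle_ineq)
    also have "\<bar>(s' - s) * (1 - r * (s + s'))\<bar> \<le> \<bar>s - s'\<bar> * 3"
    proof -
      have "r * (s + s') \<le> 1 * 2" by (rule mult_mono) (use r s s' a in auto)
      moreover have "0 \<le> r * (s + s')" using r s s' a by simp
      ultimately have "\<bar>1 - r * (s + s')\<bar> \<le> 3" by linarith
      then show ?thesis unfolding abs_mult by (intro mult_mono) auto
    qed
    also have "\<bar>(r - r') * s'\<^sup>2\<bar> \<le> \<bar>r - r'\<bar> * 1"
      unfolding abs_mult using s' a by (intro mult_left_mono) (auto simp: power_le_one)
    finally show ?thesis by (simp add: mult.commute)
  qed
  finally show ?thesis using a by (simp add: divide_right_mono)
qed

section \<open>Information matrices and their limit\<close>

locale rdpg_setting = ecdf_limit x0 F K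
  for x0 :: "nat \<Rightarrow> real^'d" and F K +
  fixes \<delta> :: real and \<rho> :: "nat \<Rightarrow> real" and \<rho>lim :: real
  assumes \<delta>: "0 < \<delta>" and K\<delta>: "restricted_latent_space \<delta> K"
    and \<rho>01: "\<And>n. n \<ge> 1 \<Longrightarrow> 0 < \<rho> n \<and> \<rho> n \<le> 1" and \<rho>lim: "\<rho> \<longlonglongrightarrow> \<rho>lim"
    and inv\<Delta>: "invertible (LINT x:latent_space|F. outer x x)"
begin

lemma K_inner: "x \<in> K \<Longrightarrow> u \<in> K \<Longrightarrow> \<delta> \<le> x \<bullet> u \<and> x \<bullet> u \<le> 1 - \<delta>"
  using K\<delta> by (auto simp: restricted_latent_space_def)

lemma K_norm: "x \<in> K \<Longrightarrow> norm x \<le> 1"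
  using KL by (auto simp: latent_space_def)

lemma \<rho>lim01: "0 \<le> \<rho>lim" "\<rho>lim \<le> 1"
proof -
  show "0 \<le> \<rho>lim" by (rule LIMSEQ_le_const[OF \<rho>lim]) (use \<rho>01 in \<open>auto intro!: exI[of _ 1] less_imp_le\<close>)
  show "\<rho>lim \<le> 1" by (rule LIMSEQ_le_const2[OF \<rho>lim]) (use \<rho>01 in \<open>auto intro!: exI[of _ 1]\<close>)
qed

lemma x0_1: "x0 1 \<in> K" using xK by simp

definition G :: "real^'d \<Rightarrow> real^'d^'d" where "G x = G_matrix \<rho>lim F x"

text \<open>The sparsity \<open>r\<close> is an argument of its own: averages converge at the fixed
  value \<open>\<rho>lim\<close>, and the step from \<open>\<rho> n\<close> to it is a Lipschitz
  estimate.\<close>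

definition Gn :: "nat \<Rightarrow> real \<Rightarrow> real^'d \<Rightarrow> real^'d^'d" where
  "Gn n r x = (1 / real n) *\<^sub>R (\<Sum>j=1..n. fisher_weight r (x \<bullet> x0 j) *\<^sub>R outer (x0 j) (x0 j))"

lemma Gn_component: "Gn n r x $ k $ l = avg n (\<lambda>u. fisher_weight r (x \<bullet> u) * (u $ k * u $ l))"
  by (simp add: Gn_def avg_def outer_def)

text \<open>\<open>F\<close> charges only \<open>K\<close>, so the entries of a matrix integral over
  the latent space are the scalar limits delivered by \<open>avg_tendsto\<close>. Boundedness is
  asked on \<open>K\<close>, where the Fisher weights have it.\<close>

lemma set_integral_latent_component:
  fixes f :: "real^'d \<Rightarrow> real^'d^'d"
  assumes m: "f \<in> borel_measurable borel" and b: "\<And>u. u \<in> K \<Longrightarrow> norm (f u) \<le> B"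
    and c: "continuous_on K (\<lambda>u. f u $ k $ l)"
  shows "(LINT u:latent_space|F. f u) $ k $ l = (LINT u|F. indicator K u * (f u $ k $ l))"
proof -
  have lat: "latent_space \<in> sets (borel :: (real^'d) measure)" by (rule borel_open[OF open_latent_space])
  have Kb: "K \<in> sets borel" using cK by (simp add: compact_imp_closed)
  have mf: "(\<lambda>u. indicator latent_space u *\<^sub>R f u) \<in> borel_measurable borel"
    using m lat by simp
  have int: "integrable F (\<lambda>u. indicator latent_space u *\<^sub>R f u)"
  proof (rule integrable_const_bound)
    show "AE u in F. norm (indicator latent_space u *\<^sub>R f u) \<le> B"
      by (rule AE_mp[OF AE_K AE_I2]) (use b KL in auto)
    show "(\<lambda>u. indicator latent_space u *\<^sub>R f u) \<in> borel_measurable F"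
      using mf by (simp add: measurable_cong_sets[OF setsF refl])
  qed
  have bl: "bounded_linear (\<lambda>A :: real^'d^'d. A $ k $ l)"
    unfolding linear_conv_bounded_linear[symmetric] by (rule linearI) simp_all
  have "(LINT u:latent_space|F. f u) $ k $ l = (LINT u|F. (indicator latent_space u *\<^sub>R f u) $ k $ l)"
    unfolding set_lebesgue_integral_def by (rule integral_bounded_linear[OF bl int, symmetric])
  also have "\<dots> = (LINT u|F. indicator K u * (f u $ k $ l))"
  proof (rule integral_cong_AE)
    show "(\<lambda>u. (indicator latent_space u *\<^sub>R f u) $ k $ l) \<in> borel_measurable F"
      using measurable_compose[OF mf borel_measurable_continuous_onI[OF linear_continuous_on[OF bl]]]
      by (simp add: measurable_cong_sets[OF setsF refl])
    show "(\<lambda>u. indicator K u * f u $ k $ l) \<in> borel_measurable F"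
      using borel_measurable_continuous_on_indicator[OF Kb c] by (simp add: measurable_cong_sets[OF setsF refl])
    show "AE u in F. (indicator latent_space u *\<^sub>R f u) $ k $ l = indicator K u * f u $ k $ l"
      by (rule AE_mp[OF AE_K AE_I2]) (use KL in auto)
  qed
  finally show ?thesis .
qed

lemma outer_measurable [measurable]: "(\<lambda>u :: real^'d. outer u u) \<in> borel_measurable borel"
  by (intro borel_measurable_vecI) (simp add: outer_def)

lemma continuous_fisher:
  assumes "x \<in> K" "0 \<le> r" "r \<le> 1"
  shows "continuous_on K (\<lambda>u. fisher_weight r (x \<bullet> u))"
proof -
  have "(x \<bullet> u) * (1 - r * (x \<bullet> u)) \<noteq> 0" if "u \<in> K" for u
    using fisher_denom_ge(1)[OF \<delta> _ _ assms(2,3), of "x \<bullet> u"] K_inner[OF assms(1) that] \<delta>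
    by (smt (verit) zero_less_power)
  then show ?thesis unfolding fisher_weight_def by (intro continuous_intros) auto
qed

lemma \<Delta>_component: "(LINT u:latent_space|F. outer u u) $ k $ l = (LINT u|F. indicator K u * (u $ k * u $ l))"
  by (subst set_integral_latent_component[where B = 1])
    (auto intro!: continuous_intros mult_le_one K_norm simp: norm_outer, auto simp: outer_def intro!: continuous_intros)

lemma G_component:
  assumes "x \<in> K"
  shows "G x $ k $ l = (LINT u|F. indicator K u * (fisher_weight \<rho>lim (x \<bullet> u) * (u $ k * u $ l)))"
proof -
  have eq: "(fisher_weight \<rho>lim (x \<bullet> u) *\<^sub>R outer u u) $ k $ l = fisher_weight \<rho>lim (x \<bullet> u) * (u $ k * u $ l)" for u
    by (simp add: outer_def)
  have "G x = (LINT u:latent_space|F. fisher_weight \<rho>lim (x \<bullet> u) *\<^sub>R outer u u)"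
    by (simp add: G_def G_matrix_def fisher_weight_def)
  also have "\<dots> $ k $ l = (LINT u|F. indicator K u * ((fisher_weight \<rho>lim (x \<bullet> u) *\<^sub>R outer u u) $ k $ l))"
  proof (rule set_integral_latent_component[where B = "1 / \<delta>\<^sup>2"])
    show "(\<lambda>u. fisher_weight \<rho>lim (x \<bullet> u) *\<^sub>R outer u u) \<in> borel_measurable borel"
      unfolding fisher_weight_def by measurable
    show "continuous_on K (\<lambda>u. (fisher_weight \<rho>lim (x \<bullet> u) *\<^sub>R outer u u) $ k $ l)"
      unfolding eq using continuous_fisher[OF assms \<rho>lim01] by (intro continuous_intros)
    fix u assume u: "u \<in> K"
    have "\<bar>fisher_weight \<rho>lim (x \<bullet> u)\<bar> * norm (outer u u) \<le> 1 / \<delta>\<^sup>2 * 1"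
      using fisher_weight_bounds(4)[OF \<delta> _ _ \<rho>lim01] K_inner[OF assms u] K_norm[OF u]
      by (intro mult_mono) (auto simp: norm_outer intro!: mult_le_one)
    then show "norm (fisher_weight \<rho>lim (x \<bullet> u) *\<^sub>R outer u u) \<le> 1 / \<delta>\<^sup>2" by simp
  qed
  finally show ?thesis unfolding eq .
qed

lemma avg_mono: "(\<And>u. u \<in> K \<Longrightarrow> f u \<le> g u) \<Longrightarrow> avg n f \<le> avg n g"
  unfolding avg_def by (intro mult_left_mono sum_mono) (auto simp: xK)

lemma norm_avg_vec_le:
  fixes f :: "nat \<Rightarrow> 'v::real_normed_vector"
  assumes "\<And>j. j \<in> {1..n} \<Longrightarrow> norm (f j) \<le> c" "n \<ge> 1"
  shows "norm ((1 / real n) *\<^sub>R (\<Sum>j=1..n. f j)) \<le> c"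
proof -
  have "norm (\<Sum>j=1..n. f j) \<le> (\<Sum>j=1..n. c)" by (rule order.trans[OF norm_sum sum_mono]) (use assms in auto)
  then show ?thesis using assms(2) by (simp add: field_simps)
qed

lemma Gn_diff_le:
  assumes "x \<in> K" "x' \<in> K" "0 \<le> r" "r \<le> 1" "0 \<le> r'" "r' \<le> 1" "n \<ge> 1"
  shows "norm (Gn n r x - Gn n r' x') \<le> (3 * norm (x - x') + \<bar>r - r'\<bar>) / \<delta>^4"
proof -
  have eq: "Gn n r x - Gn n r' x' = (1 / real n) *\<^sub>R (\<Sum>j=1..n. (fisher_weight r (x \<bullet> x0 j) - fisher_weight r' (x' \<bullet> x0 j)) *\<^sub>R outer (x0 j) (x0 j))"
    by (simp add: Gn_def scaleR_diff_left sum_subtractf scaleR_diff_right)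
  show ?thesis unfolding eq
  proof (rule norm_avg_vec_le[OF _ assms(7)])
    fix j assume "j \<in> {1..n}"
    then have j: "x0 j \<in> K" using xK by auto
    have "\<bar>x \<bullet> x0 j - x' \<bullet> x0 j\<bar> \<le> norm (x - x') * norm (x0 j)"
      using Cauchy_Schwarz_ineq2[of "x - x'" "x0 j"] by (simp add: inner_diff_left)
    also have "\<dots> \<le> norm (x - x') * 1" using K_norm[OF j] by (intro mult_left_mono) auto
    finally have i: "\<bar>x \<bullet> x0 j - x' \<bullet> x0 j\<bar> \<le> norm (x - x')" by simp
    have "\<bar>fisher_weight r (x \<bullet> x0 j) - fisher_weight r' (x' \<bullet> x0 j)\<bar> \<le> (3 * \<bar>x \<bullet> x0 j - x' \<bullet> x0 j\<bar> + \<bar>r - r'\<bar>) / \<delta>^4"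
      using K_inner[OF assms(1) j] K_inner[OF assms(2) j] by (intro fisher_weight_diff_le[OF \<delta>] assms) auto
    also have "\<dots> \<le> (3 * norm (x - x') + \<bar>r - r'\<bar>) / \<delta>^4"
      using i \<delta> by (intro divide_right_mono) auto
    finally have w: "\<bar>fisher_weight r (x \<bullet> x0 j) - fisher_weight r' (x' \<bullet> x0 j)\<bar> \<le> (3 * norm (x - x') + \<bar>r - r'\<bar>) / \<delta>^4" .
    have "\<bar>fisher_weight r (x \<bullet> x0 j) - fisher_weight r' (x' \<bullet> x0 j)\<bar> * norm (outer (x0 j) (x0 j))
      \<le> (3 * norm (x - x') + \<bar>r - r'\<bar>) / \<delta>^4 * 1"
      using w K_norm[OF j] \<delta> by (intro mult_mono) (auto simp: norm_outer intro!: mult_le_one)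
    then show "norm ((fisher_weight r (x \<bullet> x0 j) - fisher_weight r' (x' \<bullet> x0 j)) *\<^sub>R outer (x0 j) (x0 j))
      \<le> (3 * norm (x - x') + \<bar>r - r'\<bar>) / \<delta>^4" by simp
  qed
qed

lemma Gn_tendsto:
  assumes "x \<in> K"
  shows "(\<lambda>n. Gn n \<rho>lim x) \<longlonglongrightarrow> G x"
proof (intro vec_tendstoI)
  fix k l
  show "(\<lambda>n. Gn n \<rho>lim x $ k $ l) \<longlonglongrightarrow> G x $ k $ l"
    unfolding Gn_component G_component[OF assms]
    by (rule avg_tendsto) (intro continuous_intros continuous_fisher[OF assms \<rho>lim01])
qed

text \<open>Inherited from the finite averages, whose common Lipschitz bound passes to the
  limit.\<close>

lemma G_Lipschitz:
  assumes "x \<in> K" "x' \<in> K"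
  shows "norm (G x - G x') \<le> 3 / \<delta>^4 * norm (x - x')"
proof (rule LIMSEQ_le_const2)
  show "(\<lambda>n. norm (Gn n \<rho>lim x - Gn n \<rho>lim x')) \<longlonglongrightarrow> norm (G x - G x')"
    by (intro tendsto_intros Gn_tendsto assms)
  show "\<exists>N. \<forall>n\<ge>N. norm (Gn n \<rho>lim x - Gn n \<rho>lim x') \<le> 3 / \<delta>^4 * norm (x - x')"
    using Gn_diff_le[OF assms \<rho>lim01 \<rho>lim01] by (intro exI[of _ 1]) auto
qed

text \<open>Pointwise convergence on a finite net of the compact set \<open>K\<close> becomes
  uniform through the common Lipschitz bound.\<close>

lemma Gn_uniform:
  assumes "e > 0"
  shows "\<forall>\<^sub>F n in sequentially. \<forall>x\<in>K. norm (Gn n (\<rho> n) x - G x) \<le> e"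
proof -
  \<comment> \<open>With this mesh the three errors below are e / 3, e / 4 and e / 4.\<close>
  define \<eta> where "\<eta> = e * \<delta>^4 / 12"
  have \<eta>: "\<eta> > 0" using assms \<delta> by (simp add: \<eta>_def)
  obtain T where T: "finite T" "T \<subseteq> K" "K \<subseteq> (\<Union>t\<in>T. ball t \<eta>)"
    using compactE_image[OF cK, of K "\<lambda>t. ball t \<eta>"] \<eta>
    by (metis (no_types, lifting) UN_I centre_in_ball open_ball subsetI)
  have 1: "\<forall>\<^sub>F n in sequentially. \<forall>t\<in>T. dist (Gn n \<rho>lim t) (G t) < e / 4"
    using T(1,2) assms by (intro eventually_ball_finite ballI tendstoD[OF Gn_tendsto]) auto
  have 2: "\<forall>\<^sub>F n in sequentially. dist (\<rho> n) \<rho>lim < \<eta>" by (rule tendstoD[OF \<rho>lim \<eta>])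
  have 3: "\<forall>\<^sub>F n in sequentially. n \<ge> (1::nat)" by (rule eventually_ge_at_top)
  show ?thesis using 1 2 3
  proof eventually_elim
    case (elim n)
    show ?case
    proof
      fix x assume x: "x \<in> K"
      then obtain t where t: "t \<in> T" "dist t x < \<eta>" using T(3) by auto
      then have tK: "t \<in> K" using T by auto
      have nx: "norm (x - t) \<le> \<eta>" using t by (simp add: dist_norm norm_minus_commute)
      have r: "0 \<le> \<rho> n" "\<rho> n \<le> 1" using \<rho>01[OF elim(3)] by auto
      have "norm (Gn n (\<rho> n) x - Gn n \<rho>lim t) \<le> (3 * norm (x - t) + \<bar>\<rho> n - \<rho>lim\<bar>) / \<delta>^4"
        by (rule Gn_diff_le[OF x tK r \<rho>lim01 elim(3)])
      also have "\<dots> \<le> (3 * \<eta> + \<eta>) / \<delta>^4"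
        using nx elim(2) \<delta> by (intro divide_right_mono add_mono mult_left_mono) (auto simp: dist_real_def)
      also have "\<dots> = e / 3" using \<delta> by (simp add: \<eta>_def)
      finally have A: "norm (Gn n (\<rho> n) x - Gn n \<rho>lim t) \<le> e / 3" .
      have B: "norm (Gn n \<rho>lim t - G t) \<le> e / 4" using elim(1) t(1) by (auto simp: dist_norm less_imp_le)
      have "norm (G t - G x) \<le> 3 / \<delta>^4 * norm (t - x)" by (rule G_Lipschitz[OF tK x])
      also have "\<dots> \<le> 3 / \<delta>^4 * \<eta>" using nx \<delta> by (intro mult_left_mono) (auto simp: norm_minus_commute)
      also have "\<dots> = e / 4" using \<delta> by (simp add: \<eta>_def)
      finally have C: "norm (G t - G x) \<le> e / 4" .
      have "Gn n (\<rho> n) x - G x = (Gn n (\<rho> n) x - Gn n \<rho>lim t) + (Gn n \<rho>lim t - G t) + (G t - G x)" by simp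
      also have "norm \<dots> \<le> e / 3 + e / 4 + e / 4"
        by (intro norm_triangle_le add_mono A B C norm_triangle_mono)
      finally show "norm (Gn n (\<rho> n) x - G x) \<le> e" using assms by simp
    qed
  qed
qed

end

section \<open>Coercive matrices and perturbation of inverses\<close>

lemma linear_matrix_vector_left: "linear (\<lambda>A :: real^'d^'m. A *v v)"
  by (rule linearI) (simp_all add: matrix_vector_mult_add_rdistrib scaleR_matrix_vector_assoc)

lemma bounded_linear_matrix_vector_left: "bounded_linear (\<lambda>A :: real^'d^'m. A *v v)"
  using linear_matrix_vector_left by (simp add: linear_conv_bounded_linear)

text \<open>Quantitative positivity of the quadratic form: it survives small perturbations and
  rotations, and it bounds the inverse directly.\<close>

definition coercive :: "real \<Rightarrow> real^'d^'d \<Rightarrow> bool" where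
  "coercive c A \<longleftrightarrow> c > 0 \<and> (\<forall>v. c * (norm v)\<^sup>2 \<le> v \<bullet> (A *v v))"

lemma coercive_norm_le:
  assumes "coercive c A"
  shows "c * norm v \<le> norm (A *v v)"
proof (cases "v = 0")
  case False
  have "c * (norm v)\<^sup>2 \<le> norm v * norm (A *v v)"
    using assms Cauchy_Schwarz_ineq2[of v "A *v v"] unfolding coercive_def
    by (meson abs_le_D1 order.trans)
  then have "norm v * (c * norm v) \<le> norm v * norm (A *v v)" by (simp add: power2_eq_square mult_ac)
  then show ?thesis using False by simp
qed simp

lemma coercive_invertible:
  fixes A :: "real^'d^'d"
  assumes "coercive c A"
  shows "invertible A"
proof -
  have "x = 0" if "A *v x = 0" for x
  proof -
    have "c * norm x \<le> 0" using coercive_norm_le[OF assms, of x] that by simp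
    then show ?thesis using assms by (simp add: coercive_def mult_le_0_iff)
  qed
  then show ?thesis by (simp add: invertible_left_inverse matrix_left_invertible_ker)
qed

lemma coercive_inv_norm_le:
  fixes A :: "real^'d^'d"
  assumes "coercive c A"
  shows "norm (matrix_inv A *v w) \<le> norm w / c"
proof -
  have "A *v (matrix_inv A *v w) = w"
    using matrix_inv_mult(1)[OF coercive_invertible[OF assms]] by (simp add: matrix_vector_mul_assoc)
  then show ?thesis
    using coercive_norm_le[OF assms, of "matrix_inv A *v w"] assms by (simp add: coercive_def field_simps)
qed

lemma coercive_perturb:
  assumes "coercive c A" "norm (B - A) \<le> c / 2"
  shows "coercive (c / 2) B"
  unfolding coercive_def
proof (intro conjI allI)
  show "c / 2 > 0" using assms(1) by (simp add: coercive_def)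
  fix v
  have "\<bar>v \<bullet> ((B - A) *v v)\<bar> \<le> norm v * norm ((B - A) *v v)" by (rule Cauchy_Schwarz_ineq2)
  also have "\<dots> \<le> norm v * (c / 2 * norm v)"
    using assms(2) by (intro mult_left_mono order.trans[OF norm_matrix_vector_le] mult_right_mono) auto
  finally have "\<bar>v \<bullet> ((B - A) *v v)\<bar> \<le> c / 2 * (norm v)\<^sup>2" by (simp add: power2_eq_square mult_ac)
  moreover have "v \<bullet> (B *v v) = v \<bullet> (A *v v) + v \<bullet> ((B - A) *v v)"
    by (simp add: matrix_vector_mult_diff_rdistrib inner_diff_right)
  moreover have "c * (norm v)\<^sup>2 \<le> v \<bullet> (A *v v)" using assms(1) by (simp add: coercive_def)
  ultimately show "c / 2 * (norm v)\<^sup>2 \<le> v \<bullet> (B *v v)" by (simp add: abs_le_iff)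
qed

text \<open>The resolvent identity A^-1 - B^-1 = A^-1 (B - A) B^-1, with both inverses bounded by 1
  / c.\<close>

lemma coercive_inv_diff_le:
  fixes A B :: "real^'d^'d"
  assumes A: "coercive c A" and B: "coercive c B"
  shows "norm ((matrix_inv A - matrix_inv B) *v w) \<le> norm (A - B) / c\<^sup>2 * norm w"
proof -
  have c: "c > 0" using A by (simp add: coercive_def)
  note iA = matrix_inv_mult[OF coercive_invertible[OF A]] and iB = matrix_inv_mult[OF coercive_invertible[OF B]]
  have "matrix_inv A *v ((B - A) *v (matrix_inv B *v w)) = matrix_inv A *v w - matrix_inv B *v w"
  proof -
    have 1: "B *v (matrix_inv B *v w) = w" by (simp add: matrix_vector_mul_assoc iB)
    have 2: "matrix_inv A *v (A *v u) = u" for u by (simp add: matrix_vector_mul_assoc iA)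
    show ?thesis by (simp add: matrix_vector_mult_diff_rdistrib matrix_vector_mult_diff_distrib 1 2)
  qed
  then have "norm ((matrix_inv A - matrix_inv B) *v w) = norm (matrix_inv A *v ((B - A) *v (matrix_inv B *v w)))"
    by (simp add: matrix_vector_mult_diff_rdistrib)
  also have "\<dots> \<le> norm ((B - A) *v (matrix_inv B *v w)) / c" by (rule coercive_inv_norm_le[OF A])
  also have "\<dots> \<le> norm (B - A) * (norm w / c) / c"
    using c by (intro divide_right_mono order.trans[OF norm_matrix_vector_le] mult_left_mono coercive_inv_norm_le[OF B]) auto
  finally show ?thesis by (simp add: power2_eq_square norm_minus_commute field_simps)
qed

lemma trace_eq_axis: "trace A = (\<Sum>k\<in>UNIV. axis k 1 \<bullet> (A *v axis k 1))"
  by (simp add: trace_def inner_axis' matrix_vector_mult_basis column_def)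

lemma trace_inv_diff_le:
  fixes A B :: "real^'d^'d"
  assumes "coercive c A" "coercive c B"
  shows "\<bar>trace (matrix_inv A) - trace (matrix_inv B)\<bar> \<le> real CARD('d) * (norm (A - B) / c\<^sup>2)"
proof -
  have "trace (matrix_inv A) - trace (matrix_inv B) = (\<Sum>k\<in>UNIV. axis k 1 \<bullet> ((matrix_inv A - matrix_inv B) *v axis k 1))"
    by (simp add: trace_eq_axis sum_subtractf matrix_vector_mult_diff_rdistrib inner_diff_right)
  also have "\<bar>\<dots>\<bar> \<le> (\<Sum>k\<in>(UNIV :: 'd set). norm (A - B) / c\<^sup>2)"
  proof (rule order.trans[OF sum_abs sum_mono])
    fix k :: 'd
    have "\<bar>axis k 1 \<bullet> ((matrix_inv A - matrix_inv B) *v axis k 1)\<bar>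
       \<le> norm (axis k (1::real)) * norm ((matrix_inv A - matrix_inv B) *v axis k 1)"
      by (rule Cauchy_Schwarz_ineq2)
    also have "\<dots> \<le> norm (A - B) / c\<^sup>2"
      using coercive_inv_diff_le[OF assms, of "axis k 1"] by (simp add: norm_axis_1)
    finally show "\<bar>axis k 1 \<bullet> ((matrix_inv A - matrix_inv B) *v axis k 1)\<bar> \<le> norm (A - B) / c\<^sup>2" .
  qed
  finally show ?thesis by simp
qed

text \<open>Cramer's rule exhibits the entries of the inverse as rational functions of the matrix,
  from which their measurability follows.\<close>

lemma matrix_inv_component_cramer:
  fixes A :: "real^'d^'d"
  assumes "det A \<noteq> 0"
  shows "matrix_inv A $ k $ l = det (\<chi> i j. if j = k then axis l 1 $ i else A $ i $ j) / det A"
proof -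
  have "A *v (matrix_inv A *v axis l 1) = axis l 1"
    using matrix_inv_mult(1)[of A] assms by (simp add: matrix_vector_mul_assoc invertible_det_nz)
  then have "matrix_inv A *v axis l 1 = (\<chi> k. det (\<chi> i j. if j = k then axis l 1 $ i else A $ i $ j) / det A)"
    using cramer[OF assms] by blast
  moreover have "matrix_inv A $ k $ l = (matrix_inv A *v axis l 1) $ k"
    by (simp add: matrix_vector_mult_basis column_def)
  ultimately show ?thesis by simp
qed

text \<open>The matrix inverse of a singular matrix is an unspecified constant, so it does not spoil
  measurability.\<close>

lemma measurable_matrix_inv_component:
  fixes M :: "'a \<Rightarrow> real^'d^'d"
  assumes M: "\<And>k l. (\<lambda>x. M x $ k $ l) \<in> borel_measurable N"
  shows "(\<lambda>x. matrix_inv (M x) $ k $ l) \<in> borel_measurable N"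
proof -
  have md: "(\<lambda>x. det (Q x)) \<in> borel_measurable N" if "\<And>i j. (\<lambda>x. Q x $ i $ j) \<in> borel_measurable N"
    for Q :: "'a \<Rightarrow> real^'d^'d"
    unfolding det_def using that by measurable
  have sing: "matrix_inv A = (SOME A' :: real^'d^'d. False)" if "det A = 0" for A :: "real^'d^'d"
  proof -
    have "\<not> invertible A" using that by (simp add: invertible_det_nz)
    then have "(\<lambda>A'. A ** A' = mat 1 \<and> A' ** A = mat 1) = (\<lambda>_. False)" by (auto simp: invertible_def)
    then show ?thesis unfolding matrix_inv_def by simp
  qed
  have "(\<lambda>x. matrix_inv (M x) $ k $ l) = (\<lambda>x. if det (M x) = 0 then (SOME A' :: real^'d^'d. False) $ k $ l
      else det (\<chi> i j. if j = k then axis l 1 $ i else M x $ i $ j) / det (M x))"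
    by (auto simp: sing matrix_inv_component_cramer)
  also have "\<dots> \<in> borel_measurable N"
  proof -
    have [measurable]: "(\<lambda>x. det (M x)) \<in> borel_measurable N" by (rule md) (rule M)
    have [measurable]: "(\<lambda>x. det (\<chi> i j. if j = k then axis l 1 $ i else M x $ i $ j)) \<in> borel_measurable N"
      by (rule md) (use M in auto)
    show ?thesis by measurable
  qed
  finally show ?thesis .
qed

context rdpg_setting
begin

lemma G_sym: "x \<in> K \<Longrightarrow> transpose (G x) = G x"
  by (simp add: vec_eq_iff transpose_def G_component mult_ac)

lemma inner_Gn: "w \<bullet> (Gn n r x *v v) = avg n (\<lambda>u. fisher_weight r (x \<bullet> u) * ((u \<bullet> v) * (w \<bullet> u)))"
proof -
  have "Gn n r x *v v = (1 / real n) *\<^sub>R (\<Sum>j=1..n. fisher_weight r (x \<bullet> x0 j) *\<^sub>R (outer (x0 j) (x0 j) *v v))"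
    unfolding Gn_def
    by (simp add: linear_scale[OF linear_matrix_vector_left] linear_sum[OF linear_matrix_vector_left])
  then show ?thesis by (simp add: avg_def outer_mult_vec inner_sum_right mult.assoc)
qed

definition \<Delta> :: "real^'d^'d" where "\<Delta> = (LINT x:latent_space|F. outer x x)"
definition \<Delta>n :: "nat \<Rightarrow> real^'d^'d" where "\<Delta>n n = (1 / real n) *\<^sub>R (\<Sum>j=1..n. outer (x0 j) (x0 j))"

lemma inner_\<Delta>n: "w \<bullet> (\<Delta>n n *v v) = avg n (\<lambda>u. (u \<bullet> v) * (w \<bullet> u))"
  unfolding \<Delta>n_def
  by (simp add: linear_scale[OF linear_matrix_vector_left] linear_sum[OF linear_matrix_vector_left]
      avg_def outer_mult_vec inner_sum_right)

lemma \<Delta>n_tendsto: "\<Delta>n \<longlonglongrightarrow> \<Delta>"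
proof (intro vec_tendstoI)
  fix k l
  have "\<Delta>n n $ k $ l = avg n (\<lambda>u. u $ k * u $ l)" for n
    by (simp add: \<Delta>n_def avg_def outer_def)
  then show "(\<lambda>n. \<Delta>n n $ k $ l) \<longlonglongrightarrow> \<Delta> $ k $ l"
    unfolding \<Delta>_def \<Delta>_component by (simp, intro avg_tendsto continuous_intros)
qed

lemma inner_\<Delta>: "w \<bullet> (\<Delta> *v v) = (LINT u|F. indicator K u * ((u \<bullet> v) * (w \<bullet> u)))"
proof (rule LIMSEQ_unique)
  show "(\<lambda>n. w \<bullet> (\<Delta>n n *v v)) \<longlonglongrightarrow> w \<bullet> (\<Delta> *v v)"
    by (intro tendsto_intros bounded_linear.tendsto[OF bounded_linear_matrix_vector_left] \<Delta>n_tendsto)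
  show "(\<lambda>n. w \<bullet> (\<Delta>n n *v v)) \<longlonglongrightarrow> (LINT u|F. indicator K u * ((u \<bullet> v) * (w \<bullet> u)))"
    unfolding inner_\<Delta>n by (intro avg_tendsto continuous_intros)
qed

text \<open>If the form vanished at \<open>v\<close>, almost every \<open>u\<close> would be
  orthogonal to \<open>v\<close>, so \<Delta> v would be 0, against invertibility.\<close>

lemma \<Delta>_pos:
  assumes "v \<noteq> 0"
  shows "0 < v \<bullet> (\<Delta> *v v)"
proof (rule ccontr)
  assume neg: "\<not> ?thesis"
  have q: "v \<bullet> (\<Delta> *v v) = (LINT u|F. indicator K u * (u \<bullet> v)\<^sup>2)"
    by (simp add: inner_\<Delta> power2_eq_square inner_commute)
  have Kb: "K \<in> sets borel" using cK by (simp add: compact_imp_closed)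
  have int: "integrable F (\<lambda>u. indicator K u * (u \<bullet> v)\<^sup>2)"
  proof (rule integrable_bounded_F[where B = "(norm v)\<^sup>2"])
    show "(\<lambda>u. indicator K u * (u \<bullet> v)\<^sup>2) \<in> borel_measurable borel"
      using Kb by measurable
    fix u :: "real^'d"
    show "\<bar>indicator K u * (u \<bullet> v)\<^sup>2\<bar> \<le> (norm v)\<^sup>2"
    proof (cases "u \<in> K")
      case True
      have "\<bar>u \<bullet> v\<bar> \<le> norm u * norm v" by (rule Cauchy_Schwarz_ineq2)
      also have "\<dots> \<le> 1 * norm v" using K_norm[OF True] by (intro mult_right_mono) auto
      finally have "\<bar>u \<bullet> v\<bar>\<^sup>2 \<le> (norm v)\<^sup>2" by (intro power_mono) auto
      then show ?thesis using True by simp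
    qed simp
  qed
  have "(LINT u|F. indicator K u * (u \<bullet> v)\<^sup>2) \<ge> 0" by (rule integral_nonneg_AE) auto
  then have "(LINT u|F. indicator K u * (u \<bullet> v)\<^sup>2) = 0" using neg unfolding q by linarith
  then have "AE u in F. indicator K u * (u \<bullet> v)\<^sup>2 = 0"
    using int by (subst (asm) integral_nonneg_eq_0_iff_AE) auto
  then have ae: "AE u in F. indicator K u * ((u \<bullet> v) * (w \<bullet> u)) = (0 :: real)" for w
    by (rule AE_mp) (auto intro!: AE_I2)
  have "w \<bullet> (\<Delta> *v v) = 0" for w
    unfolding inner_\<Delta> using integral_cong_AE[of _ F "\<lambda>_. 0 :: real", OF _ _ ae[of w]] Kb
    by (simp add: measurable_cong_sets[OF setsF refl])
  then have "\<Delta> *v v = 0" by (metis inner_eq_zero_iff)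
  then have "matrix_inv \<Delta> *v (\<Delta> *v v) = 0" by simp
  then show False using assms matrix_inv_mult(2)[OF inv\<Delta>] by (simp add: \<Delta>_def matrix_vector_mul_assoc)
qed

text \<open>The form attains a positive minimum on the unit sphere, and homogeneity carries this
  bound to all vectors.\<close>

lemma \<Delta>_coercive: "\<exists>c. coercive c \<Delta>"
proof -
  let ?f = "\<lambda>v. v \<bullet> (\<Delta> *v v)"
  have "continuous_on (sphere 0 1) ?f"
    by (intro continuous_intros linear_continuous_on) (simp add: linear_conv_bounded_linear[symmetric])
  moreover have "sphere (0 :: real^'d) 1 \<noteq> {}" by simp
  ultimately obtain v0 where v0: "v0 \<in> sphere 0 1" "\<And>v. v \<in> sphere 0 1 \<Longrightarrow> ?f v0 \<le> ?f v"
    using continuous_attains_inf[OF compact_sphere] by blast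
  have "?f v0 * (norm v)\<^sup>2 \<le> ?f v" for v
  proof (cases "v = 0")
    case False
    define w where "w = v /\<^sub>R norm v"
    have "w \<in> sphere 0 1" using False by (simp add: w_def)
    then have "?f v0 \<le> ?f w" by (rule v0(2))
    then have "?f v0 * (norm v)\<^sup>2 \<le> ?f w * (norm v)\<^sup>2" by (intro mult_right_mono) auto
    also have "\<dots> = ?f (norm v *\<^sub>R w)"
      by (simp add: matrix_vector_mult_scaleR power2_eq_square)
    also have "norm v *\<^sub>R w = v" using False by (simp add: w_def)
    finally show ?thesis .
  qed simp
  moreover have "v0 \<noteq> 0" using v0(1) by auto
  ultimately show ?thesis using \<Delta>_pos unfolding coercive_def by blast
qed

definition \<kappa> :: real where "\<kappa> = (SOME c. coercive c \<Delta>)"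

lemma \<kappa>: "coercive \<kappa> \<Delta>"
  unfolding \<kappa>_def using someI_ex[OF \<Delta>_coercive] .

lemma \<kappa>_pos: "\<kappa> > 0" using \<kappa> by (simp add: coercive_def)

text \<open>Fisher weights are at least 1, so the finite averages dominate \<open>\<Delta>n\<close>
  as quadratic forms, and the order passes to the limit. Thus one constant \<open>\<kappa>\<close>
  serves all of \<open>K\<close>.\<close>

lemma G_coercive:
  assumes "x \<in> K"
  shows "coercive \<kappa> (G x)"
  unfolding coercive_def
proof (intro conjI allI \<kappa>_pos)
  fix v
  have "v \<bullet> (\<Delta> *v v) \<le> v \<bullet> (G x *v v)"
  proof (rule LIMSEQ_le)
    show "(\<lambda>n. v \<bullet> (\<Delta>n n *v v)) \<longlonglongrightarrow> v \<bullet> (\<Delta> *v v)"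
      by (intro tendsto_intros bounded_linear.tendsto[OF bounded_linear_matrix_vector_left] \<Delta>n_tendsto)
    show "(\<lambda>n. v \<bullet> (Gn n \<rho>lim x *v v)) \<longlonglongrightarrow> v \<bullet> (G x *v v)"
      by (intro tendsto_intros bounded_linear.tendsto[OF bounded_linear_matrix_vector_left] Gn_tendsto assms)
    have "v \<bullet> (\<Delta>n n *v v) \<le> v \<bullet> (Gn n \<rho>lim x *v v)" for n
      unfolding inner_\<Delta>n inner_Gn
    proof (rule avg_mono)
      fix u assume u: "u \<in> K"
      have "1 * ((u \<bullet> v) * (v \<bullet> u)) \<le> fisher_weight \<rho>lim (x \<bullet> u) * ((u \<bullet> v) * (v \<bullet> u))"
        using fisher_weight_bounds(1)[OF \<delta> _ _ \<rho>lim01] K_inner[OF assms u]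
        by (intro mult_right_mono) (auto simp: inner_commute)
      then show "(u \<bullet> v) * (v \<bullet> u) \<le> fisher_weight \<rho>lim (x \<bullet> u) * ((u \<bullet> v) * (v \<bullet> u))" by simp
    qed
    then show "\<exists>N. \<forall>n\<ge>N. v \<bullet> (\<Delta>n n *v v) \<le> v \<bullet> (Gn n \<rho>lim x *v v)" by blast
  qed
  moreover have "\<kappa> * (norm v)\<^sup>2 \<le> v \<bullet> (\<Delta> *v v)" using \<kappa> by (simp add: coercive_def)
  ultimately show "\<kappa> * (norm v)\<^sup>2 \<le> v \<bullet> (G x *v v)" by simp
qed

lemma G_pos_def: "x \<in> K \<Longrightarrow> pos_def_matrix (G x)"
  using G_sym G_coercive[of x] \<kappa>_pos unfolding pos_def_matrix_def coercive_def
  by (smt (verit) mult_pos_pos zero_less_norm_iff zero_less_power)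

text \<open>The trace is integrated over the whole latent space, while continuity of
  \<open>G\<close> is known on \<open>K\<close> only; joint measurability of the integrand settles
  the rest.\<close>

lemma G_measurable: "(\<lambda>x. G x $ k $ l) \<in> borel_measurable borel"
proof -
  have lat[measurable]: "latent_space \<in> sets (borel :: (real^'d) measure)" by (rule borel_open[OF open_latent_space])
  let ?f = "\<lambda>(x, u). indicator latent_space u *\<^sub>R ((1 / ((x \<bullet> u) * (1 - \<rho>lim * (x \<bullet> u)))) *\<^sub>R outer u u)"
  have "?f \<in> borel_measurable (borel \<Otimes>\<^sub>M (borel :: (real^'d) measure))"
    by measurable
  then have "?f \<in> borel_measurable (borel \<Otimes>\<^sub>M F)"
    by (simp add: measurable_cong_sets[OF sets_pair_measure_cong[OF refl setsF] refl])
  then have "(\<lambda>x. LINT u|F. ?f (x, u)) \<in> borel_measurable borel"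
    by (intro borel_measurable_lebesgue_integral) simp
  then have "G \<in> borel_measurable borel"
    by (simp add: G_def G_matrix_def set_lebesgue_integral_def[abs_def] cong: measurable_cong)
  moreover have "(\<lambda>A :: real^'d^'d. A $ k $ l) \<in> borel_measurable borel"
    by (intro borel_measurable_continuous_onI continuous_intros)
  ultimately show ?thesis by (rule measurable_compose)
qed

definition tr_inv :: "real^'d \<Rightarrow> real" where "tr_inv x = trace (matrix_inv (G x))"

lemma tr_inv_measurable: "tr_inv \<in> borel_measurable borel"
  unfolding tr_inv_def trace_def by (intro borel_measurable_sum measurable_matrix_inv_component G_measurable)

lemma tr_inv_continuous: "continuous_on K tr_inv"
proof -
  define L where "L = real CARD('d) * (3 / \<delta>^4 / \<kappa>\<^sup>2)"
  have L0: "L \<ge> 0" using \<delta> \<kappa>_pos by (simp add: L_def)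
  have "dist (tr_inv x) (tr_inv y) \<le> L * dist x y" if "x \<in> K" "y \<in> K" for x y
  proof -
    have "\<bar>tr_inv x - tr_inv y\<bar> \<le> real CARD('d) * (norm (G x - G y) / \<kappa>\<^sup>2)"
      unfolding tr_inv_def by (intro trace_inv_diff_le G_coercive that)
    also have "\<dots> \<le> real CARD('d) * (3 / \<delta>^4 * norm (x - y) / \<kappa>\<^sup>2)"
      using \<kappa>_pos by (intro mult_left_mono divide_right_mono G_Lipschitz that) auto
    finally show ?thesis by (simp add: L_def dist_norm mult_ac)
  qed
  then have "L-lipschitz_on K tr_inv" using L0 by (intro lipschitz_onI) auto
  then show ?thesis by (rule lipschitz_on_continuous_on)
qed

lemma avg_tr_inv_tendsto:
  "(\<lambda>n. avg n tr_inv) \<longlonglongrightarrow> (LINT x:latent_space|F. trace (matrix_inv (G_matrix \<rho>lim F x)))"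
proof -
  have lat: "latent_space \<in> sets (borel :: (real^'d) measure)" by (rule borel_open[OF open_latent_space])
  have Kb: "K \<in> sets borel" using cK by (simp add: compact_imp_closed)
  have "(LINT x:latent_space|F. trace (matrix_inv (G_matrix \<rho>lim F x))) = (LINT x|F. indicator latent_space x * tr_inv x)"
    by (simp add: set_lebesgue_integral_def tr_inv_def G_def)
  also have "\<dots> = (LINT x|F. indicator K x * tr_inv x)"
  proof (rule integral_cong_AE)
    show "(\<lambda>x. indicator latent_space x * tr_inv x) \<in> borel_measurable F"
      using lat tr_inv_measurable by (simp add: measurable_cong_sets[OF setsF refl])
    show "(\<lambda>x. indicator K x * tr_inv x) \<in> borel_measurable F"
      using Kb tr_inv_measurable by (simp add: measurable_cong_sets[OF setsF refl])
    show "AE x in F. indicator latent_space x * tr_inv x = indicator K x * tr_inv x"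
      by (rule AE_mp[OF AE_K AE_I2]) (use KL in auto)
  qed
  finally show ?thesis using avg_tendsto[OF tr_inv_continuous] by simp
qed

end

section \<open>Expansion of the one-step update\<close>

text \<open>The derivative of \<open>fisher_weight r\<close>, read off from the partial fractions 1
  / s + r / (1 - r s).\<close>

definition fisher_weight_deriv :: "real \<Rightarrow> real \<Rightarrow> real" where
  "fisher_weight_deriv r s = - (1 / s\<^sup>2) + r\<^sup>2 / (1 - r * s)\<^sup>2"

lemma inverse_taylor:
  fixes s s' :: real
  assumes "s \<noteq> 0" "s' \<noteq> 0"
  shows "1 / s' - 1 / s + (s' - s) / s\<^sup>2 = (s' - s)\<^sup>2 / (s\<^sup>2 * s')"
  using assms by (simp add: field_simps power2_eq_square)

lemma fisher_weight_deriv_bound: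
  fixes a s r :: real
  assumes "0 < a" "a \<le> s" "s \<le> 1 - a" "0 \<le> r" "r \<le> 1"
  shows "\<bar>fisher_weight_deriv r s\<bar> \<le> 2 / a\<^sup>2"
proof -
  note d = fisher_denom_ge[OF assms]
  have "1 / s\<^sup>2 \<le> 1 / a\<^sup>2" using assms by (intro divide_left_mono power_mono) auto
  moreover have "r\<^sup>2 / (1 - r * s)\<^sup>2 \<le> 1 / a\<^sup>2"
    using assms d(3) by (intro frac_le power_mono power_le_one) auto
  moreover have "0 \<le> 1 / s\<^sup>2" "0 \<le> r\<^sup>2 / (1 - r * s)\<^sup>2" by auto
  ultimately show ?thesis unfolding fisher_weight_deriv_def by linarith
qed

text \<open>The remainder of the reciprocal is explicit, and both partial fractions are reciprocals;
  the second one, in the variable 1 - r s, brings a factor r^3 that is at most 1.\<close>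

lemma fisher_weight_taylor:
  fixes a s s' r :: real
  assumes a: "0 < a" and s: "a \<le> s" "s \<le> 1 - a" and s': "a \<le> s'" "s' \<le> 1 - a" and r: "0 \<le> r" "r \<le> 1"
  shows "\<bar>fisher_weight r s' - fisher_weight r s - fisher_weight_deriv r s * (s' - s)\<bar> \<le> 2 * (s' - s)\<^sup>2 / a^3"
proof -
  let ?u = "1 - r * s" and ?u' = "1 - r * s'"
  note d = fisher_denom_ge[OF a s r] and d' = fisher_denom_ge[OF a s' r]
  have nz: "s \<noteq> 0" "s' \<noteq> 0" "?u \<noteq> 0" "?u' \<noteq> 0" using a s s' d(3) d'(3) by auto
  have split: "fisher_weight r t = 1 / t + r * (1 / (1 - r * t))" if "t \<noteq> 0" "1 - r * t \<noteq> 0" for t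
    using that by (simp add: fisher_weight_def divide_simps)
  have "fisher_weight r s' - fisher_weight r s - fisher_weight_deriv r s * (s' - s)
     = (1 / s' - 1 / s + (s' - s) / s\<^sup>2) + r * (1 / ?u' - 1 / ?u + (?u' - ?u) / ?u\<^sup>2)"
    unfolding split[OF nz(1,3)] split[OF nz(2,4)] fisher_weight_deriv_def
    by (simp add: algebra_simps power2_eq_square diff_divide_distrib add_divide_distrib)
  also have "\<dots> = (s' - s)\<^sup>2 / (s\<^sup>2 * s') + r * ((?u' - ?u)\<^sup>2 / (?u\<^sup>2 * ?u'))"
    unfolding inverse_taylor[OF nz(1,2)] inverse_taylor[OF nz(3,4)] ..
  also have "\<dots> = (s' - s)\<^sup>2 / (s\<^sup>2 * s') + r^3 * ((s' - s)\<^sup>2 / (?u\<^sup>2 * ?u'))"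
  proof -
    have "(?u' - ?u)\<^sup>2 = r\<^sup>2 * (s' - s)\<^sup>2" by algebra
    then show ?thesis by (simp add: power2_eq_square power3_eq_cube mult_ac)
  qed
  finally have eq: "fisher_weight r s' - fisher_weight r s - fisher_weight_deriv r s * (s' - s)
     = (s' - s)\<^sup>2 / (s\<^sup>2 * s') + r^3 * ((s' - s)\<^sup>2 / (?u\<^sup>2 * ?u'))" .
  have b: "0 \<le> (s' - s)\<^sup>2 / (x\<^sup>2 * y) \<and> (s' - s)\<^sup>2 / (x\<^sup>2 * y) \<le> (s' - s)\<^sup>2 / a^3" if "a \<le> x" "a \<le> y" for x y
  proof -
    have "a\<^sup>2 * a \<le> x\<^sup>2 * y" using that a by (intro mult_mono power_mono) auto
    then have "a^3 \<le> x\<^sup>2 * y" by (simp add: power3_eq_cube power2_eq_square)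
    then show ?thesis using that a by (intro conjI divide_left_mono) (auto intro!: mult_pos_pos divide_nonneg_nonneg)
  qed
  have "r^3 * ((s' - s)\<^sup>2 / (?u\<^sup>2 * ?u')) \<le> 1 * ((s' - s)\<^sup>2 / a^3)"
    using r b[OF d(3) d'(3)] by (intro mult_mono power_le_one) auto
  moreover have "0 \<le> r^3 * ((s' - s)\<^sup>2 / (?u\<^sup>2 * ?u'))" using r b[OF d(3) d'(3)] by (intro mult_nonneg_nonneg) auto
  ultimately show ?thesis unfolding eq using b[OF s(1) s'(1)] by (simp add: abs_le_iff)
qed

section \<open>Deterministic expansion around the true positions\<close>

lemma sum_inner_scaleR_bound: "\<bar>u \<bullet> v\<bar> \<le> norm v" if "norm (u :: 'v::real_inner) \<le> 1"
  using Cauchy_Schwarz_ineq2[of u v] mult_right_mono[OF that norm_ge_zero[of v]] by simp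

text \<open>A single realization: \<open>x\<close> are the positions, \<open>e\<close> is the noise,
  and \<open>\<epsilon>\<close> are the errors after division by the square root of the sparsity
  \<open>r\<close>. The bound \<delta> / 6 lets an inner product move by at most 3 * \<delta> / 6,
  so it keeps a distance of \<open>a\<close>, half of \<delta>, from 0 and 1.\<close>

locale one_step_expansion =
  fixes n :: nat and r \<delta> :: real and x \<epsilon> :: "nat \<Rightarrow> real^'d" and e :: "nat \<Rightarrow> nat \<Rightarrow> real"
  assumes n1: "n \<ge> 1" and r: "0 < r" "r \<le> 1" and \<delta>0: "0 < \<delta>"
    and x1: "\<And>i. i \<in> {1..n} \<Longrightarrow> norm (x i) \<le> 1"
    and xx: "\<And>i j. i \<in> {1..n} \<Longrightarrow> j \<in> {1..n} \<Longrightarrow> \<delta> \<le> x i \<bullet> x j \<and> x i \<bullet> x j \<le> 1 - \<delta>"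
    and e1: "\<And>i j. \<bar>e i j\<bar> \<le> 1"
    and small: "\<And>i. i \<in> {1..n} \<Longrightarrow> norm (\<epsilon> i) \<le> \<delta> / 6"
begin

definition z :: "nat \<Rightarrow> real^'d" where "z i = x i + \<epsilon> i"

abbreviation "\<sigma> i j \<equiv> x i \<bullet> x j"
abbreviation "\<sigma>z i j \<equiv> z i \<bullet> z j"
abbreviation "w i j \<equiv> fisher_weight r (\<sigma> i j)"
abbreviation "wz i j \<equiv> fisher_weight r (\<sigma>z i j)"
abbreviation "w' i j \<equiv> fisher_weight_deriv r (\<sigma> i j)"
abbreviation "m i j \<equiv> norm (\<epsilon> i) + norm (\<epsilon> j)"

definition a :: real where "a = \<delta> / 2"

lemma \<delta>1: "\<delta> \<le> 1 / 2"
  using xx[of 1 1] n1 by auto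

lemma a_pos: "0 < a" and a1: "a \<le> 1"
  using \<delta>0 \<delta>1 by (auto simp: a_def)

lemma \<sigma>z_diff_eq: "\<sigma>z i j - \<sigma> i j = \<epsilon> i \<bullet> x j + x i \<bullet> \<epsilon> j + \<epsilon> i \<bullet> \<epsilon> j"
  by (simp add: z_def inner_simps algebra_simps)

lemma inner_x_le: "i \<in> {1..n} \<Longrightarrow> \<bar>x i \<bullet> v\<bar> \<le> norm v" "i \<in> {1..n} \<Longrightarrow> \<bar>v \<bullet> x i\<bar> \<le> norm v"
  using sum_inner_scaleR_bound[OF x1, of i v] by (auto simp: inner_commute)

lemma inner_eps_le:
  assumes "i \<in> {1..n}" "j \<in> {1..n}"
  shows "\<bar>\<epsilon> i \<bullet> \<epsilon> j\<bar> \<le> norm (\<epsilon> j) * (\<delta> / 6)" "\<bar>\<epsilon> i \<bullet> \<epsilon> j\<bar> \<le> norm (\<epsilon> j)" "\<bar>\<epsilon> i \<bullet> \<epsilon> j\<bar> \<le> (m i j)\<^sup>2"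
proof -
  have "\<bar>\<epsilon> i \<bullet> \<epsilon> j\<bar> \<le> norm (\<epsilon> i) * norm (\<epsilon> j)" by (rule Cauchy_Schwarz_ineq2)
  also have "\<dots> \<le> (\<delta> / 6) * norm (\<epsilon> j)" using small[OF assms(1)] by (intro mult_right_mono) auto
  finally show 1: "\<bar>\<epsilon> i \<bullet> \<epsilon> j\<bar> \<le> norm (\<epsilon> j) * (\<delta> / 6)" by (simp add: mult.commute)
  also have "\<dots> \<le> norm (\<epsilon> j) * 1" using \<delta>1 \<delta>0 by (intro mult_left_mono) auto
  finally show "\<bar>\<epsilon> i \<bullet> \<epsilon> j\<bar> \<le> norm (\<epsilon> j)" by simp
  have "\<bar>\<epsilon> i \<bullet> \<epsilon> j\<bar> \<le> norm (\<epsilon> i) * norm (\<epsilon> j)" by (rule Cauchy_Schwarz_ineq2)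
  also have "\<dots> \<le> m i j * m i j" by (intro mult_mono) auto
  finally show "\<bar>\<epsilon> i \<bullet> \<epsilon> j\<bar> \<le> (m i j)\<^sup>2" by (simp add: power2_eq_square)
qed

lemma \<sigma>z_diff:
  assumes "i \<in> {1..n}" "j \<in> {1..n}"
  shows "\<bar>\<sigma>z i j - \<sigma> i j\<bar> \<le> \<delta> / 2" "\<bar>\<sigma>z i j - \<sigma> i j\<bar> \<le> 2 * m i j"
proof -
  have b: "\<bar>\<epsilon> i \<bullet> x j\<bar> \<le> norm (\<epsilon> i)" "\<bar>x i \<bullet> \<epsilon> j\<bar> \<le> norm (\<epsilon> j)" "\<bar>\<epsilon> i \<bullet> \<epsilon> j\<bar> \<le> norm (\<epsilon> j)"
    using inner_x_le assms inner_eps_le(2)[OF assms] by auto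
  then show "\<bar>\<sigma>z i j - \<sigma> i j\<bar> \<le> \<delta> / 2"
    unfolding \<sigma>z_diff_eq using small[OF assms(1)] small[OF assms(2)] by linarith
  have "\<bar>\<sigma>z i j - \<sigma> i j\<bar> \<le> norm (\<epsilon> i) + norm (\<epsilon> j) + norm (\<epsilon> j)"
    unfolding \<sigma>z_diff_eq using b by linarith
  also have "\<dots> \<le> 2 * m i j" by simp
  finally show "\<bar>\<sigma>z i j - \<sigma> i j\<bar> \<le> 2 * m i j" .
qed

lemma ranges:
  assumes "i \<in> {1..n}" "j \<in> {1..n}"
  shows "a \<le> \<sigma> i j" "\<sigma> i j \<le> 1 - a" "a \<le> \<sigma>z i j" "\<sigma>z i j \<le> 1 - a"
  using xx[OF assms] \<sigma>z_diff(1)[OF assms] \<delta>0 unfolding a_def by linarith+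

lemma w_bound: "i \<in> {1..n} \<Longrightarrow> j \<in> {1..n} \<Longrightarrow> \<bar>w i j\<bar> \<le> 1 / a\<^sup>2"
  by (rule fisher_weight_bounds(4)[OF a_pos]) (use ranges r in auto)

lemma wz_bound: "i \<in> {1..n} \<Longrightarrow> j \<in> {1..n} \<Longrightarrow> \<bar>wz i j\<bar> \<le> 1 / a\<^sup>2"
  by (rule fisher_weight_bounds(4)[OF a_pos]) (use ranges r in auto)

lemma w'_bound: "i \<in> {1..n} \<Longrightarrow> j \<in> {1..n} \<Longrightarrow> \<bar>w' i j\<bar> \<le> 2 / a\<^sup>2"
  by (rule fisher_weight_deriv_bound[OF a_pos]) (use ranges r in auto)

lemma a_pow: "1 / a\<^sup>2 \<le> 1 / a^4" "1 / a^3 \<le> 1 / a^4" "1 \<le> 1 / a^4"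
proof -
  show "1 / a\<^sup>2 \<le> 1 / a^4" "1 / a^3 \<le> 1 / a^4"
    using a_pos a1 by (auto intro!: divide_left_mono power_decreasing)
  show "1 \<le> 1 / a^4" using a_pos a1 by (simp add: power_le_one)
qed

lemma w_diff:
  assumes "i \<in> {1..n}" "j \<in> {1..n}"
  shows "\<bar>wz i j - w i j\<bar> \<le> 6 * m i j / a^4"
proof -
  have "\<bar>wz i j - w i j\<bar> \<le> (3 * \<bar>\<sigma>z i j - \<sigma> i j\<bar> + \<bar>r - r\<bar>) / a^4"
    by (rule fisher_weight_diff_le[OF a_pos]) (use ranges[OF assms] r in auto)
  also have "\<dots> \<le> (6 * m i j) / a^4"
    using \<sigma>z_diff(2)[OF assms] a_pos by (intro divide_right_mono) auto
  finally show ?thesis .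
qed

lemma m_sq: "(m i j)\<^sup>2 \<le> 2 * ((norm (\<epsilon> i))\<^sup>2 + (norm (\<epsilon> j))\<^sup>2)"
  using sum_squares_bound[of "norm (\<epsilon> i)" "norm (\<epsilon> j)"] by (simp add: power2_sum)

text \<open>The derivative at \<open>x j\<close>, in direction \<open>v\<close>, of the map sending
  u to \<open>fisher_weight r (x i \<bullet> u) *\<^sub>R u\<close>: the first-order effect of the
  error at the other vertex.\<close>

definition V :: "nat \<Rightarrow> nat \<Rightarrow> real^'d \<Rightarrow> real^'d" where
  "V i j v = w i j *\<^sub>R v + (w' i j * (x i \<bullet> v)) *\<^sub>R x j"

lemma V_add: "V i j (u + v) = V i j u + V i j v"
  by (simp add: V_def inner_simps algebra_simps)

lemma V_bound:
  assumes "i \<in> {1..n}" "j \<in> {1..n}"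
  shows "norm (V i j v) \<le> 3 / a\<^sup>2 * norm v"
proof -
  have "norm (V i j v) \<le> \<bar>w i j\<bar> * norm v + \<bar>w' i j\<bar> * \<bar>x i \<bullet> v\<bar> * norm (x j)"
    unfolding V_def by (rule order.trans[OF norm_triangle_ineq]) (simp add: abs_mult)
  also have "\<dots> \<le> 1 / a\<^sup>2 * norm v + (2 / a\<^sup>2) * norm v * 1"
    by (intro add_mono mult_mono w_bound w'_bound inner_x_le assms x1) auto
  finally show ?thesis by (simp add: algebra_simps)
qed

text \<open>The second-order remainder of \<open>wz i j *\<^sub>R z j\<close> as a function of both
  errors \<open>\<epsilon> i\<close> and \<open>\<epsilon> j\<close>.\<close>

definition Q :: "nat \<Rightarrow> nat \<Rightarrow> real^'d" where
  "Q i j = wz i j *\<^sub>R z j - w i j *\<^sub>R x j - V i j (\<epsilon> j) - (w' i j * (\<epsilon> i \<bullet> x j)) *\<^sub>R x j"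

lemma Q_bound:
  assumes "i \<in> {1..n}" "j \<in> {1..n}"
  shows "norm (Q i j) \<le> 32 / a^4 * ((norm (\<epsilon> i))\<^sup>2 + (norm (\<epsilon> j))\<^sup>2)"
proof -
  let ?d = "\<sigma>z i j - \<sigma> i j"
  \<comment> \<open>Three quadratic pieces: the weight increment times the error, the Taylor
    remainder of the weight, and the product of the two errors that the linear terms omit. Their
    constants 6 + 8 + 2 and the factor 2 of \<open>m_sq\<close> make 32.\<close>
  have eq: "Q i j = (wz i j - w i j) *\<^sub>R \<epsilon> j + (wz i j - w i j - w' i j * ?d) *\<^sub>R x j + (w' i j * (\<epsilon> i \<bullet> \<epsilon> j)) *\<^sub>R x j"
    unfolding Q_def V_def \<sigma>z_diff_eq by (simp add: z_def algebra_simps)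
  have "norm (Q i j) \<le> \<bar>wz i j - w i j\<bar> * norm (\<epsilon> j) + \<bar>wz i j - w i j - w' i j * ?d\<bar> * norm (x j)
      + \<bar>w' i j\<bar> * \<bar>\<epsilon> i \<bullet> \<epsilon> j\<bar> * norm (x j)"
    unfolding eq by (rule order.trans[OF norm_triangle_ineq], rule add_mono, rule order.trans[OF norm_triangle_ineq])
      (simp_all only: norm_scaleR abs_mult order.refl mult.assoc)
  moreover have "\<bar>wz i j - w i j\<bar> * norm (\<epsilon> j) \<le> (6 * m i j / a^4) * m i j"
    by (rule mult_mono[OF w_diff[OF assms]]) (simp_all add: a_pos less_imp_le)
  moreover have "\<bar>wz i j - w i j - w' i j * ?d\<bar> * norm (x j) \<le> (2 * ?d\<^sup>2 / a^3) * 1"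
    by (rule mult_mono[OF fisher_weight_taylor[OF a_pos ranges[OF assms] less_imp_le[OF r(1)] r(2)] x1[OF assms(2)]])
      (simp_all add: a_pos less_imp_le)
  moreover have "\<bar>w' i j\<bar> * \<bar>\<epsilon> i \<bullet> \<epsilon> j\<bar> * norm (x j) \<le> (2 / a\<^sup>2) * (m i j)\<^sup>2 * 1"
    by (rule mult_mono[OF mult_mono[OF w'_bound[OF assms] inner_eps_le(3)[OF assms]] x1[OF assms(2)]]) simp_all
  moreover have "(2 * ?d\<^sup>2 / a^3) * 1 \<le> 8 * (m i j)\<^sup>2 * (1 / a^4)"
  proof -
    have "\<bar>?d\<bar>\<^sup>2 \<le> (2 * m i j)\<^sup>2" by (rule power_mono[OF \<sigma>z_diff(2)[OF assms]]) simp
    then have "2 * ?d\<^sup>2 \<le> 8 * (m i j)\<^sup>2" unfolding power2_abs power_mult_distrib by simp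
    then have "2 * ?d\<^sup>2 * (1 / a^3) \<le> 8 * (m i j)\<^sup>2 * (1 / a^4)"
      by (rule mult_mono[OF _ a_pow(2)]) (simp_all add: a_pos less_imp_le)
    then show ?thesis by simp
  qed
  moreover have "(2 / a\<^sup>2) * (m i j)\<^sup>2 * 1 \<le> 2 * (m i j)\<^sup>2 * (1 / a^4)"
    using mult_left_mono[OF a_pow(1), of "2 * (m i j)\<^sup>2"] by simp
  ultimately have "norm (Q i j) \<le> (6 * m i j / a^4) * m i j + 8 * (m i j)\<^sup>2 * (1 / a^4) + 2 * (m i j)\<^sup>2 * (1 / a^4)"
    by linarith
  also have "\<dots> = 16 / a^4 * (m i j)\<^sup>2"
  proof -
    have "(6 * t / b) * t + 8 * t\<^sup>2 * (1 / b) + 2 * t\<^sup>2 * (1 / b) = 16 / b * t\<^sup>2" for t b :: real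
      by (simp add: power2_eq_square add_divide_distrib[symmetric])
    then show ?thesis .
  qed
  also have "\<dots> \<le> 16 / a^4 * (2 * ((norm (\<epsilon> i))\<^sup>2 + (norm (\<epsilon> j))\<^sup>2))"
    using a_pos by (intro mult_left_mono m_sq) auto
  finally show ?thesis by simp
qed

lemma D_bound:
  assumes "i \<in> {1..n}" "j \<in> {1..n}"
  shows "norm (wz i j *\<^sub>R z j - w i j *\<^sub>R x j) \<le> 7 / a^4 * m i j"
proof -
  have "wz i j *\<^sub>R z j - w i j *\<^sub>R x j = (wz i j - w i j) *\<^sub>R x j + wz i j *\<^sub>R \<epsilon> j"
    by (simp add: z_def algebra_simps)
  also have "norm \<dots> \<le> \<bar>wz i j - w i j\<bar> * norm (x j) + \<bar>wz i j\<bar> * norm (\<epsilon> j)"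
    by (rule order.trans[OF norm_triangle_ineq]) simp
  also have "\<dots> \<le> (6 * m i j / a^4) * 1 + (1 / a^4) * m i j"
    using wz_bound[OF assms] a_pow(1)
    by (intro add_mono mult_mono w_diff assms x1) (auto intro!: add_nonneg_nonneg)
  also have "\<dots> = 7 / a^4 * m i j"
  proof -
    have "(6 * t / b) * 1 + (1 / b) * t = 7 / b * t" for t b :: real
      by (simp add: add_divide_distrib[symmetric])
    then show ?thesis .
  qed
  finally show ?thesis .
qed

definition info :: "nat \<Rightarrow> real^'d^'d" where
  "info i = (1 / real n) *\<^sub>R (\<Sum>j=1..n. wz i j *\<^sub>R outer (z j) (z j))"

text \<open>Noise minus the effect of the other errors. The error \<open>\<epsilon> i\<close> of the
  vertex itself enters through the weights only, and is thereby always multiplied by noise or by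
  another error.\<close>

definition rhs :: "nat \<Rightarrow> real^'d" where
  "rhs i = (1 / (real n * r)) *\<^sub>R (\<Sum>j=1..n. e i j *\<^sub>R (wz i j *\<^sub>R z j))
     - (1 / real n) *\<^sub>R (\<Sum>j=1..n. (x i \<bullet> \<epsilon> j) *\<^sub>R (wz i j *\<^sub>R z j))"

text \<open>The diagonal summand is omitted because the graph noise is not centred there; it moves
  to the remainder, with size at most 1 / (n r a^2).\<close>

definition lead :: "nat \<Rightarrow> real^'d" where
  "lead i = (1 / (real n * r)) *\<^sub>R (\<Sum>j\<in>{1..n}-{i}. e i j *\<^sub>R (w i j *\<^sub>R x j))"

definition path_part :: "(nat \<Rightarrow> real^'d) \<Rightarrow> nat \<Rightarrow> real^'d" where
  "path_part \<eta> i = (1 / (real n * r)) *\<^sub>R (\<Sum>j=1..n. e i j *\<^sub>R V i j (\<eta> j))"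

definition mean_part :: "(nat \<Rightarrow> real^'d) \<Rightarrow> nat \<Rightarrow> real^'d" where
  "mean_part \<eta> i = (1 / real n) *\<^sub>R (\<Sum>j=1..n. (x i \<bullet> \<eta> j) *\<^sub>R (w i j *\<^sub>R x j))"

text \<open>The coefficient of the k-th coordinate of \<open>\<epsilon> i\<close> in its effect on
  the weights. Pulling the coordinates out separates the error from the noise of its own row, on
  which it depends, so each can be bounded alone.\<close>

definition row_part :: "nat \<Rightarrow> 'd \<Rightarrow> real^'d" where
  "row_part i k = (1 / (real n * r)) *\<^sub>R (\<Sum>j=1..n. e i j *\<^sub>R ((w' i j * (x j $ k)) *\<^sub>R x j))"

lemma norm_avg_le:
  fixes f :: "nat \<Rightarrow> real^'d"
  assumes "\<And>j. j \<in> {1..n} \<Longrightarrow> norm (f j) \<le> g j" "0 \<le> c"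
  shows "norm (c *\<^sub>R (\<Sum>j=1..n. f j)) \<le> c * (\<Sum>j=1..n. g j)"
  using assms by (auto intro!: mult_left_mono order.trans[OF norm_sum sum_mono])

lemma e_scaleR_le: "norm v \<le> c \<Longrightarrow> norm (e i j *\<^sub>R v) \<le> c"
  using mult_mono[OF e1[of i j], of "norm v" c] by simp

text \<open>The parts are set up for \<open>\<eta>\<close> linear in the noise, whose path and mean
  sums are kept intact so that their moments can use cancellation, and for \<open>\<tau>\<close>, of
  which only norms will be known.\<close>

lemma rhs_decomposition:
  assumes "i \<in> {1..n}" and \<epsilon>: "\<And>j. j \<in> {1..n} \<Longrightarrow> \<epsilon> j = \<eta> j + \<tau> j"
  shows "rhs i - lead i =
      (1 / (real n * r)) *\<^sub>R (e i i *\<^sub>R (w i i *\<^sub>R x i)) + path_part \<eta> i + path_part \<tau> i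
    + (\<Sum>k\<in>UNIV. (\<epsilon> i $ k) *\<^sub>R row_part i k) + (1 / (real n * r)) *\<^sub>R (\<Sum>j=1..n. e i j *\<^sub>R Q i j)
    - mean_part \<eta> i - mean_part \<tau> i
    - (1 / real n) *\<^sub>R (\<Sum>j=1..n. (x i \<bullet> \<epsilon> j) *\<^sub>R (wz i j *\<^sub>R z j - w i j *\<^sub>R x j))"
proof -
  let ?c = "1 / (real n * r)"
  have wz_eq: "wz i j *\<^sub>R z j = w i j *\<^sub>R x j + V i j (\<eta> j) + V i j (\<tau> j) + (w' i j * (\<epsilon> i \<bullet> x j)) *\<^sub>R x j + Q i j"
    if "j \<in> {1..n}" for j
    using \<epsilon>[OF that] by (simp add: Q_def V_add)
  have A: "(\<Sum>j=1..n. e i j *\<^sub>R (wz i j *\<^sub>R z j)) = (\<Sum>j=1..n. e i j *\<^sub>R (w i j *\<^sub>R x j))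
     + (\<Sum>j=1..n. e i j *\<^sub>R V i j (\<eta> j)) + (\<Sum>j=1..n. e i j *\<^sub>R V i j (\<tau> j))
     + (\<Sum>j=1..n. e i j *\<^sub>R ((w' i j * (\<epsilon> i \<bullet> x j)) *\<^sub>R x j)) + (\<Sum>j=1..n. e i j *\<^sub>R Q i j)"
    unfolding sum.distrib[symmetric] by (rule sum.cong[OF refl]) (simp only: wz_eq scaleR_add_right)
  have B: "(\<Sum>j=1..n. e i j *\<^sub>R ((w' i j * (\<epsilon> i \<bullet> x j)) *\<^sub>R x j))
     = (\<Sum>k\<in>UNIV. (\<epsilon> i $ k) *\<^sub>R (\<Sum>j=1..n. e i j *\<^sub>R ((w' i j * (x j $ k)) *\<^sub>R x j)))"
    unfolding scaleR_sum_right
  proof (subst sum.swap, rule sum.cong[OF refl])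
    fix j
    have "\<epsilon> i \<bullet> x j = (\<Sum>k\<in>UNIV. \<epsilon> i $ k * x j $ k)" by (simp add: inner_vec_def)
    then show "e i j *\<^sub>R ((w' i j * (\<epsilon> i \<bullet> x j)) *\<^sub>R x j)
       = (\<Sum>k\<in>UNIV. (\<epsilon> i $ k) *\<^sub>R (e i j *\<^sub>R ((w' i j * (x j $ k)) *\<^sub>R x j)))"
      by (simp only: scaleR_scaleR sum_distrib_left scaleR_sum_left scaleR_sum_right mult_ac)
  qed
  have C: "(\<Sum>j=1..n. e i j *\<^sub>R (w i j *\<^sub>R x j)) = e i i *\<^sub>R (w i i *\<^sub>R x i) + (\<Sum>j\<in>{1..n}-{i}. e i j *\<^sub>R (w i j *\<^sub>R x j))"
    by (rule sum.remove) (use assms in auto)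
  have D: "(\<Sum>j=1..n. (x i \<bullet> \<epsilon> j) *\<^sub>R (wz i j *\<^sub>R z j)) = (\<Sum>j=1..n. (x i \<bullet> \<eta> j) *\<^sub>R (w i j *\<^sub>R x j))
     + (\<Sum>j=1..n. (x i \<bullet> \<tau> j) *\<^sub>R (w i j *\<^sub>R x j)) + (\<Sum>j=1..n. (x i \<bullet> \<epsilon> j) *\<^sub>R (wz i j *\<^sub>R z j - w i j *\<^sub>R x j))"
    unfolding sum.distrib[symmetric]
    by (rule sum.cong[OF refl]) (simp add: \<epsilon> inner_add_right scaleR_add_left scaleR_diff_right algebra_simps)
  have E: "(\<Sum>k\<in>UNIV. (\<epsilon> i $ k) *\<^sub>R row_part i k) = ?c *\<^sub>R (\<Sum>k\<in>UNIV. (\<epsilon> i $ k) *\<^sub>R (\<Sum>j=1..n. e i j *\<^sub>R ((w' i j * (x j $ k)) *\<^sub>R x j)))"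
    unfolding row_part_def scaleR_sum_right[of ?c "\<lambda>k. (\<epsilon> i $ k) *\<^sub>R _ k"] by (rule sum.cong[OF refl]) (rule scaleR_left_commute)
  show ?thesis
    unfolding rhs_def lead_def path_part_def mean_part_def E A B C D scaleR_add_right by simp
qed

text \<open>47 = 32 + 14 + 1 collects \<open>Q\<close>, the averaged errors with perturbed weights
  and the squared error of the row itself; 4 = 3 + 1 collects the path and mean parts of
  \<open>\<tau>\<close>. Terms without a factor 1 / r are enlarged by it.\<close>

lemma remainder_bound:
  assumes i: "i \<in> {1..n}" and \<epsilon>: "\<And>j. j \<in> {1..n} \<Longrightarrow> \<epsilon> j = \<eta> j + \<tau> j"
  shows "norm (rhs i - lead i) \<le> 1 / (real n * r * a\<^sup>2) + norm (path_part \<eta> i) + norm (mean_part \<eta> i)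
    + r * (\<Sum>k\<in>UNIV. norm (row_part i k))\<^sup>2
    + 47 / (a^4 * r) * ((norm (\<epsilon> i))\<^sup>2 + (1 / real n) * (\<Sum>j=1..n. (norm (\<epsilon> j))\<^sup>2))
    + 4 / (a\<^sup>2 * r) * ((1 / real n) * (\<Sum>j=1..n. norm (\<tau> j)))"
proof -
  let ?c = "1 / (real n * r)"
  let ?M = "\<Sum>k\<in>UNIV. norm (row_part i k)"
  let ?S = "(norm (\<epsilon> i))\<^sup>2 + (1 / real n) * (\<Sum>j=1..n. (norm (\<epsilon> j))\<^sup>2)"
  let ?T = "(1 / real n) * (\<Sum>j=1..n. norm (\<tau> j))"
  have c0: "?c \<ge> 0" using r by simp
  have S0: "?S \<ge> 0" by (auto intro!: add_nonneg_nonneg sum_nonneg divide_nonneg_nonneg)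
  have T0: "?T \<ge> 0" by (auto intro!: sum_nonneg divide_nonneg_nonneg)
  have ir: "1 / r \<ge> 1" using r by simp
  have avg_S: "(1 / real n) * (\<Sum>j=1..n. (norm (\<epsilon> i))\<^sup>2 + (norm (\<epsilon> j))\<^sup>2) = ?S"
    using n1 by (simp add: sum.distrib field_simps)
  have 1: "norm (?c *\<^sub>R (e i i *\<^sub>R (w i i *\<^sub>R x i))) \<le> 1 / (real n * r * a\<^sup>2)"
  proof -
    have "norm (w i i *\<^sub>R x i) \<le> 1 / a\<^sup>2 * 1"
      unfolding norm_scaleR by (intro mult_mono w_bound x1 i) auto
    then have "norm (e i i *\<^sub>R (w i i *\<^sub>R x i)) \<le> 1 / a\<^sup>2" by (intro e_scaleR_le) simp
    then have "?c * norm (e i i *\<^sub>R (w i i *\<^sub>R x i)) \<le> ?c * (1 / a\<^sup>2)" using c0 by (rule mult_left_mono)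
    then show ?thesis using c0 by (simp add: mult.assoc)
  qed
  have 2: "norm (path_part \<tau> i) \<le> 3 / (a\<^sup>2 * r) * ?T"
  proof -
    have "norm (path_part \<tau> i) \<le> ?c * (\<Sum>j=1..n. 3 / a\<^sup>2 * norm (\<tau> j))"
      unfolding path_part_def using c0 by (intro norm_avg_le e_scaleR_le V_bound i)
    also have "\<dots> = 3 / (a\<^sup>2 * r) * ?T"
      unfolding sum_distrib_left[symmetric] by simp
    finally show ?thesis .
  qed
  have 3: "norm (\<Sum>k\<in>UNIV. (\<epsilon> i $ k) *\<^sub>R row_part i k) \<le> 1 / r * (norm (\<epsilon> i))\<^sup>2 + r * ?M\<^sup>2"
  proof -
    have "norm (\<Sum>k\<in>UNIV. (\<epsilon> i $ k) *\<^sub>R row_part i k) \<le> (\<Sum>k\<in>UNIV. norm (\<epsilon> i) * norm (row_part i k))"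
      by (rule order.trans[OF norm_sum sum_mono]) (simp add: mult_right_mono component_le_norm_cart)
    also have "\<dots> = norm (\<epsilon> i) * ?M" by (simp add: sum_distrib_left)
    also have "\<dots> \<le> 1 / r * (norm (\<epsilon> i))\<^sup>2 + r * ?M\<^sup>2"
    proof -
      \<comment> \<open>Weighted arithmetic-geometric inequality: 1 / r goes to the squared error,
        as in the other quadratic terms, and \<open>r\<close> to the row noise.\<close>
      have "0 \<le> (norm (\<epsilon> i) - r * ?M)\<^sup>2" by simp
      then have "2 * (norm (\<epsilon> i) * (r * ?M)) \<le> (norm (\<epsilon> i))\<^sup>2 + (r * ?M)\<^sup>2"
        by (simp add: power2_diff)
      then have "norm (\<epsilon> i) * (r * ?M) \<le> (norm (\<epsilon> i))\<^sup>2 + (r * ?M)\<^sup>2"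
      proof -
        have "0 \<le> norm (\<epsilon> i) * (r * ?M)"
          using r by (intro mult_nonneg_nonneg) (auto intro: sum_nonneg)
        then show ?thesis using \<open>2 * _ \<le> _\<close> by linarith
      qed
      then show ?thesis using r by (simp add: field_simps power2_eq_square)
    qed
    finally show ?thesis .
  qed
  have 4: "norm (?c *\<^sub>R (\<Sum>j=1..n. e i j *\<^sub>R Q i j)) \<le> 32 / (a^4 * r) * ?S"
  proof -
    have "norm (?c *\<^sub>R (\<Sum>j=1..n. e i j *\<^sub>R Q i j)) \<le> ?c * (\<Sum>j=1..n. 32 / a^4 * ((norm (\<epsilon> i))\<^sup>2 + (norm (\<epsilon> j))\<^sup>2))"
      using c0 by (intro norm_avg_le e_scaleR_le Q_bound i)
    also have "\<dots> = 32 / (a^4 * r) * ((1 / real n) * (\<Sum>j=1..n. (norm (\<epsilon> i))\<^sup>2 + (norm (\<epsilon> j))\<^sup>2))"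
      unfolding sum_distrib_left[symmetric] by simp
    finally show ?thesis unfolding avg_S .
  qed
  have 5: "norm (mean_part \<tau> i) \<le> 1 / (a\<^sup>2 * r) * ?T"
  proof -
    have "norm (mean_part \<tau> i) \<le> (1 / real n) * (\<Sum>j=1..n. 1 / a\<^sup>2 * norm (\<tau> j))"
      unfolding mean_part_def
    proof (rule norm_avg_le)
      fix j assume j: "j \<in> {1..n}"
      have "\<bar>x i \<bullet> \<tau> j\<bar> * (\<bar>w i j\<bar> * norm (x j)) \<le> norm (\<tau> j) * (1 / a\<^sup>2 * 1)"
        by (intro mult_mono inner_x_le w_bound x1 i j) auto
      then show "norm ((x i \<bullet> \<tau> j) *\<^sub>R w i j *\<^sub>R x j) \<le> 1 / a\<^sup>2 * norm (\<tau> j)"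
        by (simp add: abs_mult mult.assoc)
    qed simp
    also have "\<dots> = 1 / a\<^sup>2 * ?T" unfolding sum_distrib_left[symmetric] by simp
    also have "\<dots> \<le> (1 / a\<^sup>2 * (1 / r)) * ?T"
      using ir T0 mult_left_mono[OF ir, of "1 / a\<^sup>2"] by (intro mult_right_mono) auto
    finally show ?thesis by simp
  qed
  have 6: "norm ((1 / real n) *\<^sub>R (\<Sum>j=1..n. (x i \<bullet> \<epsilon> j) *\<^sub>R (wz i j *\<^sub>R z j - w i j *\<^sub>R x j))) \<le> 14 / (a^4 * r) * ?S"
  proof -
    have "norm ((1 / real n) *\<^sub>R (\<Sum>j=1..n. (x i \<bullet> \<epsilon> j) *\<^sub>R (wz i j *\<^sub>R z j - w i j *\<^sub>R x j)))
      \<le> (1 / real n) * (\<Sum>j=1..n. 14 / a^4 * ((norm (\<epsilon> i))\<^sup>2 + (norm (\<epsilon> j))\<^sup>2))"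
    proof (rule norm_avg_le)
      fix j assume j: "j \<in> {1..n}"
      have "\<bar>x i \<bullet> \<epsilon> j\<bar> \<le> m i j" using inner_x_le(1)[OF i, of "\<epsilon> j"] norm_ge_zero[of "\<epsilon> i"] by linarith
      then have "\<bar>x i \<bullet> \<epsilon> j\<bar> * norm (wz i j *\<^sub>R z j - w i j *\<^sub>R x j) \<le> m i j * (7 / a^4 * m i j)"
        by (intro mult_mono D_bound i j) auto
      also have "\<dots> = 7 / a^4 * (m i j)\<^sup>2" by (simp add: power2_eq_square)
      also have "\<dots> \<le> 7 / a^4 * (2 * ((norm (\<epsilon> i))\<^sup>2 + (norm (\<epsilon> j))\<^sup>2))"
        using a_pos by (intro mult_left_mono m_sq) auto
      finally show "norm ((x i \<bullet> \<epsilon> j) *\<^sub>R (wz i j *\<^sub>R z j - w i j *\<^sub>R x j)) \<le> 14 / a^4 * ((norm (\<epsilon> i))\<^sup>2 + (norm (\<epsilon> j))\<^sup>2)"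
        by simp
    qed simp
    also have "\<dots> = 14 / a^4 * ?S" unfolding sum_distrib_left[symmetric] avg_S[symmetric] by simp
    also have "\<dots> \<le> (14 / a^4 * (1 / r)) * ?S"
      using ir S0 mult_left_mono[OF ir, of "14 / a^4"] a_pos by (intro mult_right_mono) auto
    finally show ?thesis by simp
  qed
  have 7: "1 / r * (norm (\<epsilon> i))\<^sup>2 \<le> 1 / (a^4 * r) * ?S"
  proof -
    have "1 / r * (norm (\<epsilon> i))\<^sup>2 \<le> (1 / r * (1 / a^4)) * ?S"
      using r a_pow(3) mult_left_mono[OF a_pow(3), of "1 / r"]
      by (intro mult_mono) (auto intro!: add_increasing2 sum_nonneg divide_nonneg_nonneg)
    then show ?thesis by (simp add: mult.commute)
  qed
  have tri: "norm (A1 + A2 + A3 + A4 + A5 - A6 - A7 - A8) \<le> norm A1 + norm A2 + norm A3 + norm A4 + norm A5 + norm A6 + norm A7 + norm A8"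
    for A1 A2 A3 A4 A5 A6 A7 A8 :: "real^'d"
    by (intro order.trans[OF norm_triangle_ineq4] order.trans[OF norm_triangle_ineq] add_mono order.refl)
  have "47 / (a^4 * r) * ?S = 32 / (a^4 * r) * ?S + 14 / (a^4 * r) * ?S + 1 / (a^4 * r) * ?S"
    by (simp add: add_divide_distrib[symmetric] distrib_right[symmetric])
  moreover have "4 / (a\<^sup>2 * r) * ?T = 3 / (a\<^sup>2 * r) * ?T + 1 / (a\<^sup>2 * r) * ?T"
    by (simp add: add_divide_distrib[symmetric] distrib_right[symmetric])
  moreover have "norm (rhs i - lead i) \<le> norm (?c *\<^sub>R (e i i *\<^sub>R (w i i *\<^sub>R x i))) + norm (path_part \<eta> i) + norm (path_part \<tau> i)
    + norm (\<Sum>k\<in>UNIV. (\<epsilon> i $ k) *\<^sub>R row_part i k) + norm (?c *\<^sub>R (\<Sum>j=1..n. e i j *\<^sub>R Q i j))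
    + norm (mean_part \<eta> i) + norm (mean_part \<tau> i)
    + norm ((1 / real n) *\<^sub>R (\<Sum>j=1..n. (x i \<bullet> \<epsilon> j) *\<^sub>R (wz i j *\<^sub>R z j - w i j *\<^sub>R x j)))"
    by (subst rhs_decomposition[where \<eta> = \<eta> and \<tau> = \<tau>], rule i, erule \<epsilon>, rule tri)
  moreover have "N \<le> b1 + Pp + Mm + R + S47 + T4"
    if "S47 = b4 + b6 + b7" "T4 = b2 + b5" "N \<le> n1 + Pp + n2 + n3 + n4 + Mm + n5 + n6"
      "n1 \<le> b1" "n2 \<le> b2" "n3 \<le> b3 + R" "n4 \<le> b4" "n5 \<le> b5" "n6 \<le> b6" "b3 \<le> b7"
    for N b1 b2 b3 b4 b5 b6 b7 n1 n2 n3 n4 n5 n6 Pp Mm R S47 T4 :: real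
    using that by linarith
  ultimately show ?thesis using 1 2 3 4 5 6 7 by blast
qed

text \<open>Every row enters the matrix, hence a common bound \<open>q\<close>. Per summand the
  weight changes by at most 12 q / a^4 against an outer product of norm at most 4, and the outer
  product changes by at most 4 q.\<close>

lemma info_perturbation:
  assumes i: "i \<in> {1..n}" and q: "\<And>j. j \<in> {1..n} \<Longrightarrow> norm (\<epsilon> j) \<le> q"
  shows "norm (info i - (1 / real n) *\<^sub>R (\<Sum>j=1..n. w i j *\<^sub>R outer (x j) (x j))) \<le> 56 / a^4 * q"
proof -
  have q0: "q \<ge> 0" using q[OF i] norm_ge_zero order.trans by blast
  have eq: "info i - (1 / real n) *\<^sub>R (\<Sum>j=1..n. w i j *\<^sub>R outer (x j) (x j)) =
     (1 / real n) *\<^sub>R (\<Sum>j=1..n. wz i j *\<^sub>R outer (z j) (z j) - w i j *\<^sub>R outer (x j) (x j))"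
    by (simp add: info_def scaleR_diff_right sum_subtractf)
  have "norm (wz i j *\<^sub>R outer (z j) (z j) - w i j *\<^sub>R outer (x j) (x j)) \<le> 56 / a^4 * q" if j: "j \<in> {1..n}" for j
  proof -
    have zx: "z j - x j = \<epsilon> j" by (simp add: z_def)
    have "norm (z j) \<le> norm (x j) + norm (\<epsilon> j)" unfolding z_def by (rule norm_triangle_ineq)
    then have z2: "norm (z j) \<le> 2" using x1[OF j] small[OF j] \<delta>1 by linarith
    have zz: "norm (outer (z j) (z j)) \<le> 4"
      using mult_mono[OF z2 z2] by (simp add: norm_outer)
    have d: "norm (outer (z j) (z j) - outer (x j) (x j)) \<le> 2 * 2 * norm (\<epsilon> j)"
      using norm_outer_diff_le[OF z2, of "x j"] x1[OF j] by (simp add: zx)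
    have eq: "wz i j *\<^sub>R outer (z j) (z j) - w i j *\<^sub>R outer (x j) (x j) =
      (wz i j - w i j) *\<^sub>R outer (z j) (z j) + w i j *\<^sub>R (outer (z j) (z j) - outer (x j) (x j))"
      by (simp add: algebra_simps)
    have "norm (wz i j *\<^sub>R outer (z j) (z j) - w i j *\<^sub>R outer (x j) (x j))
      \<le> \<bar>wz i j - w i j\<bar> * norm (outer (z j) (z j)) + \<bar>w i j\<bar> * norm (outer (z j) (z j) - outer (x j) (x j))"
      unfolding eq by (rule order.trans[OF norm_triangle_ineq]) (simp only: norm_scaleR order.refl)
    moreover have "\<bar>wz i j - w i j\<bar> * norm (outer (z j) (z j)) \<le> (12 * q / a^4) * 4"
    proof (rule mult_mono[OF _ zz])
      have "6 * m i j / a^4 \<le> 12 * q / a^4"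
        using q[OF i] q[OF j] a_pos by (intro divide_right_mono) auto
      then show "\<bar>wz i j - w i j\<bar> \<le> 12 * q / a^4" using w_diff[OF i j] by linarith
    qed (use q0 a_pos in simp_all)
    moreover have "\<bar>w i j\<bar> * norm (outer (z j) (z j) - outer (x j) (x j)) \<le> (1 / a^4) * (4 * q)"
      by (rule mult_mono[OF order.trans[OF w_bound[OF i j] a_pow(1)]]) (use d q[OF j] a_pos in simp_all)
    ultimately have "norm (wz i j *\<^sub>R outer (z j) (z j) - w i j *\<^sub>R outer (x j) (x j)) \<le> (12 * q / a^4) * 4 + (1 / a^4) * (4 * q)"
      by linarith
    also have "\<dots> \<le> 56 / a^4 * q" using q0 a_pos by (simp add: field_simps)
    finally show ?thesis .
  qed
  then have "norm ((1 / real n) *\<^sub>R (\<Sum>j=1..n. wz i j *\<^sub>R outer (z j) (z j) - w i j *\<^sub>R outer (x j) (x j)))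
      \<le> (1 / real n) * (\<Sum>j=1..n. 56 / a^4 * q)"
    by (simp del: sum_constant, intro divide_right_mono order.trans[OF norm_sum sum_mono]) auto
  then show ?thesis unfolding eq using n1 by simp
qed

lemma one_step_denominator:
  assumes i: "i \<in> {1..n}" and y: "\<And>j. j \<in> {1..n} \<Longrightarrow> y j = sqrt r *\<^sub>R z j" and j: "j \<in> {1..n}"
  shows "y i \<bullet> y j = r * \<sigma>z i j" "\<sigma>z i j * (1 - r * \<sigma>z i j) > 0" "(y i \<bullet> y j) * (1 - y i \<bullet> y j) \<noteq> 0"
proof -
  show yy: "y i \<bullet> y j = r * \<sigma>z i j" using y[OF i] y[OF j] r by simp
  have "a\<^sup>2 \<le> \<sigma>z i j * (1 - r * \<sigma>z i j)"
    by (rule fisher_denom_ge(1)[OF a_pos]) (use ranges[OF i j] r in auto)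
  then show nz: "\<sigma>z i j * (1 - r * \<sigma>z i j) > 0" using a_pos by (meson less_le_trans zero_less_power)
  then show "(y i \<bullet> y j) * (1 - y i \<bullet> y j) \<noteq> 0" unfolding yy using r by auto
qed

lemma one_step_information_eq:
  assumes i: "i \<in> {1..n}" and y: "\<And>j. j \<in> {1..n} \<Longrightarrow> y j = sqrt r *\<^sub>R z j"
  shows "one_step_information n y i = info i"
proof -
  have outer_scale: "outer (c *\<^sub>R u) (c *\<^sub>R u) = (c * c) *\<^sub>R outer u u" for c :: real and u :: "real^'d"
    by (simp add: outer_def vec_eq_iff)
  show ?thesis
    unfolding one_step_information_def info_def
  proof (rule arg_cong[where f = "(*\<^sub>R) (1 / real n)"], rule sum.cong[OF refl])
    fix j assume j: "j \<in> {1..n}"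
    have yy: "y i \<bullet> y j = r * \<sigma>z i j" by (rule one_step_denominator(1)) (use i y j in auto)
    have nz: "\<sigma>z i j * (1 - r * \<sigma>z i j) > 0" by (rule one_step_denominator(2)) (use i y j in auto)
    show "(1 / ((y i \<bullet> y j) * (1 - y i \<bullet> y j))) *\<^sub>R outer (y j) (y j) = wz i j *\<^sub>R outer (z j) (z j)"
      unfolding yy unfolding y[OF j] outer_scale using r nz by (simp add: fisher_weight_def)
  qed
qed

text \<open>Solving the linear system of the one-step update, the error \<open>\<epsilon> i\<close> of the initial
  estimator cancels to first order.\<close>

lemma one_step_linear_system:
  assumes i: "i \<in> {1..n}" and y: "\<And>j. j \<in> {1..n} \<Longrightarrow> y j = sqrt r *\<^sub>R z j"
    and A: "\<And>j. j \<in> {1..n} \<Longrightarrow> A i j = e i j + r * (x i \<bullet> x j)"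
    and p: "one_step_information n y i *v p = one_step_score n A y i"
  shows "info i *v (y i + p - sqrt r *\<^sub>R x i) = sqrt r *\<^sub>R rhs i"
proof -
  have yy: "y i \<bullet> y j = r * \<sigma>z i j" if "j \<in> {1..n}" for j
    using y[OF i] y[OF that] r by simp
  have inf: "one_step_information n y i = info i" by (rule one_step_information_eq) (use i y in auto)
  have score: "one_step_score n A y i = (1 / real n) *\<^sub>R (\<Sum>j=1..n. sqrt r *\<^sub>R (((1 / r) * (e i j - r * (\<epsilon> i \<bullet> z j + x i \<bullet> \<epsilon> j))) *\<^sub>R (wz i j *\<^sub>R z j)))"
    unfolding one_step_score_def
  proof (rule arg_cong[where f = "(*\<^sub>R) (1 / real n)"], rule sum.cong[OF refl])
    fix j assume j: "j \<in> {1..n}"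
    \<comment> \<open>The error of row i is split off with the full \<open>z j\<close>, not with
      \<open>x j\<close>. It then matches the action of \<open>info i\<close> on that error exactly,
      so the cancellation involves no linearization.\<close>
    have "\<sigma>z i j = \<sigma> i j + (\<epsilon> i \<bullet> z j + x i \<bullet> \<epsilon> j)" by (simp add: z_def inner_simps)
    then have "A i j - y i \<bullet> y j = e i j - r * (\<epsilon> i \<bullet> z j + x i \<bullet> \<epsilon> j)"
      unfolding yy[OF j] A[OF j] by (simp add: algebra_simps)
    then show "((A i j - y i \<bullet> y j) / ((y i \<bullet> y j) * (1 - y i \<bullet> y j))) *\<^sub>R y j
       = sqrt r *\<^sub>R (((1 / r) * (e i j - r * (\<epsilon> i \<bullet> z j + x i \<bullet> \<epsilon> j))) *\<^sub>R (wz i j *\<^sub>R z j))"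
      unfolding yy[OF j] unfolding y[OF j] by (simp add: fisher_weight_def mult_ac)
  qed
  have info_mult: "info i *v v = (1 / real n) *\<^sub>R (\<Sum>j=1..n. (z j \<bullet> v) *\<^sub>R (wz i j *\<^sub>R z j))" for v
    unfolding info_def
    by (simp add: linear_scale[OF linear_matrix_vector_left] linear_sum[OF linear_matrix_vector_left] outer_mult_vec mult.commute)
  have "info i *v (y i + p - sqrt r *\<^sub>R x i) = info i *v (sqrt r *\<^sub>R \<epsilon> i) + info i *v p"
    unfolding y[OF i] z_def by (simp add: matrix_vector_right_distrib algebra_simps)
  also have "info i *v p = one_step_score n A y i" using p unfolding inf .
  also have "info i *v (sqrt r *\<^sub>R \<epsilon> i) + one_step_score n A y i =
     (1 / real n) *\<^sub>R (\<Sum>j=1..n. sqrt r *\<^sub>R (((1 / r) * e i j - (x i \<bullet> \<epsilon> j)) *\<^sub>R (wz i j *\<^sub>R z j)))"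
    unfolding score info_mult scaleR_add_right[symmetric] sum.distrib[symmetric]
  proof (rule arg_cong[where f = "(*\<^sub>R) (1 / real n)"], rule sum.cong[OF refl])
    fix j
    let ?u = "wz i j *\<^sub>R z j"
    have "(z j \<bullet> (sqrt r *\<^sub>R \<epsilon> i)) + sqrt r * ((1 / r) * (e i j - r * (\<epsilon> i \<bullet> z j + x i \<bullet> \<epsilon> j)))
       = sqrt r * ((1 / r) * e i j - (x i \<bullet> \<epsilon> j))"
      using r by (simp add: inner_commute[of "z j"] field_simps)
    then show "(z j \<bullet> (sqrt r *\<^sub>R \<epsilon> i)) *\<^sub>R ?u + sqrt r *\<^sub>R (((1 / r) * (e i j - r * (\<epsilon> i \<bullet> z j + x i \<bullet> \<epsilon> j))) *\<^sub>R ?u)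
       = sqrt r *\<^sub>R (((1 / r) * e i j - (x i \<bullet> \<epsilon> j)) *\<^sub>R ?u)"
      by (simp only: scaleR_scaleR[of "sqrt r"] scaleR_add_left[symmetric])
  qed
  also have "\<dots> = sqrt r *\<^sub>R rhs i"
  proof -
    have eq: "(\<Sum>j=1..n. sqrt r *\<^sub>R (((1 / r) * e i j - (x i \<bullet> \<epsilon> j)) *\<^sub>R (wz i j *\<^sub>R z j)))
      = sqrt r *\<^sub>R ((1 / r) *\<^sub>R (\<Sum>j=1..n. e i j *\<^sub>R (wz i j *\<^sub>R z j)) - (\<Sum>j=1..n. (x i \<bullet> \<epsilon> j) *\<^sub>R (wz i j *\<^sub>R z j)))"
      unfolding scaleR_sum_right sum_subtractf[symmetric]
      by (rule sum.cong[OF refl]) (simp add: algebra_simps)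
    have "(1 / real n) *\<^sub>R (sqrt r *\<^sub>R ((1 / r) *\<^sub>R S1 - S2)) = sqrt r *\<^sub>R ((1 / (real n * r)) *\<^sub>R S1 - (1 / real n) *\<^sub>R S2)"
      for S1 S2 :: "real^'d"
      by (simp add: scaleR_diff_right mult.commute)
    then show ?thesis unfolding rhs_def eq .
  qed
  finally show "info i *v (y i + p - sqrt r *\<^sub>R x i) = sqrt r *\<^sub>R rhs i" .
qed

end

section \<open>Stochastic orders\<close>

definition small_in_prob :: "(nat \<Rightarrow> 'a pmf) \<Rightarrow> (nat \<Rightarrow> 'a \<Rightarrow> real) \<Rightarrow> bool" where
  "small_in_prob M Y \<longleftrightarrow> (\<forall>\<epsilon>>0. (\<lambda>n. measure (M n) {a. \<bar>Y n a\<bar> > \<epsilon>}) \<longlonglongrightarrow> 0)"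

definition tight_in_prob :: "(nat \<Rightarrow> 'a pmf) \<Rightarrow> (nat \<Rightarrow> 'a \<Rightarrow> real) \<Rightarrow> bool" where
  "tight_in_prob M Y \<longleftrightarrow> (\<forall>\<epsilon>>0. \<exists>B. \<forall>\<^sub>F n in sequentially. measure (M n) {a. \<bar>Y n a\<bar> > B} < \<epsilon>)"

lemma small_in_prob_iff:
  "small_in_prob M Y \<longleftrightarrow> (\<forall>\<epsilon>>0. \<forall>\<eta>>0. \<forall>\<^sub>F n in sequentially. measure (M n) {a. \<bar>Y n a\<bar> > \<epsilon>} < \<eta>)"
  unfolding small_in_prob_def by (simp add: tendsto_iff dist_real_def)

lemma small_in_probD:
  "small_in_prob M Y \<Longrightarrow> \<epsilon> > 0 \<Longrightarrow> \<eta> > 0 \<Longrightarrow> \<forall>\<^sub>F n in sequentially. measure (M n) {a. \<bar>Y n a\<bar> > \<epsilon>} < \<eta>"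
  by (simp add: small_in_prob_iff)

text \<open>Off two unlikely events the bound on \<open>Y\<close> is deterministic. Most closure
  rules are instances, with \<open>X1 = X2\<close> when there is one premise.\<close>

lemma small_in_prob_union:
  assumes X: "\<And>\<epsilon>. \<epsilon> > 0 \<Longrightarrow> \<exists>\<epsilon>1>0. \<exists>\<epsilon>2>0. \<forall>\<^sub>F n in sequentially. \<forall>a. \<bar>X1 n a\<bar> \<le> \<epsilon>1 \<longrightarrow> \<bar>X2 n a\<bar> \<le> \<epsilon>2 \<longrightarrow> \<bar>Y n a\<bar> \<le> \<epsilon>"
    and s: "small_in_prob M X1" "small_in_prob M X2"
  shows "small_in_prob M Y"
  unfolding small_in_prob_iff
proof (intro allI impI)
  fix \<epsilon> \<eta> :: real assume "\<epsilon> > 0" "\<eta> > 0"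
  obtain \<epsilon>1 \<epsilon>2 where e: "\<epsilon>1 > 0" "\<epsilon>2 > 0"
    and ev: "\<forall>\<^sub>F n in sequentially. \<forall>a. \<bar>X1 n a\<bar> \<le> \<epsilon>1 \<longrightarrow> \<bar>X2 n a\<bar> \<le> \<epsilon>2 \<longrightarrow> \<bar>Y n a\<bar> \<le> \<epsilon>"
    using X[OF \<open>\<epsilon> > 0\<close>] by blast
  have h: "\<eta> / 2 > 0" using \<open>\<eta> > 0\<close> by simp
  show "\<forall>\<^sub>F n in sequentially. measure (M n) {a. \<bar>Y n a\<bar> > \<epsilon>} < \<eta>"
    using ev small_in_probD[OF s(1) e(1) h] small_in_probD[OF s(2) e(2) h]
  proof eventually_elim
    case (elim n)
    have "{a. \<bar>Y n a\<bar> > \<epsilon>} \<subseteq> {a. \<bar>X1 n a\<bar> > \<epsilon>1} \<union> {a. \<bar>X2 n a\<bar> > \<epsilon>2}"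
      using elim(1) by (auto simp: not_le[symmetric])
    then have "measure (M n) {a. \<bar>Y n a\<bar> > \<epsilon>} \<le> measure (M n) ({a. \<bar>X1 n a\<bar> > \<epsilon>1} \<union> {a. \<bar>X2 n a\<bar> > \<epsilon>2})"
      by (intro measure_pmf.finite_measure_mono) auto
    also have "\<dots> \<le> measure (M n) {a. \<bar>X1 n a\<bar> > \<epsilon>1} + measure (M n) {a. \<bar>X2 n a\<bar> > \<epsilon>2}"
      by (rule measure_Un_le) auto
    finally show ?case using elim by linarith
  qed
qed

lemma small_in_prob_mono:
  assumes "small_in_prob M X" "\<forall>\<^sub>F n in sequentially. \<forall>a. \<bar>Y n a\<bar> \<le> \<bar>X n a\<bar>"
  shows "small_in_prob M Y"
proof (rule small_in_prob_union[OF _ assms(1,1)])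
  fix \<epsilon> :: real assume "\<epsilon> > 0"
  then show "\<exists>\<epsilon>1>0. \<exists>\<epsilon>2>0. \<forall>\<^sub>F n in sequentially. \<forall>a. \<bar>X n a\<bar> \<le> \<epsilon>1 \<longrightarrow> \<bar>X n a\<bar> \<le> \<epsilon>2 \<longrightarrow> \<bar>Y n a\<bar> \<le> \<epsilon>"
    by (intro exI[of _ \<epsilon>] conjI) (use assms(2) in \<open>auto elim!: eventually_mono intro: order.trans\<close>)
qed

text \<open>For estimates available only on the event \<bar>V\<bar> \<le> c, whose complement has
  vanishing probability.\<close>

lemma small_in_prob_mono_on:
  assumes "small_in_prob M X" "small_in_prob M V" "c > 0"
    and "\<forall>\<^sub>F n in sequentially. \<forall>a. \<bar>V n a\<bar> \<le> c \<longrightarrow> \<bar>Y n a\<bar> \<le> \<bar>X n a\<bar>"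
  shows "small_in_prob M Y"
proof (rule small_in_prob_union[OF _ assms(1,2)])
  fix \<epsilon> :: real assume "\<epsilon> > 0"
  then show "\<exists>\<epsilon>1>0. \<exists>\<epsilon>2>0. \<forall>\<^sub>F n in sequentially. \<forall>a. \<bar>X n a\<bar> \<le> \<epsilon>1 \<longrightarrow> \<bar>V n a\<bar> \<le> \<epsilon>2 \<longrightarrow> \<bar>Y n a\<bar> \<le> \<epsilon>"
    by (intro exI[of _ \<epsilon>] exI[of _ c] conjI)
      (use assms(3,4) in \<open>auto elim!: eventually_mono intro: order.trans\<close>)
qed

lemma small_in_prob_add:
  assumes "small_in_prob M X" "small_in_prob M Y"
  shows "small_in_prob M (\<lambda>n a. X n a + Y n a)"
proof (rule small_in_prob_union[OF _ assms])
  fix \<epsilon> :: real assume "\<epsilon> > 0"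
  then show "\<exists>\<epsilon>1>0. \<exists>\<epsilon>2>0. \<forall>\<^sub>F n in sequentially. \<forall>a. \<bar>X n a\<bar> \<le> \<epsilon>1 \<longrightarrow> \<bar>Y n a\<bar> \<le> \<epsilon>2 \<longrightarrow> \<bar>X n a + Y n a\<bar> \<le> \<epsilon>"
    by (intro exI[of _ "\<epsilon> / 2"] conjI always_eventually allI impI) (auto simp: abs_le_iff)
qed

lemma small_in_prob_cmult:
  assumes "small_in_prob M X"
  shows "small_in_prob M (\<lambda>n a. c * X n a)"
proof (rule small_in_prob_union[OF _ assms assms])
  fix \<epsilon> :: real assume e: "\<epsilon> > 0"
  let ?e = "\<epsilon> / (\<bar>c\<bar> + 1)"
  have "\<bar>c * t\<bar> \<le> \<epsilon>" if "\<bar>t\<bar> \<le> ?e" for t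
  proof -
    have "\<bar>c\<bar> * \<bar>t\<bar> \<le> (\<bar>c\<bar> + 1) * ?e" using that by (intro mult_mono) auto
    also have "\<dots> = \<epsilon>" by (simp add: add_nonneg_eq_0_iff)
    finally show ?thesis by (simp add: abs_mult)
  qed
  then show "\<exists>\<epsilon>1>0. \<exists>\<epsilon>2>0. \<forall>\<^sub>F n in sequentially. \<forall>a. \<bar>X n a\<bar> \<le> \<epsilon>1 \<longrightarrow> \<bar>X n a\<bar> \<le> \<epsilon>2 \<longrightarrow> \<bar>c * X n a\<bar> \<le> \<epsilon>"
    using e by (intro exI[of _ ?e] conjI always_eventually allI impI) (auto simp: add_nonneg_pos)
qed

lemma small_in_prob_power:
  assumes "small_in_prob M X" "k \<ge> 1"
  shows "small_in_prob M (\<lambda>n a. (X n a) ^ k)"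
proof (rule small_in_prob_union[OF _ assms(1,1)])
  fix \<epsilon> :: real assume e: "\<epsilon> > 0"
  let ?e = "min 1 \<epsilon>"
  have "\<bar>t ^ k\<bar> \<le> \<epsilon>" if "\<bar>t\<bar> \<le> ?e" for t
  proof -
    have "\<bar>t\<bar> ^ k \<le> \<bar>t\<bar> ^ 1" using that assms(2) by (intro power_decreasing) auto
    then show ?thesis using that by (simp add: power_abs)
  qed
  then show "\<exists>\<epsilon>1>0. \<exists>\<epsilon>2>0. \<forall>\<^sub>F n in sequentially. \<forall>a. \<bar>X n a\<bar> \<le> \<epsilon>1 \<longrightarrow> \<bar>X n a\<bar> \<le> \<epsilon>2 \<longrightarrow> \<bar>X n a ^ k\<bar> \<le> \<epsilon>"
    using e by (intro exI[of _ ?e] conjI always_eventually allI impI) auto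
qed

lemma small_in_prob_sqrt:
  assumes "small_in_prob M X"
  shows "small_in_prob M (\<lambda>n a. sqrt (X n a))"
proof (rule small_in_prob_union[OF _ assms assms])
  fix \<epsilon> :: real assume e: "\<epsilon> > 0"
  have "\<bar>sqrt t\<bar> \<le> \<epsilon>" if "\<bar>t\<bar> \<le> \<epsilon>\<^sup>2" for t
  proof -
    \<comment> \<open>The real square root is extended to negative arguments as an odd
      function.\<close>
    have "\<bar>sqrt t\<bar> = sqrt \<bar>t\<bar>" by (simp add: real_sqrt_abs2 real_sqrt_minus abs_if)
    also have "\<dots> \<le> sqrt (\<epsilon>\<^sup>2)" using that by (rule real_sqrt_le_mono)
    finally show ?thesis using e by simp
  qed
  then show "\<exists>\<epsilon>1>0. \<exists>\<epsilon>2>0. \<forall>\<^sub>F n in sequentially. \<forall>a. \<bar>X n a\<bar> \<le> \<epsilon>1 \<longrightarrow> \<bar>X n a\<bar> \<le> \<epsilon>2 \<longrightarrow> \<bar>sqrt (X n a)\<bar> \<le> \<epsilon>"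
    using e by (intro exI[of _ "\<epsilon>\<^sup>2"] conjI always_eventually allI impI) auto
qed

lemma small_in_prob_det:
  assumes "b \<longlonglongrightarrow> 0"
  shows "small_in_prob M (\<lambda>n a. b n)"
  unfolding small_in_prob_iff
proof (intro allI impI)
  fix \<epsilon> \<eta> :: real assume "\<epsilon> > 0" "\<eta> > 0"
  then show "\<forall>\<^sub>F n in sequentially. measure (M n) {a. \<bar>b n\<bar> > \<epsilon>} < \<eta>"
    using tendstoD[OF assms \<open>\<epsilon> > 0\<close>]
  proof (elim eventually_mono)
    fix n assume "dist (b n) 0 < \<epsilon>"
    then have "\<not> \<bar>b n\<bar> > \<epsilon>" by (simp add: dist_real_def)
    then show "measure (M n) {a. \<bar>b n\<bar> > \<epsilon>} < \<eta>" using \<open>\<eta> > 0\<close> by simp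
  qed
qed

lemma pmf_Markov:
  assumes "finite (set_pmf p)" "c > 0"
  shows "measure p {a. \<bar>Y a\<bar> > c} \<le> measure_pmf.expectation p (\<lambda>a. \<bar>Y a\<bar>) / c"
proof -
  have "measure p {a. \<bar>Y a\<bar> > c} \<le> measure p {a \<in> space p. \<bar>Y a\<bar> \<ge> c}"
    by (intro measure_pmf.finite_measure_mono) auto
  also have "\<dots> \<le> measure_pmf.expectation p (\<lambda>a. \<bar>Y a\<bar>) / c"
    by (rule integral_Markov_inequality_measure[where A = "{}"])
      (use assms in \<open>auto intro: integrable_measure_pmf_finite\<close>)
  finally show ?thesis .
qed

lemma small_in_prob_Markov:
  assumes fin: "\<And>n. finite (set_pmf (M n))" and b: "b \<longlonglongrightarrow> 0"
    and ex: "\<forall>\<^sub>F n in sequentially. measure_pmf.expectation (M n) (\<lambda>a. \<bar>Y n a\<bar>) \<le> b n"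
  shows "small_in_prob M Y"
  unfolding small_in_prob_def
proof (intro allI impI)
  fix \<epsilon> :: real assume e: "\<epsilon> > 0"
  have "\<forall>\<^sub>F n in sequentially. norm (measure (M n) {a. \<bar>Y n a\<bar> > \<epsilon>}) \<le> b n / \<epsilon>"
    using ex
  proof eventually_elim
    case (elim n)
    have "measure (M n) {a. \<bar>Y n a\<bar> > \<epsilon>} \<le> measure_pmf.expectation (M n) (\<lambda>a. \<bar>Y n a\<bar>) / \<epsilon>"
      by (rule pmf_Markov[OF fin e])
    also have "\<dots> \<le> b n / \<epsilon>" using elim e by (intro divide_right_mono) auto
    finally show ?case by simp
  qed
  moreover have "(\<lambda>n. b n / \<epsilon>) \<longlonglongrightarrow> 0" using tendsto_divide[OF b tendsto_const[of \<epsilon>]] e by simp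
  ultimately show "(\<lambda>n. measure (M n) {a. \<bar>Y n a\<bar> > \<epsilon>}) \<longlonglongrightarrow> 0" by (rule Lim_null_comparison)
qed

lemma tight_in_prob_Markov:
  assumes fin: "\<And>n. finite (set_pmf (M n))"
    and ex: "\<forall>\<^sub>F n in sequentially. measure_pmf.expectation (M n) (\<lambda>a. \<bar>Y n a\<bar>) \<le> b"
  shows "tight_in_prob M Y"
  unfolding tight_in_prob_def
proof (intro allI impI)
  fix \<epsilon> :: real assume e: "\<epsilon> > 0"
  let ?B = "(\<bar>b\<bar> + 1) / \<epsilon>"
  have B: "?B > 0" using e by (simp add: add_nonneg_pos)
  show "\<exists>B. \<forall>\<^sub>F n in sequentially. measure (M n) {a. \<bar>Y n a\<bar> > B} < \<epsilon>"
  proof (rule exI[of _ ?B], use ex in eventually_elim)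
    case (elim n)
    have "measure (M n) {a. \<bar>Y n a\<bar> > ?B} \<le> measure_pmf.expectation (M n) (\<lambda>a. \<bar>Y n a\<bar>) / ?B"
      by (rule pmf_Markov[OF fin B])
    also have "\<dots> \<le> b / ?B" using elim B by (intro divide_right_mono) auto
    also have "\<dots> < \<epsilon>"
    proof -
      have "b < \<bar>b\<bar> + 1" by linarith
      then have "b * \<epsilon> < (\<bar>b\<bar> + 1) * \<epsilon>" using e by simp
      then show ?thesis by (simp add: pos_divide_less_eq add_nonneg_pos mult.commute)
    qed
    finally show ?case .
  qed
qed

lemma small_in_prob_mult_tight:
  assumes X: "small_in_prob M X" and Y: "tight_in_prob M Y"
  shows "small_in_prob M (\<lambda>n a. X n a * Y n a)"
  unfolding small_in_prob_iff
proof (intro allI impI)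
  fix \<epsilon> \<eta> :: real assume e: "\<epsilon> > 0" and h: "\<eta> > 0"
  have h2: "\<eta> / 2 > 0" using h by simp
  obtain B where B: "\<forall>\<^sub>F n in sequentially. measure (M n) {a. \<bar>Y n a\<bar> > B} < \<eta> / 2"
    using Y h2 unfolding tight_in_prob_def by blast
  let ?e = "\<epsilon> / (\<bar>B\<bar> + 1)"
  have e': "?e > 0" using e by (simp add: add_nonneg_pos)
  show "\<forall>\<^sub>F n in sequentially. measure (M n) {a. \<bar>X n a * Y n a\<bar> > \<epsilon>} < \<eta>"
    using B small_in_probD[OF X e' h2]
  proof eventually_elim
    case (elim n)
    have "{a. \<bar>X n a * Y n a\<bar> > \<epsilon>} \<subseteq> {a. \<bar>X n a\<bar> > ?e} \<union> {a. \<bar>Y n a\<bar> > B}"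
    proof (rule subsetI, rule ccontr)
      fix a assume a: "a \<in> {a. \<bar>X n a * Y n a\<bar> > \<epsilon>}" and "a \<notin> {a. \<bar>X n a\<bar> > ?e} \<union> {a. \<bar>Y n a\<bar> > B}"
      then have "\<bar>X n a\<bar> \<le> ?e" "\<bar>Y n a\<bar> \<le> \<bar>B\<bar> + 1" by auto
      then have "\<bar>X n a\<bar> * \<bar>Y n a\<bar> \<le> ?e * (\<bar>B\<bar> + 1)" using e' by (intro mult_mono) auto
      then show False using a by (simp add: abs_mult add_nonneg_eq_0_iff)
    qed
    then have "measure (M n) {a. \<bar>X n a * Y n a\<bar> > \<epsilon>} \<le> measure (M n) ({a. \<bar>X n a\<bar> > ?e} \<union> {a. \<bar>Y n a\<bar> > B})"
      by (intro measure_pmf.finite_measure_mono) auto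
    also have "\<dots> \<le> measure (M n) {a. \<bar>X n a\<bar> > ?e} + measure (M n) {a. \<bar>Y n a\<bar> > B}"
      by (rule measure_Un_le) auto
    finally show ?case using elim by linarith
  qed
qed

text \<open>The constant \<open>C\<close> of a stochastic order depends on the probability level; it
  is absorbed because s n * r n tends to 0.\<close>

lemma small_in_prob_rate:
  fixes M :: "nat \<Rightarrow> 'a pmf"
  assumes Y: "\<forall>\<epsilon>>0. \<exists>C. \<forall>\<^sub>F n in sequentially. measure (M n) {a. \<bar>Y n a\<bar> > C * r n} < \<epsilon>"
    and s: "(\<lambda>n. s n * r n) \<longlonglongrightarrow> 0" and s0: "\<forall>\<^sub>F n in sequentially. s n > 0"
  shows "small_in_prob M (\<lambda>n a. s n * Y n a)"
  unfolding small_in_prob_iff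
proof (intro allI impI)
  fix \<epsilon> \<eta> :: real assume e: "\<epsilon> > 0" and h: "\<eta> > 0"
  obtain C where C: "\<forall>\<^sub>F n in sequentially. measure (M n) {a. \<bar>Y n a\<bar> > C * r n} < \<eta>"
    using Y h by blast
  have "(\<lambda>n. C * (s n * r n)) \<longlonglongrightarrow> 0" using tendsto_mult_right_zero[OF s] .
  then have "\<forall>\<^sub>F n in sequentially. C * (s n * r n) < \<epsilon>" using e by (rule order_tendstoD(2))
  then show "\<forall>\<^sub>F n in sequentially. measure (M n) {a. \<bar>s n * Y n a\<bar> > \<epsilon>} < \<eta>"
    using C s0
  proof eventually_elim
    case (elim n)
    have "{a. \<bar>s n * Y n a\<bar> > \<epsilon>} \<subseteq> {a. \<bar>Y n a\<bar> > C * r n}"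
    proof (rule subsetI, rule CollectI, rule ccontr)
      fix a assume a: "a \<in> {a. \<bar>s n * Y n a\<bar> > \<epsilon>}" and "\<not> \<bar>Y n a\<bar> > C * r n"
      then have "s n * \<bar>Y n a\<bar> \<le> s n * (C * r n)" using elim(3) by (intro mult_left_mono) auto
      moreover have "\<bar>s n * Y n a\<bar> = s n * \<bar>Y n a\<bar>" using elim(3) by (simp add: abs_mult)
      moreover have "s n * (C * r n) = C * (s n * r n)" by simp
      ultimately show False using a elim(1) by simp
    qed
    then have "measure (M n) {a. \<bar>s n * Y n a\<bar> > \<epsilon>} \<le> measure (M n) {a. \<bar>Y n a\<bar> > C * r n}"
      by (intro measure_pmf.finite_measure_mono) auto
    then show ?case using elim by linarith
  qed
qed

text \<open>Estimators see matrices, while independence and finite support live on edge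
  configurations; probabilities are computed on the latter and transported by this map.\<close>

definition adj_of :: "(nat \<times> nat \<Rightarrow> bool) \<Rightarrow> adj" where
  "adj_of \<omega> i j = of_bool (\<omega> (min i j, max i j))"

lemma frob_norm_sq: "(frob_norm n X)\<^sup>2 = (\<Sum>i=1..n. (norm (X i))\<^sup>2)"
  by (simp add: frob_norm_def sum_nonneg norm_vec_def L2_set_def)

text \<open>The quotient is the c-th power of ln n / n^(1/c), which tends to 0.\<close>

lemma log_over_n_tendsto_0:
  fixes c :: real
  assumes "c > 0"
  shows "(\<lambda>n. ln (real n) powr c / real n) \<longlonglongrightarrow> 0"
proof (rule Lim_transform_eventually)
  have "(\<lambda>n. ln (real n) / real n powr (1 / c)) \<longlonglongrightarrow> 0"
    using lim_ln_over_power[of "1 / c"] assms by simp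
  moreover have nn: "\<forall>\<^sub>F n in sequentially. 0 \<le> ln (real n) / real n powr (1 / c)"
    using eventually_ge_at_top[of 1] by eventually_elim auto
  ultimately show "(\<lambda>n. (ln (real n) / real n powr (1 / c)) powr c) \<longlonglongrightarrow> 0"
    by (rule tendsto_zero_powrI[OF _ tendsto_const _ assms])
  show "\<forall>\<^sub>F n in sequentially. (ln (real n) / real n powr (1 / c)) powr c = ln (real n) powr c / real n"
    using eventually_ge_at_top[of 1]
    by eventually_elim (use assms in \<open>simp add: powr_divide powr_powr\<close>)
qed

section \<open>Size of the initial errors\<close>

locale rdpg_estimation = rdpg_setting x0 F K \<delta> \<rho> \<rho>lim
  for x0 :: "nat \<Rightarrow> real^'d" and F K \<delta> \<rho> \<rho>lim +
  fixes \<omega> C :: real and Xt Xh :: "nat \<Rightarrow> adj \<Rightarrow> nat \<Rightarrow> real^'d"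
    and W :: "nat \<Rightarrow> adj \<Rightarrow> real^'d^'d" and R :: "nat \<Rightarrow> adj \<Rightarrow> nat \<Rightarrow> real^'d"
    and \<zeta> :: "nat \<Rightarrow> nat \<Rightarrow> nat \<Rightarrow> real^'d"
  assumes \<omega>0: "\<omega> \<ge> 0"
    and regime: "(\<forall>n\<ge>1. \<rho> n = 1) \<or>
         \<rho> \<longlonglongrightarrow> 0 \<and> (\<lambda>n. ln (real n) powr (2 * max 1 \<omega>) / (real n * \<rho> n ^ 5)) \<longlonglongrightarrow> 0"
    and orth: "\<And>n a. orthogonal_matrix (W n a)"
    and \<zeta>: "\<And>n i j. i \<in> {1..n} \<Longrightarrow> j \<in> {1..n} \<Longrightarrow> norm (\<zeta> n i j) \<le> C * (1 / real n)"
    and Rrate: "bounded_in_prob (\<lambda>n. measure_pmf (RDPG n (\<rho> n) x0)) (\<lambda>n a. (frob_norm n (R n a))\<^sup>2)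
          (\<lambda>n. inverse (real n * \<rho> n) * ln (real n) powr \<omega>)"
    and linearization: "\<And>n a i. i \<in> {1..n} \<Longrightarrow>
           transpose (W n a) *v Xt n a i - sqrt (\<rho> n) *\<^sub>R x0 i =
             (1 / sqrt (\<rho> n)) *\<^sub>R (\<Sum>j=1..n. (a i j - \<rho> n * (x0 i \<bullet> x0 j)) *\<^sub>R \<zeta> n i j) + R n a i"
    and one_step: "one_step_estimator Xt Xh"
begin

text \<open>Vertices are numbered from 1; index 0 is redirected so that all rows lie in \<open>K\<close>.\<close>

definition xx :: "nat \<Rightarrow> real^'d" where "xx i = x0 (max 1 i)"
definition P :: "nat \<Rightarrow> nat \<Rightarrow> nat \<Rightarrow> real" where "P n i j = \<rho> n * (xx i \<bullet> xx j)"
definition M :: "nat \<Rightarrow> (nat \<times> nat \<Rightarrow> bool) pmf" where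
  "M n = Pi_pmf (edge_set n) False (\<lambda>(i, j). bernoulli_pmf (\<rho> n * (x0 i \<bullet> x0 j)))"
definition E :: "nat \<Rightarrow> nat \<Rightarrow> nat \<Rightarrow> (nat \<times> nat \<Rightarrow> bool) \<Rightarrow> real" where
  "E n i j a = adj_of a i j - P n i j"

abbreviation mean :: "nat \<Rightarrow> ((nat \<times> nat \<Rightarrow> bool) \<Rightarrow> real) \<Rightarrow> real" where
  "mean n \<equiv> measure_pmf.expectation (M n)"

lemma xx_eq: "i \<in> {1..n} \<Longrightarrow> xx i = x0 i" by (simp add: xx_def max_def)
lemma xxK: "xx i \<in> K" unfolding xx_def by (rule xK) simp

lemma RDPG_eq: "RDPG n (\<rho> n) x0 = map_pmf adj_of (M n)"
proof -
  have "adj_of = (\<lambda>e i j. of_bool (e (min i j, max i j)))" by (intro ext) (simp add: adj_of_def)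
  then show ?thesis by (simp only: RDPG_def M_def edge_set_def)
qed

lemma fin_M: "finite (set_pmf (M n))"
  unfolding M_def by (rule finite_set_Pi_pmf_bool[OF finite_edge_set])

lemma int_M [simp, intro]: "integrable (measure_pmf (M n)) (f :: _ \<Rightarrow> real)"
  by (rule integrable_measure_pmf_finite[OF fin_M])

lemma mean_mono: "(\<And>a. f a \<le> g a) \<Longrightarrow> mean n f \<le> mean n g"
  by (rule integral_mono) auto

lemma mean_sum: "mean n (\<lambda>a. \<Sum>i\<in>A. f i a) = (\<Sum>i\<in>A. mean n (f i))"
  by (rule Bochner_Integration.integral_sum) auto

lemma \<delta>1: "\<delta> \<le> 1 / 2" using K_inner[OF x0_1 x0_1] by simp

lemma P_bounds:
  assumes "n \<ge> 1" shows "0 \<le> P n i j" "P n i j \<le> \<rho> n" "P n i j \<le> 1"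
proof -
  note r = \<rho>01[OF assms] and k = K_inner[OF xxK[of i] xxK[of j]]
  show "0 \<le> P n i j" using r k \<delta> by (simp add: P_def)
  have "\<rho> n * (xx i \<bullet> xx j) \<le> \<rho> n * 1" using r k \<delta> by (intro mult_left_mono) auto
  then show "P n i j \<le> \<rho> n" by (simp add: P_def)
  then show "P n i j \<le> 1" using r by simp
qed

lemma bg: "n \<ge> 1 \<Longrightarrow> bernoulli_graph (P n)"
  by standard (use P_bounds in \<open>auto simp: P_def inner_commute\<close>)

lemma M_eq: "n \<ge> 1 \<Longrightarrow> M n = bernoulli_product.pr (edge_set n) (\<lambda>(i, j). P n i j)"
proof -
  assume "n \<ge> 1"
  then interpret g: bernoulli_graph n "P n" by (rule bg)
  show ?thesis unfolding M_def g.pr_def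
    by (rule Pi_pmf_cong) (auto simp: P_def edge_set_def xx_def max_def)
qed

lemma E_bg: "n \<ge> 1 \<Longrightarrow> bernoulli_graph.E (P n) i j a = E n i j a"
proof -
  assume "n \<ge> 1"
  then interpret g: bernoulli_graph n "P n" by (rule bg)
  show ?thesis by (simp add: g.E_eq E_def adj_of_def)
qed

lemma abs_E_le: "n \<ge> 1 \<Longrightarrow> \<bar>E n i j a\<bar> \<le> 1"
  using bernoulli_graph.abs_E_le[OF bg] by (simp add: E_bg)

lemma C0: "C \<ge> 0"
  using order.trans[OF norm_ge_zero \<zeta>[of 1 1 1]] by simp

lemma moment2:
  fixes w :: "nat \<Rightarrow> 'v::real_inner"
  assumes "n \<ge> 1" "i \<in> {1..n}" "\<And>j. j \<in> {1..n} \<Longrightarrow> norm (w j) \<le> c"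
  shows "mean n (\<lambda>a. (norm (\<Sum>j=1..n. E n i j a *\<^sub>R w j))\<^sup>2) \<le> 4 * real n * c\<^sup>2"
  unfolding M_eq[OF assms(1)] E_bg[OF assms(1), symmetric]
  by (rule bernoulli_graph.row_sq_le[OF bg[OF assms(1)]]) (use assms in auto)

lemma moment4:
  fixes w :: "nat \<Rightarrow> 'v::real_inner"
  assumes "n \<ge> 1" "i \<in> {1..n}" "\<And>j. j \<in> {1..n} \<Longrightarrow> norm (w j) \<le> c"
  shows "mean n (\<lambda>a. (norm (\<Sum>j=1..n. E n i j a *\<^sub>R w j))^4) \<le> 32 * (real n)\<^sup>2 * c^4"
  unfolding M_eq[OF assms(1)] E_bg[OF assms(1), symmetric]
  by (rule bernoulli_graph.row_fourth_le[OF bg[OF assms(1)]]) (use assms in auto)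

lemma moment_path:
  fixes w :: "nat \<Rightarrow> nat \<Rightarrow> 'v::real_inner"
  assumes "n \<ge> 1" "i \<in> {1..n}" "\<And>j k. j \<in> {1..n} \<Longrightarrow> k \<in> {1..n} \<Longrightarrow> norm (w j k) \<le> c"
  shows "mean n (\<lambda>a. (norm (\<Sum>j=1..n. \<Sum>k=1..n. (E n i j a * E n j k a) *\<^sub>R w j k))\<^sup>2) \<le> 20 * (real n)\<^sup>2 * c\<^sup>2"
  unfolding M_eq[OF assms(1)] E_bg[OF assms(1), symmetric]
  by (rule bernoulli_graph.path_sq_le[OF bg[OF assms(1)]]) (use assms in auto)

lemma moment_quad:
  fixes w :: "nat \<Rightarrow> nat \<Rightarrow> 'v::real_inner"
  assumes "n \<ge> 1" "\<And>j k. j \<in> {1..n} \<Longrightarrow> k \<in> {1..n} \<Longrightarrow> norm (w j k) \<le> c"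
  shows "mean n (\<lambda>a. (norm (\<Sum>j=1..n. \<Sum>k=1..n. E n j k a *\<^sub>R w j k))\<^sup>2) \<le> 10 * (real n)\<^sup>2 * c\<^sup>2"
  unfolding M_eq[OF assms(1)] E_bg[OF assms(1), symmetric]
  by (rule bernoulli_graph.quad_sq_le[OF bg[OF assms(1)]]) (use assms in auto)

lemma moment_offdiag:
  fixes w :: "nat \<Rightarrow> 'v::real_inner"
  assumes "n \<ge> 1" "i \<in> {1..n}" "\<And>j. j \<in> {1..n} \<Longrightarrow> norm (w j) \<le> c"
  shows "mean n (\<lambda>a. (norm (\<Sum>j\<in>{1..n}-{i}. E n i j a *\<^sub>R w j))\<^sup>2) \<le> \<rho> n * (real n * c\<^sup>2)"
  unfolding M_eq[OF assms(1)] E_bg[OF assms(1), symmetric]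
  by (rule bernoulli_graph.row_offdiag_sq_le[OF bg[OF assms(1)]]) (use assms P_bounds[OF assms(1)] \<rho>01[OF assms(1)] in auto)

lemma moment_concentration:
  fixes b :: "nat \<Rightarrow> nat \<Rightarrow> 'v::real_inner"
  assumes "n \<ge> 1" "\<And>j k. j \<in> {1..n} \<Longrightarrow> k \<in> {1..n} \<Longrightarrow> norm (b j k) \<le> c"
  shows "mean n (\<lambda>a. ((\<Sum>i=1..n. (norm (\<Sum>j\<in>{1..n}-{i}. E n i j a *\<^sub>R b i j))\<^sup>2)
      - (\<Sum>i=1..n. \<Sum>j\<in>{1..n}-{i}. P n i j * (1 - P n i j) * (norm (b i j))\<^sup>2))\<^sup>2) \<le> 28 * (real n)^3 * c^4"
  unfolding M_eq[OF assms(1)] E_bg[OF assms(1), symmetric]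
  by (rule bernoulli_graph.sum_row_squares_concentration[OF bg[OF assms(1)]]) (use assms in auto)

text \<open>The vanishing quantity of the sparse regime. For constant sparsity 1 it is a power of
  log n over n, so both regimes continue from \<open>lam_tendsto\<close> alone.\<close>

definition lam :: "nat \<Rightarrow> real" where "lam n = ln (real n) powr (2 * max 1 \<omega>) / (real n * \<rho> n ^ 5)"

lemma lam_tendsto: "lam \<longlonglongrightarrow> 0"
  using regime
proof
  assume "\<forall>n\<ge>1. \<rho> n = 1"
  then have ev: "\<forall>\<^sub>F n in sequentially. ln (real n) powr (2 * max 1 \<omega>) / real n = lam n"
    by (auto simp: lam_def eventually_sequentially intro!: exI[of _ 1])
  have "2 * max 1 \<omega> > 0" by simp
  from Lim_transform_eventually[OF log_over_n_tendsto_0[OF this] ev] show ?thesis .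
qed (simp add: lam_def[abs_def])

lemma ln_ge_1: "n \<ge> 3 \<Longrightarrow> ln (real n) \<ge> 1"
proof -
  assume "n \<ge> 3"
  have "exp 1 \<le> (3 :: real)" using e_less_272 by simp
  also have "\<dots> \<le> real n" using \<open>n \<ge> 3\<close> by simp
  finally have "exp 1 \<le> real n" .
  then show ?thesis using \<open>n \<ge> 3\<close> by (subst ln_ge_iff) auto
qed

lemma inv_n_rho5_le: "n \<ge> 3 \<Longrightarrow> 1 / (real n * \<rho> n ^ 5) \<le> lam n"
  unfolding lam_def using ln_ge_1[of n] \<rho>01[of n]
  by (intro divide_right_mono ge_one_powr_ge_zero) auto

text \<open>The logarithm is at least 1 from n = 3 on and \<rho> n \<le> 1, so all rates with lower
  powers of \<rho> are dominated by \<open>lam\<close>.\<close>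

lemma inv_n_rho_tendsto:
  assumes "k \<le> 5"
  shows "(\<lambda>n. 1 / (real n * \<rho> n ^ k)) \<longlonglongrightarrow> 0"
proof (rule Lim_null_comparison[OF _ lam_tendsto])
  show "\<forall>\<^sub>F n in sequentially. norm (1 / (real n * \<rho> n ^ k)) \<le> lam n"
    unfolding eventually_sequentially
  proof (intro exI[of _ 3] allI impI)
    fix n :: nat assume n: "n \<ge> 3"
    have r: "0 < \<rho> n" "\<rho> n \<le> 1" using \<rho>01[of n] n by auto
    have "\<rho> n ^ 5 \<le> \<rho> n ^ k" using r assms by (intro power_decreasing) auto
    then have "1 / (real n * \<rho> n ^ k) \<le> 1 / (real n * \<rho> n ^ 5)"
      using r n by (intro divide_left_mono mult_left_mono) auto
    then show "norm (1 / (real n * \<rho> n ^ k)) \<le> lam n" using inv_n_rho5_le[OF n] r n by simp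
  qed
qed

text \<open>The aligned initial estimator is \<open>\<rho>\<^sup>1\<^sup>/\<^sup>2 (x i + eps i)\<close>, with linear part \<open>\<eta>\<close> and remainder \<open>\<tau>\<close>
  of \<open>eps\<close>.\<close>

definition \<eta> :: "nat \<Rightarrow> (nat \<times> nat \<Rightarrow> bool) \<Rightarrow> nat \<Rightarrow> real^'d" where
  "\<eta> n a i = (1 / \<rho> n) *\<^sub>R (\<Sum>j=1..n. E n i j a *\<^sub>R \<zeta> n i j)"
definition \<tau> :: "nat \<Rightarrow> (nat \<times> nat \<Rightarrow> bool) \<Rightarrow> nat \<Rightarrow> real^'d" where
  "\<tau> n a i = (1 / sqrt (\<rho> n)) *\<^sub>R R n (adj_of a) i"
definition eps :: "nat \<Rightarrow> (nat \<times> nat \<Rightarrow> bool) \<Rightarrow> nat \<Rightarrow> real^'d" where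
  "eps n a i = \<eta> n a i + \<tau> n a i"
definition T2 :: "nat \<Rightarrow> (nat \<times> nat \<Rightarrow> bool) \<Rightarrow> real" where
  "T2 n a = (\<Sum>i=1..n. (norm (\<tau> n a i))\<^sup>2)"
text \<open>Fourth powers, because the remainder is quadratic in the errors and its squares are
  summed over the rows. The same sum bounds the largest row.\<close>

definition S4 :: "nat \<Rightarrow> (nat \<times> nat \<Rightarrow> bool) \<Rightarrow> real" where
  "S4 n a = (\<Sum>i=1..n. (norm (eps n a i))^4)"

lemma T2_eq: "n \<ge> 1 \<Longrightarrow> T2 n a = (frob_norm n (R n (adj_of a)))\<^sup>2 / \<rho> n"
  using \<rho>01[of n] by (simp add: T2_def \<tau>_def frob_norm_sq power_divide sum_divide_distrib)

lemma T2_nonneg: "0 \<le> T2 n a" by (simp add: T2_def sum_nonneg)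
lemma S4_nonneg: "0 \<le> S4 n a" by (simp add: S4_def sum_nonneg)

lemma sqrt_lam: "(\<lambda>n. sqrt (lam n)) \<longlonglongrightarrow> 0"
  using tendsto_real_sqrt[OF lam_tendsto] by simp

text \<open>The factor in front turns the assumed Frobenius rate into (log n)^\<omega> / (n^(1/2)
  \<rho>^(5/2)). Squaring it produces the doubled exponent of the logarithm and the fifth power of
  \<rho> in the regime.\<close>

lemma R_rate_le:
  assumes n: "n \<ge> 3"
  shows "sqrt (real n / \<rho> n) / \<rho> n * (inverse (real n * \<rho> n) * ln (real n) powr \<omega>) \<le> sqrt (lam n)"
proof -
  have r: "0 < \<rho> n" using \<rho>01[of n] n by auto
  have n0: "real n > 0" using n by simp
  have L: "1 \<le> ln (real n)" by (rule ln_ge_1[OF n])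
  define l where "l = ln (real n) powr max 1 \<omega>"
  have "ln (real n) powr \<omega> \<le> l" unfolding l_def using L by (intro powr_mono) auto
  then have "sqrt (real n / \<rho> n) / \<rho> n * (inverse (real n * \<rho> n) * ln (real n) powr \<omega>)
     \<le> sqrt (real n / \<rho> n) / \<rho> n * (inverse (real n * \<rho> n) * l)"
    using r n0 by (intro mult_left_mono) auto
  also have "\<dots> = sqrt (lam n)"
  proof (rule real_sqrt_unique[symmetric])
    have "l\<^sup>2 = ln (real n) powr (2 * max 1 \<omega>)" unfolding l_def by (simp add: power2_eq_square powr_add[symmetric])
    moreover have "(sqrt (real n / \<rho> n) / \<rho> n * (inverse (real n * \<rho> n) * l))\<^sup>2 = l\<^sup>2 / (real n * \<rho> n ^ 5)"
      using r n0 by (simp add: power_mult_distrib power_divide power_inverse field_simps power2_eq_square numeral_eq_Suc)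
    ultimately show "(sqrt (real n / \<rho> n) / \<rho> n * (inverse (real n * \<rho> n) * l))\<^sup>2 = lam n"
      by (simp add: lam_def)
    show "0 \<le> sqrt (real n / \<rho> n) / \<rho> n * (inverse (real n * \<rho> n) * l)"
      using r n0 by (simp add: l_def)
  qed
  finally show ?thesis .
qed

lemma ev3: "\<forall>\<^sub>F n in sequentially. n \<ge> (3::nat)" by (rule eventually_ge_at_top)

text \<open>The factor (n / \<rho>)^(1/2) is what a single row requires of its squared error, and
  for the remainder in one row the total \<open>T2\<close> is the available bound.\<close>

lemma small_T2: "small_in_prob M (\<lambda>n a. sqrt (real n / \<rho> n) * T2 n a)"
proof -
  let ?s = "\<lambda>n. sqrt (real n / \<rho> n) / \<rho> n"
  have "small_in_prob M (\<lambda>n a. ?s n * (frob_norm n (R n (adj_of a)))\<^sup>2)"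
  proof (rule small_in_prob_rate)
    show "\<forall>\<epsilon>>0. \<exists>C. \<forall>\<^sub>F n in sequentially. measure (M n)
       {a. \<bar>(frob_norm n (R n (adj_of a)))\<^sup>2\<bar> > C * (inverse (real n * \<rho> n) * ln (real n) powr \<omega>)} < \<epsilon>"
      using Rrate unfolding bounded_in_prob_def RDPG_eq by (simp add: vimage_def)
    show "\<forall>\<^sub>F n in sequentially. ?s n > 0"
      using ev3 by eventually_elim (use \<rho>01 in auto)
    show "(\<lambda>n. ?s n * (inverse (real n * \<rho> n) * ln (real n) powr \<omega>)) \<longlonglongrightarrow> 0"
    proof (rule Lim_null_comparison[OF _ sqrt_lam])
      show "\<forall>\<^sub>F n in sequentially. norm (?s n * (inverse (real n * \<rho> n) * ln (real n) powr \<omega>)) \<le> sqrt (lam n)"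
        using ev3
      proof eventually_elim
        case (elim n)
        then have "0 \<le> ?s n * (inverse (real n * \<rho> n) * ln (real n) powr \<omega>)"
          using \<rho>01[of n] by (intro mult_nonneg_nonneg divide_nonneg_nonneg) auto
        then show ?case using R_rate_le[OF elim] by simp
      qed
    qed
  qed
  then show ?thesis
    by (rule small_in_prob_mono, use ev3 in eventually_elim) (simp add: T2_eq)
qed

lemma inv_rho_le_sqrt: 
  assumes "n \<ge> 3" "1 / (real n * \<rho> n) \<le> 1"
  shows "1 / \<rho> n \<le> sqrt (real n / \<rho> n)"
proof -
  have r: "0 < \<rho> n" using \<rho>01[of n] assms by auto
  have "1 \<le> real n * \<rho> n" using assms r by (simp add: field_simps)
  then have "(1 / \<rho> n)\<^sup>2 \<le> real n / \<rho> n" using r by (simp add: field_simps power2_eq_square)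
  then show ?thesis by (rule real_le_rsqrt)
qed

lemma small_T2_rho: "small_in_prob M (\<lambda>n a. T2 n a / \<rho> n)"
proof (rule small_in_prob_mono[OF small_T2])
  have "\<forall>\<^sub>F n in sequentially. 1 / (real n * \<rho> n ^ 1) < 1"
    by (rule order_tendstoD(2)[OF inv_n_rho_tendsto]) auto
  then show "\<forall>\<^sub>F n in sequentially. \<forall>a. \<bar>T2 n a / \<rho> n\<bar> \<le> \<bar>sqrt (real n / \<rho> n) * T2 n a\<bar>"
    using ev3
  proof eventually_elim
    case (elim n)
    show ?case
    proof
      fix a
      have "1 / \<rho> n * T2 n a \<le> sqrt (real n / \<rho> n) * T2 n a"
        using inv_rho_le_sqrt[of n] elim by (intro mult_right_mono T2_nonneg) auto
      moreover have "0 \<le> T2 n a / \<rho> n" using \<rho>01[of n] elim T2_nonneg by simp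
      ultimately show "\<bar>T2 n a / \<rho> n\<bar> \<le> \<bar>sqrt (real n / \<rho> n) * T2 n a\<bar>" by simp
    qed
  qed
qed

lemma mean_eta4:
  assumes "n \<ge> 1" "i \<in> {1..n}"
  shows "mean n (\<lambda>a. (norm (\<eta> n a i))^4) \<le> 32 * C^4 / ((real n)\<^sup>2 * \<rho> n ^ 4)"
proof -
  have r: "0 < \<rho> n" using \<rho>01[OF assms(1)] by simp
  have n0: "real n > 0" using assms by simp
  have "(norm (\<eta> n a i))^4 = (1 / \<rho> n ^ 4) * (norm (\<Sum>j=1..n. E n i j a *\<^sub>R \<zeta> n i j))^4" for a
    using r by (simp add: \<eta>_def power_divide)
  then have "mean n (\<lambda>a. (norm (\<eta> n a i))^4) = (1 / \<rho> n ^ 4) * mean n (\<lambda>a. (norm (\<Sum>j=1..n. E n i j a *\<^sub>R \<zeta> n i j))^4)"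
    by simp
  also have "\<dots> \<le> (1 / \<rho> n ^ 4) * (32 * (real n)\<^sup>2 * (C * (1 / real n))^4)"
    using r assms by (intro mult_left_mono moment4 \<zeta>) auto
  also have "\<dots> = 32 * C^4 / ((real n)\<^sup>2 * \<rho> n ^ 4)"
    using r n0 by (simp add: power_divide field_simps power2_eq_square power4_eq_xxxx)
  finally show ?thesis .
qed

lemma mean_eta2:
  assumes "n \<ge> 1" "i \<in> {1..n}"
  shows "mean n (\<lambda>a. (norm (\<eta> n a i))\<^sup>2) \<le> 4 * C\<^sup>2 / (real n * \<rho> n ^ 2)"
proof -
  have r: "0 < \<rho> n" using \<rho>01[OF assms(1)] by simp
  have n0: "real n > 0" using assms by simp
  have "(norm (\<eta> n a i))\<^sup>2 = (1 / \<rho> n ^ 2) * (norm (\<Sum>j=1..n. E n i j a *\<^sub>R \<zeta> n i j))\<^sup>2" for a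
    using r by (simp add: \<eta>_def power_divide)
  then have "mean n (\<lambda>a. (norm (\<eta> n a i))\<^sup>2) = (1 / \<rho> n ^ 2) * mean n (\<lambda>a. (norm (\<Sum>j=1..n. E n i j a *\<^sub>R \<zeta> n i j))\<^sup>2)"
    by simp
  also have "\<dots> \<le> (1 / \<rho> n ^ 2) * (4 * real n * (C * (1 / real n))\<^sup>2)"
    using r assms by (intro mult_left_mono moment2 \<zeta>) auto
  also have "\<dots> = 4 * C\<^sup>2 / (real n * \<rho> n ^ 2)"
    using r n0 by (simp add: power_divide field_simps power2_eq_square)
  finally show ?thesis .
qed

lemma sum_sq_le_sq_sum:
  fixes f :: "nat \<Rightarrow> real"
  assumes "\<And>i. i \<in> A \<Longrightarrow> 0 \<le> f i" "finite A"
  shows "(\<Sum>i\<in>A. (f i)\<^sup>2) \<le> (\<Sum>i\<in>A. f i)\<^sup>2"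
proof -
  have "(\<Sum>i\<in>A. (f i)\<^sup>2) \<le> (\<Sum>i\<in>A. f i * (\<Sum>j\<in>A. f j))"
    unfolding power2_eq_square using assms by (intro sum_mono mult_left_mono member_le_sum) auto
  then show ?thesis by (simp add: sum_distrib_right[symmetric] power2_eq_square)
qed

text \<open>The linear part has n rows with fourth moments of order 1 / (n^2 \<rho>^4), which gives
  1 / (n \<rho>^5). For the remainder, the sum of fourth powers is at most the square of
  \<open>T2\<close>.\<close>

lemma small_S4: "small_in_prob M (\<lambda>n a. S4 n a / \<rho> n)"
proof -
  let ?H = "\<lambda>n a. (\<Sum>i=1..n. (norm (\<eta> n a i))^4) / \<rho> n"
  have H: "small_in_prob M ?H"
  proof (rule small_in_prob_Markov[OF fin_M])
    show "(\<lambda>n. 32 * C^4 * (1 / (real n * \<rho> n ^ 5))) \<longlonglongrightarrow> 0"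
      by (rule tendsto_mult_right_zero[OF inv_n_rho_tendsto]) simp
    show "\<forall>\<^sub>F n in sequentially. mean n (\<lambda>a. \<bar>?H n a\<bar>) \<le> 32 * C^4 * (1 / (real n * \<rho> n ^ 5))"
      using ev3
    proof eventually_elim
      case (elim n)
      have r: "0 < \<rho> n" using \<rho>01[of n] elim by simp
      have "mean n (\<lambda>a. \<bar>?H n a\<bar>) = (\<Sum>i=1..n. mean n (\<lambda>a. (norm (\<eta> n a i))^4)) / \<rho> n"
        using r by (simp add: abs_of_nonneg sum_nonneg mean_sum)
      also have "\<dots> \<le> (\<Sum>i=1..n. 32 * C^4 / ((real n)\<^sup>2 * \<rho> n ^ 4)) / \<rho> n"
        using r elim by (intro divide_right_mono sum_mono mean_eta4) auto
      also have "\<dots> = 32 * C^4 * (1 / (real n * \<rho> n ^ 5))"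
        using r elim by (simp add: field_simps power2_eq_square numeral_eq_Suc)
      finally show ?case .
    qed
  qed
  have T: "small_in_prob M (\<lambda>n a. (sqrt (real n / \<rho> n) * T2 n a)\<^sup>2)"
    by (rule small_in_prob_power[OF small_T2]) simp
  show ?thesis
  proof (rule small_in_prob_mono[OF small_in_prob_add[OF small_in_prob_cmult[OF H, of 8] small_in_prob_cmult[OF T, of 8]]])
    show "\<forall>\<^sub>F n in sequentially. \<forall>a. \<bar>S4 n a / \<rho> n\<bar> \<le> \<bar>8 * ?H n a + 8 * (sqrt (real n / \<rho> n) * T2 n a)\<^sup>2\<bar>"
      using ev3
    proof eventually_elim
      case (elim n)
      have r: "0 < \<rho> n" using \<rho>01[of n] elim by simp
      show ?case
      proof
        fix a
        have "S4 n a \<le> (\<Sum>i=1..n. 8 * (norm (\<eta> n a i))^4 + 8 * (norm (\<tau> n a i))^4)"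
          unfolding S4_def eps_def by (intro sum_mono norm_add_fourth_le)
        also have "\<dots> = 8 * (\<Sum>i=1..n. (norm (\<eta> n a i))^4) + 8 * (\<Sum>i=1..n. ((norm (\<tau> n a i))\<^sup>2)\<^sup>2)"
          by (simp add: sum.distrib sum_distrib_left)
        also have "(\<Sum>i=1..n. ((norm (\<tau> n a i))\<^sup>2)\<^sup>2) \<le> (T2 n a)\<^sup>2"
          unfolding T2_def by (rule sum_sq_le_sq_sum) auto
        finally have "S4 n a / \<rho> n \<le> (8 * (\<Sum>i=1..n. (norm (\<eta> n a i))^4) + 8 * (T2 n a)\<^sup>2) / \<rho> n"
          using r by (intro divide_right_mono) auto
        also have "\<dots> = 8 * ?H n a + 8 * (1 / \<rho> n * (T2 n a)\<^sup>2)" by (simp add: add_divide_distrib)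
        also have "1 / \<rho> n * (T2 n a)\<^sup>2 \<le> real n / \<rho> n * (T2 n a)\<^sup>2"
          using elim r by (intro mult_right_mono divide_right_mono) auto
        also have "real n / \<rho> n * (T2 n a)\<^sup>2 = (sqrt (real n / \<rho> n) * T2 n a)\<^sup>2"
          using r by (simp add: power_mult_distrib)
        finally show "\<bar>S4 n a / \<rho> n\<bar> \<le> \<bar>8 * ?H n a + 8 * (sqrt (real n / \<rho> n) * T2 n a)\<^sup>2\<bar>"
          using S4_nonneg[of n a] r by (simp add: abs_of_nonneg)
      qed
    qed
  qed
qed

text \<open>\<open>small_S4\<close> misses a factor n for an individual row. Here the second moment
  of the linear part gives (n \<rho>^5)^(-1/2), and the remainder is covered by
  \<open>small_T2\<close>.\<close>

lemma small_eps_fixed: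
  assumes "i \<ge> 1"
  shows "small_in_prob M (\<lambda>n a. sqrt (real n / \<rho> n) * (norm (eps n a i))\<^sup>2)"
proof -
  let ?H = "\<lambda>n a. sqrt (real n / \<rho> n) * (norm (\<eta> n a i))\<^sup>2"
  have evi: "\<forall>\<^sub>F n in sequentially. n \<ge> max 3 i" by (rule eventually_ge_at_top)
  have H: "small_in_prob M ?H"
  proof (rule small_in_prob_Markov[OF fin_M])
    show "(\<lambda>n. 4 * C\<^sup>2 * sqrt (1 / (real n * \<rho> n ^ 5))) \<longlonglongrightarrow> 0"
      using tendsto_mult_right_zero[OF tendsto_real_sqrt[OF inv_n_rho_tendsto[of 5], simplified real_sqrt_zero]] by simp
    show "\<forall>\<^sub>F n in sequentially. mean n (\<lambda>a. \<bar>?H n a\<bar>) \<le> 4 * C\<^sup>2 * sqrt (1 / (real n * \<rho> n ^ 5))"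
      using evi
    proof eventually_elim
      case (elim n)
      have r: "0 < \<rho> n" using \<rho>01[of n] elim by simp
      have n0: "0 < real n" using elim by simp
      have "mean n (\<lambda>a. \<bar>?H n a\<bar>) = sqrt (real n / \<rho> n) * mean n (\<lambda>a. (norm (\<eta> n a i))\<^sup>2)"
        using r by (simp add: abs_mult)
      also have "\<dots> \<le> sqrt (real n / \<rho> n) * (4 * C\<^sup>2 / (real n * \<rho> n ^ 2))"
        using elim assms r by (intro mult_left_mono mean_eta2) auto
      also have "\<dots> = 4 * C\<^sup>2 * (sqrt (real n / \<rho> n) / (real n * \<rho> n ^ 2))" by simp
      also have "sqrt (real n / \<rho> n) / (real n * \<rho> n ^ 2) = sqrt (1 / (real n * \<rho> n ^ 5))"
        by (rule real_sqrt_unique[symmetric])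
          (use r n0 in \<open>simp_all add: power_divide power_mult_distrib field_simps power2_eq_square numeral_eq_Suc\<close>)
      finally show ?case .
    qed
  qed
  show ?thesis
  proof (rule small_in_prob_mono[OF small_in_prob_add[OF small_in_prob_cmult[OF H, of 2] small_in_prob_cmult[OF small_T2, of 2]]])
    show "\<forall>\<^sub>F n in sequentially. \<forall>a. \<bar>sqrt (real n / \<rho> n) * (norm (eps n a i))\<^sup>2\<bar>
      \<le> \<bar>2 * ?H n a + 2 * (sqrt (real n / \<rho> n) * T2 n a)\<bar>"
      using evi
    proof eventually_elim
      case (elim n)
      have s: "0 \<le> sqrt (real n / \<rho> n)" using \<rho>01[of n] elim by simp
      show ?case
      proof
        fix a
        have "(norm (\<tau> n a i))\<^sup>2 \<le> T2 n a"
          unfolding T2_def using elim assms by (intro member_le_sum) auto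
        then have "(norm (eps n a i))\<^sup>2 \<le> 2 * (norm (\<eta> n a i))\<^sup>2 + 2 * T2 n a"
          unfolding eps_def using norm_add_sq_le[of "\<eta> n a i" "\<tau> n a i"] by linarith
        then have "sqrt (real n / \<rho> n) * (norm (eps n a i))\<^sup>2 \<le> sqrt (real n / \<rho> n) * (2 * (norm (\<eta> n a i))\<^sup>2 + 2 * T2 n a)"
          using s by (rule mult_left_mono)
        moreover have "0 \<le> sqrt (real n / \<rho> n) * (norm (eps n a i))\<^sup>2" using s by simp
        ultimately show "\<bar>sqrt (real n / \<rho> n) * (norm (eps n a i))\<^sup>2\<bar>
          \<le> \<bar>2 * ?H n a + 2 * (sqrt (real n / \<rho> n) * T2 n a)\<bar>"
          by (simp add: algebra_simps)
      qed
    qed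
  qed
qed

end

section \<open>Rotation equivariance of the scoring step\<close>

lemma orthogonal_inner_transpose:
  fixes Q :: "real^'d^'d"
  assumes "orthogonal_matrix Q"
  shows "(transpose Q *v u) \<bullet> (transpose Q *v v) = u \<bullet> v"
proof -
  have "(transpose Q *v u) \<bullet> (transpose Q *v v) = u \<bullet> (Q *v (transpose Q *v v))"
    by (simp only: inner_matrix_transpose[of u Q])
  also have "Q *v (transpose Q *v v) = v"
    using assms by (simp add: orthogonal_matrix_def matrix_vector_mul_assoc del: transpose_matrix_vector)
  finally show ?thesis .
qed

lemma one_step_information_mult:
  "one_step_information n y i *v u =
     (1 / real n) *\<^sub>R (\<Sum>j=1..n. (1 / ((y i \<bullet> y j) * (1 - y i \<bullet> y j))) *\<^sub>R ((y j \<bullet> u) *\<^sub>R y j))"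
  unfolding one_step_information_def
  by (simp add: linear_scale[OF linear_matrix_vector_left] linear_sum[OF linear_matrix_vector_left] outer_mult_vec)

text \<open>The weights depend on inner products only, so a rotation passes through the sum.
  Together with the score this makes the step of the unaligned estimator the rotated step of the
  aligned one.\<close>

lemma one_step_information_rotate:
  fixes Q :: "real^'d^'d"
  assumes Q: "orthogonal_matrix Q" and y: "\<And>j. y j = transpose Q *v x j"
  shows "one_step_information n y i *v (transpose Q *v v) = transpose Q *v (one_step_information n x i *v v)"
proof -
  have lin: "linear ((*v) (transpose Q))" by (rule matrix_vector_mul_linear)
  show ?thesis
    unfolding one_step_information_mult y orthogonal_inner_transpose[OF Q]
    by (simp only: linear_scale[OF lin] linear_sum[OF lin])
qed

lemma one_step_score_rotate:
  fixes Q :: "real^'d^'d"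
  assumes Q: "orthogonal_matrix Q" and y: "\<And>j. y j = transpose Q *v x j"
  shows "one_step_score n A y i = transpose Q *v one_step_score n A x i"
proof -
  have lin: "linear ((*v) (transpose Q))" by (rule matrix_vector_mul_linear)
  show ?thesis
    unfolding one_step_score_def y orthogonal_inner_transpose[OF Q]
    by (simp only: linear_scale[OF lin] linear_sum[OF lin])
qed

text \<open>Carries invertibility from the aligned rows, where the expansion applies, back to the
  rows of the estimator itself.\<close>

lemma coercive_rotate:
  fixes Q :: "real^'d^'d"
  assumes Q: "orthogonal_matrix Q" and y: "\<And>j. y j = transpose Q *v x j"
    and c: "coercive c (one_step_information n y i)"
  shows "coercive c (one_step_information n x i)"
  unfolding coercive_def
proof (intro conjI allI)
  show "c > 0" using c by (simp add: coercive_def)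
  fix v
  have "v \<bullet> (one_step_information n x i *v v) = (transpose Q *v v) \<bullet> (one_step_information n y i *v (transpose Q *v v))"
    unfolding one_step_information_rotate[of Q y x, OF Q y] orthogonal_inner_transpose[OF Q] ..
  moreover have "norm (transpose Q *v v) = norm v"
    unfolding norm_eq_sqrt_inner orthogonal_inner_transpose[OF Q] ..
  moreover have "c * (norm (transpose Q *v v))\<^sup>2 \<le> (transpose Q *v v) \<bullet> (one_step_information n y i *v (transpose Q *v v))"
    using c unfolding coercive_def by blast
  ultimately show "c * (norm v)\<^sup>2 \<le> v \<bullet> (one_step_information n x i *v v)" by simp
qed

lemma sum_sq_le_card_sum_sq:
  fixes f :: "'i \<Rightarrow> real"
  shows "(\<Sum>i\<in>A. f i)\<^sup>2 \<le> real (card A) * (\<Sum>i\<in>A. (f i)\<^sup>2)"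
  using sum_squared_le_sum_of_squares[of f A] by (simp add: mult.commute)

lemma sum_fourth_le:
  fixes f :: "'i \<Rightarrow> real"
  shows "(\<Sum>i\<in>A. f i)^4 \<le> (real (card A))^3 * (\<Sum>i\<in>A. (f i)^4)"
proof -
  have "(\<Sum>i\<in>A. f i)^4 = ((\<Sum>i\<in>A. f i)\<^sup>2)\<^sup>2" by simp
  also have "\<dots> \<le> (real (card A) * (\<Sum>i\<in>A. (f i)\<^sup>2))\<^sup>2"
    by (intro power_mono sum_sq_le_card_sum_sq) auto
  also have "\<dots> = (real (card A))\<^sup>2 * (\<Sum>i\<in>A. (f i)\<^sup>2)\<^sup>2" by (simp add: power_mult_distrib)
  also have "\<dots> \<le> (real (card A))\<^sup>2 * (real (card A) * (\<Sum>i\<in>A. ((f i)\<^sup>2)\<^sup>2))"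
    by (intro mult_left_mono sum_sq_le_card_sum_sq) auto
  finally show ?thesis by (simp add: power2_eq_square power3_eq_cube power4_eq_xxxx mult_ac)
qed

section \<open>Moments of the remainder\<close>

context rdpg_estimation
begin

text \<open>This and the following definitions repeat the quantities of the deterministic expansion
  for every configuration: the expansion holds only where the errors are small, but moments are
  taken over all configurations.\<close>

definition av :: real where "av = \<delta> / 2"
definition wt :: "nat \<Rightarrow> nat \<Rightarrow> nat \<Rightarrow> real" where "wt n i j = fisher_weight (\<rho> n) (xx i \<bullet> xx j)"
definition wd :: "nat \<Rightarrow> nat \<Rightarrow> nat \<Rightarrow> real" where "wd n i j = fisher_weight_deriv (\<rho> n) (xx i \<bullet> xx j)"
definition Vv :: "nat \<Rightarrow> nat \<Rightarrow> nat \<Rightarrow> real^'d \<Rightarrow> real^'d" where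
  "Vv n i j v = wt n i j *\<^sub>R v + (wd n i j * (xx i \<bullet> v)) *\<^sub>R xx j"
definition pathp where
  "pathp n a i = (1 / (real n * \<rho> n)) *\<^sub>R (\<Sum>j=1..n. E n i j a *\<^sub>R Vv n i j (\<eta> n a j))"
definition meanp where
  "meanp n a i = (1 / real n) *\<^sub>R (\<Sum>j=1..n. (xx i \<bullet> \<eta> n a j) *\<^sub>R (wt n i j *\<^sub>R xx j))"
definition rowp where
  "rowp n a i k = (1 / (real n * \<rho> n)) *\<^sub>R (\<Sum>j=1..n. E n i j a *\<^sub>R ((wd n i j * (xx j $ k)) *\<^sub>R xx j))"
definition leadp where
  "leadp n a i = (1 / (real n * \<rho> n)) *\<^sub>R (\<Sum>j\<in>{1..n}-{i}. E n i j a *\<^sub>R (wt n i j *\<^sub>R xx j))"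

text \<open>The part of the remainder estimated through its mean square; the rest of the remainder
  is bounded pathwise by the error sums.\<close>

definition U :: "nat \<Rightarrow> (nat \<times> nat \<Rightarrow> bool) \<Rightarrow> nat \<Rightarrow> real" where
  "U n a i = 1 / (real n * \<rho> n * av\<^sup>2) + norm (pathp n a i) + norm (meanp n a i)
    + \<rho> n * (\<Sum>k\<in>UNIV. norm (rowp n a i k))\<^sup>2"

lemma av: "0 < av" "av \<le> 1" using \<delta> \<delta>1 by (auto simp: av_def)

lemma xx_range: "av \<le> xx i \<bullet> xx j" "xx i \<bullet> xx j \<le> 1 - av"
  using K_inner[OF xxK[of i] xxK[of j]] \<delta> unfolding av_def by linarith+

lemma xx_norm: "norm (xx i) \<le> 1" by (rule K_norm[OF xxK])

lemma xx_inner_le: "\<bar>xx i \<bullet> v\<bar> \<le> norm v" by (rule sum_inner_scaleR_bound[OF xx_norm])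

lemma wt_bound: "n \<ge> 1 \<Longrightarrow> \<bar>wt n i j\<bar> \<le> 1 / av\<^sup>2"
  unfolding wt_def by (rule fisher_weight_bounds(4)[OF av(1) xx_range]) (use \<rho>01[of n] in auto)

lemma wd_bound: "n \<ge> 1 \<Longrightarrow> \<bar>wd n i j\<bar> \<le> 2 / av\<^sup>2"
  unfolding wd_def by (rule fisher_weight_deriv_bound[OF av(1) xx_range]) (use \<rho>01[of n] in auto)

lemma Vv_bound:
  assumes "n \<ge> 1" "norm v \<le> c"
  shows "norm (Vv n i j v) \<le> 3 / av\<^sup>2 * c"
proof -
  have c0: "0 \<le> c" using assms(2) norm_ge_zero order.trans by blast
  have "norm (Vv n i j v) \<le> \<bar>wt n i j\<bar> * norm v + \<bar>wd n i j\<bar> * \<bar>xx i \<bullet> v\<bar> * norm (xx j)"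
    unfolding Vv_def by (rule order.trans[OF norm_triangle_ineq]) (simp add: abs_mult)
  moreover have "\<bar>wt n i j\<bar> * norm v \<le> 1 / av\<^sup>2 * c"
    by (rule mult_mono[OF wt_bound[OF assms(1)] assms(2)]) simp_all
  moreover have "\<bar>wd n i j\<bar> * \<bar>xx i \<bullet> v\<bar> * norm (xx j) \<le> (2 / av\<^sup>2) * c * 1"
    by (rule mult_mono[OF mult_mono[OF wd_bound[OF assms(1)] order.trans[OF xx_inner_le assms(2)]] xx_norm])
      (use c0 in simp_all)
  ultimately have "norm (Vv n i j v) \<le> 1 / av\<^sup>2 * c + (2 / av\<^sup>2) * c * 1" by linarith
  also have "\<dots> = 3 / av\<^sup>2 * c" by (simp add: add_divide_distrib[symmetric])
  finally show ?thesis .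
qed

lemma Vv_scaleR: "Vv n i j (c *\<^sub>R v) = c *\<^sub>R Vv n i j v"
  by (simp add: Vv_def scaleR_add_right mult_ac)

lemma Vv_sum: "Vv n i j (\<Sum>k\<in>A. f k) = (\<Sum>k\<in>A. Vv n i j (f k))"
  by (simp add: Vv_def scaleR_sum_right inner_sum_right sum_distrib_left scaleR_sum_left sum.distrib)

text \<open>Inserting the linear error of the neighbour j produces a weighted sum over two-edge
  paths starting at i. The constant is 20 * 9, with 9 from the square of the bound on
  \<open>Vv\<close>.\<close>

lemma mean_pathp:
  assumes n: "n \<ge> 1" and i: "i \<in> {1..n}"
  shows "mean n (\<lambda>a. (norm (pathp n a i))\<^sup>2) \<le> 180 * C\<^sup>2 / av^4 / ((real n)\<^sup>2 * \<rho> n ^ 4)"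
proof -
  have r: "0 < \<rho> n" using \<rho>01[OF n] by simp
  have n0: "real n > 0" using n by simp
  let ?w = "\<lambda>j k. Vv n i j (\<zeta> n j k)"
  let ?c = "1 / (real n * (\<rho> n)\<^sup>2)"
  have eq: "pathp n a i = ?c *\<^sub>R (\<Sum>j=1..n. \<Sum>k=1..n. (E n i j a * E n j k a) *\<^sub>R ?w j k)" for a
    unfolding pathp_def \<eta>_def Vv_scaleR Vv_sum scaleR_sum_right
    by (intro sum.cong refl) (simp add: power2_eq_square)
  have "mean n (\<lambda>a. (norm (pathp n a i))\<^sup>2) = ?c\<^sup>2 * mean n (\<lambda>a. (norm (\<Sum>j=1..n. \<Sum>k=1..n. (E n i j a * E n j k a) *\<^sub>R ?w j k))\<^sup>2)"
    by (simp only: eq norm_scaleR power_mult_distrib power2_abs integral_mult_right_zero)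
  also have "\<dots> \<le> ?c\<^sup>2 * (20 * (real n)\<^sup>2 * (3 / av\<^sup>2 * (C * (1 / real n)))\<^sup>2)"
    by (intro mult_left_mono moment_path Vv_bound \<zeta> n i) auto
  also have "\<dots> = 180 * C\<^sup>2 / av^4 / ((real n)\<^sup>2 * \<rho> n ^ 4)"
    using n0 r av(1) by (simp add: power_divide power_mult_distrib field_simps numeral_eq_Suc)
  finally show ?thesis .
qed

text \<open>No noise of row i occurs, so the double sum is linear in the edges. The power of \<rho>
  is weakened from 2 to 4 to match the path part.\<close>

lemma mean_meanp:
  assumes n: "n \<ge> 1" and i: "i \<in> {1..n}"
  shows "mean n (\<lambda>a. (norm (meanp n a i))\<^sup>2) \<le> 10 * C\<^sup>2 / av^4 / ((real n)\<^sup>2 * \<rho> n ^ 4)"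
proof -
  have r: "0 < \<rho> n" "\<rho> n \<le> 1" using \<rho>01[OF n] by auto
  have n0: "real n > 0" using n by simp
  let ?w = "\<lambda>j k. (xx i \<bullet> \<zeta> n j k) *\<^sub>R (wt n i j *\<^sub>R xx j)"
  let ?c = "1 / (real n * \<rho> n)"
  have wb: "norm (?w j k) \<le> C * (1 / real n) * (1 / av\<^sup>2)" if "j \<in> {1..n}" "k \<in> {1..n}" for j k
  proof -
    have "\<bar>xx i \<bullet> \<zeta> n j k\<bar> * (\<bar>wt n i j\<bar> * norm (xx j)) \<le> C * (1 / real n) * (1 / av\<^sup>2 * 1)"
      by (rule mult_mono[OF order.trans[OF xx_inner_le \<zeta>[OF that]] mult_mono[OF wt_bound[OF n] xx_norm]])
        (use C0 n0 in simp_all)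
    then show ?thesis by (simp add: abs_mult mult.assoc)
  qed
  have eq: "meanp n a i = ?c *\<^sub>R (\<Sum>j=1..n. \<Sum>k=1..n. E n j k a *\<^sub>R ?w j k)" for a
    unfolding meanp_def \<eta>_def inner_scaleR_right inner_sum_right scaleR_sum_right scaleR_sum_left sum_distrib_left
    by (intro sum.cong refl) (simp add: mult_ac)
  have "mean n (\<lambda>a. (norm (meanp n a i))\<^sup>2) = ?c\<^sup>2 * mean n (\<lambda>a. (norm (\<Sum>j=1..n. \<Sum>k=1..n. E n j k a *\<^sub>R ?w j k))\<^sup>2)"
    by (simp only: eq norm_scaleR power_mult_distrib power2_abs integral_mult_right_zero)
  also have "\<dots> \<le> ?c\<^sup>2 * (10 * (real n)\<^sup>2 * (C * (1 / real n) * (1 / av\<^sup>2))\<^sup>2)"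
    by (intro mult_left_mono moment_quad n wb) auto
  also have "\<dots> = 10 * C\<^sup>2 / av^4 / ((real n)\<^sup>2 * \<rho> n ^ 2)"
    using n0 r av(1) by (simp add: power_divide power_mult_distrib field_simps numeral_eq_Suc)
  also have "\<dots> \<le> 10 * C\<^sup>2 / av^4 / ((real n)\<^sup>2 * \<rho> n ^ 4)"
    using r n0 av(1) by (intro divide_left_mono mult_left_mono power_decreasing) auto
  finally show ?thesis .
qed

text \<open>Fourth moments are needed because \<open>rowp\<close> enters \<open>U\<close> squared
  and \<open>U\<close> is squared once more. The constant is 32 * 2^4.\<close>

lemma mean_rowp:
  assumes n: "n \<ge> 1" and i: "i \<in> {1..n}"
  shows "mean n (\<lambda>a. (norm (rowp n a i k))^4) \<le> 512 / av^8 / ((real n)\<^sup>2 * \<rho> n ^ 4)"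
proof -
  have r: "0 < \<rho> n" "\<rho> n \<le> 1" using \<rho>01[OF n] by auto
  have n0: "real n > 0" using n by simp
  let ?c = "1 / (real n * \<rho> n)"
  have wb: "norm ((wd n i j * (xx j $ k)) *\<^sub>R xx j) \<le> 2 / av\<^sup>2" for j
  proof -
    have "\<bar>wd n i j\<bar> * \<bar>xx j $ k\<bar> * norm (xx j) \<le> 2 / av\<^sup>2 * 1 * 1"
      by (rule mult_mono[OF mult_mono[OF wd_bound[OF n] order.trans[OF component_le_norm_cart xx_norm]] xx_norm]) simp_all
    then show ?thesis by (simp add: abs_mult)
  qed
  have "mean n (\<lambda>a. (norm (rowp n a i k))^4) = ?c^4 * mean n (\<lambda>a. (norm (\<Sum>j=1..n. E n i j a *\<^sub>R ((wd n i j * (xx j $ k)) *\<^sub>R xx j)))^4)"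
    unfolding rowp_def using r by (simp add: power_mult_distrib power_divide)
  also have "\<dots> \<le> ?c^4 * (32 * (real n)\<^sup>2 * (2 / av\<^sup>2)^4)"
    using r by (intro mult_left_mono moment4 n i wb) auto
  also have "\<dots> = 512 / av^8 / ((real n)\<^sup>2 * \<rho> n ^ 4)"
    using n0 r av(1) by (simp add: power_divide power_mult_distrib field_simps numeral_eq_Suc)
  finally show ?thesis .
qed

text \<open>The leading 4 comes from squaring a sum of four terms. Of the four powers of the
  dimension, three come from the fourth power of a sum over coordinates and one from the
  summation.\<close>

definition CU :: real where
  "CU = 4 * (1 / av^4 + 180 * C\<^sup>2 / av^4 + 10 * C\<^sup>2 / av^4 + (real CARD('d))^4 * (512 / av^8))"

lemma mean_U_sq:
  assumes n: "n \<ge> 1" and i: "i \<in> {1..n}"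
  shows "mean n (\<lambda>a. (U n a i)\<^sup>2) \<le> CU / ((real n)\<^sup>2 * \<rho> n ^ 4)"
proof -
  have r: "0 < \<rho> n" "\<rho> n \<le> 1" using \<rho>01[OF n] by auto
  have n0: "real n > 0" using n by simp
  let ?q = "(real n)\<^sup>2 * \<rho> n ^ 4" and ?d = "real CARD('d)"
  have q0: "?q > 0" using r n0 by simp
  let ?u1 = "1 / (real n * \<rho> n * av\<^sup>2)"
  let ?s = "\<lambda>a. \<Sum>k\<in>UNIV. norm (rowp n a i k)"
  have sq4: "(t1 + t2 + t3 + t4)\<^sup>2 \<le> 4 * (t1\<^sup>2 + t2\<^sup>2 + t3\<^sup>2 + t4\<^sup>2)" for t1 t2 t3 t4 :: real
  proof -
    have "4 * (t1\<^sup>2 + t2\<^sup>2 + t3\<^sup>2 + t4\<^sup>2) - (t1 + t2 + t3 + t4)\<^sup>2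
      = (t1 - t2)\<^sup>2 + (t1 - t3)\<^sup>2 + (t1 - t4)\<^sup>2 + (t2 - t3)\<^sup>2 + (t2 - t4)\<^sup>2 + (t3 - t4)\<^sup>2" by algebra
    moreover have "\<dots> \<ge> 0" by simp
    ultimately show ?thesis by linarith
  qed
  have u1: "?u1\<^sup>2 \<le> (1 / av^4) / ?q"
  proof -
    have "?u1\<^sup>2 = (1 / av^4) / ((real n)\<^sup>2 * \<rho> n ^ 2)" by (simp add: power_divide power_mult_distrib mult_ac)
    also have "\<dots> \<le> (1 / av^4) / ?q"
      using r n0 av(1) by (intro divide_left_mono mult_left_mono power_decreasing) auto
    finally show ?thesis .
  qed
  have u4: "(\<rho> n * (?s a)\<^sup>2)\<^sup>2 \<le> ?d^3 * (\<Sum>k\<in>UNIV. (norm (rowp n a i k))^4)" for a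
  proof -
    have "(\<rho> n * (?s a)\<^sup>2)\<^sup>2 = (\<rho> n)\<^sup>2 * (?s a)^4" by (simp add: power_mult_distrib)
    also have "\<dots> \<le> 1 * (?d^3 * (\<Sum>k\<in>UNIV. (norm (rowp n a i k))^4))"
      using sum_fourth_le[of "\<lambda>k. norm (rowp n a i k)" UNIV] r by (intro mult_mono) (auto simp: power_le_one)
    finally show ?thesis by simp
  qed
  have "mean n (\<lambda>a. (U n a i)\<^sup>2) \<le> mean n (\<lambda>a. 4 * ((1 / av^4) / ?q + (norm (pathp n a i))\<^sup>2 + (norm (meanp n a i))\<^sup>2
     + ?d^3 * (\<Sum>k\<in>UNIV. (norm (rowp n a i k))^4)))"
  proof (rule mean_mono)
    fix a
    show "(U n a i)\<^sup>2 \<le> 4 * ((1 / av^4) / ?q + (norm (pathp n a i))\<^sup>2 + (norm (meanp n a i))\<^sup>2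
     + ?d^3 * (\<Sum>k\<in>UNIV. (norm (rowp n a i k))^4))"
      unfolding U_def by (rule order.trans[OF sq4]) (intro mult_left_mono add_mono u1 u4 order.refl, simp)
  qed
  also have "\<dots> = 4 * ((1 / av^4) / ?q + mean n (\<lambda>a. (norm (pathp n a i))\<^sup>2) + mean n (\<lambda>a. (norm (meanp n a i))\<^sup>2)
     + ?d^3 * (\<Sum>k\<in>UNIV. mean n (\<lambda>a. (norm (rowp n a i k))^4)))"
    by (simp add: mean_sum)
  also have "\<dots> \<le> 4 * ((1 / av^4) / ?q + 180 * C\<^sup>2 / av^4 / ?q + 10 * C\<^sup>2 / av^4 / ?q
     + ?d^3 * (\<Sum>k\<in>(UNIV::'d set). 512 / av^8 / ?q))"
    by (intro mult_left_mono add_mono mean_pathp mean_meanp sum_mono mean_rowp n i order.refl) auto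
  also have "\<dots> = CU / ?q"
    by (simp add: CU_def add_divide_distrib power3_eq_cube power4_eq_xxxx mult_ac)
  finally show ?thesis .
qed

definition Rem :: "nat \<Rightarrow> (nat \<times> nat \<Rightarrow> bool) \<Rightarrow> nat \<Rightarrow> real" where
  "Rem n a i = U n a i + 47 / (av^4 * \<rho> n) * ((norm (eps n a i))\<^sup>2 + (1 / real n) * (\<Sum>j=1..n. (norm (eps n a j))\<^sup>2))
    + 4 / (av\<^sup>2 * \<rho> n) * ((1 / real n) * (\<Sum>j=1..n. norm (\<tau> n a j)))"

text \<open>A sum of fourth powers below (\<delta> / 6)^4 forces each row error below \<delta> / 6,
  simultaneously for all rows.\<close>

lemma expansion:
  assumes n: "n \<ge> 1" and S: "S4 n a \<le> (\<delta> / 6)^4"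
  shows "one_step_expansion n (\<rho> n) \<delta> xx (eps n a) (\<lambda>i j. E n i j a)"
proof
  show "1 \<le> n" "0 < \<rho> n" "\<rho> n \<le> 1" "0 < \<delta>" using n \<rho>01[OF n] \<delta> by auto
  show "norm (xx i) \<le> 1" for i by (rule xx_norm)
  show "\<delta> \<le> xx i \<bullet> xx j \<and> xx i \<bullet> xx j \<le> 1 - \<delta>" for i j by (rule K_inner[OF xxK xxK])
  show "\<bar>E n i j a\<bar> \<le> 1" for i j by (rule abs_E_le[OF n])
  fix i assume i: "i \<in> {1..n}"
  have "(norm (eps n a i))^4 \<le> S4 n a" unfolding S4_def by (rule member_le_sum[OF i]) auto
  then have "(norm (eps n a i))^4 \<le> (\<delta> / 6)^4" using S by simp
  then show "norm (eps n a i) \<le> \<delta> / 6" by (rule power_le_imp_le_base[of _ 3, simplified]) (use \<delta> in simp_all)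
qed

text \<open>\<open>D\<close> is the error of the aligned one-step estimator and \<open>Z\<close> its leading term, a sum of
  independent vectors.\<close>

definition D :: "nat \<Rightarrow> (nat \<times> nat \<Rightarrow> bool) \<Rightarrow> nat \<Rightarrow> real^'d" where
  "D n a i = transpose (W n (adj_of a)) *v Xh n (adj_of a) i - sqrt (\<rho> n) *\<^sub>R x0 i"
definition Z :: "nat \<Rightarrow> (nat \<times> nat \<Rightarrow> bool) \<Rightarrow> nat \<Rightarrow> real^'d" where
  "Z n a i = matrix_inv (G (xx i)) *v (sqrt (\<rho> n) *\<^sub>R leadp n a i)"
definition q4 :: "nat \<Rightarrow> (nat \<times> nat \<Rightarrow> bool) \<Rightarrow> real" where "q4 n a = sqrt (sqrt (S4 n a))"

lemma eps_le_q4: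
  assumes "i \<in> {1..n}" shows "norm (eps n a i) \<le> q4 n a"
proof -
  have "(norm (eps n a i))^4 \<le> S4 n a" unfolding S4_def by (rule member_le_sum[OF assms]) auto
  then have "((norm (eps n a i))\<^sup>2)\<^sup>2 \<le> S4 n a" by simp
  then have "(norm (eps n a i))\<^sup>2 \<le> sqrt (S4 n a)" by (rule real_le_rsqrt)
  then show ?thesis unfolding q4_def by (rule real_le_rsqrt)
qed

text \<open>Subtracting the system solved by \<open>Z\<close> from that of the update gives info (D
  - Z) = \<rho>^(1/2) (rhs - lead) - (info - G) Z. The threshold \<open>\<kappa> / 2\<close> leaves
  \<open>info\<close> half of the coercivity of \<open>G\<close>.\<close>

lemma one_step_error:
  assumes n: "n \<ge> 1" and S: "S4 n a \<le> (\<delta> / 6)^4" and i: "i \<in> {1..n}"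
    and g: "norm (Gn n (\<rho> n) (xx i) - G (xx i)) \<le> g" and \<theta>: "g + 56 / av^4 * q4 n a \<le> \<kappa> / 2"
  shows "norm (D n a i - Z n a i) \<le> 2 / \<kappa> * (sqrt (\<rho> n) * Rem n a i + (g + 56 / av^4 * q4 n a) * norm (Z n a i))"
proof -
  interpret X: one_step_expansion n "\<rho> n" \<delta> xx "eps n a" "\<lambda>i j. E n i j a" by (rule expansion[OF n S])
  let ?A = "adj_of a" and ?\<theta> = "g + 56 / av^4 * q4 n a"
  let ?Q = "W n ?A"
  define y where "y j = transpose ?Q *v Xt n ?A j" for j
  have a_av: "X.a = av" by (simp add: X.a_def av_def)
  have r: "0 < \<rho> n" using \<rho>01[OF n] by simp
  \<comment> \<open>This is the linearization with the factor \<rho>^(1/2) taken out, the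
    normalization built into \<open>eps\<close>.\<close>
  have y: "y j = sqrt (\<rho> n) *\<^sub>R X.z j" if j: "j \<in> {1..n}" for j
  proof -
    have "(\<Sum>k=1..n. (?A j k - \<rho> n * (x0 j \<bullet> x0 k)) *\<^sub>R \<zeta> n j k) = (\<Sum>k=1..n. E n j k a *\<^sub>R \<zeta> n j k)"
    proof (rule sum.cong[OF refl])
      fix k assume k: "k \<in> {1..n}"
      show "(?A j k - \<rho> n * (x0 j \<bullet> x0 k)) *\<^sub>R \<zeta> n j k = E n j k a *\<^sub>R \<zeta> n j k"
        by (simp add: E_def P_def xx_eq[OF j] xx_eq[OF k])
    qed
    then have "y j = sqrt (\<rho> n) *\<^sub>R x0 j + (1 / sqrt (\<rho> n)) *\<^sub>R (\<Sum>k=1..n. E n j k a *\<^sub>R \<zeta> n j k) + R n ?A j"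
      using linearization[OF j, of ?A] unfolding y_def by (simp add: algebra_simps)
    moreover have "sqrt (\<rho> n) *\<^sub>R X.z j = sqrt (\<rho> n) *\<^sub>R x0 j + (sqrt (\<rho> n) * (1 / \<rho> n)) *\<^sub>R (\<Sum>k=1..n. E n j k a *\<^sub>R \<zeta> n j k)
      + (sqrt (\<rho> n) * (1 / sqrt (\<rho> n))) *\<^sub>R R n ?A j"
      unfolding X.z_def eps_def \<eta>_def \<tau>_def xx_eq[OF j] by (simp add: scaleR_add_right)
    moreover have "sqrt (\<rho> n) * (1 / \<rho> n) = 1 / sqrt (\<rho> n)" "sqrt (\<rho> n) * (1 / sqrt (\<rho> n)) = 1"
      using r by (simp_all add: field_simps)
    ultimately show ?thesis by simp
  qed
  have Gn_eq: "(1 / real n) *\<^sub>R (\<Sum>j=1..n. fisher_weight (\<rho> n) (xx i \<bullet> xx j) *\<^sub>R outer (xx j) (xx j)) = Gn n (\<rho> n) (xx i)"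
    unfolding Gn_def by (rule arg_cong[where f = "(*\<^sub>R) (1 / real n)"], rule sum.cong) (auto simp: xx_eq)
  have pert: "norm (X.info i - G (xx i)) \<le> ?\<theta>"
  proof -
    have "norm (X.info i - Gn n (\<rho> n) (xx i)) \<le> 56 / X.a^4 * q4 n a"
      unfolding Gn_eq[symmetric] by (rule X.info_perturbation[OF i]) (rule eps_le_q4)
    then show ?thesis
      using norm_triangle_ineq[of "X.info i - Gn n (\<rho> n) (xx i)" "Gn n (\<rho> n) (xx i) - G (xx i)"] g
      unfolding a_av by simp
  qed
  have coX: "coercive (\<kappa> / 2) (X.info i)"
    by (rule coercive_perturb[OF G_coercive[OF xxK] order.trans[OF pert \<theta>]])
  have inf: "one_step_information n y i = X.info i"
    by (rule X.one_step_information_eq) (use i y in auto)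
  have coXt: "coercive (\<kappa> / 2) (one_step_information n (Xt n ?A) i)"
    by (rule coercive_rotate[OF orth y_def]) (use coX inf in simp)
  have inner_y: "Xt n ?A i \<bullet> Xt n ?A j = y i \<bullet> y j" for j
    unfolding y_def orthogonal_inner_transpose[OF orth] ..
  \<comment> \<open>The formula for \<open>Xh\<close> is available only once this holds. The
    denominators are inner products, so they agree with those of the aligned rows.\<close>
  have "one_step_well_defined n (Xt n ?A) i"
    unfolding one_step_well_defined_def inner_y
  proof (intro conjI ballI coercive_invertible[OF coXt])
    fix j assume "j \<in> {1..n}"
    then show "(y i \<bullet> y j) * (1 - y i \<bullet> y j) \<noteq> 0"
      using X.one_step_denominator(3)[of i y j] i y by blast
  qed
  then have Xh: "Xh n ?A i = Xt n ?A i + matrix_inv (one_step_information n (Xt n ?A) i) *v one_step_score n ?A (Xt n ?A) i"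
    using one_step i unfolding one_step_estimator_def by blast
  define p0 where "p0 = matrix_inv (one_step_information n (Xt n ?A) i) *v one_step_score n ?A (Xt n ?A) i"
  have p0: "one_step_information n (Xt n ?A) i *v p0 = one_step_score n ?A (Xt n ?A) i"
    unfolding p0_def by (simp add: matrix_vector_mul_assoc matrix_inv_mult(1)[OF coercive_invertible[OF coXt]])
  have "one_step_information n y i *v (transpose ?Q *v p0) = one_step_score n ?A y i"
    unfolding one_step_information_rotate[OF orth y_def] one_step_score_rotate[OF orth y_def] p0 ..
  then have sys: "X.info i *v (y i + transpose ?Q *v p0 - sqrt (\<rho> n) *\<^sub>R xx i) = sqrt (\<rho> n) *\<^sub>R X.rhs i"
    by (intro X.one_step_linear_system[OF i y]) (use i in \<open>auto simp: E_def P_def\<close>)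
  have Deq: "D n a i = y i + transpose ?Q *v p0 - sqrt (\<rho> n) *\<^sub>R xx i"
    unfolding D_def Xh p0_def[symmetric] y_def xx_eq[OF i] by (simp add: matrix_vector_right_distrib)
  have lead: "X.lead i = leadp n a i" by (simp add: X.lead_def leadp_def wt_def)
  have GZ: "G (xx i) *v Z n a i = sqrt (\<rho> n) *\<^sub>R leadp n a i"
    unfolding Z_def by (simp add: matrix_vector_mul_assoc matrix_inv_mult(1)[OF coercive_invertible[OF G_coercive[OF xxK]]])
  have "X.info i *v (D n a i - Z n a i) = sqrt (\<rho> n) *\<^sub>R (X.rhs i - X.lead i) - (X.info i - G (xx i)) *v Z n a i"
    unfolding matrix_vector_mult_diff_distrib matrix_vector_mult_diff_rdistrib GZ sys[folded Deq] lead
    by (simp add: scaleR_diff_right)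
  then have "norm (X.info i *v (D n a i - Z n a i)) \<le> sqrt (\<rho> n) * norm (X.rhs i - X.lead i) + norm ((X.info i - G (xx i)) *v Z n a i)"
    using norm_triangle_ineq4[of "sqrt (\<rho> n) *\<^sub>R (X.rhs i - X.lead i)" "(X.info i - G (xx i)) *v Z n a i"] r by simp
  moreover have "norm ((X.info i - G (xx i)) *v Z n a i) \<le> ?\<theta> * norm (Z n a i)"
    by (rule order.trans[OF norm_matrix_vector_le mult_right_mono[OF pert norm_ge_zero]])
  moreover have "norm (X.rhs i - X.lead i) \<le> Rem n a i"
  proof -
    have "X.path_part (\<eta> n a) i = pathp n a i" "X.mean_part (\<eta> n a) i = meanp n a i" "X.row_part i k = rowp n a i k" for k
      by (simp_all add: X.path_part_def pathp_def X.V_def Vv_def X.mean_part_def meanp_def X.row_part_def rowp_def wt_def wd_def)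
    then show ?thesis
      using X.remainder_bound[where i = i and \<eta> = "\<eta> n a" and \<tau> = "\<tau> n a"] i
      by (simp add: Rem_def U_def a_av eps_def)
  qed
  then have "sqrt (\<rho> n) * norm (X.rhs i - X.lead i) \<le> sqrt (\<rho> n) * Rem n a i"
    using r by (intro mult_left_mono) auto
  moreover have "\<kappa> / 2 * norm (D n a i - Z n a i) \<le> norm (X.info i *v (D n a i - Z n a i))"
    by (rule coercive_norm_le[OF coX])
  ultimately have "\<kappa> / 2 * norm (D n a i - Z n a i) \<le> sqrt (\<rho> n) * Rem n a i + ?\<theta> * norm (Z n a i)" by linarith
  then show ?thesis using \<kappa>_pos by (simp add: field_simps)
qed

end

section \<open>A quantitative central limit theorem\<close>

text \<open>For the upper bound, exp x dominates 1 + x + x^2/2, and (1 - x + x^2/2)(1 + x + x^2/2) =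
  1 + x^4/4 is at least 1.\<close>

lemma exp_minus_quadratic_bounds:
  fixes x :: real
  assumes "0 \<le> x"
  shows "\<bar>exp (- x) - (1 - x)\<bar> \<le> x\<^sup>2 / 2"
proof -
  have p: "1 + x + x\<^sup>2 / 2 > 0" using assms by (simp add: add_pos_nonneg)
  have "exp (- x) * (1 + x + x\<^sup>2 / 2) \<le> exp (- x) * exp x"
    using exp_lower_Taylor_quadratic[OF assms] by (intro mult_left_mono) auto
  also have "\<dots> = 1" by (simp add: exp_minus)
  also have "\<dots> \<le> (1 - x + x\<^sup>2 / 2) * (1 + x + x\<^sup>2 / 2)"
  proof -
    have "(1 - x + x\<^sup>2 / 2) * (1 + x + x\<^sup>2 / 2) = 1 + x^4 / 4" by (simp add: field_simps power2_eq_square power4_eq_xxxx)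
    then show ?thesis by simp
  qed
  finally have "exp (- x) \<le> 1 - x + x\<^sup>2 / 2" using p by simp
  moreover have "1 - x \<le> exp (- x)" using exp_ge_add_one_self[of "- x"] by simp
  ultimately show ?thesis by (simp add: abs_le_iff)
qed

context bernoulli_product
begin

text \<open>The characteristic function of \<open>xi e\<close> at \<open>c\<close>.\<close>

definition char_factor :: "real \<Rightarrow> 'a \<Rightarrow> complex" where
  "char_factor c e = of_real (q e) * cis (c * (1 - q e)) + of_real (1 - q e) * cis (- (c * q e))"

text \<open>The phase \<open>s\<close> is arbitrary so that the value of a newly drawn edge can be
  absorbed into the phase for the remaining ones.\<close>

lemma ex_cos_linear:
  assumes "finite J" "J \<subseteq> I"
  shows "ex (\<lambda>\<omega>. cos ((\<Sum>e\<in>J. c e * xi e \<omega>) + s)) = Re (cis s * (\<Prod>e\<in>J. char_factor (c e) e))"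
  using assms
proof (induction J arbitrary: s)
  case (insert e J)
  define S where "S \<omega> = (\<Sum>e\<in>J. c e * xi e \<omega>)" for \<omega>
  let ?T = "\<Prod>e\<in>J. char_factor (c e) e"
  have Sind: "S (fun_upd \<omega> e b) = S \<omega>" for \<omega> b
    unfolding S_def by (intro sum.cong refl) (use insert in \<open>auto simp: xi_def\<close>)
  have e: "e \<in> I" "0 \<le> q e" "q e \<le> 1" using insert q01[of e] by auto
  let ?f = "\<lambda>\<omega>. cos (S \<omega> + (c e * xi e \<omega> + s))"
  have "ex ?f = ex (\<lambda>\<omega>. q e * ?f (fun_upd \<omega> e True) + (1 - q e) * ?f (fun_upd \<omega> e False))"
    unfolding pr_def by (rule expectation_Pi_pmf_resample[where q = q and e = e and I = I and f = ?f, OF fin e])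
  also have "\<dots> = q e * ex (\<lambda>\<omega>. cos (S \<omega> + (c e * (1 - q e) + s))) + (1 - q e) * ex (\<lambda>\<omega>. cos (S \<omega> + (- (c e * q e) + s)))"
    unfolding Sind by (simp add: xi_def ex_add)
  also have "\<dots> = q e * Re (cis (c e * (1 - q e) + s) * ?T) + (1 - q e) * Re (cis (- (c e * q e) + s) * ?T)"
    using insert by (simp add: S_def)
  also have "\<dots> = Re (cis s * (char_factor (c e) e * ?T))"
  proof -
    have "cis s * (char_factor (c e) e * ?T) = of_real (q e) * (cis (c e * (1 - q e) + s) * ?T) + of_real (1 - q e) * (cis (- (c e * q e) + s) * ?T)"
      unfolding char_factor_def cis_mult[symmetric] by (simp only: distrib_left distrib_right mult_ac)
    then show ?thesis by (simp only: plus_complex.simps Re_complex_of_real times_complex.simps Im_complex_of_real mult_zero_left diff_zero)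
  qed
  finally show ?case using insert by (simp add: S_def add_ac)
qed simp

lemma norm_char_factor_le: "norm (char_factor c e) \<le> 1"
proof -
  have "norm (char_factor c e) \<le> norm (of_real (q e) * cis (c * (1 - q e))) + norm (of_real (1 - q e) * cis (- (c * q e)))"
    unfolding char_factor_def by (rule norm_triangle_ineq)
  also have "\<dots> = q e + (1 - q e)" using q01[of e] by (simp only: norm_mult norm_of_real norm_cis) simp
  finally show ?thesis by simp
qed

text \<open>First-order terms cancel as the edge is centred. The absolute third moment q (1 - q) ((1
  - q)^2 + q^2) is at most the variance, so the error stays proportional to the variance even for
  sparse edges.\<close>

lemma char_factor_approx:
  "norm (char_factor c e - of_real (1 - c\<^sup>2 * (q e * (1 - q e)) / 2)) \<le> \<bar>c\<bar>^3 * (q e * (1 - q e)) / 6"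
proof -
  let ?q = "q e"
  have q: "0 \<le> ?q" "?q \<le> 1" using q01[of e] by auto
  then have q': "0 \<le> 1 - ?q" by simp
  define r where "r x = cis x - (1 + \<i> * of_real x - of_real (x\<^sup>2 / 2))" for x :: real
  have r: "norm (r x) \<le> \<bar>x\<bar>^3 / 6" for x
  proof -
    have "(\<Sum>k\<le>2. (\<i> * complex_of_real x)^k / fact k) = 1 + \<i> * of_real x - of_real (x\<^sup>2 / 2)"
      by (simp add: numeral_2_eq_2 power2_eq_square complex_eq_iff)
    then show ?thesis using iexp_approx1[of x 2] by (simp add: r_def cis_conv_exp eval_nat_numeral)
  qed
  have cis_r: "cis x = 1 + \<i> * of_real x - of_real (x\<^sup>2 / 2) + r x" for x by (simp add: r_def)
  have "char_factor c e - of_real (1 - c\<^sup>2 * (?q * (1 - ?q)) / 2) = of_real ?q * r (c * (1 - ?q)) + of_real (1 - ?q) * r (- (c * ?q))"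
    unfolding char_factor_def cis_r
    by (simp add: complex_eq_iff) (simp add: field_simps power2_eq_square)
  also have "norm \<dots> \<le> ?q * (\<bar>c * (1 - ?q)\<bar>^3 / 6) + (1 - ?q) * (\<bar>- (c * ?q)\<bar>^3 / 6)"
  proof (rule order.trans[OF norm_triangle_ineq add_mono])
    show "norm (of_real ?q * r (c * (1 - ?q))) \<le> ?q * (\<bar>c * (1 - ?q)\<bar>^3 / 6)"
      unfolding norm_mult norm_of_real abs_of_nonneg[OF q(1)] by (rule mult_left_mono[OF r q(1)])
    show "norm (of_real (1 - ?q) * r (- (c * ?q))) \<le> (1 - ?q) * (\<bar>- (c * ?q)\<bar>^3 / 6)"
      unfolding norm_mult norm_of_real abs_of_nonneg[OF q'] by (rule mult_left_mono[OF r q'])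
  qed
  also have "\<dots> = \<bar>c\<bar>^3 / 6 * (?q * (1 - ?q)) * ((1 - ?q)\<^sup>2 + ?q\<^sup>2)"
  proof -
    have *: "\<bar>c * (1 - ?q)\<bar> = \<bar>c\<bar> * (1 - ?q)" "\<bar>- (c * ?q)\<bar> = \<bar>c\<bar> * ?q" using q by (simp_all add: abs_mult)
    have "x * ((k * (1 - x))^3 / 6) + (1 - x) * ((k * x)^3 / 6) = k^3 / 6 * (x * (1 - x)) * ((1 - x)\<^sup>2 + x\<^sup>2)" for k x :: real
      by (simp add: field_simps power2_eq_square power3_eq_cube)
    then show ?thesis unfolding * .
  qed
  also have "\<dots> \<le> \<bar>c\<bar>^3 / 6 * (?q * (1 - ?q)) * 1"
  proof (rule mult_left_mono)
    have "(1 - ?q)\<^sup>2 \<le> (1 - ?q) * 1" "?q\<^sup>2 \<le> ?q * 1"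
      unfolding power2_eq_square using q by (intro mult_left_mono; simp)+
    from add_mono[OF this] show "(1 - ?q)\<^sup>2 + ?q\<^sup>2 \<le> 1" by simp
  qed (use q in simp)
  finally show ?thesis by simp
qed

text \<open>Factors are exchanged one by one for Gaussian ones; all have modulus at most 1, so the
  products differ by at most the sum of the single differences. Per unit of variance the edge costs
  cm / 6 and the Gaussian factor cm^2 / 8.\<close>

lemma clt_cos_bound:
  assumes "finite A" "inj_on m A" "m ` A \<subseteq> I" "\<And>a. a \<in> A \<Longrightarrow> \<bar>c a\<bar> \<le> cm" "0 \<le> cm"
  defines "V \<equiv> \<Sum>a\<in>A. (c a)\<^sup>2 * (q (m a) * (1 - q (m a)))"
  shows "\<bar>ex (\<lambda>\<omega>. cos ((\<Sum>a\<in>A. c a * xi (m a) \<omega>) + s)) - exp (- V / 2) * cos s\<bar> \<le> (cm / 6 + cm\<^sup>2 / 8) * V"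
proof -
  let ?v = "\<lambda>a. (c a)\<^sup>2 * (q (m a) * (1 - q (m a)))"
  let ?\<phi> = "\<lambda>a. char_factor (c a) (m a)" and ?\<psi> = "\<lambda>a. complex_of_real (exp (- ?v a / 2))"
  have v0: "0 \<le> ?v a" for a using q01[of "m a"] by simp
  have fJ: "finite (m ` A)" using assms(1) by simp
  let ?c' = "c \<circ> inv_into A m"
  have "ex (\<lambda>\<omega>. cos ((\<Sum>a\<in>A. c a * xi (m a) \<omega>) + s)) = ex (\<lambda>\<omega>. cos ((\<Sum>e\<in>m ` A. ?c' e * xi e \<omega>) + s))"
    using assms(2) by (simp add: sum.reindex)
  also have "\<dots> = Re (cis s * (\<Prod>e\<in>m ` A. char_factor (?c' e) e))"
    by (rule ex_cos_linear[OF fJ assms(3)])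
  also have "(\<Prod>e\<in>m ` A. char_factor (?c' e) e) = (\<Prod>a\<in>A. ?\<phi> a)"
    using assms(2) by (simp add: prod.reindex)
  finally have ex: "ex (\<lambda>\<omega>. cos ((\<Sum>a\<in>A. c a * xi (m a) \<omega>) + s)) = Re (cis s * (\<Prod>a\<in>A. ?\<phi> a))" .
  have "(\<Prod>a\<in>A. ?\<psi> a) = of_real (exp (\<Sum>a\<in>A. - ?v a / 2))"
    using assms(1) by (simp add: exp_sum)
  also have "(\<Sum>a\<in>A. - ?v a / 2) = - V / 2" unfolding V_def by (simp add: sum_negf sum_divide_distrib)
  finally have psi: "exp (- V / 2) * cos s = Re (cis s * (\<Prod>a\<in>A. ?\<psi> a))" by simp
  have each: "norm (?\<phi> a - ?\<psi> a) \<le> (cm / 6 + cm\<^sup>2 / 8) * ?v a" if "a \<in> A" for a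
  proof -
    have ca: "\<bar>c a\<bar> \<le> cm" by (rule assms(4)[OF that])
    have "norm (?\<phi> a - ?\<psi> a) \<le> norm (?\<phi> a - of_real (1 - ?v a / 2)) + norm (of_real (1 - ?v a / 2) - ?\<psi> a)"
      using norm_triangle_ineq[of "?\<phi> a - of_real (1 - ?v a / 2)" "of_real (1 - ?v a / 2) - ?\<psi> a"]
      by (simp only: diff_add_eq_diff_diff_swap add_diff_eq diff_add_cancel)
    moreover have "norm (?\<phi> a - of_real (1 - ?v a / 2)) \<le> cm / 6 * ?v a"
    proof -
      have "norm (?\<phi> a - of_real (1 - ?v a / 2)) \<le> \<bar>c a\<bar>^3 * (q (m a) * (1 - q (m a))) / 6"
        by (rule char_factor_approx)
      also have "\<dots> = \<bar>c a\<bar> / 6 * ?v a" by (simp add: power3_eq_cube power2_eq_square mult_ac abs_mult_self_eq)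
      also have "\<dots> \<le> cm / 6 * ?v a" using ca v0 by (intro mult_right_mono divide_right_mono) auto
      finally show ?thesis .
    qed
    moreover have "norm (of_real (1 - ?v a / 2) - ?\<psi> a) \<le> cm\<^sup>2 / 8 * ?v a"
    proof -
      have "norm (of_real (1 - ?v a / 2) - ?\<psi> a) = \<bar>exp (- (?v a / 2)) - (1 - ?v a / 2)\<bar>"
        unfolding of_real_diff[symmetric] norm_of_real by (simp add: abs_minus_commute)
      also have "\<dots> \<le> (?v a / 2)\<^sup>2 / 2" using v0[of a] by (intro exp_minus_quadratic_bounds) simp
      also have "\<dots> = ?v a / 8 * ?v a" by (simp add: power2_eq_square)
      also have "\<dots> \<le> cm\<^sup>2 / 8 * ?v a"
      proof -
        have "?v a \<le> \<bar>c a\<bar>\<^sup>2 * 1" unfolding power2_abs using q_var_le[of "m a"] by (intro mult_left_mono) auto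
        also have "\<dots> \<le> cm\<^sup>2" using ca power_mono[OF ca, of 2] by simp
        finally show ?thesis using v0 by (intro mult_right_mono divide_right_mono) auto
      qed
      finally show ?thesis .
    qed
    ultimately show ?thesis by (simp add: distrib_right)
  qed
  have "\<bar>ex (\<lambda>\<omega>. cos ((\<Sum>a\<in>A. c a * xi (m a) \<omega>) + s)) - exp (- V / 2) * cos s\<bar>
     = \<bar>Re (cis s * ((\<Prod>a\<in>A. ?\<phi> a) - (\<Prod>a\<in>A. ?\<psi> a)))\<bar>"
    unfolding ex psi right_diff_distrib minus_complex.simps ..
  also have "\<dots> \<le> norm (cis s * ((\<Prod>a\<in>A. ?\<phi> a) - (\<Prod>a\<in>A. ?\<psi> a)))" by (rule abs_Re_le_cmod)
  also have "\<dots> = norm ((\<Prod>a\<in>A. ?\<phi> a) - (\<Prod>a\<in>A. ?\<psi> a))" by (simp add: norm_mult)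
  also have "\<dots> \<le> (\<Sum>a\<in>A. norm (?\<phi> a - ?\<psi> a))"
    by (rule norm_prod_diff) (use norm_char_factor_le v0 in auto)
  also have "\<dots> \<le> (\<Sum>a\<in>A. (cm / 6 + cm\<^sup>2 / 8) * ?v a)" by (rule sum_mono) (rule each)
  finally show ?thesis unfolding V_def by (simp add: sum_distrib_left)
qed

end

section \<open>Limit theorems for the one-step estimator\<close>

lemma abs_le_absI: "0 \<le> x \<Longrightarrow> x \<le> y \<Longrightarrow> \<bar>x\<bar> \<le> \<bar>y :: real\<bar>"
  by simp

text \<open>Off an unlikely event the two functions are close, and on it they differ by at most
  2.\<close>

lemma expectation_diff_tendsto:
  fixes f g :: "nat \<Rightarrow> 'a \<Rightarrow> real"
  assumes fin: "\<And>n. finite (set_pmf (M n))" and small: "small_in_prob M Y"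
    and d: "\<And>n a. \<bar>f n a - g n a\<bar> \<le> \<bar>Y n a\<bar>" and b: "\<And>n a. \<bar>f n a\<bar> \<le> 1" "\<And>n a. \<bar>g n a\<bar> \<le> 1"
  shows "(\<lambda>n. measure_pmf.expectation (M n) (f n) - measure_pmf.expectation (M n) (g n)) \<longlonglongrightarrow> 0"
proof (rule tendstoI)
  fix e :: real assume e: "e > 0"
  have int: "integrable (measure_pmf (M n)) (h :: 'a \<Rightarrow> real)" for n h
    by (rule integrable_measure_pmf_finite[OF fin])
  have "\<forall>\<^sub>F n in sequentially. measure (M n) {a. \<bar>Y n a\<bar> > e / 2} < e / 4"
    by (rule small_in_probD[OF small]) (use e in auto)
  then show "\<forall>\<^sub>F n in sequentially. dist (measure_pmf.expectation (M n) (f n) - measure_pmf.expectation (M n) (g n)) 0 < e"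
  proof eventually_elim
    case (elim n)
    let ?B = "{a. \<bar>Y n a\<bar> > e / 2}"
    have "\<bar>measure_pmf.expectation (M n) (f n) - measure_pmf.expectation (M n) (g n)\<bar> = \<bar>measure_pmf.expectation (M n) (\<lambda>a. f n a - g n a)\<bar>"
      by (subst Bochner_Integration.integral_diff[OF int int]) simp
    also have "\<dots> \<le> measure_pmf.expectation (M n) (\<lambda>a. \<bar>f n a - g n a\<bar>)" by (rule integral_abs_bound)
    also have "\<dots> \<le> measure_pmf.expectation (M n) (\<lambda>a. e / 2 + 2 * indicator ?B a)"
    proof (rule integral_mono[OF int int])
      fix a
      show "\<bar>f n a - g n a\<bar> \<le> e / 2 + 2 * indicator ?B a"
        using d[of n a] b[of n a] e by (auto simp: indicator_def)
    qed
    also have "\<dots> = e / 2 + 2 * measure (M n) ?B"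
      by (subst Bochner_Integration.integral_add[OF int int]) simp
    also have "\<dots> < e" using elim by simp
    finally show ?case by (simp add: dist_real_def)
  qed
qed

section \<open>Negligibility of the remainder\<close>

context rdpg_estimation
begin

definition gs :: "nat \<Rightarrow> real" where
  "gs n = Max ((\<lambda>i. norm (Gn n (\<rho> n) (xx i) - G (xx i))) ` {1..n})"

lemma gs_ge: "i \<in> {1..n} \<Longrightarrow> norm (Gn n (\<rho> n) (xx i) - G (xx i)) \<le> gs n"
  unfolding gs_def by (rule Max_ge) auto

lemma gs_nonneg: "n \<ge> 1 \<Longrightarrow> 0 \<le> gs n"
  using order.trans[OF norm_ge_zero gs_ge[of 1 n]] by simp

lemma gs_tendsto: "gs \<longlonglongrightarrow> 0"
proof (rule tendstoI)
  fix e :: real assume "e > 0"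
  then have "e / 2 > 0" by simp
  from Gn_uniform[OF this] ev3 show "\<forall>\<^sub>F n in sequentially. dist (gs n) 0 < e"
  proof eventually_elim
    case (elim n)
    have "gs n \<le> e / 2" unfolding gs_def using elim by (subst Max_le_iff) (auto simp: xxK)
    then show ?case using gs_nonneg[of n] elim \<open>e > 0\<close> by (simp add: dist_real_def)
  qed
qed

text \<open>\<open>th\<close> bounds the perturbation of the information matrix; on the event \<open>bad \<le> 1\<close> the one-step
  update is well defined at every vertex.\<close>

definition th :: "nat \<Rightarrow> (nat \<times> nat \<Rightarrow> bool) \<Rightarrow> real" where "th n a = gs n + 56 / av^4 * q4 n a"
definition bad :: "nat \<Rightarrow> (nat \<times> nat \<Rightarrow> bool) \<Rightarrow> real" where "bad n a = S4 n a / (\<delta> / 6)^4 + th n a / (\<kappa> / 2)"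

lemma q4_nonneg: "0 \<le> q4 n a" by (simp add: q4_def S4_nonneg)

lemma th_nonneg: "n \<ge> 1 \<Longrightarrow> 0 \<le> th n a"
  unfolding th_def using gs_nonneg q4_nonneg av by (intro add_nonneg_nonneg mult_nonneg_nonneg) auto

lemma small_S4': "small_in_prob M S4"
proof (rule small_in_prob_mono[OF small_S4])
  show "\<forall>\<^sub>F n in sequentially. \<forall>a. \<bar>S4 n a\<bar> \<le> \<bar>S4 n a / \<rho> n\<bar>"
    using ev3
  proof eventually_elim
    case (elim n)
    have "0 < \<rho> n" "\<rho> n \<le> 1" using \<rho>01[of n] elim by auto
    then show ?case using S4_nonneg by (auto simp: field_simps mult_left_le_one_le)
  qed
qed

lemma small_th: "small_in_prob M th"
proof -
  have "small_in_prob M q4" unfolding q4_def by (intro small_in_prob_sqrt) (rule small_S4')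
  then show ?thesis unfolding th_def
    by (intro small_in_prob_add small_in_prob_cmult small_in_prob_det gs_tendsto)
qed

lemma small_bad: "small_in_prob M bad"
  using small_in_prob_add[OF small_in_prob_cmult[OF small_S4', of "1 / (\<delta> / 6)^4"] small_in_prob_cmult[OF small_th, of "1 / (\<kappa> / 2)"]]
  unfolding bad_def by (simp add: mult.commute)

lemma DZ_sq:
  assumes n: "n \<ge> 1" and b: "\<bar>bad n a\<bar> \<le> 1" and i: "i \<in> {1..n}"
  shows "(norm (D n a i - Z n a i))\<^sup>2 \<le> 8 / \<kappa>\<^sup>2 * (\<rho> n * (Rem n a i)\<^sup>2 + (th n a)\<^sup>2 * (norm (Z n a i))\<^sup>2)"
proof -
  have r: "0 < \<rho> n" using \<rho>01[OF n] by simp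
  have p: "0 \<le> S4 n a / (\<delta> / 6)^4" "0 \<le> th n a / (\<kappa> / 2)"
    using S4_nonneg th_nonneg[OF n] \<delta> \<kappa>_pos by auto
  then have "S4 n a / (\<delta> / 6)^4 \<le> 1" "th n a / (\<kappa> / 2) \<le> 1" using b by (auto simp: bad_def)
  then have S: "S4 n a \<le> (\<delta> / 6)^4" and t: "th n a \<le> \<kappa> / 2" using \<delta> \<kappa>_pos by (auto simp: divide_le_eq)
  let ?p = "sqrt (\<rho> n) * Rem n a i" and ?q = "th n a * norm (Z n a i)"
  have "norm (D n a i - Z n a i) \<le> 2 / \<kappa> * (?p + ?q)"
    unfolding th_def by (rule one_step_error[OF n S i gs_ge[OF i] t[unfolded th_def]])
  then have "(norm (D n a i - Z n a i))\<^sup>2 \<le> (2 / \<kappa> * (?p + ?q))\<^sup>2" by (intro power_mono) auto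
  also have "\<dots> = 4 / \<kappa>\<^sup>2 * (?p + ?q)\<^sup>2" unfolding power_mult_distrib[of "2 / \<kappa>"] power_divide by simp
  also have "\<dots> \<le> 4 / \<kappa>\<^sup>2 * (2 * (?p\<^sup>2 + ?q\<^sup>2))"
    using sum_squares_bound[of ?p ?q] by (intro mult_left_mono) (auto simp: power2_sum)
  also have "\<dots> = 8 / \<kappa>\<^sup>2 * (\<rho> n * (Rem n a i)\<^sup>2 + (th n a)\<^sup>2 * (norm (Z n a i))\<^sup>2)"
    using r by (simp add: power_mult_distrib)
  finally show ?thesis .
qed

text \<open>Squared averages over rows are replaced by \<open>S4 n a / real n\<close> and
  \<open>T2 n a / real n\<close>, so that summing over the n rows returns \<open>S4\<close> and
  \<open>T2\<close> themselves.\<close>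

lemma Rem_sq:
  assumes n: "n \<ge> 1"
  shows "\<rho> n * (Rem n a i)\<^sup>2 \<le> 3 * (\<rho> n * (U n a i)\<^sup>2)
    + 6 * (47 / av^4)\<^sup>2 * (((norm (eps n a i))^4 + S4 n a / real n) / \<rho> n) + 3 * (4 / av\<^sup>2)\<^sup>2 * (T2 n a / \<rho> n / real n)"
proof -
  have r: "0 < \<rho> n" using \<rho>01[OF n] by simp
  have n0: "0 < real n" using n by simp
  let ?e = "(norm (eps n a i))\<^sup>2" and ?S = "\<Sum>j=1..n. (norm (eps n a j))\<^sup>2" and ?T = "\<Sum>j=1..n. norm (\<tau> n a j)"
  let ?v = "47 / (av^4 * \<rho> n) * (?e + (1 / real n) * ?S)" and ?w = "4 / (av\<^sup>2 * \<rho> n) * ((1 / real n) * ?T)"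
  have sq2: "(x + y)\<^sup>2 \<le> 2 * (x\<^sup>2 + y\<^sup>2)" for x y :: real
    using sum_squares_bound[of x y] by (simp add: power2_sum)
  have sq3: "(x + y + z)\<^sup>2 \<le> 3 * (x\<^sup>2 + y\<^sup>2 + z\<^sup>2)" for x y z :: real
  proof -
    have "3 * (x\<^sup>2 + y\<^sup>2 + z\<^sup>2) - (x + y + z)\<^sup>2 = (x - y)\<^sup>2 + (x - z)\<^sup>2 + (y - z)\<^sup>2" by algebra
    moreover have "\<dots> \<ge> 0" by simp
    ultimately show ?thesis by linarith
  qed
  have S: "((1 / real n) * ?S)\<^sup>2 \<le> S4 n a / real n"
  proof -
    have "?S\<^sup>2 \<le> real n * S4 n a"
      using sum_sq_le_card_sum_sq[of "\<lambda>j. (norm (eps n a j))\<^sup>2" "{1..n}"] by (simp add: S4_def)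
    then have "(1 / real n)\<^sup>2 * ?S\<^sup>2 \<le> (1 / real n)\<^sup>2 * (real n * S4 n a)" by (rule mult_left_mono) simp
    then show ?thesis using n0 unfolding power_mult_distrib by (simp add: power2_eq_square)
  qed
  have T: "((1 / real n) * ?T)\<^sup>2 \<le> T2 n a / real n"
  proof -
    have "?T\<^sup>2 \<le> real n * T2 n a"
      using sum_sq_le_card_sum_sq[of "\<lambda>j. norm (\<tau> n a j)" "{1..n}"] by (simp add: T2_def)
    then have "(1 / real n)\<^sup>2 * ?T\<^sup>2 \<le> (1 / real n)\<^sup>2 * (real n * T2 n a)" by (rule mult_left_mono) simp
    then show ?thesis using n0 unfolding power_mult_distrib by (simp add: power2_eq_square)
  qed
  have "\<rho> n * ?v\<^sup>2 \<le> \<rho> n * ((47 / (av^4 * \<rho> n))\<^sup>2 * (2 * (?e\<^sup>2 + S4 n a / real n)))"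
    unfolding power_mult_distrib[of "47 / (av^4 * \<rho> n)"]
    using r S by (intro mult_left_mono order.trans[OF sq2]) auto
  also have "\<dots> = 2 * (47 / av^4)\<^sup>2 * (((norm (eps n a i))^4 + S4 n a / real n) / \<rho> n)"
    using r av by (simp add: power_divide power_mult_distrib power2_eq_square[of "\<rho> n"])
  finally have v: "\<rho> n * ?v\<^sup>2 \<le> 2 * (47 / av^4)\<^sup>2 * (((norm (eps n a i))^4 + S4 n a / real n) / \<rho> n)" .
  have "\<rho> n * ?w\<^sup>2 \<le> \<rho> n * ((4 / (av\<^sup>2 * \<rho> n))\<^sup>2 * (T2 n a / real n))"
    unfolding power_mult_distrib[of "4 / (av\<^sup>2 * \<rho> n)"] using r T by (intro mult_left_mono) auto
  also have "\<dots> = (4 / av\<^sup>2)\<^sup>2 * (T2 n a / \<rho> n / real n)"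
    using r av by (simp add: power_divide power_mult_distrib power2_eq_square[of "\<rho> n"] mult_ac)
  finally have w: "\<rho> n * ?w\<^sup>2 \<le> (4 / av\<^sup>2)\<^sup>2 * (T2 n a / \<rho> n / real n)" .
  have "\<rho> n * (Rem n a i)\<^sup>2 \<le> \<rho> n * (3 * ((U n a i)\<^sup>2 + ?v\<^sup>2 + ?w\<^sup>2))"
    unfolding Rem_def using r by (intro mult_left_mono sq3) auto
  also have "\<dots> = 3 * (\<rho> n * (U n a i)\<^sup>2) + 3 * (\<rho> n * ?v\<^sup>2) + 3 * (\<rho> n * ?w\<^sup>2)" by algebra
  finally show ?thesis using v w by linarith
qed

lemma mean_rho_U:
  assumes "n \<ge> 1" "i \<in> {1..n}"
  shows "mean n (\<lambda>a. real n * (\<rho> n * (U n a i)\<^sup>2)) \<le> CU * (1 / (real n * \<rho> n ^ 3))"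
proof -
  have r: "0 < \<rho> n" using \<rho>01[OF assms(1)] by simp
  have "mean n (\<lambda>a. real n * (\<rho> n * (U n a i)\<^sup>2)) = real n * (\<rho> n * mean n (\<lambda>a. (U n a i)\<^sup>2))" by simp
  also have "\<dots> \<le> real n * (\<rho> n * (CU / ((real n)\<^sup>2 * \<rho> n ^ 4)))"
    using r by (intro mult_left_mono mean_U_sq assms) auto
  also have "\<dots> = CU * (1 / (real n * \<rho> n ^ 3))"
    using r assms(1) by (simp add: field_simps power2_eq_square numeral_eq_Suc)
  finally show ?thesis .
qed

lemma CU_rate: "(\<lambda>n. CU * (1 / (real n * \<rho> n ^ 3))) \<longlonglongrightarrow> 0"
  by (rule tendsto_mult_right_zero[OF inv_n_rho_tendsto]) simp

text \<open>\<open>U\<close> contributes 1 / (n \<rho>^3); the own errors of the rows and the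
  averaged ones contribute \<open>S4\<close> each.\<close>

lemma small_Rem_sum: "small_in_prob M (\<lambda>n a. \<Sum>i=1..n. \<rho> n * (Rem n a i)\<^sup>2)"
proof -
  have U: "small_in_prob M (\<lambda>n a. \<Sum>i=1..n. \<rho> n * (U n a i)\<^sup>2)"
  proof (rule small_in_prob_Markov[OF fin_M CU_rate])
    show "\<forall>\<^sub>F n in sequentially. mean n (\<lambda>a. \<bar>\<Sum>i=1..n. \<rho> n * (U n a i)\<^sup>2\<bar>) \<le> CU * (1 / (real n * \<rho> n ^ 3))"
      using ev3
    proof eventually_elim
      case (elim n)
      have r: "0 < \<rho> n" and n0: "0 < real n" using \<rho>01[of n] elim by auto
      have "real n * mean n (\<lambda>a. \<bar>\<Sum>i=1..n. \<rho> n * (U n a i)\<^sup>2\<bar>) = (\<Sum>i=1..n. mean n (\<lambda>a. real n * (\<rho> n * (U n a i)\<^sup>2)))"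
        using r by (simp add: abs_of_nonneg sum_nonneg mean_sum sum_distrib_left)
      also have "\<dots> \<le> (\<Sum>i=1..n. CU * (1 / (real n * \<rho> n ^ 3)))"
        by (intro sum_mono mean_rho_U) (use elim in auto)
      also have "\<dots> = real n * (CU * (1 / (real n * \<rho> n ^ 3)))" by simp
      finally show ?case using n0 by (simp only: mult_le_cancel_left_pos)
    qed
  qed
  let ?c = "6 * (47 / av^4)\<^sup>2" and ?c' = "3 * (4 / av\<^sup>2)\<^sup>2"
  show ?thesis
  proof (rule small_in_prob_mono[OF small_in_prob_add[OF small_in_prob_add[OF small_in_prob_cmult[OF U, of 3]
        small_in_prob_cmult[OF small_S4, of "2 * ?c"]] small_in_prob_cmult[OF small_T2_rho, of ?c']]])
    show "\<forall>\<^sub>F n in sequentially. \<forall>a. \<bar>\<Sum>i=1..n. \<rho> n * (Rem n a i)\<^sup>2\<bar>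
        \<le> \<bar>3 * (\<Sum>i=1..n. \<rho> n * (U n a i)\<^sup>2) + 2 * ?c * (S4 n a / \<rho> n) + ?c' * (T2 n a / \<rho> n)\<bar>"
      using ev3
    proof (eventually_elim, intro allI)
      fix n a assume n: "(3::nat) \<le> n"
      then have r: "0 < \<rho> n" and n0: "0 < real n" and n1: "n \<ge> 1" using \<rho>01[of n] by auto
      have "(\<Sum>i=1..n. \<rho> n * (Rem n a i)\<^sup>2) \<le> (\<Sum>i=1..n. 3 * (\<rho> n * (U n a i)\<^sup>2)
         + ?c * (((norm (eps n a i))^4 + S4 n a / real n) / \<rho> n) + ?c' * (T2 n a / \<rho> n / real n))"
        by (rule sum_mono) (rule Rem_sq[OF n1])
      also have "\<dots> = (\<Sum>i=1..n. 3 * (\<rho> n * (U n a i)\<^sup>2))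
         + (\<Sum>i=1..n. ?c * (((norm (eps n a i))^4 + S4 n a / real n) / \<rho> n)) + (\<Sum>i=1..n. ?c' * (T2 n a / \<rho> n / real n))"
        by (simp only: sum.distrib)
      also have "\<dots> = 3 * (\<Sum>i=1..n. \<rho> n * (U n a i)\<^sup>2)
         + ?c * ((\<Sum>i=1..n. (norm (eps n a i))^4 + S4 n a / real n) / \<rho> n) + ?c' * (\<Sum>i=1..n. T2 n a / \<rho> n / real n)"
        by (simp only: sum_distrib_left sum_divide_distrib)
      also have "\<dots> = 3 * (\<Sum>i=1..n. \<rho> n * (U n a i)\<^sup>2) + ?c * ((2 * S4 n a) / \<rho> n) + ?c' * (T2 n a / \<rho> n)"
        using n0 by (simp add: sum.distrib S4_def)
      finally have "(\<Sum>i=1..n. \<rho> n * (Rem n a i)\<^sup>2) \<le> 3 * (\<Sum>i=1..n. \<rho> n * (U n a i)\<^sup>2) + 2 * ?c * (S4 n a / \<rho> n) + ?c' * (T2 n a / \<rho> n)"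
        by simp
      moreover have "0 \<le> (\<Sum>i=1..n. \<rho> n * (Rem n a i)\<^sup>2)" using r by (intro sum_nonneg) simp
      ultimately show "\<bar>\<Sum>i=1..n. \<rho> n * (Rem n a i)\<^sup>2\<bar>
        \<le> \<bar>3 * (\<Sum>i=1..n. \<rho> n * (U n a i)\<^sup>2) + 2 * ?c * (S4 n a / \<rho> n) + ?c' * (T2 n a / \<rho> n)\<bar>" by linarith
    qed
  qed
qed

text \<open>Multiplication by n replaces the summation over rows. The averaged terms come out as in
  the sum, and the own error of the row is the subject of \<open>small_eps_fixed\<close>.\<close>

lemma small_Rem_fixed:
  assumes i: "i \<ge> 1"
  shows "small_in_prob M (\<lambda>n a. real n * (\<rho> n * (Rem n a i)\<^sup>2))"
proof -
  have evi: "\<forall>\<^sub>F n in sequentially. n \<ge> max 3 i" by (rule eventually_ge_at_top)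
  have U: "small_in_prob M (\<lambda>n a. real n * (\<rho> n * (U n a i)\<^sup>2))"
  proof (rule small_in_prob_Markov[OF fin_M CU_rate])
    show "\<forall>\<^sub>F n in sequentially. mean n (\<lambda>a. \<bar>real n * (\<rho> n * (U n a i)\<^sup>2)\<bar>) \<le> CU * (1 / (real n * \<rho> n ^ 3))"
      using evi
    proof eventually_elim
      case (elim n)
      have "0 < \<rho> n" using \<rho>01[of n] elim by auto
      then show ?case using mean_rho_U[of n i] elim i by (simp add: abs_mult)
    qed
  qed
  have e: "small_in_prob M (\<lambda>n a. (sqrt (real n / \<rho> n) * (norm (eps n a i))\<^sup>2)\<^sup>2)"
    by (rule small_in_prob_power[OF small_eps_fixed[OF i]]) simp
  let ?c = "6 * (47 / av^4)\<^sup>2" and ?c' = "3 * (4 / av\<^sup>2)\<^sup>2"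
  show ?thesis
  proof (rule small_in_prob_mono[OF small_in_prob_add[OF small_in_prob_add[OF small_in_prob_cmult[OF U, of 3]
        small_in_prob_cmult[OF small_in_prob_add[OF e small_S4], of ?c]] small_in_prob_cmult[OF small_T2_rho, of ?c']]])
    show "\<forall>\<^sub>F n in sequentially. \<forall>a. \<bar>real n * (\<rho> n * (Rem n a i)\<^sup>2)\<bar>
        \<le> \<bar>3 * (real n * (\<rho> n * (U n a i)\<^sup>2)) + ?c * ((sqrt (real n / \<rho> n) * (norm (eps n a i))\<^sup>2)\<^sup>2 + S4 n a / \<rho> n) + ?c' * (T2 n a / \<rho> n)\<bar>"
      using ev3
    proof (eventually_elim, intro allI)
      fix n a assume n: "(3::nat) \<le> n"
      then have r: "0 < \<rho> n" and n0: "0 < real n" and n1: "n \<ge> 1" using \<rho>01[of n] by auto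
      let ?e4 = "(norm (eps n a i))^4"
      have "real n * (\<rho> n * (Rem n a i)\<^sup>2) \<le> real n * (3 * (\<rho> n * (U n a i)\<^sup>2)
         + ?c * ((?e4 + S4 n a / real n) / \<rho> n) + ?c' * (T2 n a / \<rho> n / real n))"
        by (rule mult_left_mono[OF Rem_sq[OF n1]]) simp
      also have "\<dots> = 3 * (real n * (\<rho> n * (U n a i)\<^sup>2)) + ?c * (real n * ((?e4 + S4 n a / real n) / \<rho> n)) + ?c' * (real n * (T2 n a / \<rho> n / real n))"
        by (simp only: distrib_left mult_ac)
      also have "real n * ((?e4 + S4 n a / real n) / \<rho> n) = (sqrt (real n / \<rho> n) * (norm (eps n a i))\<^sup>2)\<^sup>2 + S4 n a / \<rho> n"
        using n0 r by (simp add: power_mult_distrib add_divide_distrib distrib_left)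
      also have "real n * (T2 n a / \<rho> n / real n) = T2 n a / \<rho> n" using n0 by simp
      finally have "real n * (\<rho> n * (Rem n a i)\<^sup>2) \<le> 3 * (real n * (\<rho> n * (U n a i)\<^sup>2)) + ?c * ((sqrt (real n / \<rho> n) * (norm (eps n a i))\<^sup>2)\<^sup>2 + S4 n a / \<rho> n) + ?c' * (T2 n a / \<rho> n)" .
      moreover have "0 \<le> real n * (\<rho> n * (Rem n a i)\<^sup>2)" using r by simp
      ultimately show "\<bar>real n * (\<rho> n * (Rem n a i)\<^sup>2)\<bar>
        \<le> \<bar>3 * (real n * (\<rho> n * (U n a i)\<^sup>2)) + ?c * ((sqrt (real n / \<rho> n) * (norm (eps n a i))\<^sup>2)\<^sup>2 + S4 n a / \<rho> n) + ?c' * (T2 n a / \<rho> n)\<bar>"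
        by linarith
    qed
  qed
qed

text \<open>An edge variance of at most \<open>\<rho> n\<close> cancels the power of \<rho> left by
  the normalization, so the bound is uniform in the sparsity.\<close>

lemma mean_Z:
  assumes n: "n \<ge> 1" and i: "i \<in> {1..n}"
  shows "mean n (\<lambda>a. real n * (norm (Z n a i))\<^sup>2) \<le> 1 / (av^4 * \<kappa>\<^sup>2)"
proof -
  have r: "0 < \<rho> n" using \<rho>01[OF n] by simp
  have n0: "0 < real n" using n by simp
  let ?L = "\<lambda>a. \<Sum>j\<in>{1..n}-{i}. E n i j a *\<^sub>R (wt n i j *\<^sub>R xx j)"
  have wb: "norm (wt n i j *\<^sub>R xx j) \<le> 1 / av\<^sup>2" for j
    using mult_mono[OF wt_bound[OF n, of i j] xx_norm[of j]] by simp
  have "real n * (norm (Z n a i))\<^sup>2 \<le> 1 / (real n * \<rho> n * \<kappa>\<^sup>2) * (norm (?L a))\<^sup>2" for a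
  proof -
    have "norm (Z n a i) \<le> norm (sqrt (\<rho> n) *\<^sub>R leadp n a i) / \<kappa>"
      unfolding Z_def by (rule coercive_inv_norm_le[OF G_coercive[OF xxK]])
    then have "real n * (norm (Z n a i))\<^sup>2 \<le> real n * (norm (sqrt (\<rho> n) *\<^sub>R leadp n a i) / \<kappa>)\<^sup>2"
      by (intro mult_left_mono power_mono) auto
    also have "\<dots> = real n * (\<rho> n * ((1 / (real n * \<rho> n))\<^sup>2 * (norm (?L a))\<^sup>2) / \<kappa>\<^sup>2)"
      using r by (simp add: leadp_def power_divide power_mult_distrib)
    also have "\<dots> = 1 / (real n * \<rho> n * \<kappa>\<^sup>2) * (norm (?L a))\<^sup>2"
      using r n0 \<kappa>_pos by (simp add: field_simps power2_eq_square)
    finally show ?thesis .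
  qed
  then have "mean n (\<lambda>a. real n * (norm (Z n a i))\<^sup>2) \<le> mean n (\<lambda>a. 1 / (real n * \<rho> n * \<kappa>\<^sup>2) * (norm (?L a))\<^sup>2)"
    by (rule mean_mono)
  also have "\<dots> = 1 / (real n * \<rho> n * \<kappa>\<^sup>2) * mean n (\<lambda>a. (norm (?L a))\<^sup>2)" by simp
  also have "\<dots> \<le> 1 / (real n * \<rho> n * \<kappa>\<^sup>2) * (\<rho> n * (real n * (1 / av\<^sup>2)\<^sup>2))"
    using r by (intro mult_left_mono moment_offdiag n i wb) auto
  also have "\<dots> = 1 / (av^4 * \<kappa>\<^sup>2)" using r n0 \<kappa>_pos av by (simp add: field_simps power2_eq_square numeral_eq_Suc)
  finally show ?thesis .
qed

lemma tight_Z_fixed: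
  assumes "i \<ge> 1"
  shows "tight_in_prob M (\<lambda>n a. real n * (norm (Z n a i))\<^sup>2)"
proof (rule tight_in_prob_Markov[OF fin_M])
  show "\<forall>\<^sub>F n in sequentially. mean n (\<lambda>a. \<bar>real n * (norm (Z n a i))\<^sup>2\<bar>) \<le> 1 / (av^4 * \<kappa>\<^sup>2)"
    using eventually_ge_at_top[of i] by eventually_elim (use mean_Z[of _ i] assms in simp)
qed

lemma tight_Z_sum: "tight_in_prob M (\<lambda>n a. \<Sum>i=1..n. (norm (Z n a i))\<^sup>2)"
proof (rule tight_in_prob_Markov[OF fin_M])
  show "\<forall>\<^sub>F n in sequentially. mean n (\<lambda>a. \<bar>\<Sum>i=1..n. (norm (Z n a i))\<^sup>2\<bar>) \<le> 1 / (av^4 * \<kappa>\<^sup>2)"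
    using ev3
  proof eventually_elim
    case (elim n)
    have n0: "0 < real n" using elim by simp
    have "real n * mean n (\<lambda>a. \<bar>\<Sum>i=1..n. (norm (Z n a i))\<^sup>2\<bar>) = (\<Sum>i=1..n. mean n (\<lambda>a. real n * (norm (Z n a i))\<^sup>2))"
      by (simp add: abs_of_nonneg sum_nonneg mean_sum sum_distrib_left)
    also have "\<dots> \<le> (\<Sum>i=1..n. 1 / (av^4 * \<kappa>\<^sup>2))"
      by (intro sum_mono mean_Z) (use elim in auto)
    also have "\<dots> = real n * (1 / (av^4 * \<kappa>\<^sup>2))" by simp
    finally show ?case using n0 by (simp only: mult_le_cancel_left_pos)
  qed
qed

lemma small_th_sq: "small_in_prob M (\<lambda>n a. (th n a)\<^sup>2)"
  by (rule small_in_prob_power[OF small_th]) simp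

text \<open>Where \<open>bad\<close> exceeds 1 the update may be arbitrary, but that event has
  vanishing probability. Elsewhere a vanishing perturbation multiplies the tight norm of the leading
  term.\<close>

lemma small_DZ_sum: "small_in_prob M (\<lambda>n a. \<Sum>i=1..n. (norm (D n a i - Z n a i))\<^sup>2)"
proof (rule small_in_prob_mono_on[OF small_in_prob_cmult[OF small_in_prob_add[OF small_Rem_sum
        small_in_prob_mult_tight[OF small_th_sq tight_Z_sum]], of "8 / \<kappa>\<^sup>2"] small_bad zero_less_one])
  show "\<forall>\<^sub>F n in sequentially. \<forall>a. \<bar>bad n a\<bar> \<le> 1 \<longrightarrow> \<bar>\<Sum>i=1..n. (norm (D n a i - Z n a i))\<^sup>2\<bar>
    \<le> \<bar>8 / \<kappa>\<^sup>2 * ((\<Sum>i=1..n. \<rho> n * (Rem n a i)\<^sup>2) + (th n a)\<^sup>2 * (\<Sum>i=1..n. (norm (Z n a i))\<^sup>2))\<bar>"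
    using ev3
  proof (eventually_elim, intro allI impI)
    fix n a assume n: "(3::nat) \<le> n" and b: "\<bar>bad n a\<bar> \<le> 1"
    have "(\<Sum>i=1..n. (norm (D n a i - Z n a i))\<^sup>2) \<le> (\<Sum>i=1..n. 8 / \<kappa>\<^sup>2 * (\<rho> n * (Rem n a i)\<^sup>2 + (th n a)\<^sup>2 * (norm (Z n a i))\<^sup>2))"
      by (rule sum_mono) (rule DZ_sq, use n b in auto)
    also have "\<dots> = 8 / \<kappa>\<^sup>2 * ((\<Sum>i=1..n. \<rho> n * (Rem n a i)\<^sup>2) + (th n a)\<^sup>2 * (\<Sum>i=1..n. (norm (Z n a i))\<^sup>2))"
      by (simp only: sum_distrib_left sum.distrib distrib_left)
    finally show "\<bar>\<Sum>i=1..n. (norm (D n a i - Z n a i))\<^sup>2\<bar>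
      \<le> \<bar>8 / \<kappa>\<^sup>2 * ((\<Sum>i=1..n. \<rho> n * (Rem n a i)\<^sup>2) + (th n a)\<^sup>2 * (\<Sum>i=1..n. (norm (Z n a i))\<^sup>2))\<bar>"
      by (rule abs_le_absI[OF sum_nonneg, rotated]) simp
  qed
qed

lemma small_DZ_fixed:
  assumes i: "i \<ge> 1"
  shows "small_in_prob M (\<lambda>n a. real n * (norm (D n a i - Z n a i))\<^sup>2)"
proof (rule small_in_prob_mono_on[OF small_in_prob_cmult[OF small_in_prob_add[OF small_Rem_fixed[OF i]
        small_in_prob_mult_tight[OF small_th_sq tight_Z_fixed[OF i]]], of "8 / \<kappa>\<^sup>2"] small_bad zero_less_one])
  show "\<forall>\<^sub>F n in sequentially. \<forall>a. \<bar>bad n a\<bar> \<le> 1 \<longrightarrow> \<bar>real n * (norm (D n a i - Z n a i))\<^sup>2\<bar>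
    \<le> \<bar>8 / \<kappa>\<^sup>2 * (real n * (\<rho> n * (Rem n a i)\<^sup>2) + (th n a)\<^sup>2 * (real n * (norm (Z n a i))\<^sup>2))\<bar>"
    using eventually_ge_at_top[of i]
  proof (eventually_elim, intro allI impI)
    fix n a assume n: "i \<le> n" and b: "\<bar>bad n a\<bar> \<le> 1"
    have "real n * (norm (D n a i - Z n a i))\<^sup>2 \<le> real n * (8 / \<kappa>\<^sup>2 * (\<rho> n * (Rem n a i)\<^sup>2 + (th n a)\<^sup>2 * (norm (Z n a i))\<^sup>2))"
      by (rule mult_left_mono[OF DZ_sq]) (use n b i in auto)
    also have "\<dots> = 8 / \<kappa>\<^sup>2 * (real n * (\<rho> n * (Rem n a i)\<^sup>2) + (th n a)\<^sup>2 * (real n * (norm (Z n a i))\<^sup>2))"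
      by (simp only: distrib_left mult_ac)
    finally show "\<bar>real n * (norm (D n a i - Z n a i))\<^sup>2\<bar>
      \<le> \<bar>8 / \<kappa>\<^sup>2 * (real n * (\<rho> n * (Rem n a i)\<^sup>2) + (th n a)\<^sup>2 * (real n * (norm (Z n a i))\<^sup>2))\<bar>"
      by (rule abs_le_absI[rotated]) simp
  qed
qed

end

lemma abs_cos_diff_le: "\<bar>cos x - cos y\<bar> \<le> \<bar>x - y :: real\<bar>"
proof -
  have "\<bar>cos x - cos y\<bar> = 2 * (\<bar>sin ((x + y) / 2)\<bar> * \<bar>sin ((y - x) / 2)\<bar>)"
    by (simp add: cos_diff_cos abs_mult)
  also have "\<dots> \<le> 2 * (1 * \<bar>(y - x) / 2\<bar>)"
    by (intro mult_left_mono mult_mono abs_sin_le_one abs_sin_x_le_abs_x) auto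
  finally show ?thesis by simp
qed

section \<open>Leading term: concentration of the loss and Gaussian limit of a row\<close>

context rdpg_estimation
begin

abbreviation Gi :: "nat \<Rightarrow> real^'d^'d" where "Gi i \<equiv> matrix_inv (G (xx i))"

lemma G_Gi: "G (xx i) *v (Gi i *v v) = v"
  by (simp add: matrix_vector_mul_assoc matrix_inv_mult(1)[OF coercive_invertible[OF G_coercive[OF xxK]]])

lemma Gi_commute: "v \<bullet> (Gi i *v w) = w \<bullet> (Gi i *v v)"
  using pos_def_commute[OF G_pos_def[OF xxK], of "Gi i *v v" i "Gi i *v w"] by (simp add: G_Gi inner_commute)

lemma norm_Gi_le: "norm (Gi i *v v) \<le> norm v / \<kappa>"
  by (rule coercive_inv_norm_le[OF G_coercive[OF xxK]])

text \<open>The coefficient of an edge in \<open>Z\<close>, up to the normalization 1 / (n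
  \<rho>^(1/2)).\<close>

definition bb :: "nat \<Rightarrow> nat \<Rightarrow> nat \<Rightarrow> real^'d" where "bb n i j = wt n i j *\<^sub>R (Gi i *v xx j)"

lemma norm_bb_le: "n \<ge> 1 \<Longrightarrow> norm (bb n i j) \<le> 1 / (av\<^sup>2 * \<kappa>)"
proof -
  assume n: "n \<ge> 1"
  have "norm (Gi i *v xx j) \<le> 1 / \<kappa>"
    using norm_Gi_le[of i "xx j"] divide_right_mono[OF xx_norm[of j], of \<kappa>] \<kappa>_pos by linarith
  then have "\<bar>wt n i j\<bar> * norm (Gi i *v xx j) \<le> 1 / av\<^sup>2 * (1 / \<kappa>)"
    by (intro mult_mono wt_bound n) auto
  then show ?thesis by (simp add: bb_def)
qed

lemma Z_eq:
  assumes "n \<ge> 1"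
  shows "Z n a i = (1 / (real n * sqrt (\<rho> n))) *\<^sub>R (\<Sum>j\<in>{1..n}-{i}. E n i j a *\<^sub>R bb n i j)"
proof -
  have r: "0 < \<rho> n" using \<rho>01[OF assms] by simp
  have lin: "linear ((*v) (Gi i))" by (rule matrix_vector_mul_linear)
  have s: "sqrt (\<rho> n) * (1 / (real n * \<rho> n)) = 1 / (real n * sqrt (\<rho> n))"
    using r assms by (simp add: field_simps)
  show ?thesis
    unfolding Z_def leadp_def scaleR_scaleR s linear_scale[OF lin] linear_sum[OF lin] bb_def ..
qed

text \<open>The Fisher weight is \<open>\<rho> n\<close> divided by the edge variance. Hence the
  weighted noise has, up to normalization, covariance close to \<open>G\<close>, and multiplication
  by the inverse on both sides leaves G^-1.\<close>

lemma P_var_wt: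
  assumes "n \<ge> 1"
  shows "P n i j * (1 - P n i j) * (wt n i j)\<^sup>2 = \<rho> n * wt n i j"
proof -
  let ?s = "xx i \<bullet> xx j"
  have r: "0 \<le> \<rho> n" "\<rho> n \<le> 1" using \<rho>01[OF assms] by auto
  have "av\<^sup>2 \<le> ?s * (1 - \<rho> n * ?s)" by (rule fisher_denom_ge(1)[OF av(1) xx_range r])
  then have "?s * (1 - \<rho> n * ?s) \<noteq> 0" using av by (smt (verit) zero_less_power)
  then show ?thesis by (simp add: P_def wt_def fisher_weight_def power2_eq_square)
qed

text \<open>The quadratic form of \<open>Gn\<close> at row i without its diagonal summand. At u = Gi
  t it is the variance of n^(1/2) t . Z for that row.\<close>

definition Qf :: "nat \<Rightarrow> nat \<Rightarrow> real^'d \<Rightarrow> real" where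
  "Qf n i u = (1 / real n) * (\<Sum>j\<in>{1..n}-{i}. wt n i j * (xx j \<bullet> u)\<^sup>2)"

lemma Qf_approx:
  assumes n: "n \<ge> 1" and i: "i \<in> {1..n}"
  shows "\<bar>Qf n i u - u \<bullet> (G (xx i) *v u)\<bar> \<le> (norm u)\<^sup>2 * (gs n + 1 / (real n * av\<^sup>2))"
proof -
  let ?d = "(1 / real n) * (wt n i i * (xx i \<bullet> u)\<^sup>2)"
  have n0: "0 < real n" using n by simp
  have "u \<bullet> (Gn n (\<rho> n) (xx i) *v u) = (1 / real n) * (\<Sum>j=1..n. wt n i j * (xx j \<bullet> u)\<^sup>2)"
    unfolding inner_Gn avg_def wt_def
    by (rule arg_cong[where f = "(*) (1 / real n)"], rule sum.cong)
      (auto simp: xx_eq power2_eq_square inner_commute)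
  also have "(\<Sum>j=1..n. wt n i j * (xx j \<bullet> u)\<^sup>2) = wt n i i * (xx i \<bullet> u)\<^sup>2 + (\<Sum>j\<in>{1..n}-{i}. wt n i j * (xx j \<bullet> u)\<^sup>2)"
    by (rule sum.remove) (use i in auto)
  finally have q: "Qf n i u - u \<bullet> (G (xx i) *v u) = u \<bullet> ((Gn n (\<rho> n) (xx i) - G (xx i)) *v u) - ?d"
    by (simp add: Qf_def distrib_left matrix_vector_mult_diff_rdistrib inner_diff_right)
  have "\<bar>u \<bullet> ((Gn n (\<rho> n) (xx i) - G (xx i)) *v u)\<bar> \<le> norm u * (gs n * norm u)"
    by (rule order.trans[OF Cauchy_Schwarz_ineq2 mult_left_mono[OF order.trans[OF norm_matrix_vector_le mult_right_mono[OF gs_ge[OF i]]]]])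
      auto
  moreover have "\<bar>?d\<bar> \<le> (1 / real n) * (1 / av\<^sup>2 * (norm u)\<^sup>2)"
  proof -
    have "(xx i \<bullet> u)\<^sup>2 \<le> (norm u)\<^sup>2" using power_mono[OF xx_inner_le[of i u], of 2] by simp
    then have "\<bar>wt n i i\<bar> * (xx i \<bullet> u)\<^sup>2 \<le> 1 / av\<^sup>2 * (norm u)\<^sup>2"
      by (intro mult_mono wt_bound n) auto
    from mult_left_mono[OF this, of "1 / real n"] show ?thesis by (simp add: abs_mult)
  qed
  ultimately have "\<bar>Qf n i u - u \<bullet> (G (xx i) *v u)\<bar> \<le> norm u * (gs n * norm u) + (1 / real n) * (1 / av\<^sup>2 * (norm u)\<^sup>2)"
    unfolding q by linarith
  also have "\<dots> = (norm u)\<^sup>2 * (gs n + 1 / (real n * av\<^sup>2))" by (simp add: power2_eq_square algebra_simps)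
  finally show ?thesis .
qed

lemma Qf_rate: "(\<lambda>n. gs n + 1 / (real n * av\<^sup>2)) \<longlonglongrightarrow> 0"
proof -
  have "(\<lambda>n. gs n + 1 / av\<^sup>2 * (1 / (real n * \<rho> n ^ 0))) \<longlonglongrightarrow> 0 + 1 / av\<^sup>2 * 0"
    by (intro tendsto_add gs_tendsto tendsto_mult tendsto_const inv_n_rho_tendsto) simp
  then show ?thesis by (simp add: mult.commute)
qed

text \<open>The mean of the summed squared norms of \<open>Z\<close>, by independence of the edges
  within a row.\<close>

definition vv :: "nat \<Rightarrow> real" where
  "vv n = 1 / ((real n)\<^sup>2 * \<rho> n) * (\<Sum>i=1..n. \<Sum>j\<in>{1..n}-{i}. P n i j * (1 - P n i j) * (norm (bb n i j))\<^sup>2)"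

text \<open>Squared norms are written in coordinates and \<open>Gi\<close> is moved across the inner
  product by symmetry, so that each row becomes a sum of values of \<open>Qf\<close> at the columns
  of \<open>Gi\<close>.\<close>

lemma vv_eq:
  assumes n: "n \<ge> 1"
  shows "vv n = (1 / real n) * (\<Sum>i=1..n. \<Sum>k\<in>UNIV. Qf n i (Gi i *v axis k 1))"
proof -
  have r: "0 < \<rho> n" using \<rho>01[OF n] by simp
  have n0: "0 < real n" using n by simp
  have nG: "(norm (Gi i *v w))\<^sup>2 = (\<Sum>k\<in>UNIV. (w \<bullet> (Gi i *v axis k 1))\<^sup>2)" for i w
  proof -
    have "(norm (Gi i *v w))\<^sup>2 = (\<Sum>k\<in>UNIV. ((Gi i *v w) $ k)\<^sup>2)"
      by (simp add: norm_vec_def L2_set_def sum_nonneg)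
    moreover have "(Gi i *v w) $ k = w \<bullet> (Gi i *v axis k 1)" for k
      using Gi_commute[of "axis k 1" i w] by (simp add: inner_axis')
    ultimately show ?thesis by simp
  qed
  have entry: "P n i j * (1 - P n i j) * (norm (bb n i j))\<^sup>2 = \<rho> n * (\<Sum>k\<in>UNIV. wt n i j * (xx j \<bullet> (Gi i *v axis k 1))\<^sup>2)" for i j
  proof -
    have "P n i j * (1 - P n i j) * (norm (bb n i j))\<^sup>2 = (P n i j * (1 - P n i j) * (wt n i j)\<^sup>2) * (norm (Gi i *v xx j))\<^sup>2"
      by (simp add: bb_def power_mult_distrib)
    also have "\<dots> = \<rho> n * (\<Sum>k\<in>UNIV. wt n i j * (xx j \<bullet> (Gi i *v axis k 1))\<^sup>2)"
      unfolding P_var_wt[OF n] nG by (simp add: sum_distrib_left mult.assoc)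
    finally show ?thesis .
  qed
  have row: "(\<Sum>j\<in>{1..n}-{i}. P n i j * (1 - P n i j) * (norm (bb n i j))\<^sup>2) = \<rho> n * real n * (\<Sum>k\<in>UNIV. Qf n i (Gi i *v axis k 1))" for i
  proof -
    have "(\<Sum>j\<in>{1..n}-{i}. P n i j * (1 - P n i j) * (norm (bb n i j))\<^sup>2)
      = \<rho> n * (\<Sum>k\<in>UNIV. \<Sum>j\<in>{1..n}-{i}. wt n i j * (xx j \<bullet> (Gi i *v axis k 1))\<^sup>2)"
      by (simp only: entry sum_distrib_left) (rule sum.swap)
    also have "\<dots> = \<rho> n * (\<Sum>k\<in>UNIV. real n * Qf n i (Gi i *v axis k 1))"
      using n0 by (simp add: Qf_def)
    finally show ?thesis by (simp add: sum_distrib_left mult.assoc)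
  qed
  show ?thesis
    unfolding vv_def row sum_distrib_left[symmetric] using r n0 by (simp add: power2_eq_square)
qed

text \<open>Up to the error of \<open>Qf_approx\<close>, row i contributes the sum over k of (Gi
  e_k) . G (Gi e_k), which is the trace of \<open>Gi\<close>. The average of the traces is a Riemann
  sum.\<close>

lemma vv_tendsto: "vv \<longlonglongrightarrow> (LINT x:latent_space|F. trace (matrix_inv (G_matrix \<rho>lim F x)))"
proof -
  let ?r = "\<lambda>n. real CARD('d) / \<kappa>\<^sup>2 * (gs n + 1 / (real n * av\<^sup>2))"
  have "(\<lambda>n. vv n - avg n tr_inv) \<longlonglongrightarrow> 0"
  proof (rule Lim_null_comparison[OF _ tendsto_mult_right_zero[OF Qf_rate]])
    show "\<forall>\<^sub>F n in sequentially. norm (vv n - avg n tr_inv) \<le> ?r n"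
      using ev3
    proof eventually_elim
      case (elim n)
      then have n: "n \<ge> 1" and n0: "0 < real n" by auto
      let ?u = "\<lambda>i k. Gi i *v axis k 1"
      have tr: "tr_inv (x0 i) = (\<Sum>k\<in>UNIV. ?u i k \<bullet> (G (xx i) *v ?u i k))" if "i \<in> {1..n}" for i
        unfolding tr_inv_def xx_eq[OF that, symmetric] trace_eq_axis G_Gi by (simp add: inner_commute)
      have "avg n tr_inv = (1 / real n) * (\<Sum>i=1..n. \<Sum>k\<in>UNIV. ?u i k \<bullet> (G (xx i) *v ?u i k))"
        unfolding avg_def by (rule arg_cong[where f = "(*) (1 / real n)"], rule sum.cong[OF refl tr])
      then have "vv n - avg n tr_inv = (1 / real n) * (\<Sum>i=1..n. \<Sum>k\<in>UNIV. Qf n i (?u i k) - ?u i k \<bullet> (G (xx i) *v ?u i k))"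
        unfolding vv_eq[OF n] by (simp only: sum_subtractf right_diff_distrib)
      also have "norm \<dots> \<le> (1 / real n) * (\<Sum>i=1..n. \<Sum>k\<in>(UNIV :: 'd set). (1 / \<kappa>)\<^sup>2 * (gs n + 1 / (real n * av\<^sup>2)))"
      proof -
        have "\<bar>Qf n i (?u i k) - ?u i k \<bullet> (G (xx i) *v ?u i k)\<bar> \<le> (1 / \<kappa>)\<^sup>2 * (gs n + 1 / (real n * av\<^sup>2))"
          if "i \<in> {1..n}" for i k
        proof (rule order.trans[OF Qf_approx[OF n that] mult_right_mono])
          have "norm (?u i k) \<le> 1 / \<kappa>" using norm_Gi_le[of i "axis k 1"] by simp
          then show "(norm (?u i k))\<^sup>2 \<le> (1 / \<kappa>)\<^sup>2" by (rule power_mono) simp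
        qed (use gs_nonneg[OF n] in simp)
        then have "\<bar>\<Sum>i=1..n. \<Sum>k\<in>UNIV. Qf n i (?u i k) - ?u i k \<bullet> (G (xx i) *v ?u i k)\<bar>
           \<le> (\<Sum>i=1..n. \<Sum>k\<in>(UNIV :: 'd set). (1 / \<kappa>)\<^sup>2 * (gs n + 1 / (real n * av\<^sup>2)))"
          by (intro order.trans[OF sum_abs] sum_mono) auto
        from mult_left_mono[OF this, of "1 / real n"] show ?thesis using n0 by (simp add: abs_mult)
      qed
      also have "\<dots> = ?r n" using n0 by (simp add: power_divide)
      finally show ?case .
    qed
  qed
  from tendsto_add[OF this avg_tr_inv_tendsto] show ?thesis by simp
qed

text \<open>Chebyshev: the variance bound n^3 against the normalization (n^2 \<rho>)^-2 leaves 1 /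
  (n \<rho>^2).\<close>

lemma small_Z_vv: "small_in_prob M (\<lambda>n a. (\<Sum>i=1..n. (norm (Z n a i))\<^sup>2) - vv n)"
proof -
  let ?X = "\<lambda>n a. ((\<Sum>i=1..n. (norm (Z n a i))\<^sup>2) - vv n)\<^sup>2"
  let ?c = "1 / (av\<^sup>2 * \<kappa>)"
  have "small_in_prob M ?X"
  proof (rule small_in_prob_Markov[OF fin_M])
    show "(\<lambda>n. 28 * ?c^4 * (1 / (real n * \<rho> n ^ 2))) \<longlonglongrightarrow> 0"
      by (rule tendsto_mult_right_zero[OF inv_n_rho_tendsto]) simp
    show "\<forall>\<^sub>F n in sequentially. mean n (\<lambda>a. \<bar>?X n a\<bar>) \<le> 28 * ?c^4 * (1 / (real n * \<rho> n ^ 2))"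
      using ev3
    proof eventually_elim
      case (elim n)
      then have n: "n \<ge> 1" and n0: "0 < real n" and r: "0 < \<rho> n" using \<rho>01[of n] by auto
      let ?k = "1 / ((real n)\<^sup>2 * \<rho> n)"
      let ?Y = "\<lambda>a. (\<Sum>i=1..n. (norm (\<Sum>j\<in>{1..n}-{i}. E n i j a *\<^sub>R bb n i j))\<^sup>2)
        - (\<Sum>i=1..n. \<Sum>j\<in>{1..n}-{i}. P n i j * (1 - P n i j) * (norm (bb n i j))\<^sup>2)"
      have Z2: "(norm (Z n a i))\<^sup>2 = ?k * (norm (\<Sum>j\<in>{1..n}-{i}. E n i j a *\<^sub>R bb n i j))\<^sup>2" for a i
        unfolding Z_eq[OF n] using r by (simp add: power_mult_distrib power_divide)
      have X: "?X n a = ?k\<^sup>2 * (?Y a)\<^sup>2" for a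
        unfolding Z2 vv_def sum_distrib_left[symmetric] right_diff_distrib[symmetric] power_mult_distrib ..
      have "mean n (\<lambda>a. \<bar>?X n a\<bar>) = ?k\<^sup>2 * mean n (\<lambda>a. (?Y a)\<^sup>2)"
        unfolding abs_power2 X by simp
      also have "\<dots> \<le> ?k\<^sup>2 * (28 * (real n)^3 * ?c^4)"
        by (intro mult_left_mono moment_concentration n norm_bb_le) auto
      also have "\<dots> = 28 * ?c^4 * (?k\<^sup>2 * (real n)^3)" by simp
      also have "?k\<^sup>2 * (real n)^3 = 1 / (real n * \<rho> n ^ 2)"
        using r n0 by (simp add: power_mult_distrib power_divide field_simps numeral_eq_Suc)
      finally show ?case .
    qed
  qed
  from small_in_prob_sqrt[OF this] show ?thesis by (rule small_in_prob_mono) simp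
qed

text \<open>In each row \<bar>D\<bar>^2 - \<bar>Z\<bar>^2 = \<bar>D - Z\<bar>^2 + 2 (D - Z) . Z, and
  the cross terms add up to at most twice the geometric mean of a vanishing and a tight sum.\<close>

lemma small_D_Z: "small_in_prob M (\<lambda>n a. (\<Sum>i=1..n. (norm (D n a i))\<^sup>2) - (\<Sum>i=1..n. (norm (Z n a i))\<^sup>2))"
proof -
  let ?Y = "\<lambda>n a. \<Sum>i=1..n. (norm (D n a i - Z n a i))\<^sup>2" and ?Z = "\<lambda>n a. \<Sum>i=1..n. (norm (Z n a i))\<^sup>2"
  have "small_in_prob M (\<lambda>n a. ?Y n a + 2 * sqrt (?Y n a * ?Z n a))"
    by (intro small_in_prob_add small_in_prob_cmult small_in_prob_sqrt small_in_prob_mult_tight small_DZ_sum tight_Z_sum)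
  then show ?thesis
  proof (rule small_in_prob_mono, intro always_eventually allI)
    fix n a
    have each: "\<bar>(norm (D n a i))\<^sup>2 - (norm (Z n a i))\<^sup>2\<bar> \<le> (norm (D n a i - Z n a i))\<^sup>2 + 2 * (norm (D n a i - Z n a i) * norm (Z n a i))" for i
    proof -
      let ?y = "D n a i - Z n a i"
      have "(norm (D n a i))\<^sup>2 - (norm (Z n a i))\<^sup>2 = (norm ?y)\<^sup>2 + 2 * (?y \<bullet> Z n a i)"
        by (simp add: power2_norm_eq_inner inner_diff_left inner_diff_right inner_commute)
      moreover have "\<bar>?y \<bullet> Z n a i\<bar> \<le> norm ?y * norm (Z n a i)" by (rule Cauchy_Schwarz_ineq2)
      ultimately show ?thesis by (smt (verit) zero_le_power2)
    qed
    have "\<bar>(\<Sum>i=1..n. (norm (D n a i))\<^sup>2) - ?Z n a\<bar> \<le> (\<Sum>i=1..n. \<bar>(norm (D n a i))\<^sup>2 - (norm (Z n a i))\<^sup>2\<bar>)"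
      unfolding sum_subtractf[symmetric] by (rule sum_abs)
    also have "\<dots> \<le> (\<Sum>i=1..n. (norm (D n a i - Z n a i))\<^sup>2 + 2 * (norm (D n a i - Z n a i) * norm (Z n a i)))"
      by (rule sum_mono) (rule each)
    also have "\<dots> = ?Y n a + 2 * (\<Sum>i=1..n. norm (D n a i - Z n a i) * norm (Z n a i))"
      by (simp add: sum.distrib sum_distrib_left)
    finally have "\<bar>(\<Sum>i=1..n. (norm (D n a i))\<^sup>2) - ?Z n a\<bar> \<le> ?Y n a + 2 * (\<Sum>i=1..n. norm (D n a i - Z n a i) * norm (Z n a i))" .
    moreover have "(\<Sum>i=1..n. norm (D n a i - Z n a i) * norm (Z n a i)) \<le> sqrt (?Y n a * ?Z n a)"
      by (rule real_le_rsqrt) (rule Cauchy_Schwarz_ineq_sum)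
    ultimately show "\<bar>(\<Sum>i=1..n. (norm (D n a i))\<^sup>2) - ?Z n a\<bar> \<le> \<bar>?Y n a + 2 * sqrt (?Y n a * ?Z n a)\<bar>"
      by linarith
  qed
qed

lemma small_loss:
  "small_in_prob M (\<lambda>n a. (\<Sum>i=1..n. (norm (D n a i))\<^sup>2) - (LINT x:latent_space|F. trace (matrix_inv (G_matrix \<rho>lim F x))))"
  (is "small_in_prob M (\<lambda>n a. _ - ?T)")
proof -
  have "(\<lambda>n. vv n - ?T) \<longlonglongrightarrow> 0" using vv_tendsto by (simp add: LIM_zero)
  from small_in_prob_add[OF small_in_prob_add[OF small_D_Z small_Z_vv] small_in_prob_det[OF this]]
  show ?thesis by simp
qed

text \<open>The linear form is a sum of independent edges with coefficients of order (n
  \<rho>)^(-1/2) and total variance \<open>Qf\<close> at u = Gi t, which tends to u . G u = t . Gi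
  t.\<close>

lemma cos_Z_tendsto:
  assumes i: "i \<ge> 1"
  shows "(\<lambda>n. mean n (\<lambda>a. cos (t \<bullet> (sqrt (real n) *\<^sub>R Z n a i) + s))) \<longlonglongrightarrow> exp (- (t \<bullet> (Gi i *v t)) / 2) * cos s"
proof -
  define u where "u = Gi i *v t"
  define cm where "cm n = norm t / (av\<^sup>2 * \<kappa>) * sqrt (1 / (real n * \<rho> n ^ 1))" for n
  have cm: "cm \<longlonglongrightarrow> 0"
    using tendsto_mult_right_zero[OF tendsto_real_sqrt[OF inv_n_rho_tendsto[of 1], simplified real_sqrt_zero], of "norm t / (av\<^sup>2 * \<kappa>)"]
    unfolding cm_def[abs_def] by simp
  have evi: "\<forall>\<^sub>F n in sequentially. n \<ge> i" by (rule eventually_ge_at_top)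
  have Q: "(\<lambda>n. Qf n i u) \<longlonglongrightarrow> t \<bullet> u"
  proof -
    have "(\<lambda>n. Qf n i u - t \<bullet> u) \<longlonglongrightarrow> 0"
    proof (rule Lim_null_comparison[OF _ tendsto_mult_right_zero[OF Qf_rate]])
      show "\<forall>\<^sub>F n in sequentially. norm (Qf n i u - t \<bullet> u) \<le> (norm u)\<^sup>2 * (gs n + 1 / (real n * av\<^sup>2))"
        using evi
      proof eventually_elim
        case (elim n)
        have "u \<bullet> (G (xx i) *v u) = t \<bullet> u" unfolding u_def G_Gi by (simp add: inner_commute)
        then show ?case using Qf_approx[of n i u] elim i by simp
      qed
    qed
    then show ?thesis by (simp add: LIM_zero_iff)
  qed
  let ?R = "\<lambda>n. (cm n / 6 + (cm n)\<^sup>2 / 8) * Qf n i u"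
  have R: "?R \<longlonglongrightarrow> 0"
    using tendsto_mult[OF tendsto_add[OF tendsto_divide[OF cm tendsto_const[of 6]] tendsto_divide[OF tendsto_power[OF cm, of 2] tendsto_const[of 8]]] Q]
    by simp
  have main: "(\<lambda>n. mean n (\<lambda>a. cos (t \<bullet> (sqrt (real n) *\<^sub>R Z n a i) + s)) - exp (- Qf n i u / 2) * cos s) \<longlonglongrightarrow> 0"
  proof (rule Lim_null_comparison[OF _ R])
    show "\<forall>\<^sub>F n in sequentially. norm (mean n (\<lambda>a. cos (t \<bullet> (sqrt (real n) *\<^sub>R Z n a i) + s)) - exp (- Qf n i u / 2) * cos s) \<le> ?R n"
      using evi
    proof eventually_elim
      case (elim n)
      then have n: "n \<ge> 1" and iN: "i \<in> {1..n}" using i by auto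
      have r: "0 < \<rho> n" using \<rho>01[OF n] by simp
      have n0: "0 < real n" using n by simp
      interpret g: bernoulli_graph n "P n" by (rule bg[OF n])
      let ?A = "{1..n} - {i}" and ?m = "\<lambda>j. mk_edge i j"
      define k where "k = 1 / sqrt (real n * \<rho> n)"
      have k0: "0 \<le> k" using r by (simp add: k_def)
      have k2: "k\<^sup>2 * (real n * \<rho> n) = 1" using r n0 by (simp add: k_def power_divide)
      define c where "c j = k * (t \<bullet> bb n i j)" for j
      have ks: "sqrt (real n) * (1 / (real n * sqrt (\<rho> n))) = k"
        using r n0 by (simp add: k_def real_sqrt_mult field_simps)
      have lin: "t \<bullet> (sqrt (real n) *\<^sub>R Z n a i) = (\<Sum>j\<in>?A. c j * g.xi (?m j) a)" for a
      proof -
        have "t \<bullet> (sqrt (real n) *\<^sub>R Z n a i) = k * (\<Sum>j\<in>?A. E n i j a * (t \<bullet> bb n i j))"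
          unfolding Z_eq[OF n] scaleR_scaleR ks by (simp add: inner_sum_right)
        also have "\<dots> = (\<Sum>j\<in>?A. c j * g.E i j a)"
          by (simp add: sum_distrib_left c_def E_bg[OF n] mult_ac)
        finally show ?thesis by (simp add: g.E_def)
      qed
      have cb: "\<bar>c j\<bar> \<le> cm n" for j
      proof -
        have "\<bar>t \<bullet> bb n i j\<bar> \<le> norm t * (1 / (av\<^sup>2 * \<kappa>))"
          by (rule order.trans[OF Cauchy_Schwarz_ineq2 mult_left_mono[OF norm_bb_le[OF n]]]) simp
        from mult_left_mono[OF this k0] show ?thesis
          using k0 by (simp add: c_def cm_def k_def abs_mult real_sqrt_divide mult.commute)
      qed
      have cm0: "0 \<le> cm n" using cb[of 1] by linarith
      have V: "(\<Sum>j\<in>?A. (c j)\<^sup>2 * ((\<lambda>(i, j). P n i j) (?m j) * (1 - (\<lambda>(i, j). P n i j) (?m j)))) = Qf n i u"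
      proof -
        have "(c j)\<^sup>2 * ((\<lambda>(i, j). P n i j) (?m j) * (1 - (\<lambda>(i, j). P n i j) (?m j))) = k\<^sup>2 * \<rho> n * (wt n i j * (xx j \<bullet> u)\<^sup>2)" for j
        proof -
          have tb: "t \<bullet> bb n i j = wt n i j * (xx j \<bullet> u)"
            unfolding bb_def u_def using Gi_commute[of t i "xx j"] by simp
          have "(c j)\<^sup>2 * ((\<lambda>(i, j). P n i j) (?m j) * (1 - (\<lambda>(i, j). P n i j) (?m j))) = k\<^sup>2 * (P n i j * (1 - P n i j) * (wt n i j)\<^sup>2) * (xx j \<bullet> u)\<^sup>2"
            unfolding g.var_mk_edge c_def tb by (simp add: power_mult_distrib mult_ac)
          then show ?thesis unfolding P_var_wt[OF n] by (simp add: mult_ac)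
        qed
        then have "(\<Sum>j\<in>?A. (c j)\<^sup>2 * ((\<lambda>(i, j). P n i j) (?m j) * (1 - (\<lambda>(i, j). P n i j) (?m j))))
          = k\<^sup>2 * \<rho> n * (\<Sum>j\<in>?A. wt n i j * (xx j \<bullet> u)\<^sup>2)" by (simp add: sum_distrib_left)
        moreover have "k\<^sup>2 * \<rho> n = 1 / real n" using k2 n0 by (simp add: field_simps)
        ultimately show ?thesis by (simp add: Qf_def)
      qed
      have "\<bar>g.ex (\<lambda>\<omega>. cos ((\<Sum>j\<in>?A. c j * g.xi (?m j) \<omega>) + s)) - exp (- Qf n i u / 2) * cos s\<bar> \<le> ?R n"
        unfolding V[symmetric]
        by (rule g.clt_cos_bound[OF _ g.row_inj g.row_sub[OF iN] cb cm0]) simp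
      then show ?case unfolding lin M_eq[OF n] by simp
    qed
  qed
  have "(\<lambda>n. exp (- Qf n i u / 2) * cos s) \<longlonglongrightarrow> exp (- (t \<bullet> u) / 2) * cos s"
    by (intro tendsto_intros Q) simp
  from tendsto_add[OF main this] show ?thesis by (simp add: u_def)
qed

text \<open>\<open>Z\<close> carries the limit: D - Z vanishes at scale n^(1/2) and the cosine is
  1-Lipschitz. Tightness comes from the second moment of \<open>Z\<close>.\<close>

lemma clt_D:
  assumes i: "i \<ge> 1"
  shows "tendsto_in_distr (\<lambda>n. measure_pmf (M n)) (\<lambda>n a. sqrt (real n) *\<^sub>R D n a i) (mv_normal 0 (Gi i))"
proof (rule tendsto_in_distr_cosI)
  note N = mv_normal_pos_def[OF G_pos_def[OF xxK[of i]]]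
  show "prob_space (mv_normal 0 (Gi i))" by (rule N(1))
  show "sets (mv_normal 0 (Gi i)) = sets borel" by (rule sets_mv_normal)
  have sY: "small_in_prob M (\<lambda>n a. norm t * sqrt (real n * (norm (D n a i - Z n a i))\<^sup>2))" for t :: "real^'d"
    by (intro small_in_prob_cmult small_in_prob_sqrt small_DZ_fixed i)
  fix t :: "real^'d" and s :: real
  have "(\<lambda>n. mean n (\<lambda>a. cos (t \<bullet> (sqrt (real n) *\<^sub>R D n a i) + s)) - mean n (\<lambda>a. cos (t \<bullet> (sqrt (real n) *\<^sub>R Z n a i) + s))) \<longlonglongrightarrow> 0"
  proof (rule expectation_diff_tendsto[OF fin_M sY[of t]])
    fix n a
    have "\<bar>cos (t \<bullet> (sqrt (real n) *\<^sub>R D n a i) + s) - cos (t \<bullet> (sqrt (real n) *\<^sub>R Z n a i) + s)\<bar>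
      \<le> \<bar>(t \<bullet> (sqrt (real n) *\<^sub>R D n a i) + s) - (t \<bullet> (sqrt (real n) *\<^sub>R Z n a i) + s)\<bar>" by (rule abs_cos_diff_le)
    also have "\<dots> = sqrt (real n) * \<bar>t \<bullet> (D n a i - Z n a i)\<bar>"
      by (simp add: inner_diff_right right_diff_distrib[symmetric] abs_mult)
    also have "\<dots> \<le> sqrt (real n) * (norm t * norm (D n a i - Z n a i))"
      by (intro mult_left_mono Cauchy_Schwarz_ineq2) simp
    also have "\<dots> = \<bar>norm t * sqrt (real n * (norm (D n a i - Z n a i))\<^sup>2)\<bar>"
      by (simp add: real_sqrt_mult abs_mult)
    finally show "\<bar>cos (t \<bullet> (sqrt (real n) *\<^sub>R D n a i) + s) - cos (t \<bullet> (sqrt (real n) *\<^sub>R Z n a i) + s)\<bar>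
      \<le> \<bar>norm t * sqrt (real n * (norm (D n a i - Z n a i))\<^sup>2)\<bar>" .
  qed (simp_all add: abs_cos_le_one)
  from tendsto_add[OF this cos_Z_tendsto[OF i, of t s]]
  show "(\<lambda>n. mean n (\<lambda>a. cos (t \<bullet> (sqrt (real n) *\<^sub>R D n a i) + s))) \<longlonglongrightarrow> (LINT z|mv_normal 0 (Gi i). cos (t \<bullet> z + s))"
    unfolding N(2) by simp
next
  fix e :: real assume e: "e > 0"
  let ?z = "\<lambda>n a. real n * (norm (Z n a i))\<^sup>2" and ?y = "\<lambda>n a. real n * (norm (D n a i - Z n a i))\<^sup>2"
  have e2: "e / 2 > 0" using e by simp
  then obtain B where B: "\<forall>\<^sub>F n in sequentially. measure (M n) {a. \<bar>?z n a\<bar> > B} < e / 2"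
    using tight_Z_fixed[OF i] unfolding tight_in_prob_def by blast
  have y: "\<forall>\<^sub>F n in sequentially. measure (M n) {a. \<bar>?y n a\<bar> > 1} < e / 2"
    by (rule small_in_probD[OF small_DZ_fixed[OF i] zero_less_one e2])
  show "\<exists>L. \<forall>\<^sub>F n in sequentially. measure (M n) {a. norm (sqrt (real n) *\<^sub>R D n a i) > L} < e"
  proof (intro exI)
    \<comment> \<open>From \<bar>D\<bar>^2 \<le> 2 \<bar>D - Z\<bar>^2 + 2 \<bar>Z\<bar>^2, scaled
      by n, with the two squares bounded by 1 and \<open>B\<close>.\<close>
    let ?L = "sqrt (2 * \<bar>B\<bar> + 2)"
    show "\<forall>\<^sub>F n in sequentially. measure (M n) {a. norm (sqrt (real n) *\<^sub>R D n a i) > ?L} < e"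
      using B y
    proof eventually_elim
      case (elim n)
      have "{a. norm (sqrt (real n) *\<^sub>R D n a i) > ?L} \<subseteq> {a. \<bar>?z n a\<bar> > B} \<union> {a. \<bar>?y n a\<bar> > 1}"
      proof (rule subsetI, rule ccontr)
        fix a assume a: "a \<in> {a. norm (sqrt (real n) *\<^sub>R D n a i) > ?L}" and na: "a \<notin> {a. \<bar>?z n a\<bar> > B} \<union> {a. \<bar>?y n a\<bar> > 1}"
        have "(norm (D n a i))\<^sup>2 \<le> (norm (D n a i - Z n a i) + norm (Z n a i))\<^sup>2"
          by (intro power_mono norm_triangle_sub[THEN order.trans]) (auto simp: add.commute)
        also have "\<dots> \<le> 2 * (norm (D n a i - Z n a i))\<^sup>2 + 2 * (norm (Z n a i))\<^sup>2"
          using sum_squares_bound[of "norm (D n a i - Z n a i)" "norm (Z n a i)"] by (simp add: power2_sum)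
        finally have "real n * (norm (D n a i))\<^sup>2 \<le> real n * (2 * (norm (D n a i - Z n a i))\<^sup>2 + 2 * (norm (Z n a i))\<^sup>2)"
          by (rule mult_left_mono) simp
        also have "\<dots> = 2 * ?y n a + 2 * ?z n a" by (simp add: algebra_simps)
        also have "\<dots> \<le> 2 * \<bar>B\<bar> + 2" using na by auto
        finally have "sqrt (real n * (norm (D n a i))\<^sup>2) \<le> ?L" by (rule real_sqrt_le_mono)
        then show False using a by (simp add: real_sqrt_mult)
      qed
      then have "measure (M n) {a. norm (sqrt (real n) *\<^sub>R D n a i) > ?L} \<le> measure (M n) ({a. \<bar>?z n a\<bar> > B} \<union> {a. \<bar>?y n a\<bar> > 1})"
        by (intro measure_pmf.finite_measure_mono) auto
      also have "\<dots> \<le> measure (M n) {a. \<bar>?z n a\<bar> > B} + measure (M n) {a. \<bar>?y n a\<bar> > 1}"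
        by (rule measure_Un_le) auto
      also have "\<dots> < e" using elim by simp
      finally show ?case .
    qed
  qed
qed

theorem loss_tendsto:
  "tendsto_in_prob (\<lambda>n. measure_pmf (RDPG n (\<rho> n) x0))
      (\<lambda>n a. (frob_norm n (\<lambda>i. Xh n a i v* W n a - sqrt (\<rho> n) *\<^sub>R x0 i))\<^sup>2)
      (LINT x:latent_space|F. trace (matrix_inv (G_matrix \<rho>lim F x)))"
  using small_loss
  unfolding tendsto_in_prob_def small_in_prob_def RDPG_eq frob_norm_sq D_def transpose_matrix_vector
  by (simp add: vimage_def)

theorem row_clt:
  assumes i: "i \<ge> 1"
  shows "tendsto_in_distr (\<lambda>n. measure_pmf (RDPG n (\<rho> n) x0))
      (\<lambda>n a. sqrt (real n) *\<^sub>R (transpose (W n a) *v Xh n a i - sqrt (\<rho> n) *\<^sub>R x0 i))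
      (mv_normal 0 (matrix_inv (G_matrix \<rho>lim F (x0 i))))"
proof -
  have x: "xx i = x0 i" using i by (simp add: xx_def max_def)
  have d: "distr (measure_pmf (RDPG n (\<rho> n) x0)) borel (\<lambda>a. sqrt (real n) *\<^sub>R (transpose (W n a) *v Xh n a i - sqrt (\<rho> n) *\<^sub>R x0 i))
    = distr (measure_pmf (M n)) borel (\<lambda>a. sqrt (real n) *\<^sub>R D n a i)" for n
    unfolding RDPG_eq map_pmf_rep_eq D_def by (subst distr_distr) (simp_all add: comp_def)
  show ?thesis
    using clt_D[OF i] unfolding tendsto_in_distr_def d x G_def .
qed

end

theorem theorem5:
  fixes x0 :: "nat \<Rightarrow> real^'d"
    and F :: "(real^'d) measure"
    and \<rho> :: "nat \<Rightarrow> real" and \<rho>lim \<delta> \<omega> :: real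
    and K :: "(real^'d) set"
    and Xt Xh :: "nat \<Rightarrow> adj \<Rightarrow> nat \<Rightarrow> real^'d"
  assumes "prob_space F" and "sets F = sets borel" and "measure F latent_space = 1"
    and "invertible (LINT x:latent_space|F. outer x x)"
    and "\<And>n. n \<ge> 1 \<Longrightarrow> 0 < \<rho> n \<and> \<rho> n \<le> 1"
    and "(\<lambda>n. SUP x\<in>latent_space. \<bar>ecdf n x0 x - mv_cdf F x\<bar>) \<longlonglongrightarrow> 0"
    and "0 < \<delta>" and "\<delta> < 1/2" and "restricted_latent_space \<delta> K"
    and "\<And>i. i \<ge> 1 \<Longrightarrow> x0 i \<in> K"
    and "\<omega> \<ge> 0" and "approx_linearization \<omega> \<rho> x0 Xt"
    and "one_step_estimator Xt Xh"
    and "(\<forall>n\<ge>1. \<rho> n = 1) \<or>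
         \<rho> \<longlonglongrightarrow> 0 \<and> (\<lambda>n. ln (real n) powr (2 * max 1 \<omega>) / (real n * \<rho> n ^ 5)) \<longlonglongrightarrow> 0"
    and "\<rho> \<longlonglongrightarrow> \<rho>lim"
  shows "\<exists>W :: nat \<Rightarrow> adj \<Rightarrow> real^'d^'d.
    (\<forall>n a. orthogonal_matrix (W n a)) \<and>
    tendsto_in_prob (\<lambda>n. measure_pmf (RDPG n (\<rho> n) x0))
      (\<lambda>n a. (frob_norm n (\<lambda>i. Xh n a i v* W n a - sqrt (\<rho> n) *\<^sub>R x0 i))\<^sup>2)
      (LINT x:latent_space|F. trace (matrix_inv (G_matrix \<rho>lim F x))) \<and>
    (\<forall>i\<ge>1. tendsto_in_distr (\<lambda>n. measure_pmf (RDPG n (\<rho> n) x0))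
      (\<lambda>n a. sqrt (real n) *\<^sub>R (transpose (W n a) *v Xh n a i - sqrt (\<rho> n) *\<^sub>R x0 i))
      (mv_normal 0 (matrix_inv (G_matrix \<rho>lim F (x0 i)))))"
proof -
  \<comment> \<open>The matrices that align the initial estimator also align the one-step
    estimator.\<close>
  obtain W R \<zeta> C where orth: "\<And>n a. orthogonal_matrix (W n a)"
    and \<zeta>: "\<And>n i j. i \<in> {1..n} \<Longrightarrow> j \<in> {1..n} \<Longrightarrow> norm (\<zeta> n i j) \<le> C * (1 / real n)"
    and Rr: "bounded_in_prob (\<lambda>n. measure_pmf (RDPG n (\<rho> n) x0)) (\<lambda>n a. (frob_norm n (R n a))\<^sup>2)
          (\<lambda>n. inverse (real n * \<rho> n) * ln (real n) powr \<omega>)"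
    and lin: "\<And>n a i. i \<in> {1..n} \<Longrightarrow> transpose (W n a) *v Xt n a i - sqrt (\<rho> n) *\<^sub>R x0 i =
             (1 / sqrt (\<rho> n)) *\<^sub>R (\<Sum>j=1..n. (a i j - \<rho> n * (x0 i \<bullet> x0 j)) *\<^sub>R \<zeta> n i j) + R n a i"
    using assms(12) unfolding approx_linearization_def by blast
  have K: "compact K" "K \<subseteq> latent_space" using assms(9) by (auto simp: restricted_latent_space_def)
  interpret rdpg_estimation x0 F K \<delta> \<rho> \<rho>lim \<omega> C Xt Xh W R \<zeta>
    by (intro rdpg_estimation.intro rdpg_estimation_axioms.intro rdpg_setting.intro rdpg_setting_axioms.intro ecdf_limit.intro)
      (fact assms K orth \<zeta> Rr lin)+
  show ?thesis using orth loss_tendsto row_clt by blast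
qed

end
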